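(* Every quasitriangular Poisson–Lie group $G$ (with Lie bialgebra $\mathfrak g$ and quasitriangular structure $r$) has a compatible bicovariant preconnection given by $\hat\Xi=0$. The corresponding $\tilde\gamma$ is given by $$\tilde\gamma(a,s)(g)=\{a,s\}(g)+a'(g;g\,r_-^{[1]})\,\mathrm{ad}^*_{r_-^{[2]}}(s(g))$$ for $a\in C^\infty(G)$ and $s\in C^\infty(G,\mathfrak g^* )$, where $r_-=\frac12(r-r_{21})=r_-^{[1]}\otimes r_-^{[2]}$. If $\mathfrak g$ is semisimple then the curvature of this preconnection vanishes if and only if the Lie bialgebra is triangular, and in this case all super Jacobi identities $J_1=0$, $J_2=0$, $J_3=0$ hold.
   Context: Poisson–Lie notation. $\mathfrak g=T_eG$; $gv$, $vg$ denote the images of $v\in\mathfrak g$ in $T_gG$ under left and right translation. The Poisson bivector is $\omega=\omega^{[1]}\otimes\omega^{[2]}$ (summation understood), $\{a,b\}(g)=a'(g;\omega^{[1]}(g))\,b'(g;\omega^{[2]}(g))$, $a'(g;u)$ being the derivative of $a$ at $g$ in direction $u\in T_gG$ (also for vector-valued functions). Quasitriangular: $\delta v=\mathrm{ad}_v(r)$ with $r\in\mathfrak g\otimes\mathfrak g$ satisfying $[r_{12},r_{13}]+[r_{12},r_{23}]+[r_{13},r_{23}]=0$ and $r_+=\frac12(r+r_{21})$ ad-invariant; then $\omega(g)=gr-rg$. Triangular means $r_+=0$. Conventions: $\mathrm{Ad}^*_g=(\mathrm{Ad}_{g^{-1}})^*$, $(\mathrm{ad}^*_v\psi)(w)=\psi([w,v])$.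 Preconnections. A preconnection is a map $\gamma:C^\infty(G)\times\Omega^1(G)\to\Omega^1(G)$ with $\gamma(xy,\tau)=x\gamma(y,\tau)+\gamma(x,\tau)y$ and $\gamma(x,\tau y)=\gamma(x,\tau)y+\tau\{x,y\}$; it is compatible if $\mathrm{d}\{x,y\}=\gamma(x,\mathrm{d}y)-\gamma(y,\mathrm{d}x)$. Its curvature is $R(\hat x,\hat y)\tau=\gamma(x,\gamma(y,\tau))-\gamma(y,\gamma(x,\tau))-\gamma(\{x,y\},\tau)$, where $\hat x=\{x,-\}$. A $1$-form $\tau$ is identified with $\tilde\tau\in C^\infty(G,\mathfrak g^* )$, $\tilde\tau(g)(v)=\tau(g)(gv)$, and $\tilde\gamma(a,\tilde\tau)=\widetilde{\gamma(a,\tau)}$. It is left invariant when $\tilde\gamma(a,s)(g)=\{a,s\}(g)+\Xi(\hat L_a(g),s(g))$ for a bilinear $\Xi:\mathfrak g^*\otimes\mathfrak g^*\to\mathfrak g^*$ independent of $g$, where $\hat L_a(g)(v)=a'(g;gv)$; right invariant when, with $t(g)=\mathrm{Ad}^*_gs(g)$ and $\hat R_a(g)(v)=a'(g;vg)$, $\mathrm{Ad}^*_g(\tilde\gamma(a,s)(g))=\{a,t\}(g)+\Psi(\hat R_a(g),t(g))$ for a bilinear $\Psi:\mathfrak g^*\otimes\mathfrak g^*\to\mathfrak g^*$ independent of $g$; bicovariant when both. $\hat\Xi(\phi,\psi)=\Xi(\phi,\psi)-\phi(r_-^{[1]})\,\mathrm{ad}^*_{r_-^{[2]}}\psi$. Super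 Jacobi obstructions. These refer to a formal deformation of the differential calculus on $G$ to lowest order in $\hbar$ with semiclassical data $(\{\ ,\ \},\gamma)$: maps with power series expansions in a parameter $\hbar$, namely an associative product $\bullet$ on $C^\infty(G)$ with $x\bullet y=xy+O(\hbar)$, $x\bullet y-y\bullet x=\hbar\{x,y\}+O(\hbar^2)$; left and right products $x\bullet\tau,\ \tau\bullet x=x\tau+O(\hbar)$ of functions and $1$-forms obeying the bimodule axioms up to $O(\hbar^2)$, with $x\bullet\tau-\tau\bullet x=\hbar\gamma(x,\tau)+O(\hbar^2)$; a product $\wedge_\bullet=\wedge+O(\hbar)$ on forms, associative to $O(\hbar^2)$ (written $\bullet$ when a factor is a function); and $\mathrm{d}^\bullet=\mathrm{d}+O(\hbar)$, a graded derivation of $\wedge_\bullet$ to $O(\hbar^2)$. With the super-commutator $[\xi,\eta]_\bullet=\xi\wedge_\bullet\eta-(-1)^{\deg\xi\deg\eta}\eta\wedge_\bullet\xi$, the maps $J_i:C^\infty(G)^{\otimes3}\to\Omega^i(G)$ are defined modulo $O(\hbar^3)$ by $[x,[y,\mathrm{d}z]_\bullet]_\bullet+[\mathrm{d}z,[x,y]_\bullet]_\bullet+[y,[\mathrm{d}z,x]_\bullet]_\bullet=\hbar^2J_1(x,y,z)$, $[x,[\mathrm{d}y,\mathrm{d}z]_\bullet]_\bullet-[\mathrm{d}z,[x,\mathrm{d}y]_\bullet]_\bullet+[\mathrm{d}y,[\mathrm{d}z,x]_\bullet]_\bullet=\hbar^2J_2(x,y,z)$, $[\mathrm{d}x,[\mathrm{d}y,\mathrm{d}z]_\bullet]_\bullet+[\mathrm{d}z,[\mathrm{d}x,\mathrm{d}y]_\bullet]_\bullet+[\mathrm{d}y,[\mathrm{d}z,\mathrm{d}x]_\bullet]_\bullet=\hbar^2J_3(x,y,z)$.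 *)

theory Defs
  imports "HOL-Analysis.Analysis" "HOL-Library.Function_Algebras" "HOL-Combinatorics.Permutations"
begin

(* Sums, products and zero of functions, tangent vectors, covectors and differential forms are the
   pointwise ones of HOL-Library.Function_Algebras. *)

section \<open>Smooth functions and Lie groups\<close>

primrec Ck_on :: "nat \<Rightarrow> 'a::real_normed_vector set \<Rightarrow> ('a \<Rightarrow> 'b::real_normed_vector) \<Rightarrow> bool" where
  "Ck_on 0 S f \<longleftrightarrow> continuous_on S f"
| "Ck_on (Suc k) S f \<longleftrightarrow>
     (\<exists>f'. (\<forall>x\<in>S. (f has_derivative f' x) (at x)) \<and> (\<forall>v. Ck_on k S (\<lambda>x. f' x v)))"

(* meant for open S *)
definition smooth_on :: "'a::real_normed_vector set \<Rightarrow> ('a \<Rightarrow> 'b::real_normed_vector) \<Rightarrow> bool" where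
  "smooth_on S f \<longleftrightarrow> (\<forall>k. Ck_on k S f)"

(* The underlying set is the whole type 'g; 'e is the model vector space. A chart is a pair of a
   domain and a map that is relevant on this domain only. *)
record ('g, 'e) lie_group_data =
  atlas :: "('g set \<times> ('g \<Rightarrow> 'e)) set"
  gmul :: "'g \<Rightarrow> 'g \<Rightarrow> 'g"
  gone :: "'g"
  ginv :: "'g \<Rightarrow> 'g"

definition smooth_atlas ::
    "('g::topological_space set \<times> ('g \<Rightarrow> 'e::real_normed_vector)) set \<Rightarrow> bool" where
  "smooth_atlas A \<longleftrightarrow>
     (\<Union>(U, \<phi>)\<in>A. U) = UNIV \<and>
     (\<forall>(U, \<phi>)\<in>A. open U \<and> open (\<phi> ` U) \<and> homeomorphism U (\<phi> ` U) \<phi> (inv_into U \<phi>)) \<and>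
     (\<forall>(U, \<phi>)\<in>A. \<forall>(V, \<psi>)\<in>A. smooth_on (\<phi> ` (U \<inter> V)) (\<psi> \<circ> inv_into U \<phi>))"

(* The model space is an arbitrary finite-dimensional real inner product space rather than a type
   of class euclidean_space, because the latter excludes dimension 0. *)
definition lie_group ::
    "('g::{t2_space,second_countable_topology}, 'e::real_inner) lie_group_data \<Rightarrow> bool" where
  "lie_group G \<longleftrightarrow>
     (\<exists>B::'e set. finite B \<and> span B = UNIV) \<and>
     smooth_atlas (atlas G) \<and>
     group (gmul G) (gone G) (ginv G) \<and>
     continuous_on UNIV (\<lambda>(p, q). gmul G p q) \<and>
     (\<forall>(U, \<phi>)\<in>atlas G. \<forall>(V, \<psi>)\<in>atlas G. \<forall>(W, \<kappa>)\<in>atlas G.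
        smooth_on {(x, y). x \<in> \<phi> ` U \<and> y \<in> \<psi> ` V \<and> gmul G (inv_into U \<phi> x) (inv_into V \<psi> y) \<in> W}
          (\<lambda>(x, y). \<kappa> (gmul G (inv_into U \<phi> x) (inv_into V \<psi> y)))) \<and>
     continuous_on UNIV (ginv G) \<and>
     (\<forall>(U, \<phi>)\<in>atlas G. \<forall>(V, \<psi>)\<in>atlas G.
        smooth_on {x \<in> \<phi> ` U. ginv G (inv_into U \<phi> x) \<in> V} (\<lambda>x. \<psi> (ginv G (inv_into U \<phi> x))))"

definition smooth_funs :: "('g, 'e::real_normed_vector) lie_group_data \<Rightarrow> ('g \<Rightarrow> real) set" where
  "smooth_funs G = {a. \<forall>(U, \<phi>)\<in>atlas G. smooth_on (\<phi> ` U) (a \<circ> inv_into U \<phi>)}"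


section \<open>Linear algebra\<close>

definition linear_over ::
    "(real \<Rightarrow> 'a \<Rightarrow> 'a) \<Rightarrow> (real \<Rightarrow> 'b \<Rightarrow> 'b) \<Rightarrow> 'a set \<Rightarrow> ('a::plus \<Rightarrow> 'b::plus) \<Rightarrow> bool" where
  "linear_over s1 s2 V f \<longleftrightarrow>
     (\<forall>u\<in>V. \<forall>v\<in>V. f (u + v) = f u + f v) \<and> (\<forall>c. \<forall>u\<in>V. f (s1 c u) = s2 c (f u))"

definition bilinear_over ::
    "(real \<Rightarrow> 'a \<Rightarrow> 'a) \<Rightarrow> (real \<Rightarrow> 'b \<Rightarrow> 'b) \<Rightarrow> (real \<Rightarrow> 'c \<Rightarrow> 'c) \<Rightarrow> 'a set \<Rightarrow> 'b set
      \<Rightarrow> ('a::plus \<Rightarrow> 'b::plus \<Rightarrow> 'c::plus) \<Rightarrow> bool" where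
  "bilinear_over s1 s2 s3 V W B \<longleftrightarrow>
     (\<forall>w\<in>W. linear_over s1 s3 V (\<lambda>v. B v w)) \<and> (\<forall>v\<in>V. linear_over s2 s3 W (B v))"

definition sc :: "real \<Rightarrow> ('a \<Rightarrow> real) \<Rightarrow> 'a \<Rightarrow> real" where
  "sc c u = (\<lambda>x. c * u x)"

definition fun_subspace :: "('a \<Rightarrow> real) set \<Rightarrow> bool" where
  "fun_subspace W \<longleftrightarrow> 0 \<in> W \<and> (\<forall>u\<in>W. \<forall>v\<in>W. u + v \<in> W) \<and> (\<forall>c. \<forall>u\<in>W. sc c u \<in> W)"


section \<open>Tangent vectors and the Lie algebra\<close>

(* Tangent vectors at p are the derivations at p of the smooth functions, so a'(p; u) is u a.
   They are extended by 0 to non-smooth arguments to have a unique representative. *)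
type_synonym 'g tvec = "('g \<Rightarrow> real) \<Rightarrow> real"

definition tangent_space :: "('g, 'e::real_normed_vector) lie_group_data \<Rightarrow> 'g \<Rightarrow> 'g tvec set" where
  "tangent_space G p = {u.
     (\<forall>f. f \<notin> smooth_funs G \<longrightarrow> u f = 0) \<and>
     linear_over sc (*) (smooth_funs G) u \<and>
     (\<forall>f\<in>smooth_funs G. \<forall>h\<in>smooth_funs G. u (f * h) = f p * u h + u f * h p)}"

abbreviation lie_alg :: "('g, 'e::real_normed_vector) lie_group_data \<Rightarrow> 'g tvec set" where
  "lie_alg G \<equiv> tangent_space G (gone G)"

(* ltrans G g v is the vector gv, rtrans G g v is the vector vg. *)
definition ltrans :: "('g, 'e) lie_group_data \<Rightarrow> 'g \<Rightarrow> 'g tvec \<Rightarrow> 'g tvec" where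
  "ltrans G g v = (\<lambda>f. v (\<lambda>h. f (gmul G g h)))"

definition rtrans :: "('g, 'e) lie_group_data \<Rightarrow> 'g \<Rightarrow> 'g tvec \<Rightarrow> 'g tvec" where
  "rtrans G g v = (\<lambda>f. v (\<lambda>h. f (gmul G h g)))"

(* commutator of left-invariant vector fields, evaluated at the unit *)
definition lbr :: "('g, 'e) lie_group_data \<Rightarrow> 'g tvec \<Rightarrow> 'g tvec \<Rightarrow> 'g tvec" where
  "lbr G v w = (\<lambda>f. v (\<lambda>g. ltrans G g w f) - w (\<lambda>g. ltrans G g v f))"

definition Ad :: "('g, 'e) lie_group_data \<Rightarrow> 'g \<Rightarrow> 'g tvec \<Rightarrow> 'g tvec" where
  "Ad G g v = ltrans G g (rtrans G (ginv G g) v)"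

(* covectors are extended by 0 outside V *)
definition dual :: "'g tvec set \<Rightarrow> ('g tvec \<Rightarrow> real) set" where
  "dual V = {\<phi>. linear_over sc (*) V \<phi> \<and> (\<forall>u. u \<notin> V \<longrightarrow> \<phi> u = 0)}"

definition Ad_star ::
    "('g, 'e) lie_group_data \<Rightarrow> 'g \<Rightarrow> ('g tvec \<Rightarrow> real) \<Rightarrow> 'g tvec \<Rightarrow> real" where
  "Ad_star G g \<phi> = (\<lambda>w. \<phi> (Ad G (ginv G g) w))"

definition ad_star ::
    "('g, 'e::real_normed_vector) lie_group_data \<Rightarrow> 'g tvec \<Rightarrow> ('g tvec \<Rightarrow> real) \<Rightarrow> 'g tvec \<Rightarrow> real" where
  "ad_star G v \<psi> = (\<lambda>w. if w \<in> lie_alg G then \<psi> (lbr G w v) else 0)"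

definition lie_ideal :: "('g, 'e::real_normed_vector) lie_group_data \<Rightarrow> 'g tvec set \<Rightarrow> bool" where
  "lie_ideal G I \<longleftrightarrow> fun_subspace I \<and> I \<subseteq> lie_alg G \<and> (\<forall>v\<in>lie_alg G. \<forall>w\<in>I. lbr G v w \<in> I)"

primrec derived_series :: "('g, 'e) lie_group_data \<Rightarrow> 'g tvec set \<Rightarrow> nat \<Rightarrow> 'g tvec set" where
  "derived_series G I 0 = I"
| "derived_series G I (Suc n) =
     fun_subspace hull {lbr G v w | v w. v \<in> derived_series G I n \<and> w \<in> derived_series G I n}"

definition lie_semisimple :: "('g, 'e::real_normed_vector) lie_group_data \<Rightarrow> bool" where
  "lie_semisimple G \<longleftrightarrow> (\<forall>I. lie_ideal G I \<and> (\<exists>n. derived_series G I n = {0}) \<longrightarrow> I = {0})"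


section \<open>Tensors of rank two\<close>

(* A tensor t = \<Sum>\<^sub>i u\<^sub>i \<otimes> v\<^sub>i in V \<otimes> V is encoded, through the universal property of the tensor
   product, by B \<mapsto> \<Sum>\<^sub>i B u\<^sub>i v\<^sub>i; so t (\<lambda>u v. B u v) is B(t\<^sub>1, t\<^sub>2) with summation understood. Only
   the values on bilinear B are relevant, hence equality of tensors is tens_eq. *)
type_synonym 'g tens2 = "('g tvec \<Rightarrow> 'g tvec \<Rightarrow> real) \<Rightarrow> real"

abbreviation bilin :: "'g tvec set \<Rightarrow> ('g tvec \<Rightarrow> 'g tvec \<Rightarrow> real) \<Rightarrow> bool" where
  "bilin V B \<equiv> bilinear_over sc sc (*) V V B"

definition tensor_square :: "'g tvec set \<Rightarrow> 'g tens2 set" where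
  "tensor_square V =
     {t. \<exists>uvs. set uvs \<subseteq> V \<times> V \<and> (\<forall>B. bilin V B \<longrightarrow> t B = (\<Sum>(u, v)\<leftarrow>uvs. B u v))}"

definition tens_eq :: "'g tvec set \<Rightarrow> 'g tens2 \<Rightarrow> 'g tens2 \<Rightarrow> bool" where
  "tens_eq V t t' \<longleftrightarrow> (\<forall>B. bilin V B \<longrightarrow> t B = t' B)"

definition tflip :: "'g tens2 \<Rightarrow> 'g tens2" where
  "tflip t = (\<lambda>B. t (\<lambda>u v. B v u))"

definition r_plus :: "'g tens2 \<Rightarrow> 'g tens2" where
  "r_plus r = (\<lambda>B. (r B + tflip r B) / 2)"

definition r_minus :: "'g tens2 \<Rightarrow> 'g tens2" where
  "r_minus r = (\<lambda>B. (r B - tflip r B) / 2)"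

definition ad_tens :: "('g, 'e) lie_group_data \<Rightarrow> 'g tvec \<Rightarrow> 'g tens2 \<Rightarrow> 'g tens2" where
  "ad_tens G v t = (\<lambda>B. t (\<lambda>x y. B (lbr G v x) y) + t (\<lambda>x y. B x (lbr G v y)))"

(* [r\<^sub>1\<^sub>2,r\<^sub>1\<^sub>3] + [r\<^sub>1\<^sub>2,r\<^sub>2\<^sub>3] + [r\<^sub>1\<^sub>3,r\<^sub>2\<^sub>3] = 0, tested on trilinear forms *)
definition cybe :: "('g, 'e::real_normed_vector) lie_group_data \<Rightarrow> 'g tens2 \<Rightarrow> bool" where
  "cybe G r \<longleftrightarrow> (\<forall>T.
     (\<forall>x\<in>lie_alg G. bilin (lie_alg G) (T x)) \<and>
     (\<forall>y\<in>lie_alg G. bilin (lie_alg G) (\<lambda>x z. T x y z)) \<longrightarrow>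
       r (\<lambda>a b. r (\<lambda>c d. T (lbr G a c) b d)) +
       r (\<lambda>a b. r (\<lambda>c d. T a (lbr G b c) d)) +
       r (\<lambda>a b. r (\<lambda>c d. T a c (lbr G b d))) = 0)"


section \<open>Quasitriangular Poisson-Lie groups\<close>

definition pb :: "('g \<Rightarrow> 'g tens2) \<Rightarrow> ('g \<Rightarrow> real) \<Rightarrow> ('g \<Rightarrow> real) \<Rightarrow> 'g \<Rightarrow> real" where
  "pb \<omega> a b = (\<lambda>g. \<omega> g (\<lambda>u v. u a * v b))"

definition poisson_bivector ::
    "('g, 'e::real_normed_vector) lie_group_data \<Rightarrow> ('g \<Rightarrow> 'g tens2) \<Rightarrow> bool" where
  "poisson_bivector G \<omega> \<longleftrightarrow>
     (\<forall>g. \<omega> g \<in> tensor_square (tangent_space G g)) \<and>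
     (\<forall>g. tens_eq (tangent_space G g) (tflip (\<omega> g)) (- \<omega> g)) \<and>
     (\<forall>a\<in>smooth_funs G. \<forall>b\<in>smooth_funs G. pb \<omega> a b \<in> smooth_funs G) \<and>
     (\<forall>a\<in>smooth_funs G. \<forall>b\<in>smooth_funs G. \<forall>c\<in>smooth_funs G.
        pb \<omega> a (pb \<omega> b c) + pb \<omega> b (pb \<omega> c a) + pb \<omega> c (pb \<omega> a b) = 0)"

(* The last conjunct says that multiplication is a Poisson map from G \<times> G, with the product Poisson
   structure, to G. *)
definition poisson_lie_group ::
    "('g::{t2_space,second_countable_topology}, 'e::real_inner) lie_group_data
      \<Rightarrow> ('g \<Rightarrow> 'g tens2) \<Rightarrow> bool" where
  "poisson_lie_group G \<omega> \<longleftrightarrow> lie_group G \<and> poisson_bivector G \<omega> \<and>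
     (\<forall>a\<in>smooth_funs G. \<forall>b\<in>smooth_funs G. \<forall>g h.
        pb \<omega> a b (gmul G g h) =
          pb \<omega> (\<lambda>k. a (gmul G g k)) (\<lambda>k. b (gmul G g k)) h +
          pb \<omega> (\<lambda>k. a (gmul G k h)) (\<lambda>k. b (gmul G k h)) g)"

(* Lie cobracket: the derivative at the unit, in direction v, of g \<mapsto> \<omega>(g)g\<^sup>-\<^sup>1 *)
definition cobracket ::
    "('g, 'e) lie_group_data \<Rightarrow> ('g \<Rightarrow> 'g tens2) \<Rightarrow> 'g tvec \<Rightarrow> 'g tens2" where
  "cobracket G \<omega> v =
     (\<lambda>B. v (\<lambda>g. \<omega> g (\<lambda>x y. B (rtrans G (ginv G g) x) (rtrans G (ginv G g) y))))"

(* \<omega>(g) = gr - rg follows from \<delta>v = ad\<^sub>v(r) for connected G; for general G it is part of what it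
   means for the Poisson-Lie group (and not just its Lie bialgebra) to be quasitriangular. *)
definition quasitriangular ::
    "('g, 'e::real_normed_vector) lie_group_data \<Rightarrow> ('g \<Rightarrow> 'g tens2) \<Rightarrow> 'g tens2 \<Rightarrow> bool" where
  "quasitriangular G \<omega> r \<longleftrightarrow>
     r \<in> tensor_square (lie_alg G) \<and>
     (\<forall>v\<in>lie_alg G. tens_eq (lie_alg G) (cobracket G \<omega> v) (ad_tens G v r)) \<and>
     cybe G r \<and>
     (\<forall>v\<in>lie_alg G. tens_eq (lie_alg G) (ad_tens G v (r_plus r)) 0) \<and>
     (\<forall>g. tens_eq (tangent_space G g) (\<omega> g)
        (\<lambda>B. r (\<lambda>u v. B (ltrans G g u) (ltrans G g v)) -
              r (\<lambda>u v. B (rtrans G g u) (rtrans G g v))))"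

definition triangular :: "('g, 'e::real_normed_vector) lie_group_data \<Rightarrow> 'g tens2 \<Rightarrow> bool" where
  "triangular G r \<longleftrightarrow> tens_eq (lie_alg G) (r_plus r) 0"


section \<open>Differential forms\<close>

(* A k-form maps a point p and a list of k tangent vectors at p to a number; it is extended by 0 to
   all other lists. *)
type_synonym 'g form = "'g \<Rightarrow> 'g tvec list \<Rightarrow> real"

definition fsc :: "real \<Rightarrow> 'g form \<Rightarrow> 'g form" where
  "fsc c \<alpha> = (\<lambda>p us. c * \<alpha> p us)"

definition vector_fields :: "('g, 'e::real_normed_vector) lie_group_data \<Rightarrow> ('g \<Rightarrow> 'g tvec) set" where
  "vector_fields G =
     {X. (\<forall>p. X p \<in> tangent_space G p) \<and> (\<forall>f\<in>smooth_funs G. (\<lambda>p. X p f) \<in> smooth_funs G)}"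

definition forms :: "('g, 'e::real_normed_vector) lie_group_data \<Rightarrow> nat \<Rightarrow> 'g form set" where
  "forms G k = {\<alpha>.
     (\<forall>p us. \<not> (length us = k \<and> set us \<subseteq> tangent_space G p) \<longrightarrow> \<alpha> p us = 0) \<and>
     (\<forall>p us i. length us = k \<and> set us \<subseteq> tangent_space G p \<and> i < k \<longrightarrow>
        linear_over sc (*) (tangent_space G p) (\<lambda>u. \<alpha> p (us[i := u]))) \<and>
     (\<forall>p us i j. length us = k \<and> i < j \<and> j < k \<and> us ! i = us ! j \<longrightarrow> \<alpha> p us = 0) \<and>
     (\<forall>Xs. length Xs = k \<and> set Xs \<subseteq> vector_fields G \<longrightarrow>
        (\<lambda>p. \<alpha> p (map (\<lambda>X. X p) Xs)) \<in> smooth_funs G)}"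

definition fun_form :: "('g \<Rightarrow> real) \<Rightarrow> 'g form" where
  "fun_form a = (\<lambda>p us. if us = [] then a p else 0)"

definition fmul :: "('g \<Rightarrow> real) \<Rightarrow> 'g form \<Rightarrow> 'g form" where
  "fmul a \<alpha> = (\<lambda>p us. a p * \<alpha> p us)"

(* For forms of degrees k and l only the k-th summand contributes on lists of length k + l. The
   normalisation is (\<alpha> \<and> \<beta>)(u,v) = \<alpha>(u)\<beta>(v) - \<alpha>(v)\<beta>(u) for 1-forms. *)
definition wedge :: "'g form \<Rightarrow> 'g form \<Rightarrow> 'g form" where
  "wedge \<alpha> \<beta> = (\<lambda>p us. \<Sum>k\<le>length us.
     (\<Sum>\<pi> | \<pi> permutes {..<length us}. of_int (sign \<pi>) *
        \<alpha> p (map (\<lambda>i. us ! \<pi> i) [0..<k]) * \<beta> p (map (\<lambda>i. us ! \<pi> i) [k..<length us]))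
     / (fact k * fact (length us - k)))"

(* Invariant formula
     d\<alpha>(X\<^sub>0,...,X\<^sub>k) = \<Sum>\<^sub>i (-1)\<^sup>i X\<^sub>i(\<alpha>(..omit i..)) + \<Sum>\<^sub>i\<^sub><\<^sub>j (-1)\<^sup>i\<^sup>+\<^sup>j \<alpha>([X\<^sub>i,X\<^sub>j],..omit i,j..),
   evaluated at p on the left-invariant vector fields X\<^sub>i(q) = q p\<^sup>-\<^sup>1 u\<^sub>i extending the given u\<^sub>i. *)
definition ext_d :: "('g, 'e::real_normed_vector) lie_group_data \<Rightarrow> 'g form \<Rightarrow> 'g form" where
  "ext_d G \<alpha> = (\<lambda>p us.
     if set us \<subseteq> tangent_space G p then
       (\<Sum>i<length us. (- 1) ^ i *
          (us ! i) (\<lambda>q. \<alpha> q (map (ltrans G (gmul G q (ginv G p))) (nths us (- {i}))))) +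
       (\<Sum>j<length us. \<Sum>i<j. (- 1) ^ (i + j) *
          \<alpha> p (ltrans G p (lbr G (ltrans G (ginv G p) (us ! i)) (ltrans G (ginv G p) (us ! j)))
                # nths us (- {i, j})))
     else 0)"

abbreviation df :: "('g, 'e::real_normed_vector) lie_group_data \<Rightarrow> ('g \<Rightarrow> real) \<Rightarrow> 'g form" where
  "df G a \<equiv> ext_d G (fun_form a)"


section \<open>Preconnections\<close>

type_synonym 'g precon = "('g \<Rightarrow> real) \<Rightarrow> 'g form \<Rightarrow> 'g form"

definition preconnection ::
    "('g, 'e::real_normed_vector) lie_group_data \<Rightarrow> ('g \<Rightarrow> 'g tens2) \<Rightarrow> 'g precon \<Rightarrow> bool" where
  "preconnection G \<omega> \<gamma> \<longleftrightarrow>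
     (\<forall>x\<in>smooth_funs G. \<forall>\<tau>\<in>forms G 1. \<gamma> x \<tau> \<in> forms G 1) \<and>
     bilinear_over sc fsc fsc (smooth_funs G) (forms G 1) \<gamma> \<and>
     (\<forall>x\<in>smooth_funs G. \<forall>y\<in>smooth_funs G. \<forall>\<tau>\<in>forms G 1.
        \<gamma> (x * y) \<tau> = fmul x (\<gamma> y \<tau>) + fmul y (\<gamma> x \<tau>) \<and>
        \<gamma> x (fmul y \<tau>) = fmul y (\<gamma> x \<tau>) + fmul (pb \<omega> x y) \<tau>)"

definition compatible ::
    "('g, 'e::real_normed_vector) lie_group_data \<Rightarrow> ('g \<Rightarrow> 'g tens2) \<Rightarrow> 'g precon \<Rightarrow> bool" where
  "compatible G \<omega> \<gamma> \<longleftrightarrow> (\<forall>x\<in>smooth_funs G. \<forall>y\<in>smooth_funs G.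
     df G (pb \<omega> x y) = \<gamma> x (df G y) - \<gamma> y (df G x))"

definition curvature ::
    "('g \<Rightarrow> 'g tens2) \<Rightarrow> 'g precon \<Rightarrow> ('g \<Rightarrow> real) \<Rightarrow> ('g \<Rightarrow> real) \<Rightarrow> 'g form \<Rightarrow> 'g form" where
  "curvature \<omega> \<gamma> x y \<tau> = \<gamma> x (\<gamma> y \<tau>) - \<gamma> y (\<gamma> x \<tau>) - \<gamma> (pb \<omega> x y) \<tau>"

(* C\<^sup>\<infinity>(G, g\<^sup>* ) *)
definition dual_funs ::
    "('g, 'e::real_normed_vector) lie_group_data \<Rightarrow> ('g \<Rightarrow> 'g tvec \<Rightarrow> real) set" where
  "dual_funs G =
     {s. (\<forall>g. s g \<in> dual (lie_alg G)) \<and> (\<forall>v\<in>lie_alg G. (\<lambda>g. s g v) \<in> smooth_funs G)}"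

definition tilde ::
    "('g, 'e::real_normed_vector) lie_group_data \<Rightarrow> 'g form \<Rightarrow> 'g \<Rightarrow> 'g tvec \<Rightarrow> real" where
  "tilde G \<tau> = (\<lambda>g v. if v \<in> lie_alg G then \<tau> g [ltrans G g v] else 0)"

(* inverse of tilde *)
definition untilde ::
    "('g, 'e) lie_group_data \<Rightarrow> ('g \<Rightarrow> 'g tvec \<Rightarrow> real) \<Rightarrow> 'g form" where
  "untilde G s = (\<lambda>g us. if length us = 1 then s g (ltrans G (ginv G g) (hd us)) else 0)"

definition tilde_con ::
    "('g, 'e::real_normed_vector) lie_group_data \<Rightarrow> 'g precon
      \<Rightarrow> ('g \<Rightarrow> real) \<Rightarrow> ('g \<Rightarrow> 'g tvec \<Rightarrow> real) \<Rightarrow> 'g \<Rightarrow> 'g tvec \<Rightarrow> real" where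
  "tilde_con G \<gamma> a s = tilde G (\<gamma> a (untilde G s))"

(* {a,s} for g\<^sup>*-valued s, componentwise *)
definition pb_vec ::
    "('g \<Rightarrow> 'g tens2) \<Rightarrow> ('g \<Rightarrow> real) \<Rightarrow> ('g \<Rightarrow> 'g tvec \<Rightarrow> real) \<Rightarrow> 'g \<Rightarrow> 'g tvec \<Rightarrow> real" where
  "pb_vec \<omega> a s = (\<lambda>g v. pb \<omega> a (\<lambda>h. s h v) g)"

definition L_hat ::
    "('g, 'e::real_normed_vector) lie_group_data \<Rightarrow> ('g \<Rightarrow> real) \<Rightarrow> 'g \<Rightarrow> 'g tvec \<Rightarrow> real" where
  "L_hat G a g = (\<lambda>v. if v \<in> lie_alg G then ltrans G g v a else 0)"

definition R_hat ::
    "('g, 'e::real_normed_vector) lie_group_data \<Rightarrow> ('g \<Rightarrow> real) \<Rightarrow> 'g \<Rightarrow> 'g tvec \<Rightarrow> real" where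
  "R_hat G a g = (\<lambda>v. if v \<in> lie_alg G then rtrans G g v a else 0)"

type_synonym 'g dual_op = "('g tvec \<Rightarrow> real) \<Rightarrow> ('g tvec \<Rightarrow> real) \<Rightarrow> ('g tvec \<Rightarrow> real)"

definition dual_bilinear ::
    "('g, 'e::real_normed_vector) lie_group_data \<Rightarrow> 'g dual_op \<Rightarrow> bool" where
  "dual_bilinear G \<Xi> \<longleftrightarrow>
     (\<forall>\<phi>\<in>dual (lie_alg G). \<forall>\<psi>\<in>dual (lie_alg G). \<Xi> \<phi> \<psi> \<in> dual (lie_alg G)) \<and>
     bilinear_over sc sc sc (dual (lie_alg G)) (dual (lie_alg G)) \<Xi>"

definition left_inv_by ::
    "('g, 'e::real_normed_vector) lie_group_data \<Rightarrow> ('g \<Rightarrow> 'g tens2) \<Rightarrow> 'g precon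
      \<Rightarrow> 'g dual_op \<Rightarrow> bool" where
  "left_inv_by G \<omega> \<gamma> \<Xi> \<longleftrightarrow> dual_bilinear G \<Xi> \<and>
     (\<forall>a\<in>smooth_funs G. \<forall>s\<in>dual_funs G. \<forall>g.
        tilde_con G \<gamma> a s g = pb_vec \<omega> a s g + \<Xi> (L_hat G a g) (s g))"

definition right_inv_by ::
    "('g, 'e::real_normed_vector) lie_group_data \<Rightarrow> ('g \<Rightarrow> 'g tens2) \<Rightarrow> 'g precon
      \<Rightarrow> 'g dual_op \<Rightarrow> bool" where
  "right_inv_by G \<omega> \<gamma> \<Psi> \<longleftrightarrow> dual_bilinear G \<Psi> \<and>
     (\<forall>a\<in>smooth_funs G. \<forall>s\<in>dual_funs G. \<forall>g. let t = (\<lambda>h. Ad_star G h (s h)) in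
        Ad_star G g (tilde_con G \<gamma> a s g) = pb_vec \<omega> a t g + \<Psi> (R_hat G a g) (t g))"

definition bicovariant ::
    "('g, 'e::real_normed_vector) lie_group_data \<Rightarrow> ('g \<Rightarrow> 'g tens2) \<Rightarrow> 'g precon \<Rightarrow> bool" where
  "bicovariant G \<omega> \<gamma> \<longleftrightarrow> (\<exists>\<Xi>. left_inv_by G \<omega> \<gamma> \<Xi>) \<and> (\<exists>\<Psi>. right_inv_by G \<omega> \<gamma> \<Psi>)"

definition Xi_hat ::
    "('g, 'e::real_normed_vector) lie_group_data \<Rightarrow> 'g tens2 \<Rightarrow> 'g dual_op \<Rightarrow> 'g dual_op" where
  "Xi_hat G r \<Xi> \<phi> \<psi> = \<Xi> \<phi> \<psi> - (\<lambda>w. r_minus r (\<lambda>u v. \<phi> u * ad_star G v \<psi> w))"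


section \<open>Deformations to lowest order and super Jacobi obstructions\<close>

(* Formal power series in the deformation parameter are coefficient sequences. The product is given
   by coefficient maps P n, extended bilinearly to series. *)
type_synonym 'g fseries = "nat \<Rightarrow> 'g form"

definition const_ser :: "'g form \<Rightarrow> 'g fseries" where
  "const_ser \<alpha> = (\<lambda>n. if n = 0 then \<alpha> else 0)"

definition ser_mul ::
    "(nat \<Rightarrow> 'g form \<Rightarrow> 'g form \<Rightarrow> 'g form) \<Rightarrow> 'g fseries \<Rightarrow> 'g fseries \<Rightarrow> 'g fseries" where
  "ser_mul P F H = (\<lambda>n. \<Sum>i\<le>n. \<Sum>j\<le>n - i. P i (F j) (H (n - i - j)))"

definition ser_d :: "(nat \<Rightarrow> 'g form \<Rightarrow> 'g form) \<Rightarrow> 'g fseries \<Rightarrow> 'g fseries" where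
  "ser_d D F = (\<lambda>n. \<Sum>i\<le>n. D i (F (n - i)))"

definition ser_sc :: "real \<Rightarrow> 'g fseries \<Rightarrow> 'g fseries" where
  "ser_sc c F = (\<lambda>n. fsc c (F n))"

(* agreement up to an error of order m *)
definition ser_eq_upto :: "nat \<Rightarrow> 'g fseries \<Rightarrow> 'g fseries \<Rightarrow> bool" where
  "ser_eq_upto m F H \<longleftrightarrow> (\<forall>n<m. F n = H n)"

(* One family P of coefficient maps describes the products on functions (0-forms), of functions and
   1-forms, and of forms; the bimodule axioms are the associativity clause in degrees involving two
   functions and one 1-form. *)
definition deformation ::
    "('g, 'e::real_normed_vector) lie_group_data \<Rightarrow> ('g \<Rightarrow> 'g tens2) \<Rightarrow> 'g precon
      \<Rightarrow> (nat \<Rightarrow> 'g form \<Rightarrow> 'g form \<Rightarrow> 'g form) \<Rightarrow> (nat \<Rightarrow> 'g form \<Rightarrow> 'g form) \<Rightarrow> bool" where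
  "deformation G \<omega> \<gamma> P D \<longleftrightarrow>
     (\<forall>n k l. (\<forall>\<xi>\<in>forms G k. \<forall>\<eta>\<in>forms G l. P n \<xi> \<eta> \<in> forms G (k + l)) \<and>
        bilinear_over fsc fsc fsc (forms G k) (forms G l) (P n)) \<and>
     (\<forall>n k. (\<forall>\<xi>\<in>forms G k. D n \<xi> \<in> forms G (k + 1)) \<and> linear_over fsc fsc (forms G k) (D n)) \<and>
     (\<forall>k l. \<forall>\<xi>\<in>forms G k. \<forall>\<eta>\<in>forms G l. P 0 \<xi> \<eta> = wedge \<xi> \<eta>) \<and>
     (\<forall>k. \<forall>\<xi>\<in>forms G k. D 0 \<xi> = ext_d G \<xi>) \<and>
     (\<forall>x\<in>forms G 0. \<forall>y\<in>forms G 0. \<forall>z\<in>forms G 0.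
        ser_mul P (ser_mul P (const_ser x) (const_ser y)) (const_ser z) =
        ser_mul P (const_ser x) (ser_mul P (const_ser y) (const_ser z))) \<and>
     (\<forall>k l m. \<forall>\<xi>\<in>forms G k. \<forall>\<eta>\<in>forms G l. \<forall>\<zeta>\<in>forms G m. ser_eq_upto 2
        (ser_mul P (ser_mul P (const_ser \<xi>) (const_ser \<eta>)) (const_ser \<zeta>))
        (ser_mul P (const_ser \<xi>) (ser_mul P (const_ser \<eta>) (const_ser \<zeta>)))) \<and>
     (\<forall>k l. \<forall>\<xi>\<in>forms G k. \<forall>\<eta>\<in>forms G l. ser_eq_upto 2
        (ser_d D (ser_mul P (const_ser \<xi>) (const_ser \<eta>)))
        (ser_mul P (ser_d D (const_ser \<xi>)) (const_ser \<eta>) +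
         ser_sc ((- 1) ^ k) (ser_mul P (const_ser \<xi>) (ser_d D (const_ser \<eta>))))) \<and>
     (\<forall>x\<in>smooth_funs G. \<forall>y\<in>smooth_funs G.
        P 1 (fun_form x) (fun_form y) - P 1 (fun_form y) (fun_form x) = fun_form (pb \<omega> x y)) \<and>
     (\<forall>x\<in>smooth_funs G. \<forall>\<tau>\<in>forms G 1. P 1 (fun_form x) \<tau> - P 1 \<tau> (fun_form x) = \<gamma> x \<tau>)"

(* super-commutator of series of forms of degrees k and l *)
definition scomm ::
    "(nat \<Rightarrow> 'g form \<Rightarrow> 'g form \<Rightarrow> 'g form) \<Rightarrow> nat \<Rightarrow> nat
      \<Rightarrow> 'g fseries \<Rightarrow> 'g fseries \<Rightarrow> 'g fseries" where
  "scomm P k l F H = ser_mul P F H - ser_sc ((- 1) ^ (k * l)) (ser_mul P H F)"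

(* super_J1 G P x y z \<theta> says that J\<^sub>1(x,y,z) = \<theta>, i.e. that the left-hand side of the defining
   equation is \<theta> times the square of the parameter, modulo its cube; likewise for J\<^sub>2 and J\<^sub>3. *)
definition second_order :: "'g form \<Rightarrow> 'g fseries" where
  "second_order \<theta> = (\<lambda>n. if n = 2 then \<theta> else 0)"

definition super_J1 ::
    "('g, 'e::real_normed_vector) lie_group_data \<Rightarrow> (nat \<Rightarrow> 'g form \<Rightarrow> 'g form \<Rightarrow> 'g form)
      \<Rightarrow> ('g \<Rightarrow> real) \<Rightarrow> ('g \<Rightarrow> real) \<Rightarrow> ('g \<Rightarrow> real) \<Rightarrow> 'g form \<Rightarrow> bool" where
  "super_J1 G P x y z \<theta> \<longleftrightarrow>
     (let X = const_ser (fun_form x); Y = const_ser (fun_form y); dZ = const_ser (df G z) in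
      ser_eq_upto 3
        (scomm P 0 1 X (scomm P 0 1 Y dZ) + scomm P 1 0 dZ (scomm P 0 0 X Y) +
         scomm P 0 1 Y (scomm P 1 0 dZ X))
        (second_order \<theta>))"

definition super_J2 ::
    "('g, 'e::real_normed_vector) lie_group_data \<Rightarrow> (nat \<Rightarrow> 'g form \<Rightarrow> 'g form \<Rightarrow> 'g form)
      \<Rightarrow> ('g \<Rightarrow> real) \<Rightarrow> ('g \<Rightarrow> real) \<Rightarrow> ('g \<Rightarrow> real) \<Rightarrow> 'g form \<Rightarrow> bool" where
  "super_J2 G P x y z \<theta> \<longleftrightarrow>
     (let X = const_ser (fun_form x); dY = const_ser (df G y); dZ = const_ser (df G z) in
      ser_eq_upto 3
        (scomm P 0 2 X (scomm P 1 1 dY dZ) - scomm P 1 1 dZ (scomm P 0 1 X dY) +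
         scomm P 1 1 dY (scomm P 1 0 dZ X))
        (second_order \<theta>))"

definition super_J3 ::
    "('g, 'e::real_normed_vector) lie_group_data \<Rightarrow> (nat \<Rightarrow> 'g form \<Rightarrow> 'g form \<Rightarrow> 'g form)
      \<Rightarrow> ('g \<Rightarrow> real) \<Rightarrow> ('g \<Rightarrow> real) \<Rightarrow> ('g \<Rightarrow> real) \<Rightarrow> 'g form \<Rightarrow> bool" where
  "super_J3 G P x y z \<theta> \<longleftrightarrow>
     (let dX = const_ser (df G x); dY = const_ser (df G y); dZ = const_ser (df G z) in
      ser_eq_upto 3
        (scomm P 1 2 dX (scomm P 1 1 dY dZ) + scomm P 1 2 dZ (scomm P 1 1 dX dY) +
         scomm P 1 2 dY (scomm P 1 1 dZ dX))
        (second_order \<theta>))"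

end

theory Submission
  imports Defs
begin

text \<open>
  Write \<open>r\<^sub>- = (\<Sum>i. \<alpha>\<^sub>i \<otimes> \<beta>\<^sub>i)\<close>, and let \<open>L\<^sub>v\<close>, \<open>R\<^sub>v\<close> be the left- and right-invariant vector fields of a Lie
  algebra element \<open>v\<close>. As \<open>\<omega>\<close> is antisymmetric, \<open>\<omega>(g) = g r - r g\<close> implies \<open>\<omega>(g) = g r\<^sub>- - r\<^sub>- g\<close>, so that
  \<open>{x, y} = (\<Sum>i. L\<^bsub>\<alpha>\<^sub>i\<^esub> x \<cdot> L\<^bsub>\<beta>\<^sub>i\<^esub> y - R\<^bsub>\<alpha>\<^sub>i\<^esub> x \<cdot> R\<^bsub>\<beta>\<^sub>i\<^esub> y)\<close> (lemma \<open>pb_eq\<close>). Nearly everything is a computation with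
  these first-order operators, based on \<open>[L\<^sub>v, L\<^sub>w] = L\<^bsub>[v,w]\<^esub>\<close>, \<open>[R\<^sub>v, R\<^sub>w] = - R\<^bsub>[v,w]\<^esub>\<close>, \<open>[L\<^sub>v, R\<^sub>w] = 0\<close>.

  The analytic input is what makes tangent vectors, which are derivations of the algebra of global smooth
  functions, into such operators: Hadamard's lemma and bump functions show that near a point a derivation
  is a combination of partial derivatives (\<open>local_coordinates\<close>). Hence \<open>L\<^sub>v\<close> and \<open>R\<^sub>v\<close> preserve smoothness,
  derivatives in different arguments commute (\<open>tangent_commute\<close>), the Lie algebra has a finite frame, and
  vector fields have smooth coefficients in it (\<open>vector_field_smooth2\<close>).

  \<^emph>\<open>The preconnection.\<close> Compatibility is the formula \<open>L_pb\<close> for \<open>L\<^sub>w {x, y}\<close>. Left invariance is built into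
  the definition. For right invariance one differentiates the coadjoint action along \<open>\<omega>\<close>
  (\<open>Ad_derivatives\<close>): the left half of \<open>\<omega>\<close> reproduces the correction term of the preconnection, and the
  right half produces a term of the same shape, whence \<open>\<Psi> = \<Xi>\<close>.

  \<^emph>\<open>Curvature.\<close> The curvature is tensorial, and pairs the Yang-Baxter expression of \<open>r\<^sub>-\<close> with the two
  differentials and with the coadjoint action on the 1-form (\<open>curvature_Gam\<close>). By invariance of \<open>r\<^sub>+\<close> the
  Yang-Baxter equation for \<open>r\<close> identifies this expression, up to sign, with the bracket of the legs of
  two copies of \<open>r\<^sub>+\<close> (\<open>yb_symmetric_part\<close>). So triangular implies flat. Conversely, flatness makes the
  brackets of elements of the image of \<open>r\<^sub>+\<close> central; a semisimple Lie algebra has trivial centre, so this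
  image, which is an ideal, is abelian and therefore zero (\<open>flat_triangular\<close>).

  \<^emph>\<open>Obstructions.\<close> At lowest order, associativity and the Leibniz rule force the supercommutator of a
  deformation to be a graded biderivation commuting with the exterior derivative (\<open>br_wedge\<close>, \<open>d_br\<close>). It
  is known on functions and on pairs of a function and a 1-form, and hence on exact 1-forms:
  if \<open>{x, y} = (\<Sum>k. A\<^sub>k x \<cdot> B\<^sub>k y)\<close> then the bracket of \<open>dy\<close> and \<open>dz\<close> is \<open>(\<Sum>k. d(A\<^sub>k y) \<and> d(B\<^sub>k z))\<close>. The first
  obstruction is the curvature. The second one becomes the Yang-Baxter equation evaluated on the
  trilinear form \<open>(a, b, c) \<mapsto> (a x) \<cdot> d(b y) \<and> d(c z)\<close> (\<open>triangular_jac2\<close>), and the third one is the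
  exterior derivative of the second (\<open>jac3_d_jac2\<close>).
\<close>

section \<open>Calculus of smooth functions\<close>

abbreviation dder where "dder f x \<equiv> frechet_derivative f (at x)"

lemma Ck_on_cong:
  assumes "open S" "\<And>x. x \<in> S \<Longrightarrow> f x = h x" "Ck_on k S f"
  shows "Ck_on k S h"
  using assms(2,3)
proof (induction k arbitrary: f h)
  case 0
  then show ?case by (simp cong: continuous_on_cong)
next
  case (Suc k)
  then obtain f' where f': "\<forall>x\<in>S. (f has_derivative f' x) (at x)" "\<forall>v. Ck_on k S (\<lambda>x. f' x v)"
    by auto
  have "(h has_derivative f' x) (at x)" if "x \<in> S" for x
    using has_derivative_transform_within_open[OF _ \<open>open S\<close> that] f' that Suc.prems(1) by blast
  then show ?case using f'(2) by auto
qed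

text \<open>On an open set the derivative is unique, so that no choice of a derivative has to be carried through
  the inductions on the order of differentiability.\<close>

lemma Ck_on_Suc_iff:
  assumes "open S"
  shows "Ck_on (Suc k) S f \<longleftrightarrow>
    (\<forall>x\<in>S. f differentiable (at x)) \<and> (\<forall>v. Ck_on k S (\<lambda>x. dder f x v))"
proof
  assume "Ck_on (Suc k) S f"
  then obtain f' where f': "\<forall>x\<in>S. (f has_derivative f' x) (at x)" "\<forall>v. Ck_on k S (\<lambda>x. f' x v)"
    by auto
  then have "f' x = dder f x" if "x \<in> S" for x
    using frechet_derivative_at that by blast
  then have "Ck_on k S (\<lambda>x. dder f x v)" for v
    using Ck_on_cong[OF assms, of "\<lambda>x. f' x v" "\<lambda>x. dder f x v"] f'(2) by simp
  then show "(\<forall>x\<in>S. f differentiable (at x)) \<and> (\<forall>v. Ck_on k S (\<lambda>x. dder f x v))"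
    using f'(1) differentiableI by blast
next
  assume "(\<forall>x\<in>S. f differentiable (at x)) \<and> (\<forall>v. Ck_on k S (\<lambda>x. dder f x v))"
  then show "Ck_on (Suc k) S f"
    using frechet_derivative_works by (auto intro!: exI[of _ "\<lambda>x. dder f x"])
qed

lemma Ck_on_subset: "Ck_on k S f \<Longrightarrow> T \<subseteq> S \<Longrightarrow> Ck_on k T f"
proof (induction k arbitrary: f)
  case 0
  then show ?case using continuous_on_subset by auto
next
  case (Suc k)
  then show ?case by (simp) (meson subsetD)
qed

lemma has_derivative_imp_continuous_on:
  "(\<And>x. x \<in> S \<Longrightarrow> (f has_derivative f' x) (at x)) \<Longrightarrow> continuous_on S f"
  by (meson continuous_at_imp_continuous_on has_derivative_continuous)

lemma Ck_on_SucD: "Ck_on (Suc k) S f \<Longrightarrow> Ck_on k S f"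
proof (induction k arbitrary: f)
  case 0
  then show ?case using has_derivative_imp_continuous_on by auto
next
  case (Suc k)
  then obtain f' where f': "\<forall>x\<in>S. (f has_derivative f' x) (at x)"
    "\<forall>v. Ck_on (Suc k) S (\<lambda>x. f' x v)"
    by (metis Ck_on.simps(2))
  then show ?case using Suc.IH by auto
qed

lemma Ck_on_local:
  assumes "open S" "\<And>x. x \<in> S \<Longrightarrow> \<exists>T. open T \<and> x \<in> T \<and> Ck_on k T f"
  shows "Ck_on k S f"
  using assms(2)
proof (induction k arbitrary: f)
  case 0
  then have "continuous (at x) f" if "x \<in> S" for x
    using that by (metis Ck_on.simps(1) continuous_on_eq_continuous_at)
  then show ?case by (simp add: continuous_at_imp_continuous_on)
next
  case (Suc k)
  have "f differentiable (at x)" if "x \<in> S" for x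
    using Suc.prems[OF that] Ck_on_Suc_iff by metis
  moreover have "Ck_on k S (\<lambda>x. dder f x v)" for v
    using Suc.IH[of "\<lambda>x. dder f x v"] Suc.prems Ck_on_Suc_iff by metis
  ultimately show ?case using Ck_on_Suc_iff[OF assms(1)] by blast
qed

lemma Ck_on_const: "Ck_on k S (\<lambda>x. c)"
proof (induction k arbitrary: c)
  case (Suc k)
  have "\<forall>x\<in>S. ((\<lambda>x. c) has_derivative (\<lambda>x v. 0) x) (at x)" by simp
  then show ?case using Suc.IH[of 0] unfolding Ck_on.simps by (intro exI[of _ "\<lambda>x v. 0"]) auto
qed auto

lemma Ck_on_bounded_linear_comp:
  "bounded_linear A \<Longrightarrow> Ck_on k S f \<Longrightarrow> Ck_on k S (\<lambda>x. A (f x))"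
proof (induction k arbitrary: f)
  case 0
  then show ?case by (simp add: bounded_linear.continuous_on)
next
  case (Suc k)
  then obtain f' where f': "\<forall>x\<in>S. (f has_derivative f' x) (at x)" "\<forall>v. Ck_on k S (\<lambda>x. f' x v)"
    by auto
  have "\<forall>x\<in>S. ((\<lambda>x. A (f x)) has_derivative (\<lambda>v. A (f' x v))) (at x)"
    using bounded_linear.has_derivative[OF Suc.prems(1)] f'(1) by blast
  then show ?case using f'(2) Suc.IH[OF Suc.prems(1)]
    unfolding Ck_on.simps by (intro exI[of _ "\<lambda>x v. A (f' x v)"]) auto
qed

lemma Ck_on_id: "Ck_on k S (\<lambda>x. x)"
proof (cases k)
  case (Suc j)
  then show ?thesis unfolding Suc Ck_on.simps by (intro exI[of _ "\<lambda>x v. v"]) (auto simp: Ck_on_const)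
qed auto

lemma Ck_on_linear: "bounded_linear A \<Longrightarrow> Ck_on k S A"
  using Ck_on_bounded_linear_comp[OF _ Ck_on_id] by blast

lemma Ck_on_add: "Ck_on k S f \<Longrightarrow> Ck_on k S h \<Longrightarrow> Ck_on k S (\<lambda>x. f x + h x)"
proof (induction k arbitrary: f h)
  case 0
  then show ?case by (simp add: continuous_on_add)
next
  case (Suc k)
  then obtain f' h' where
    "\<forall>x\<in>S. (f has_derivative f' x) (at x)" "\<forall>v. Ck_on k S (\<lambda>x. f' x v)"
    "\<forall>x\<in>S. (h has_derivative h' x) (at x)" "\<forall>v. Ck_on k S (\<lambda>x. h' x v)" by auto
  then show ?case using Suc.IH unfolding Ck_on.simps
    by (intro exI[of _ "\<lambda>x v. f' x v + h' x v"]) (auto intro: has_derivative_add)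
qed

lemma Ck_on_sum: "(\<And>i. i \<in> I \<Longrightarrow> Ck_on k S (f i)) \<Longrightarrow> Ck_on k S (\<lambda>x. \<Sum>i\<in>I. f i x)"
  by (induction I rule: infinite_finite_induct) (auto intro: Ck_on_const Ck_on_add)

lemma Ck_on_mult:
  fixes f h :: "'a::real_normed_vector \<Rightarrow> real"
  shows "Ck_on k S f \<Longrightarrow> Ck_on k S h \<Longrightarrow> Ck_on k S (\<lambda>x. f x * h x)"
proof (induction k arbitrary: f h)
  case 0
  then show ?case by (simp add: continuous_on_mult)
next
  case (Suc k)
  then obtain f' h' where
    "\<forall>x\<in>S. (f has_derivative f' x) (at x)" "\<forall>v. Ck_on k S (\<lambda>x. f' x v)"
    "\<forall>x\<in>S. (h has_derivative h' x) (at x)" "\<forall>v. Ck_on k S (\<lambda>x. h' x v)" by auto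
  moreover have "Ck_on k S f" "Ck_on k S h" using Suc.prems Ck_on_SucD by auto
  ultimately show ?case using Suc.IH unfolding Ck_on.simps
    by (intro exI[of _ "\<lambda>x v. f x * h' x v + f' x v * h x"])
       (auto intro: Ck_on_add has_derivative_mult)
qed

lemma Ck_on_inverse:
  fixes f :: "'a::real_normed_vector \<Rightarrow> real"
  assumes "\<And>x. x \<in> S \<Longrightarrow> f x \<noteq> 0"
  shows "Ck_on k S f \<Longrightarrow> Ck_on k S (\<lambda>x. inverse (f x))"
proof (induction k)
  case 0
  then show ?case using assms by (auto simp: continuous_on_inverse)
next
  case (Suc k)
  then obtain f' where
    f': "\<forall>x\<in>S. (f has_derivative f' x) (at x)" "\<forall>v. Ck_on k S (\<lambda>x. f' x v)" by auto
  have inv: "Ck_on k S (\<lambda>x. inverse (f x))" using Suc Ck_on_SucD by blast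
  have "Ck_on k S (\<lambda>x. (- 1) * (inverse (f x) * (f' x v * inverse (f x))))" for v
    by (intro Ck_on_mult Ck_on_const inv) (use f' in auto)
  then have "Ck_on k S (\<lambda>x. - (inverse (f x) * f' x v * inverse (f x)))" for v
    by (simp add: mult.assoc)
  moreover have "\<forall>x\<in>S. ((\<lambda>x. inverse (f x)) has_derivative
      (\<lambda>v. - (inverse (f x) * f' x v * inverse (f x)))) (at x)"
    using Deriv.has_derivative_inverse f' assms by blast
  ultimately show ?case unfolding Ck_on.simps
    by (intro exI[of _ "\<lambda>x v. - (inverse (f x) * f' x v * inverse (f x))"]) auto
qed

text \<open>A Parseval frame: the expansion that an orthonormal basis provides, which is the only property of
  such a basis that enters below.\<close>

definition tight_frame :: "'a::real_inner set \<Rightarrow> bool" where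
  "tight_frame B \<longleftrightarrow> finite B \<and> (\<forall>x. x = (\<Sum>b\<in>B. (x \<bullet> b) *\<^sub>R b))"

lemma tight_frameD: "tight_frame B \<Longrightarrow> finite B" "tight_frame B \<Longrightarrow> (\<Sum>b\<in>B. (x \<bullet> b) *\<^sub>R b) = x"
  unfolding tight_frame_def by (simp, metis)

lemma linear_tight_frame:
  assumes "tight_frame B" "linear A" shows "A v = (\<Sum>b\<in>B. (v \<bullet> b) *\<^sub>R A b)"
proof -
  have "A v = A (\<Sum>b\<in>B. (v \<bullet> b) *\<^sub>R b)" using tight_frameD(2)[OF assms(1)] by simp
  then show ?thesis using assms(2) by (simp add: linear_sum linear_scale)
qed

lemma tight_frame_real: "tight_frame {1::real}"
  by (simp add: tight_frame_def)

lemma tight_frame_prod: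
  fixes B :: "'a::real_inner set" and C :: "'b::real_inner set"
  assumes "tight_frame B" "tight_frame C"
  shows "tight_frame ((\<lambda>b. (b, 0)) ` B \<union> (\<lambda>c. (0, c)) ` C - {0})"
proof -
  let ?X = "(\<lambda>b. (b, 0::'b)) ` B" and ?Y = "(\<lambda>c. (0::'a, c)) ` C"
  have fin: "finite ?X" "finite ?Y" using tight_frameD(1) assms by auto
  have "(\<Sum>b\<in>?X \<union> ?Y - {0}. (x \<bullet> b) *\<^sub>R b) = x" for x
  proof -
    have "(\<Sum>b\<in>?X \<union> ?Y - {0}. (x \<bullet> b) *\<^sub>R b) = (\<Sum>b\<in>?X \<union> ?Y. (x \<bullet> b) *\<^sub>R b)"
      by (rule sum.mono_neutral_left) (use fin in auto)
    also have "\<dots> = (\<Sum>b\<in>?X. (x \<bullet> b) *\<^sub>R b) + (\<Sum>b\<in>?Y. (x \<bullet> b) *\<^sub>R b)"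
    proof -
      have "(\<Sum>b\<in>?X \<inter> ?Y. (x \<bullet> b) *\<^sub>R b) = 0"
        by (rule sum.neutral) (auto simp: zero_prod_def[symmetric])
      then show ?thesis using sum.union_inter[OF fin, of "\<lambda>b. (x \<bullet> b) *\<^sub>R b"] by simp
    qed
    also have "(\<Sum>b\<in>?X. (x \<bullet> b) *\<^sub>R b) = (\<Sum>b\<in>B. (fst x \<bullet> b) *\<^sub>R (b, 0))"
      by (subst sum.reindex) (auto simp: inj_on_def inner_prod_def)
    also have "(\<Sum>b\<in>?Y. (x \<bullet> b) *\<^sub>R b) = (\<Sum>b\<in>C. (snd x \<bullet> b) *\<^sub>R (0, b))"
      by (subst sum.reindex) (auto simp: inj_on_def inner_prod_def)
    also have "(\<Sum>b\<in>B. (fst x \<bullet> b) *\<^sub>R (b, 0)) + (\<Sum>b\<in>C. (snd x \<bullet> b) *\<^sub>R (0, b)) = x"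
      using tight_frameD(2)[OF assms(1), of "fst x"] tight_frameD(2)[OF assms(2), of "snd x"]
      by (intro prod_eqI) (simp_all add: fst_sum snd_sum)
    finally show ?thesis .
  qed
  then show ?thesis using fin by (simp add: tight_frame_def)
qed

lemma tight_frame_exists:
  assumes "finite (A::'a::real_inner set)" "span A = UNIV"
  shows "\<exists>B::'a set. tight_frame B"
proof -
  obtain C where C: "finite C" "span C = (UNIV::'a set)" "pairwise orthogonal C"
    using basis_orthogonal[OF assms(1)] assms(2) by metis
  define B where "B = (\<lambda>c. c /\<^sub>R norm c) ` (C - {0})"
  have "x = (\<Sum>b\<in>B. (x \<bullet> b) *\<^sub>R b)" for x
  proof -
    have x: "x \<in> span (C - {0})" using C(2) by simp
    then obtain u where u: "x = (\<Sum>c\<in>C - {0}. u c *\<^sub>R c)"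
      using C(1) span_finite[of "C - {0}"] by auto
    have xc: "x \<bullet> c = u c * (norm c)\<^sup>2" if "c \<in> C - {0}" for c
    proof -
      have "x \<bullet> c = (\<Sum>d\<in>C - {0}. u d * (d \<bullet> c))" by (simp add: u inner_sum_left)
      also have "\<dots> = (\<Sum>d\<in>C - {0}. if d = c then u c * (c \<bullet> c) else 0)"
        using C(3) that by (intro sum.cong) (auto simp: pairwise_def orthogonal_def)
      finally show ?thesis using that C(1) by (simp add: power2_norm_eq_inner)
    qed
    have inj: "inj_on (\<lambda>c. c /\<^sub>R norm c) (C - {0})"
    proof (rule inj_onI, rule ccontr)
      fix c d assume cd: "c \<in> C - {0}" "d \<in> C - {0}" "c /\<^sub>R norm c = d /\<^sub>R norm d" "c \<noteq> d"
      have "c \<bullet> d = 0" using C(3) cd(1,2,4) by (simp add: pairwise_def orthogonal_def)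
      then have "(c /\<^sub>R norm c) \<bullet> (d /\<^sub>R norm d) = 0" by simp
      then have "d /\<^sub>R norm d = 0" using cd(3) by (metis inner_eq_zero_iff)
      then show False using cd by simp
    qed
    have "(\<Sum>b\<in>B. (x \<bullet> b) *\<^sub>R b) = (\<Sum>c\<in>C - {0}. (x \<bullet> (c /\<^sub>R norm c)) *\<^sub>R (c /\<^sub>R norm c))"
      unfolding B_def by (subst sum.reindex[OF inj]) simp
    also have "\<dots> = (\<Sum>c\<in>C - {0}. u c *\<^sub>R c)"
      by (rule sum.cong) (auto simp: xc power2_eq_square)
    finally show ?thesis using u by simp
  qed
  moreover have "finite B" using C(1) by (simp add: B_def)
  ultimately show ?thesis unfolding tight_frame_def by blast
qed

text \<open>The differentiability class only controls derivatives in fixed directions. The derivative of the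
  outer function, taken in the direction of the varying derivative of the inner one, therefore has to be
  expanded in a frame before the induction hypothesis applies.\<close>

lemma Ck_on_compose:
  fixes f :: "'a::real_normed_vector \<Rightarrow> 'b::real_inner" and h :: "'b \<Rightarrow> real"
  assumes "tight_frame (B :: 'b set)"
  shows "Ck_on k S f \<Longrightarrow> Ck_on k T h \<Longrightarrow> f ` S \<subseteq> T \<Longrightarrow> Ck_on k S (\<lambda>x. h (f x))"
proof (induction k arbitrary: h)
  case 0
  then show ?case using continuous_on_compose2[of T h S f] by auto
next
  case (Suc k)
  from Suc.prems obtain f' h' where
    f': "\<forall>x\<in>S. (f has_derivative f' x) (at x)" "\<forall>v. Ck_on k S (\<lambda>x. f' x v)" and
    h': "\<forall>x\<in>T. (h has_derivative h' x) (at x)" "\<forall>v. Ck_on k T (\<lambda>x. h' x v)" by auto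
  let ?g' = "\<lambda>x v. \<Sum>b\<in>B. (f' x v \<bullet> b) * h' (f x) b"
  have "((\<lambda>x. h (f x)) has_derivative ?g' x) (at x)" if "x \<in> S" for x
  proof -
    have hx: "(h has_derivative h' (f x)) (at (f x))" using h' Suc.prems(3) that by blast
    then have "((\<lambda>x. h (f x)) has_derivative (\<lambda>v. h' (f x) (f' x v))) (at x)"
      using has_derivative_compose f' that by blast
    moreover have "(\<lambda>v. h' (f x) (f' x v)) = ?g' x"
    proof
      fix v
      show "h' (f x) (f' x v) = ?g' x v"
        using linear_tight_frame[OF assms has_derivative_linear[OF hx], of "f' x v"]
        unfolding real_scaleR_def .
    qed
    ultimately show ?thesis by simp
  qed
  moreover have "Ck_on k S (\<lambda>x. ?g' x v)" for v
  proof (intro Ck_on_sum Ck_on_mult)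
    fix b
    show "Ck_on k S (\<lambda>x. f' x v \<bullet> b)"
      using Ck_on_bounded_linear_comp[OF bounded_linear_inner_left] f'(2) by blast
    show "Ck_on k S (\<lambda>x. h' (f x) b)"
      using Suc.IH[of "\<lambda>x. h' x b"] Suc.prems Ck_on_SucD h'(2) by blast
  qed
  ultimately show ?case unfolding Ck_on.simps by (intro exI[of _ ?g']) auto
qed

lemma Ck_on_Pair:
  "Ck_on k S f \<Longrightarrow> Ck_on k S h \<Longrightarrow> Ck_on k S (\<lambda>x. (f x, h x))"
proof (induction k arbitrary: f h)
  case 0
  then show ?case by (simp add: continuous_on_Pair)
next
  case (Suc k)
  then obtain f' h' where
    "\<forall>x\<in>S. (f has_derivative f' x) (at x)" "\<forall>v. Ck_on k S (\<lambda>x. f' x v)"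
    "\<forall>x\<in>S. (h has_derivative h' x) (at x)" "\<forall>v. Ck_on k S (\<lambda>x. h' x v)" by auto
  then show ?case using Suc.IH unfolding Ck_on.simps
    by (intro exI[of _ "\<lambda>x v. (f' x v, h' x v)"]) (auto intro: has_derivative_Pair)
qed

lemma smooth_on_cong:
  "open S \<Longrightarrow> (\<And>x. x \<in> S \<Longrightarrow> f x = h x) \<Longrightarrow> smooth_on S f \<Longrightarrow> smooth_on S h"
  unfolding smooth_on_def using Ck_on_cong by blast

lemma smooth_on_subset: "smooth_on S f \<Longrightarrow> T \<subseteq> S \<Longrightarrow> smooth_on T f"
  unfolding smooth_on_def using Ck_on_subset by blast

lemma smooth_on_local:
  "open S \<Longrightarrow> (\<And>x. x \<in> S \<Longrightarrow> \<exists>T. open T \<and> x \<in> T \<and> smooth_on T f) \<Longrightarrow> smooth_on S f"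
  unfolding smooth_on_def by (intro allI, rule Ck_on_local) meson+

lemma smooth_on_differentiable: "smooth_on S f \<Longrightarrow> x \<in> S \<Longrightarrow> f differentiable (at x)"
  unfolding smooth_on_def using Ck_on.simps(2) differentiableI by blast

lemma smooth_on_has_derivative: "smooth_on S f \<Longrightarrow> x \<in> S \<Longrightarrow> (f has_derivative dder f x) (at x)"
  using smooth_on_differentiable frechet_derivative_works by blast

lemma smooth_on_dder: "open S \<Longrightarrow> smooth_on S f \<Longrightarrow> smooth_on S (\<lambda>x. dder f x v)"
  unfolding smooth_on_def using Ck_on_Suc_iff by blast

lemma smooth_on_continuous: "smooth_on S f \<Longrightarrow> continuous_on S f"
  unfolding smooth_on_def using Ck_on.simps(1) by blast

lemma smooth_on_linear: "bounded_linear A \<Longrightarrow> smooth_on S A"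
  unfolding smooth_on_def using Ck_on_linear by blast

lemma smooth_on_const: "smooth_on S (\<lambda>x. c)"
  unfolding smooth_on_def using Ck_on_const by blast

lemma smooth_on_id: "smooth_on S (\<lambda>x. x)"
  unfolding smooth_on_def using Ck_on_id by blast

lemma smooth_on_linear_comp:
  "bounded_linear A \<Longrightarrow> smooth_on S f \<Longrightarrow> smooth_on S (\<lambda>x. A (f x))"
  unfolding smooth_on_def using Ck_on_bounded_linear_comp by blast

lemma smooth_on_add: "smooth_on S f \<Longrightarrow> smooth_on S h \<Longrightarrow> smooth_on S (\<lambda>x. f x + h x)"
  unfolding smooth_on_def by (simp add: Ck_on_add)

lemma smooth_on_sum: "(\<And>i. i \<in> I \<Longrightarrow> smooth_on S (f i)) \<Longrightarrow> smooth_on S (\<lambda>x. \<Sum>i\<in>I. f i x)"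
  unfolding smooth_on_def by (simp add: Ck_on_sum)

lemma smooth_on_mult:
  fixes f h :: "'a::real_normed_vector \<Rightarrow> real"
  shows "smooth_on S f \<Longrightarrow> smooth_on S h \<Longrightarrow> smooth_on S (\<lambda>x. f x * h x)"
  unfolding smooth_on_def by (simp add: Ck_on_mult)

lemma smooth_on_inverse:
  fixes f :: "'a::real_normed_vector \<Rightarrow> real"
  shows "(\<And>x. x \<in> S \<Longrightarrow> f x \<noteq> 0) \<Longrightarrow> smooth_on S f \<Longrightarrow> smooth_on S (\<lambda>x. inverse (f x))"
  unfolding smooth_on_def by (simp add: Ck_on_inverse)

lemma smooth_on_compose:
  fixes f :: "'a::real_normed_vector \<Rightarrow> 'b::real_inner" and h :: "'b \<Rightarrow> real"
  shows "tight_frame (B :: 'b set) \<Longrightarrow> smooth_on S f \<Longrightarrow> smooth_on T h \<Longrightarrow> f ` S \<subseteq> T \<Longrightarrow> smooth_on S (\<lambda>x. h (f x))"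
  unfolding smooth_on_def by (intro allI, rule Ck_on_compose) auto

lemma smooth_on_Pair:
  "smooth_on S f \<Longrightarrow> smooth_on S h \<Longrightarrow> smooth_on S (\<lambda>x. (f x, h x))"
  unfolding smooth_on_def by (simp add: Ck_on_Pair)

text \<open>The coordinates of the points of a ball are bounded, so that the ball is a closed subset of a Minkowski
  sum of finitely many segments.\<close>

lemma tight_frame_compact_cball:
  fixes x0 :: "'a::real_inner"
  assumes "tight_frame (B :: 'a set)"
  shows "compact (cball x0 R)"
proof -
  have B: "finite B" using tight_frameD(1)[OF assms] .
  define K where "K C M = {x. \<exists>u. (\<forall>b\<in>C. \<bar>u b\<bar> \<le> M) \<and> x = (\<Sum>b\<in>C. u b *\<^sub>R b)}" for C :: "'a set" and M :: real
  have K: "compact (K C M)" if "finite C" "M \<ge> 0" for C M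
    using that
  proof (induction C rule: finite_induct)
    case empty
    then show ?case by (simp add: K_def)
  next
    case (insert c C)
    have "compact ((\<lambda>s. s *\<^sub>R c) ` {-M..M})"
      by (intro compact_continuous_image continuous_intros compact_Icc)
    then have "compact {x + y | x y. x \<in> (\<lambda>s. s *\<^sub>R c) ` {-M..M} \<and> y \<in> K C M}"
      using insert compact_sums by blast
    moreover have "{x + y | x y. x \<in> (\<lambda>s. s *\<^sub>R c) ` {-M..M} \<and> y \<in> K C M} = K (insert c C) M"
    proof (intro equalityI subsetI)
      fix z assume "z \<in> {x + y | x y. x \<in> (\<lambda>s. s *\<^sub>R c) ` {-M..M} \<and> y \<in> K C M}"
      then obtain s y where sy: "s \<in> {-M..M}" "y \<in> K C M" "z = s *\<^sub>R c + y" by blast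
      then obtain u where u: "\<forall>b\<in>C. \<bar>u b\<bar> \<le> M" "y = (\<Sum>b\<in>C. u b *\<^sub>R b)"
        unfolding K_def by blast
      have s: "\<bar>s\<bar> \<le> M" "\<forall>b\<in>C. \<bar>u b\<bar> \<le> M" "z = s *\<^sub>R c + (\<Sum>b\<in>C. u b *\<^sub>R b)"
        using sy u by auto
      have "(\<Sum>b\<in>C. (u(c := s)) b *\<^sub>R b) = (\<Sum>b\<in>C. u b *\<^sub>R b)"
        by (rule sum.cong) (use insert in auto)
      then have "z = (\<Sum>b\<in>insert c C. (u(c := s)) b *\<^sub>R b)"
        using insert s(3) by simp
      then show "z \<in> K (insert c C) M"
        unfolding K_def using s insert by (intro CollectI exI[of _ "u(c := s)"]) auto
    next
      fix z assume "z \<in> K (insert c C) M"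
      then obtain u where "\<forall>b\<in>insert c C. \<bar>u b\<bar> \<le> M" "z = (\<Sum>b\<in>insert c C. u b *\<^sub>R b)"
        unfolding K_def by auto
      then have "\<bar>u c\<bar> \<le> M" "\<forall>b\<in>C. \<bar>u b\<bar> \<le> M" "z = u c *\<^sub>R c + (\<Sum>b\<in>C. u b *\<^sub>R b)"
        using insert by auto
      then show "z \<in> {x + y | x y. x \<in> (\<lambda>s. s *\<^sub>R c) ` {-M..M} \<and> y \<in> K C M}"
        by (intro CollectI exI[of _ "u c *\<^sub>R c"] exI[of _ "\<Sum>b\<in>C. u b *\<^sub>R b"])
           (auto simp: K_def abs_le_iff)
    qed
    ultimately show ?case by simp
  qed
  define M where "M = (norm x0 + \<bar>R\<bar>) * (\<Sum>b\<in>B. norm b)"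
  have M0: "M \<ge> 0" unfolding M_def by (simp add: sum_nonneg)
  have "cball x0 R \<subseteq> K B M"
  proof
    fix x assume "x \<in> cball x0 R"
    then have nx: "norm x \<le> norm x0 + \<bar>R\<bar>"
      using norm_triangle_sub[of x x0] by (simp add: dist_norm norm_minus_commute)
    have "\<bar>x \<bullet> b\<bar> \<le> M" if "b \<in> B" for b
    proof -
      have "\<bar>x \<bullet> b\<bar> \<le> norm x * norm b" by (rule Cauchy_Schwarz_ineq2)
      also have "\<dots> \<le> M" unfolding M_def
        using nx member_le_sum[OF that _ B, of norm] by (intro mult_mono) auto
      finally show ?thesis .
    qed
    then show "x \<in> K B M" unfolding K_def
      using tight_frameD(2)[OF assms, of x] by (intro CollectI exI[of _ "\<lambda>b. x \<bullet> b"]) auto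
  qed
  then have "cball x0 R = K B M \<inter> cball x0 R" by blast
  then show ?thesis using K[OF B M0] compact_Int_closed[OF _ closed_cball] by metis
qed

section \<open>Hadamard's lemma and bump functions\<close>

text \<open>Moments of a function along the segment from \<open>x0\<close> to \<open>x\<close>. Differentiation in \<open>x\<close> replaces the function by its
  derivative and raises the exponent, so the family of all moments is closed under differentiation and
  its smoothness follows by one induction.\<close>

definition ray_moment :: "nat \<Rightarrow> ('a::real_normed_vector \<Rightarrow> real) \<Rightarrow> 'a \<Rightarrow> 'a \<Rightarrow> real" where
  "ray_moment j f x0 x = integral {0..1} (\<lambda>t. t ^ j * f (x0 + t *\<^sub>R (x - x0)))"

lemma ball_segment:
  fixes x0 :: "'a::real_normed_vector"
  assumes "x \<in> ball x0 \<rho>" "0 \<le> t" "t \<le> 1"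
  shows "x0 + t *\<^sub>R (x - x0) \<in> ball x0 \<rho>"
proof -
  have "t * norm (x - x0) \<le> 1 * norm (x - x0)" using assms by (intro mult_right_mono) auto
  then show ?thesis using assms by (auto simp: dist_norm norm_minus_commute)
qed

lemma cball_segment:
  fixes x0 :: "'a::real_normed_vector"
  assumes "x \<in> cball x0 \<rho>" "0 \<le> t" "t \<le> 1"
  shows "x0 + t *\<^sub>R (x - x0) \<in> cball x0 \<rho>"
proof -
  have "t * norm (x - x0) \<le> 1 * norm (x - x0)" using assms by (intro mult_right_mono) auto
  then show ?thesis using assms by (auto simp: dist_norm norm_minus_commute)
qed

lemma ray_moment_integrable:
  fixes f :: "'a::real_normed_vector \<Rightarrow> real"
  assumes "continuous_on (ball x0 \<rho>) f" "x \<in> ball x0 \<rho>"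
  shows "(\<lambda>t. t ^ j * f (x0 + t *\<^sub>R (x - x0))) integrable_on {0..1}"
proof (rule integrable_continuous_real)
  have "continuous_on {0..1} (\<lambda>t. f (x0 + t *\<^sub>R (x - x0)))"
    by (rule continuous_on_compose2[OF assms(1)]) (use ball_segment[OF assms(2)] in \<open>auto intro!: continuous_intros\<close>)
  then show "continuous_on {0..1} (\<lambda>t. t ^ j * f (x0 + t *\<^sub>R (x - x0)))"
    by (intro continuous_intros)
qed

text \<open>Differentiation under the integral sign. The derivative is uniformly continuous on a compact ball that
  contains the segments to all points near \<open>x\<close>, so the linear approximation is uniform in the integration
  variable.\<close>

lemma ray_moment_derivative:
  fixes f :: "'a::real_inner \<Rightarrow> real"
  assumes B: "tight_frame (B :: 'a set)" and f: "smooth_on (ball x0 \<rho>) f" and x: "x \<in> ball x0 \<rho>"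
  shows "(ray_moment j f x0 has_derivative (\<lambda>v. ray_moment (Suc j) (\<lambda>y. dder f y v) x0 x)) (at x)"
proof -
  let ?S = "ball x0 \<rho>"
  have df: "(f has_derivative dder f y) (at y)" if "y \<in> ?S" for y
    using smooth_on_has_derivative[OF f that] .
  have cf: "continuous_on ?S f" using f smooth_on_continuous by blast
  have cd: "continuous_on ?S (\<lambda>y. dder f y v)" for v
    using f smooth_on_dder smooth_on_continuous open_ball by blast
  have lin: "dder f y v = (\<Sum>b\<in>B. (v \<bullet> b) * dder f y b)" if "y \<in> ?S" for y v
    using linear_tight_frame[OF B has_derivative_linear[OF df[OF that]], of v] by (simp only: real_scaleR_def)
  have hadlin: "ray_moment (Suc j) (\<lambda>y. dder f y v) x0 x = (\<Sum>b\<in>B. (v \<bullet> b) * ray_moment (Suc j) (\<lambda>y. dder f y b) x0 x)" for v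
  proof -
    have "ray_moment (Suc j) (\<lambda>y. dder f y v) x0 x =
        integral {0..1} (\<lambda>t. \<Sum>b\<in>B. (v \<bullet> b) * (t ^ Suc j * dder f (x0 + t *\<^sub>R (x - x0)) b))"
      unfolding ray_moment_def
    proof (rule integral_cong)
      fix t :: real assume "t \<in> {0..1}"
      then have "x0 + t *\<^sub>R (x - x0) \<in> ?S" using ball_segment[OF x] by auto
      then show "t ^ Suc j * dder f (x0 + t *\<^sub>R (x - x0)) v =
          (\<Sum>b\<in>B. (v \<bullet> b) * (t ^ Suc j * dder f (x0 + t *\<^sub>R (x - x0)) b))"
        by (subst lin) (simp_all add: sum_distrib_left mult_ac)
    qed
    also have "\<dots> = (\<Sum>b\<in>B. integral {0..1} (\<lambda>t. (v \<bullet> b) * (t ^ Suc j * dder f (x0 + t *\<^sub>R (x - x0)) b)))"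
      by (intro integral_sum tight_frameD(1)[OF B] integrable_on_mult_right ray_moment_integrable[OF cd x])
    finally show ?thesis unfolding ray_moment_def by simp
  qed
  have bl: "bounded_linear (\<lambda>v. ray_moment (Suc j) (\<lambda>y. dder f y v) x0 x)"
    by (subst hadlin) (intro bounded_linear_sum bounded_linear_mult_const bounded_linear_inner_left)
  have "\<exists>d>0. \<forall>y. norm (y - x) < d \<longrightarrow>
      norm (ray_moment j f x0 y - ray_moment j f x0 x - ray_moment (Suc j) (\<lambda>z. dder f z (y - x)) x0 x) \<le> e * norm (y - x)"
    if e: "e > 0" for e
  proof -
    \<comment> \<open>an intermediate radius: the closed ball is compact and contains a neighbourhood of \<open>x\<close>\<close>
    define \<rho>' where "\<rho>' = (norm (x - x0) + \<rho>) / 2"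
    have nx: "norm (x - x0) < \<rho>" using x by (simp add: dist_norm norm_minus_commute)
    have \<rho>': "norm (x - x0) < \<rho>'" "\<rho>' < \<rho>" using nx unfolding \<rho>'_def by auto
    let ?K = "cball x0 \<rho>'"
    have KS: "?K \<subseteq> ?S" using \<rho>' by auto
    define e' where "e' = e / (1 + (\<Sum>b\<in>B. norm b))"
    have e': "e' > 0" "e' * (\<Sum>b\<in>B. norm b) \<le> e"
    proof -
      have s: "(\<Sum>b\<in>B. norm b) \<ge> 0" by (simp add: sum_nonneg)
      then show "e' > 0" using e unfolding e'_def by (simp add: add_pos_nonneg)
      then have "e' * (\<Sum>b\<in>B. norm b) \<le> e' * (1 + (\<Sum>b\<in>B. norm b))" by (intro mult_left_mono) auto
      also have "\<dots> = e" unfolding e'_def using s by (auto simp: add_nonneg_eq_0_iff)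
      finally show "e' * (\<Sum>b\<in>B. norm b) \<le> e" .
    qed
    have "\<exists>d>0. \<forall>y\<in>?K. \<forall>z\<in>?K. dist z y < d \<longrightarrow> dist (dder f z b) (dder f y b) < e'" for b
    proof -
      have "uniformly_continuous_on ?K (\<lambda>y. dder f y b)"
        by (rule compact_uniformly_continuous[OF continuous_on_subset[OF cd KS] tight_frame_compact_cball[OF B]])
      then show ?thesis using e'(1) unfolding uniformly_continuous_on_def by blast
    qed
    then obtain d where d: "\<And>b. d b > 0"
      "\<And>b y z. y \<in> ?K \<Longrightarrow> z \<in> ?K \<Longrightarrow> dist z y < d b \<Longrightarrow> dist (dder f z b) (dder f y b) < e'" by metis
    define \<delta> where "\<delta> = Min (insert (\<rho>' - norm (x - x0)) (d ` B))"
    have fin: "finite (insert (\<rho>' - norm (x - x0)) (d ` B))" using tight_frameD(1)[OF B] by simp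
    have \<delta>0: "\<delta> > 0" unfolding \<delta>_def using d(1) \<rho>' fin by (subst Min_gr_iff) auto
    have \<delta>1: "\<delta> \<le> \<rho>' - norm (x - x0)" unfolding \<delta>_def using fin by (intro Min_le) auto
    have \<delta>2: "\<delta> \<le> d b" if "b \<in> B" for b unfolding \<delta>_def using fin that by (intro Min_le) auto
    have onm: "onorm (\<lambda>v. dder f z v - dder f y v) \<le> e" if yz: "y \<in> ?K" "z \<in> ?K" "dist z y < \<delta>" for y z
    proof (rule onorm_bound)
      show "0 \<le> e" using e by simp
      fix v
      have "dder f z v - dder f y v = (\<Sum>b\<in>B. (v \<bullet> b) * (dder f z b - dder f y b))"
        using lin[of z v] lin[of y v] yz KS by (simp add: sum_subtractf right_diff_distrib subset_iff)
      then have "norm (dder f z v - dder f y v) \<le> (\<Sum>b\<in>B. norm v * norm b * e')"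
      proof (elim ssubst, intro sum_norm_le)
        fix b assume b: "b \<in> B"
        have "\<bar>dder f z b - dder f y b\<bar> \<le> e'"
          using d(2)[of y z b] yz \<delta>2[OF b] by (simp add: dist_real_def)
        then show "norm ((v \<bullet> b) * (dder f z b - dder f y b)) \<le> norm v * norm b * e'"
          unfolding real_norm_def abs_mult using Cauchy_Schwarz_ineq2[of v b] by (intro mult_mono) auto
      qed
      also have "\<dots> = norm v * (e' * (\<Sum>b\<in>B. norm b))"
        by (simp add: sum_distrib_left mult_ac)
      also have "\<dots> \<le> norm v * e" using e'(2) by (intro mult_left_mono) auto
      finally show "norm (dder f z v - dder f y v) \<le> e * norm v" by (simp add: mult.commute)
    qed
    have "norm (ray_moment j f x0 y - ray_moment j f x0 x - ray_moment (Suc j) (\<lambda>z. dder f z (y - x)) x0 x) \<le> e * norm (y - x)"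
      if y: "norm (y - x) < \<delta>" for y
    proof -
      have yK: "y \<in> ?K"
        using norm_triangle_ineq[of "y - x" "x - x0"] y \<delta>1 by (simp add: dist_norm norm_minus_commute)
      have yS: "y \<in> ?S" using yK KS by blast
      let ?z = "\<lambda>t. x0 + t *\<^sub>R (x - x0)" and ?w = "\<lambda>t. x0 + t *\<^sub>R (y - x0)"
      let ?h = "\<lambda>t. t ^ j * f (?w t) - t ^ j * f (?z t) - t ^ Suc j * dder f (?z t) (y - x)"
      have int: "ray_moment j f x0 y - ray_moment j f x0 x - ray_moment (Suc j) (\<lambda>z. dder f z (y - x)) x0 x = integral {0..1} ?h"
        unfolding ray_moment_def
        by (simp only: integral_diff integrable_diff
            ray_moment_integrable[OF cf yS] ray_moment_integrable[OF cf x] ray_moment_integrable[OF cd x])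
      have inth: "?h integrable_on {0..1}"
        by (intro integrable_diff
            ray_moment_integrable[OF cf yS] ray_moment_integrable[OF cf x] ray_moment_integrable[OF cd x])
      have "norm (?h t) \<le> e * norm (y - x)" if t: "t \<in> {0..1}" for t
      proof -
        have zK: "?z t \<in> ?K" using cball_segment[of x x0 \<rho>' t] t \<rho>' by (auto simp: dist_norm norm_minus_commute)
        have wK: "?w t \<in> ?K" using cball_segment[OF yK] t by auto
        have wz: "?w t - ?z t = t *\<^sub>R (y - x)" by (simp add: algebra_simps)
        have dwz: "dist (?w t) (?z t) < \<delta>"
        proof -
          have "t * norm (y - x) \<le> 1 * norm (y - x)" using t by (intro mult_right_mono) auto
          then show ?thesis using y t unfolding dist_norm wz by simp
        qed
        let ?T = "?K \<inter> ball (?z t) \<delta>"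
        have "norm (f (?w t) - f (?z t) - dder f (?z t) (?w t - ?z t)) \<le> norm (?w t - ?z t) * e"
        proof (rule differentiable_bound_linearization[where S = ?T and f' = "\<lambda>y. dder f y"])
          fix s :: real assume s: "s \<in> {0..1}"
          have "convex ?T" by (intro convex_Int convex_cball convex_ball)
          moreover have "?z t \<in> ?T" "?w t \<in> ?T" using zK wK dwz \<delta>0 by (auto simp: dist_commute)
          ultimately have "(1 - s) *\<^sub>R ?z t + s *\<^sub>R ?w t \<in> ?T" using s by (intro convexD) auto
          then show "?z t + s *\<^sub>R (?w t - ?z t) \<in> ?T" by (simp add: algebra_simps)
        next
          fix u assume "u \<in> ?T"
          then show "(f has_derivative dder f u) (at u within ?T)"
            using df[of u] KS has_derivative_at_withinI by blast
        next
          fix u assume u: "u \<in> ?T"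
          have "onorm (\<lambda>v. dder f u v - dder f (?z t) v) \<le> e"
            using onm[OF zK, of u] u by (auto simp: dist_commute)
          then show "onorm (dder f u - dder f (?z t)) \<le> e" by (simp add: fun_diff_def)
        next
          show "?z t \<in> ?T" using zK \<delta>0 by auto
        qed
        also have "norm (?w t - ?z t) * e = t * (e * norm (y - x))" using t unfolding wz by simp
        finally have A: "norm (f (?w t) - f (?z t) - dder f (?z t) (?w t - ?z t)) \<le> t * (e * norm (y - x))" .
        have "dder f (?z t) (?w t - ?z t) = t * dder f (?z t) (y - x)"
          using linear_scale[OF has_derivative_linear[OF df[of "?z t"]], of t "y - x"] zK KS
          unfolding wz by auto
        then have "?h t = t ^ j * (f (?w t) - f (?z t) - dder f (?z t) (?w t - ?z t))"
          by (simp add: algebra_simps)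
        then have "norm (?h t) \<le> t ^ j * (t * (e * norm (y - x)))"
          using A t by (simp add: abs_mult mult_left_mono)
        also have "\<dots> = t ^ Suc j * (e * norm (y - x))" by simp
        also have "\<dots> \<le> 1 * (e * norm (y - x))"
          using t e power_le_one[of t "Suc j"] by (intro mult_right_mono) auto
        finally show ?thesis by simp
      qed
      then have "norm (integral {0..1} ?h) \<le> integral {0..1} (\<lambda>t::real. e * norm (y - x))"
        by (intro integral_norm_bound_integral inth integrable_const_ivl)
      then show ?thesis unfolding int by simp
    qed
    then show ?thesis using \<delta>0 by blast
  qed
  then show ?thesis using bl unfolding has_derivative_at_alt by blast
qed

lemma smooth_on_ray_moment:
  fixes f :: "'a::real_inner \<Rightarrow> real"
  assumes B: "tight_frame (B :: 'a set)" and f: "smooth_on (ball x0 \<rho>) f"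
  shows "smooth_on (ball x0 \<rho>) (ray_moment j f x0)"
proof -
  have "Ck_on k (ball x0 \<rho>) (ray_moment j f x0)" for k
    using f
  proof (induction k arbitrary: j f)
    case 0
    then show ?case
      using has_derivative_continuous[OF ray_moment_derivative[OF B 0]]
      by (simp add: continuous_at_imp_continuous_on)
  next
    case (Suc k)
    have "Ck_on k (ball x0 \<rho>) (\<lambda>x. ray_moment (Suc j) (\<lambda>y. dder f y v) x0 x)" for v
      using Suc.IH[OF smooth_on_dder[OF open_ball Suc.prems]] .
    then show ?case using ray_moment_derivative[OF B Suc.prems] unfolding Ck_on.simps
      by (intro exI[of _ "\<lambda>x v. ray_moment (Suc j) (\<lambda>y. dder f y v) x0 x"]) auto
  qed
  then show ?thesis by (simp add: smooth_on_def)
qed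

lemma ray_moment_at_center: "ray_moment 0 f x0 x0 = f x0"
  by (simp add: ray_moment_def)

text \<open>The fundamental theorem of calculus along the segment from \<open>x0\<close> to \<open>x\<close>.\<close>

lemma hadamard:
  fixes f :: "'a::real_inner \<Rightarrow> real"
  assumes B: "tight_frame (B :: 'a set)" and f: "smooth_on (ball x0 \<rho>) f" and x: "x \<in> ball x0 \<rho>"
  shows "f x = f x0 + (\<Sum>b\<in>B. ((x - x0) \<bullet> b) * ray_moment 0 (\<lambda>y. dder f y b) x0 x)"
proof -
  let ?S = "ball x0 \<rho>" and ?z = "\<lambda>t. x0 + t *\<^sub>R (x - x0)"
  have df: "(f has_derivative dder f y) (at y)" if "y \<in> ?S" for y
    using smooth_on_has_derivative[OF f that] .
  have cd: "continuous_on ?S (\<lambda>y. dder f y v)" for v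
    using f smooth_on_dder smooth_on_continuous open_ball by blast
  have zS: "?z t \<in> ?S" if "t \<in> {0..1}" for t using ball_segment[OF x] that by auto
  have "((\<lambda>t. f (?z t)) has_vector_derivative dder f (?z t) (x - x0)) (at t within {0..1})"
    if t: "t \<in> {0..1}" for t
  proof -
    have "(?z has_derivative (\<lambda>s. s *\<^sub>R (x - x0))) (at t within {0..1})"
      by (auto intro!: derivative_eq_intros)
    then have "((\<lambda>t. f (?z t)) has_derivative (\<lambda>s. dder f (?z t) (s *\<^sub>R (x - x0)))) (at t within {0..1})"
      using has_derivative_compose df[OF zS[OF t]] by blast
    then show ?thesis unfolding has_vector_derivative_def
      using linear_scale[OF has_derivative_linear[OF df[OF zS[OF t]]], of _ "x - x0"] by simp
  qed
  then have "((\<lambda>t. dder f (?z t) (x - x0)) has_integral (f (?z 1) - f (?z 0))) {0..1}"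
    by (intro fundamental_theorem_of_calculus) auto
  then have "f x - f x0 = integral {0..1} (\<lambda>t. dder f (?z t) (x - x0))"
    by (simp add: integral_unique)
  also have "\<dots> = integral {0..1} (\<lambda>t. \<Sum>b\<in>B. ((x - x0) \<bullet> b) * (t ^ 0 * dder f (?z t) b))"
  proof (rule integral_cong)
    fix t :: real assume "t \<in> {0..1}"
    then show "dder f (?z t) (x - x0) = (\<Sum>b\<in>B. ((x - x0) \<bullet> b) * (t ^ 0 * dder f (?z t) b))"
      using linear_tight_frame[OF B has_derivative_linear[OF df[OF zS]], of t "x - x0"]
      by (simp only: real_scaleR_def power_0 mult_1)
  qed
  also have "\<dots> = (\<Sum>b\<in>B. integral {0..1} (\<lambda>t. ((x - x0) \<bullet> b) * (t ^ 0 * dder f (?z t) b)))"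
    by (intro integral_sum tight_frameD(1)[OF B] integrable_on_mult_right ray_moment_integrable[OF cd x])
  finally show ?thesis by (simp add: ray_moment_def)
qed

lemma dder_mult:
  fixes f h :: "'a::real_normed_vector \<Rightarrow> real"
  assumes "f differentiable (at x)" "h differentiable (at x)"
  shows "dder (\<lambda>y. f y * h y) x v = f x * dder h x v + dder f x v * h x"
proof -
  have "((\<lambda>y. f y * h y) has_derivative (\<lambda>v. f x * dder h x v + dder f x v * h x)) (at x)"
    using assms frechet_derivative_works has_derivative_mult by blast
  then show ?thesis using frechet_derivative_at by metis
qed

lemma dder_sum:
  assumes "\<And>i. i \<in> I \<Longrightarrow> f i differentiable (at x)"
  shows "dder (\<lambda>y. \<Sum>i\<in>I. f i y) x v = (\<Sum>i\<in>I. dder (f i) x v)"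
proof -
  have "((\<lambda>y. \<Sum>i\<in>I. f i y) has_derivative (\<lambda>v. \<Sum>i\<in>I. dder (f i) x v)) (at x)"
    by (rule has_derivative_sum) (use assms frechet_derivative_works in blast)
  then show ?thesis using frechet_derivative_at by metis
qed

lemma dder_add_const:
  fixes f :: "'a::real_normed_vector \<Rightarrow> real"
  assumes "f differentiable (at x)"
  shows "dder (\<lambda>y. c + f y) x v = dder f x v"
proof -
  have "((\<lambda>y. c + f y) has_derivative dder f x) (at x)"
    using has_derivative_add[OF has_derivative_const[of c] assms[unfolded frechet_derivative_works]]
    by simp
  then show ?thesis using frechet_derivative_at by metis
qed

lemma dder_add:
  assumes "f differentiable (at x)" "h differentiable (at x)"
  shows "dder (\<lambda>y. f y + h y) x v = dder f x v + dder h x v"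
proof -
  have "((\<lambda>y. f y + h y) has_derivative (\<lambda>v. dder f x v + dder h x v)) (at x)"
    using assms frechet_derivative_works has_derivative_add by blast
  then have "(\<lambda>v. dder f x v + dder h x v) = dder (\<lambda>y. f y + h y) x"
    by (rule frechet_derivative_at)
  then show ?thesis by metis
qed

lemma dder_cong_open:
  assumes "open S" "x \<in> S" "\<And>y. y \<in> S \<Longrightarrow> f y = h y" "f differentiable (at x)"
  shows "dder h x = dder f x"
proof -
  have "(h has_derivative dder f x) (at x)"
    using has_derivative_transform_within_open[OF assms(4)[unfolded frechet_derivative_works] assms(1,2)]
      assms(3) by blast
  then show ?thesis using frechet_derivative_at by metis
qed

text \<open>Expanding \<open>f\<close> by Hadamard's lemma, \<open>f x = f x0 + (\<Sum>b. (x - x0)\<^sub>b G\<^sub>b x)\<close>, the second derivative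
  at \<open>x0\<close> in directions \<open>v\<close>, \<open>w\<close> becomes the visibly symmetric expression
  \<open>\<Sum>b. w\<^sub>b \<partial>\<^sub>v G\<^sub>b + v\<^sub>b \<partial>\<^sub>w G\<^sub>b\<close>.\<close>

lemma second_derivative_symmetric:
  fixes f :: "'a::real_inner \<Rightarrow> real"
  assumes B: "tight_frame (B :: 'a set)" and S: "open S" "x0 \<in> S" and f: "smooth_on S f"
  shows "dder (\<lambda>x. dder f x w) x0 v = dder (\<lambda>x. dder f x v) x0 w"
proof -
  obtain \<rho> where \<rho>: "\<rho> > 0" "ball x0 \<rho> \<subseteq> S" using S open_contains_ball by blast
  let ?S = "ball x0 \<rho>"
  have x0: "x0 \<in> ?S" using \<rho> by simp
  have fS: "smooth_on ?S f" using f \<rho> smooth_on_subset by blast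
  define H where "H b = ray_moment 0 (\<lambda>y. dder f y b) x0" for b
  have H: "smooth_on ?S (H b)" for b
    unfolding H_def using smooth_on_ray_moment[OF B smooth_on_dder[OF open_ball fS]] .
  have dlin: "dder (\<lambda>x. (x - x0) \<bullet> b) x w = w \<bullet> b" for b x w
  proof -
    have "((\<lambda>x. (x - x0) \<bullet> b) has_derivative (\<lambda>w. w \<bullet> b)) (at x)"
      by (auto intro!: derivative_eq_intros)
    then show ?thesis using frechet_derivative_at by metis
  qed
  have ldiff: "(\<lambda>x. (x - x0) \<bullet> b) differentiable (at x)" for b x
    by (intro differentiableI[of _ "\<lambda>w. w \<bullet> b"]) (auto intro!: derivative_eq_intros)
  have first: "dder f x w = (\<Sum>b\<in>B. (x - x0) \<bullet> b * dder (H b) x w + (w \<bullet> b) * H b x)"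
    if x: "x \<in> ?S" for x w
  proof -
    let ?F = "\<lambda>x. \<Sum>b\<in>B. ((x - x0) \<bullet> b) * H b x"
    have dH: "H b differentiable (at x)" for b using smooth_on_differentiable[OF H x] .
    have dm: "(\<lambda>x. ((x - x0) \<bullet> b) * H b x) differentiable (at x)" for b
      using ldiff dH by (rule differentiable_mult)
    have "f y = f x0 + ?F y" if "y \<in> ?S" for y
      using hadamard[OF B fS that] unfolding H_def .
    then have "dder f x = dder (\<lambda>y. f x0 + ?F y) x"
      by (intro dder_cong_open[OF open_ball x])
         (auto intro!: differentiable_add differentiable_sum dm tight_frameD(1)[OF B])
    moreover have "?F differentiable (at x)"
      by (intro differentiable_sum tight_frameD(1)[OF B] ballI dm)
    ultimately have "dder f x w = dder ?F x w"
      by (simp only: dder_add_const)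
    also have "\<dots> = (\<Sum>b\<in>B. (x - x0) \<bullet> b * dder (H b) x w + (w \<bullet> b) * H b x)"
      by (simp add: dder_sum[OF dm] dder_mult[OF ldiff dH] dlin)
    finally show ?thesis .
  qed
  have "dder (\<lambda>x. dder f x w) x0 v = (\<Sum>b\<in>B. (v \<bullet> b) * dder (H b) x0 w + (w \<bullet> b) * dder (H b) x0 v)" for v w
  proof -
    let ?F = "\<lambda>x. \<Sum>b\<in>B. (x - x0) \<bullet> b * dder (H b) x w + (w \<bullet> b) * H b x"
    have dH: "H b differentiable (at x0)" for b using smooth_on_differentiable[OF H x0] .
    have ddH: "(\<lambda>x. dder (H b) x w) differentiable (at x0)" for b
      using smooth_on_differentiable[OF smooth_on_dder[OF open_ball H] x0] .
    have cdiff: "(\<lambda>x. w \<bullet> b) differentiable (at x0)" for b by simp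
    have dm: "(\<lambda>x. (x - x0) \<bullet> b * dder (H b) x w) differentiable (at x0)"
      "(\<lambda>x. (w \<bullet> b) * H b x) differentiable (at x0)" for b
      using ldiff ddH dH cdiff by (auto intro!: differentiable_mult)
    have dd: "(\<lambda>x. (x - x0) \<bullet> b * dder (H b) x w + (w \<bullet> b) * H b x) differentiable (at x0)" for b
      using dm by (rule differentiable_add)
    have "?F differentiable (at x0)"
      by (intro differentiable_sum tight_frameD(1)[OF B] ballI dd)
    then have "dder (\<lambda>x. dder f x w) x0 = dder ?F x0"
      using first by (intro dder_cong_open[OF open_ball x0]) auto
    then have "dder (\<lambda>x. dder f x w) x0 v = dder ?F x0 v" by simp
    also have "\<dots> = (\<Sum>b\<in>B. dder (\<lambda>x. (x - x0) \<bullet> b * dder (H b) x w + (w \<bullet> b) * H b x) x0 v)"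
      by (rule dder_sum[OF dd])
    also have "\<dots> = (\<Sum>b\<in>B. (v \<bullet> b) * dder (H b) x0 w + (w \<bullet> b) * dder (H b) x0 v)"
    proof (rule sum.cong[OF refl])
      fix b
      show "dder (\<lambda>x. (x - x0) \<bullet> b * dder (H b) x w + (w \<bullet> b) * H b x) x0 v =
         (v \<bullet> b) * dder (H b) x0 w + (w \<bullet> b) * dder (H b) x0 v"
        by (simp add: dder_add[OF dm] dder_mult[OF ldiff ddH] dder_mult[OF cdiff dH] dlin)
    qed
    finally show ?thesis .
  qed
  from this[of w v] this[of v w] show ?thesis by (simp add: add.commute)
qed


text \<open>The family \<open>exp_flat n\<close> is closed under differentiation up to linear combinations, so that its
  smoothness follows by one induction on the order of differentiability.\<close>

definition exp_flat :: "nat \<Rightarrow> real \<Rightarrow> real" where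
  "exp_flat n x = (if x > 0 then exp (- inverse x) * inverse x ^ n else 0)"

lemma exp_flat_tendsto: "(exp_flat n \<longlongrightarrow> 0) (at_right 0)"
proof -
  have "((\<lambda>x::real. inverse x ^ n / exp (inverse x)) \<longlongrightarrow> 0) (at_right 0)"
    using filterlim_compose[OF tendsto_power_div_exp_0 filterlim_inverse_at_top_right] .
  moreover have "eventually (\<lambda>x. inverse x ^ n / exp (inverse x) = exp_flat n x) (at_right (0::real))"
    using eventually_at_right_less[of "0::real"]
    by eventually_elim (simp add: exp_flat_def exp_minus field_simps)
  ultimately show ?thesis using filterlim_cong[OF refl refl] by fast
qed

text \<open>At \<open>0\<close> from the right, the difference quotient of a member of the family is the next member.\<close>

lemma exp_flat_DERIV:
  "DERIV (exp_flat n) x :> exp_flat (n + 2) x - real n * exp_flat (Suc n) x"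
proof -
  consider "x > 0" | "x < 0" | "x = 0" by linarith
  then show ?thesis
  proof cases
    case 1
    have inv: "DERIV inverse x :> - (inverse x ^ 2)"
      using DERIV_inverse[of x] 1 by (simp add: power2_eq_square)
    have "DERIV (\<lambda>x. exp (- inverse x) * inverse x ^ n) x :>
        exp (- inverse x) * (real n * inverse x ^ (n - 1) * - (inverse x ^ 2))
        + exp (- inverse x) * (inverse x ^ 2) * inverse x ^ n"
      by (rule derivative_eq_intros inv refl)+ simp
    moreover have "exp (- inverse x) * (real n * inverse x ^ (n - 1) * - (inverse x ^ 2))
        + exp (- inverse x) * (inverse x ^ 2) * inverse x ^ n
        = exp_flat (n + 2) x - real n * exp_flat (Suc n) x"
      using 1 by (cases n) (simp_all add: exp_flat_def algebra_simps power2_eq_square)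
    ultimately have "DERIV (\<lambda>x. exp (- inverse x) * inverse x ^ n) x :>
        exp_flat (n + 2) x - real n * exp_flat (Suc n) x" by (simp only:)
    then show ?thesis
      by (rule has_field_derivative_transform_within_open[where S = "{0<..}"])
         (use 1 in \<open>auto simp: exp_flat_def\<close>)
  next
    case 2
    have "DERIV (\<lambda>x. 0::real) x :> exp_flat (n + 2) x - real n * exp_flat (Suc n) x"
      using 2 by (simp add: exp_flat_def)
    then show ?thesis
      by (rule has_field_derivative_transform_within_open[where S = "{..<0}"])
         (use 2 in \<open>auto simp: exp_flat_def\<close>)
  next
    case 3
    have "((\<lambda>h. exp_flat n h / h) \<longlongrightarrow> 0) (at_right 0)"
    proof -
      have "eventually (\<lambda>h. exp_flat (Suc n) h = exp_flat n h / h) (at_right (0::real))"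
        using eventually_at_right_less[of "0::real"]
        by eventually_elim (simp add: exp_flat_def field_simps)
      then show ?thesis using exp_flat_tendsto[of "Suc n"] filterlim_cong[OF refl refl] by fast
    qed
    moreover have "((\<lambda>h. exp_flat n h / h) \<longlongrightarrow> 0) (at_left 0)"
    proof -
      have "eventually (\<lambda>h::real. h < 0) (at_left 0)"
        by (simp add: eventually_at_filter)
      then have "eventually (\<lambda>h. 0 = exp_flat n h / h) (at_left (0::real))"
        by eventually_elim (simp add: exp_flat_def)
      then show ?thesis using tendsto_const[of "0::real" "at_left (0::real)"] filterlim_cong[OF refl refl] by fast
    qed
    ultimately have "((\<lambda>h. exp_flat n h / h) \<longlongrightarrow> 0) (at 0)"
      by (rule filterlim_split_at[rotated])
    then show ?thesis using 3 by (simp add: DERIV_def exp_flat_def)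
  qed
qed

lemma smooth_on_exp_flat: "smooth_on S (exp_flat n)"
proof -
  have "Ck_on k S (exp_flat n)" for k
  proof (induction k arbitrary: n)
    case 0
    then show ?case
      using DERIV_isCont[OF exp_flat_DERIV] by (simp add: continuous_at_imp_continuous_on)
  next
    case (Suc k)
    have "(exp_flat n has_derivative
        (\<lambda>v. (exp_flat (n + 2) x + (- real n) * exp_flat (Suc n) x) * v)) (at x)" for x
      using exp_flat_DERIV[of n x] by (simp add: has_field_derivative_def)
    moreover have "Ck_on k S (\<lambda>x. (exp_flat (n + 2) x + (- real n) * exp_flat (Suc n) x) * v)" for v
      by (intro Ck_on_mult Ck_on_add Ck_on_const Suc.IH)
    ultimately show ?case unfolding Ck_on.simps
      by (intro exI[of _ "\<lambda>x v. (exp_flat (n + 2) x + (- real n) * exp_flat (Suc n) x) * v"]) auto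
  qed
  then show ?thesis by (simp add: smooth_on_def)
qed

definition cutoff :: "real \<Rightarrow> real" where
  "cutoff t = exp_flat 0 (2 - t) * inverse (exp_flat 0 (2 - t) + exp_flat 0 (t - 1))"

lemma cutoff_values: "t \<le> 1 \<Longrightarrow> cutoff t = 1" "t \<ge> 2 \<Longrightarrow> cutoff t = 0"
  by (auto simp: cutoff_def exp_flat_def)

lemma smooth_on_cutoff: "smooth_on UNIV cutoff"
proof -
  have aff: "smooth_on UNIV (\<lambda>t::real. 2 - t)" "smooth_on UNIV (\<lambda>t::real. t - 1)"
    using smooth_on_add[OF smooth_on_const[of UNIV "2::real"] smooth_on_linear[OF bounded_linear_minus[OF bounded_linear_ident]]]
      smooth_on_add[OF smooth_on_id smooth_on_const[of UNIV "- 1::real"]] by simp_all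
  have e: "smooth_on UNIV (\<lambda>t. exp_flat 0 (2 - t))" "smooth_on UNIV (\<lambda>t. exp_flat 0 (t - 1))"
    by (rule smooth_on_compose[OF tight_frame_real aff(1) smooth_on_exp_flat[of UNIV]], simp)
       (rule smooth_on_compose[OF tight_frame_real aff(2) smooth_on_exp_flat[of UNIV]], simp)
  have "exp_flat 0 (2 - t) + exp_flat 0 (t - 1) > 0" for t
    by (cases "t < 2") (auto simp: exp_flat_def add_pos_nonneg)
  then have "smooth_on UNIV (\<lambda>t. inverse (exp_flat 0 (2 - t) + exp_flat 0 (t - 1)))"
    by (intro smooth_on_inverse smooth_on_add e) (metis less_irrefl)
  then have "smooth_on UNIV (\<lambda>t. exp_flat 0 (2 - t) * inverse (exp_flat 0 (2 - t) + exp_flat 0 (t - 1)))"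
    by (rule smooth_on_mult[OF e(1)])
  then show ?thesis by (simp add: cutoff_def[abs_def])
qed

text \<open>The constant 4 makes the argument of the cutoff at most 1 for \<open>norm (x - x0) \<le> \<rho> / 2\<close>, and at least
  \<open>4 \<cdot> 9 / 16 > 2\<close> for \<open>norm (x - x0) \<ge> 3 / 4 \<cdot> \<rho>\<close>.\<close>

definition bump :: "'a::real_inner \<Rightarrow> real \<Rightarrow> 'a \<Rightarrow> real" where
  "bump x0 \<rho> x = cutoff ((4 / \<rho>\<^sup>2) * ((x - x0) \<bullet> (x - x0)))"

lemma bump_one: "\<rho> > 0 \<Longrightarrow> x \<in> ball x0 (\<rho> / 2) \<Longrightarrow> bump x0 \<rho> x = 1"
proof -
  assume r: "\<rho> > 0" and x: "x \<in> ball x0 (\<rho> / 2)"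
  have "norm (x - x0) \<le> \<rho> / 2" using x by (simp add: dist_norm norm_minus_commute)
  then have "(norm (x - x0))\<^sup>2 \<le> (\<rho> / 2)\<^sup>2" by (intro power_mono) auto
  then show ?thesis unfolding bump_def using r
    by (intro cutoff_values) (simp add: power2_norm_eq_inner power_divide divide_simps)
qed

lemma bump_zero: "\<rho> > 0 \<Longrightarrow> x \<notin> cball x0 (3 / 4 * \<rho>) \<Longrightarrow> bump x0 \<rho> x = 0"
proof -
  assume r: "\<rho> > 0" and x: "x \<notin> cball x0 (3 / 4 * \<rho>)"
  have "3 / 4 * \<rho> \<le> norm (x - x0)" using x by (simp add: dist_norm norm_minus_commute)
  then have "(3 / 4 * \<rho>)\<^sup>2 \<le> (norm (x - x0))\<^sup>2" using r by (intro power_mono) auto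
  then have "9 / 16 * \<rho>\<^sup>2 \<le> (x - x0) \<bullet> (x - x0)"
    by (simp add: power2_norm_eq_inner power_mult_distrib power_divide)
  then have "4 / \<rho>\<^sup>2 * (9 / 16 * \<rho>\<^sup>2) \<le> 4 / \<rho>\<^sup>2 * ((x - x0) \<bullet> (x - x0))"
    by (intro mult_left_mono) auto
  then show ?thesis unfolding bump_def using r by (intro cutoff_values) simp
qed

lemma smooth_on_bump:
  assumes B: "tight_frame (B :: 'a::real_inner set)"
  shows "smooth_on S (bump (x0 :: 'a) \<rho>)"
proof -
  have c: "smooth_on UNIV (\<lambda>x. (x - x0) \<bullet> b)" for b
    using smooth_on_linear_comp[OF bounded_linear_inner_left[of b]
        smooth_on_add[OF smooth_on_id smooth_on_const[of UNIV "- x0"]]] by simp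
  have sq: "(\<lambda>x. (x - x0) \<bullet> (x - x0)) = (\<lambda>x. \<Sum>b\<in>B. ((x - x0) \<bullet> b) * ((x - x0) \<bullet> b))"
  proof
    fix x
    have "(x - x0) \<bullet> (x - x0) = (x - x0) \<bullet> (\<Sum>b\<in>B. ((x - x0) \<bullet> b) *\<^sub>R b)"
      by (simp only: tight_frameD(2)[OF B])
    then show "(x - x0) \<bullet> (x - x0) = (\<Sum>b\<in>B. ((x - x0) \<bullet> b) * ((x - x0) \<bullet> b))"
      by (simp only: inner_sum_right inner_scaleR_right)
  qed
  have "smooth_on UNIV (\<lambda>x. (x - x0) \<bullet> (x - x0))"
    unfolding sq by (intro smooth_on_mult smooth_on_sum c)
  then have "smooth_on UNIV (\<lambda>x. (4 / \<rho>\<^sup>2) * ((x - x0) \<bullet> (x - x0)))"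
    by (intro smooth_on_mult smooth_on_const)
  then have "smooth_on UNIV (\<lambda>x. cutoff ((4 / \<rho>\<^sup>2) * ((x - x0) \<bullet> (x - x0))))"
    by (rule smooth_on_compose[OF tight_frame_real _ smooth_on_cutoff]) simp
  then show ?thesis
    using smooth_on_subset[of UNIV "bump x0 \<rho>" S] by (simp add: bump_def[abs_def])
qed

section \<open>Tangent vectors in charts\<close>

locale lie =
  fixes G :: "('g::{t2_space,second_countable_topology}, 'e::real_inner) lie_group_data"
  assumes lie: "lie_group G"
begin

abbreviation mul (infixl "\<bullet>\<bullet>" 70) where "g \<bullet>\<bullet> h \<equiv> gmul G g h"
abbreviation iv where "iv \<equiv> ginv G"
abbreviation e1 where "e1 \<equiv> gone G"
abbreviation C where "C \<equiv> smooth_funs G"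
abbreviation T where "T \<equiv> tangent_space G"

lemma group: "group (gmul G) (gone G) (ginv G)"
  using lie by (simp add: lie_group_def)

sublocale gr: group "gmul G" "gone G" "ginv G" by (rule group)

lemma mul_iv [simp]: "iv g \<bullet>\<bullet> (g \<bullet>\<bullet> h) = h" "g \<bullet>\<bullet> (iv g \<bullet>\<bullet> h) = h"
  "(h \<bullet>\<bullet> g) \<bullet>\<bullet> iv g = h" "(h \<bullet>\<bullet> iv g) \<bullet>\<bullet> g = h" "g \<bullet>\<bullet> iv g = e1" "iv g \<bullet>\<bullet> g = e1"
  by (simp_all add: gr.assoc[symmetric]) (simp_all add: gr.assoc)

lemma iv_iv [simp]: "iv (iv g) = g" "iv e1 = e1" "iv (g \<bullet>\<bullet> h) = iv h \<bullet>\<bullet> iv g"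
  by (simp_all add: gr.inverse_distrib_swap)

lemma mul_one [simp]: "e1 \<bullet>\<bullet> g = g" "g \<bullet>\<bullet> e1 = g"
  by simp_all

lemma tight_frame_ex: obtains B :: "'e set" where "tight_frame B"
proof -
  obtain A :: "'e set" where "finite A" "span A = UNIV"
    using lie unfolding lie_group_def by (elim conjE exE)
  then show thesis using tight_frame_exists that by metis
qed

lemma smooth_atlas: "smooth_atlas (atlas G)"
  using lie by (simp add: lie_group_def)

lemma chart:
  assumes "(U, \<phi>) \<in> atlas G"
  shows "open U" "open (\<phi> ` U)" "homeomorphism U (\<phi> ` U) \<phi> (inv_into U \<phi>)"
    "inj_on \<phi> U" "continuous_on U \<phi>" "continuous_on (\<phi> ` U) (inv_into U \<phi>)"
    "\<And>q. q \<in> U \<Longrightarrow> inv_into U \<phi> (\<phi> q) = q"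
    "\<And>x. x \<in> \<phi> ` U \<Longrightarrow> inv_into U \<phi> x \<in> U"
    "\<And>x. x \<in> \<phi> ` U \<Longrightarrow> \<phi> (inv_into U \<phi> x) = x"
proof -
  have *: "open U \<and> open (\<phi> ` U) \<and> homeomorphism U (\<phi> ` U) \<phi> (inv_into U \<phi>)"
    using bspec[OF conjunct1[OF conjunct2[OF smooth_atlas[unfolded smooth_atlas_def]]] assms]
    unfolding prod.case .
  then show "open U" "open (\<phi> ` U)" and h: "homeomorphism U (\<phi> ` U) \<phi> (inv_into U \<phi>)" by auto
  show "continuous_on U \<phi>" "continuous_on (\<phi> ` U) (inv_into U \<phi>)"
    using h by (auto simp: homeomorphism_def)
  show i: "inj_on \<phi> U" using homeomorphism_apply1[OF h] by (rule inj_on_inverseI)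
  show "\<And>q. q \<in> U \<Longrightarrow> inv_into U \<phi> (\<phi> q) = q" by (rule inv_into_f_f[OF i])
  show "\<And>x. x \<in> \<phi> ` U \<Longrightarrow> inv_into U \<phi> x \<in> U" by (rule inv_into_into)
  show "\<And>x. x \<in> \<phi> ` U \<Longrightarrow> \<phi> (inv_into U \<phi> x) = x" by (rule f_inv_into_f)
qed

lemma chart_at: obtains U \<phi> where "(U, \<phi>) \<in> atlas G" "p \<in> U"
proof -
  have "(\<Union>(U, \<phi>)\<in>atlas G. U) = UNIV"
    using smooth_atlas unfolding smooth_atlas_def by (elim conjE)
  then have "p \<in> (\<Union>(U, \<phi>)\<in>atlas G. U)" by simp
  then show thesis using that by auto
qed

lemma transition:
  assumes "(U, \<phi>) \<in> atlas G" "(V, \<psi>) \<in> atlas G"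
  shows "smooth_on (\<phi> ` (U \<inter> V)) (\<lambda>x. \<psi> (inv_into U \<phi> x))"
  using bspec[OF bspec[OF conjunct2[OF conjunct2[OF smooth_atlas[unfolded smooth_atlas_def]]] assms(1),
      unfolded prod.case] assms(2), unfolded prod.case] unfolding o_def .

lemma open_chart_image:
  assumes "(U, \<phi>) \<in> atlas G" "open W" "W \<subseteq> U"
  shows "open (\<phi> ` W)"
proof -
  have "openin (top_of_set U) W" using assms by (simp add: openin_open_eq chart(1))
  then have "openin (top_of_set (\<phi> ` U)) (\<phi> ` W)"
    using homeomorphism_imp_open_map[OF chart(3)[OF assms(1)]] by blast
  then show ?thesis using chart(2)[OF assms(1)] by (simp add: openin_open_eq)
qed

lemma open_chart_preimage:
  assumes "(U, \<phi>) \<in> atlas G" "open S" "S \<subseteq> \<phi> ` U"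
  shows "open (inv_into U \<phi> ` S)"
proof -
  have "inv_into U \<phi> ` S = U \<inter> \<phi> -` S"
    using assms(3) chart(7-9)[OF assms(1)] by force
  then show ?thesis
    using continuous_open_preimage[OF chart(5)[OF assms(1)] chart(1)[OF assms(1)] assms(2)] by simp
qed

lemma smooth_fun_chart:
  "f \<in> C \<Longrightarrow> (U, \<phi>) \<in> atlas G \<Longrightarrow> smooth_on (\<phi> ` U) (\<lambda>x. f (inv_into U \<phi> x))"
  unfolding smooth_funs_def o_def by blast

lemma smooth_funI:
  "(\<And>U \<phi>. (U, \<phi>) \<in> atlas G \<Longrightarrow> smooth_on (\<phi> ` U) (\<lambda>x. f (inv_into U \<phi> x))) \<Longrightarrow> f \<in> C"
  unfolding smooth_funs_def o_def by blast

text \<open>Smoothness may be checked near each point in one chart of one's choice, because transition maps are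
  smooth.\<close>

lemma smooth_fun_local:
  assumes "\<And>p. \<exists>U \<phi> W. (U, \<phi>) \<in> atlas G \<and> open W \<and> p \<in> W \<and> W \<subseteq> U \<and>
    smooth_on (\<phi> ` W) (\<lambda>x. f (inv_into U \<phi> x))"
  shows "f \<in> C"
proof (rule smooth_funI)
  fix V \<psi> assume V: "(V, \<psi>) \<in> atlas G"
  obtain B :: "'e set" where B: "tight_frame B" by (rule tight_frame_ex)
  show "smooth_on (\<psi> ` V) (\<lambda>x. f (inv_into V \<psi> x))"
  proof (rule smooth_on_local[OF chart(2)[OF V]])
    fix y assume "y \<in> \<psi> ` V"
    then obtain q where q: "q \<in> V" "y = \<psi> q" by blast
    obtain U \<phi> W where W: "(U, \<phi>) \<in> atlas G" "open W" "q \<in> W" "W \<subseteq> U"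
      "smooth_on (\<phi> ` W) (\<lambda>x. f (inv_into U \<phi> x))" using assms by blast
    let ?T = "\<psi> ` (W \<inter> V)"
    have oT: "open ?T" using open_chart_image[OF V] W chart(1)[OF V] by blast
    have "smooth_on ?T (\<lambda>x. \<phi> (inv_into V \<psi> x))"
      using transition[OF V W(1)] smooth_on_subset W(4) by (metis Int_commute Int_mono image_mono order_refl)
    then have "smooth_on ?T (\<lambda>x. f (inv_into U \<phi> (\<phi> (inv_into V \<psi> x))))"
      by (rule smooth_on_compose[OF B _ W(5)]) (use chart(7)[OF V] in auto)
    then have "smooth_on ?T (\<lambda>x. f (inv_into V \<psi> x))"
      by (rule smooth_on_cong[OF oT, rotated]) (use W chart(7)[OF V] chart(7)[OF W(1)] in auto)
    then show "\<exists>T. open T \<and> y \<in> T \<and> smooth_on T (\<lambda>x. f (inv_into V \<psi> x))"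
      using oT q W by blast
  qed
qed

lemma C_add [intro]: "f \<in> C \<Longrightarrow> h \<in> C \<Longrightarrow> (\<lambda>p. f p + h p) \<in> C"
  by (rule smooth_funI) (auto intro: smooth_on_add smooth_fun_chart)
lemma C_mult [intro]: "f \<in> C \<Longrightarrow> h \<in> C \<Longrightarrow> (\<lambda>p. f p * h p) \<in> C"
  by (rule smooth_funI) (auto intro: smooth_on_mult smooth_fun_chart)
lemma C_const [intro, simp]: "(\<lambda>p. c) \<in> C"
  by (rule smooth_funI) (auto intro: smooth_on_const)
lemma C_sum [intro]: "(\<And>i. i \<in> I \<Longrightarrow> f i \<in> C) \<Longrightarrow> (\<lambda>p. \<Sum>i\<in>I. f i p) \<in> C"
  by (rule smooth_funI, rule smooth_on_sum) (rule smooth_fun_chart)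
lemma C_cmult [intro]: "f \<in> C \<Longrightarrow> (\<lambda>p. c * f p) \<in> C"
  by (intro C_mult C_const)
lemma C_minus [intro]: "f \<in> C \<Longrightarrow> (\<lambda>p. - f p) \<in> C"
  using C_cmult[of f "-1"] by simp
lemma C_diff [intro]: "f \<in> C \<Longrightarrow> h \<in> C \<Longrightarrow> (\<lambda>p. f p - h p) \<in> C"
  using C_add[of f "\<lambda>p. - h p"] C_minus[of h] by simp

lemma T_outside: "v \<in> T p \<Longrightarrow> f \<notin> C \<Longrightarrow> v f = 0"
  unfolding tangent_space_def by blast
lemma T_add: "v \<in> T p \<Longrightarrow> f \<in> C \<Longrightarrow> h \<in> C \<Longrightarrow> v (\<lambda>q. f q + h q) = v f + v h"
  unfolding tangent_space_def linear_over_def plus_fun_def by blast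
lemma T_cmult: "v \<in> T p \<Longrightarrow> f \<in> C \<Longrightarrow> v (\<lambda>q. c * f q) = c * v f"
  unfolding tangent_space_def linear_over_def sc_def by blast
lemma T_mult: "v \<in> T p \<Longrightarrow> f \<in> C \<Longrightarrow> h \<in> C \<Longrightarrow> v (\<lambda>q. f q * h q) = f p * v h + v f * h p"
  unfolding tangent_space_def times_fun_def by blast
lemma T_const: assumes "v \<in> T p" shows "v (\<lambda>q. c) = 0"
proof -
  have "v (\<lambda>q. 1 * 1) = v (\<lambda>q. 1) + v (\<lambda>q. 1)"
    using T_mult[OF assms C_const C_const, of 1 1] by simp
  then have "v (\<lambda>q. 1) = 0" by simp
  then show ?thesis using T_cmult[OF assms C_const, of c 1] by simp
qed
lemma T_minus: "v \<in> T p \<Longrightarrow> f \<in> C \<Longrightarrow> v (\<lambda>q. - f q) = - v f"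
  using T_cmult[of v p f "-1"] by simp
lemma T_diff: "v \<in> T p \<Longrightarrow> f \<in> C \<Longrightarrow> h \<in> C \<Longrightarrow> v (\<lambda>q. f q - h q) = v f - v h"
  using T_add[of v p f "\<lambda>q. - h q"] T_minus[of v p h] C_minus[of h] by simp
lemma T_sum:
  assumes "v \<in> T p" "\<And>i. i \<in> I \<Longrightarrow> f i \<in> C"
  shows "v (\<lambda>q. \<Sum>i\<in>I. f i q) = (\<Sum>i\<in>I. v (f i))"
  using assms(2)
  by (induction I rule: infinite_finite_induct) (auto simp: T_const[OF assms(1)] T_add[OF assms(1)] C_sum)

lemma T_I:
  assumes "\<And>f. f \<notin> C \<Longrightarrow> v f = 0"
    "\<And>f h. f \<in> C \<Longrightarrow> h \<in> C \<Longrightarrow> v (\<lambda>q. f q + h q) = v f + v h"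
    "\<And>f c. f \<in> C \<Longrightarrow> v (\<lambda>q. c * f q) = c * v f"
    "\<And>f h. f \<in> C \<Longrightarrow> h \<in> C \<Longrightarrow> v (\<lambda>q. f q * h q) = f p * v h + v f * h p"
  shows "v \<in> T p"
  unfolding tangent_space_def linear_over_def sc_def plus_fun_def times_fun_def using assms by auto

text \<open>Functions given in a ball of a chart, cut off to become global ones.\<close>

definition chart_ext where
  "chart_ext U \<phi> x0 \<rho> H = (\<lambda>q. if q \<in> U \<and> \<phi> q \<in> ball x0 \<rho> then bump x0 \<rho> (\<phi> q) * H (\<phi> q) else (0::real))"

text \<open>The support lies in the image of a closed ball of radius \<open>3 / 4 \<cdot> \<rho>\<close>. This image is compact, hence closed in
  the Hausdorff space, and the function vanishes on its open complement.\<close>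

lemma chart_ext_smooth:
  assumes U: "(U, \<phi>) \<in> atlas G" and \<rho>: "\<rho> > 0" "cball x0 \<rho> \<subseteq> \<phi> ` U" and H: "smooth_on (ball x0 \<rho>) H"
  shows "chart_ext U \<phi> x0 \<rho> H \<in> C"
proof (rule smooth_fun_local)
  fix p
  obtain B :: "'e set" where B: "tight_frame B" by (rule tight_frame_ex)
  note ch = chart[OF U]
  have bU: "ball x0 \<rho> \<subseteq> \<phi> ` U" using \<rho> by auto
  show "\<exists>V \<psi> W. (V, \<psi>) \<in> atlas G \<and> open W \<and> p \<in> W \<and> W \<subseteq> V \<and>
    smooth_on (\<psi> ` W) (\<lambda>x. chart_ext U \<phi> x0 \<rho> H (inv_into V \<psi> x))"
  proof (cases "p \<in> U \<and> \<phi> p \<in> ball x0 \<rho>")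
    case True
    let ?W = "inv_into U \<phi> ` ball x0 \<rho>"
    have "\<phi> ` ?W = ball x0 \<rho>" using bU ch(9) by (force simp: image_image)
    moreover have "smooth_on (ball x0 \<rho>) (\<lambda>x. chart_ext U \<phi> x0 \<rho> H (inv_into U \<phi> x))"
    proof (rule smooth_on_cong[OF open_ball])
      show "smooth_on (ball x0 \<rho>) (\<lambda>x. bump x0 \<rho> x * H x)"
        by (intro smooth_on_mult H smooth_on_bump[OF B])
      fix x assume "x \<in> ball x0 \<rho>"
      moreover then have "x \<in> \<phi> ` U" using bU by blast
      ultimately show "bump x0 \<rho> x * H x = chart_ext U \<phi> x0 \<rho> H (inv_into U \<phi> x)"
        using ch(8,9) by (simp add: chart_ext_def)
    qed
    moreover have "open ?W" by (rule open_chart_preimage[OF U open_ball bU])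
    moreover have "p \<in> ?W" using True ch(7) by force
    moreover have "?W \<subseteq> U" using bU ch(8) by blast
    ultimately show ?thesis using U by metis
  next
    case False
    let ?K = "inv_into U \<phi> ` cball x0 (3 / 4 * \<rho>)"
    have sub: "cball x0 (3 / 4 * \<rho>) \<subseteq> ball x0 \<rho>" using \<rho> by auto
    have "compact ?K"
      by (intro compact_continuous_image tight_frame_compact_cball[OF B] continuous_on_subset[OF ch(6)])
         (use sub bU in auto)
    then have "closed ?K" by (rule compact_imp_closed)
    obtain V \<psi> where V: "(V, \<psi>) \<in> atlas G" "p \<in> V" by (rule chart_at)
    let ?W = "V - ?K"
    have W: "open ?W" using chart(1)[OF V(1)] \<open>closed ?K\<close> by (simp add: open_Diff)
    have "p \<notin> ?K"
    proof
      assume "p \<in> ?K"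
      then obtain x where x: "x \<in> cball x0 (3 / 4 * \<rho>)" "p = inv_into U \<phi> x" by blast
      then have "x \<in> ball x0 \<rho>" "x \<in> \<phi> ` U" using sub bU by blast+
      then show False using False x(2) ch(8,9) by simp
    qed
    moreover have "chart_ext U \<phi> x0 \<rho> H q = 0" if "q \<in> ?W" for q
    proof (cases "q \<in> U \<and> \<phi> q \<in> ball x0 \<rho>")
      case True
      then have "\<phi> q \<notin> cball x0 (3 / 4 * \<rho>)" using that ch(7) by force
      from bump_zero[OF \<rho>(1) this] show ?thesis by (simp add: chart_ext_def)
    qed (auto simp: chart_ext_def)
    then have "smooth_on (\<psi> ` ?W) (\<lambda>x. chart_ext U \<phi> x0 \<rho> H (inv_into V \<psi> x))"
      by (intro smooth_on_cong[OF open_chart_image[OF V(1) W] _ smooth_on_const[of _ 0]])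
         (auto simp: chart(7)[OF V(1)])
    ultimately show ?thesis using V W by (intro exI[of _ V] exI[of _ \<psi>] exI[of _ ?W]) auto
  qed
qed

lemma chart_ext_near:
  assumes "(U, \<phi>) \<in> atlas G" "\<rho> > 0" "q \<in> U" "\<phi> q \<in> ball x0 (\<rho> / 2)"
  shows "chart_ext U \<phi> x0 \<rho> H q = H (\<phi> q)"
  using assms bump_one[OF assms(2,4)] by (simp add: chart_ext_def)

lemma chart_ball:
  assumes "(U, \<phi>) \<in> atlas G" "p \<in> U" "open W" "p \<in> W"
  obtains \<rho> where "\<rho> > 0" "cball (\<phi> p) \<rho> \<subseteq> \<phi> ` (U \<inter> W)"
proof -
  have "open (\<phi> ` (U \<inter> W))" using open_chart_image[OF assms(1)] chart(1)[OF assms(1)] assms(3) by blast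
  then show thesis using that assms open_contains_cball by blast
qed

text \<open>A bump function supported where \<open>f\<close> and \<open>h\<close> agree annihilates their difference; apply the Leibniz rule.\<close>

lemma T_local:
  assumes v: "v \<in> T p" and f: "f \<in> C" "h \<in> C" and W: "open W" "p \<in> W" "\<And>q. q \<in> W \<Longrightarrow> f q = h q"
  shows "v f = v h"
proof -
  obtain U \<phi> where U: "(U, \<phi>) \<in> atlas G" "p \<in> U" by (rule chart_at)
  obtain \<rho> where \<rho>: "\<rho> > 0" "cball (\<phi> p) \<rho> \<subseteq> \<phi> ` (U \<inter> W)"
    using chart_ball[OF U W(1,2)] by blast
  let ?\<chi> = "chart_ext U \<phi> (\<phi> p) \<rho> (\<lambda>x. 1)"
  have \<chi>: "?\<chi> \<in> C" by (rule chart_ext_smooth[OF U(1) \<rho>(1)]) (use \<rho>(2) smooth_on_const in auto)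
  have \<chi>p: "?\<chi> p = 1" using chart_ext_near[OF U(1) \<rho>(1) U(2)] \<rho>(1) by simp
  have k: "(\<lambda>q. f q - h q) \<in> C" using f by blast
  have "?\<chi> q * (f q - h q) = 0" for q
  proof (cases "q \<in> U \<and> \<phi> q \<in> ball (\<phi> p) \<rho>")
    case True
    then have "\<phi> q \<in> cball (\<phi> p) \<rho>" by simp
    then have "\<phi> q \<in> \<phi> ` (U \<inter> W)" using \<rho> by blast
    then have "q \<in> W" using True chart(4)[OF U(1)] by (auto dest: inj_onD)
    then show ?thesis using W(3) by simp
  qed (auto simp: chart_ext_def)
  then have "(\<lambda>q. ?\<chi> q * (f q - h q)) = (\<lambda>q. 0)" by (rule ext)
  then have "0 = v (\<lambda>q. ?\<chi> q * (f q - h q))" using T_const[OF v, of 0] by simp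
  also have "\<dots> = v (\<lambda>q. f q - h q)"
    using T_mult[OF v \<chi> k] \<chi>p W(2,3) by simp
  finally show ?thesis using T_diff[OF v f] by simp
qed

text \<open>Near \<open>p\<close>, Hadamard's lemma gives \<open>f = f p + (\<Sum>b. (y b - y b p) \<cdot> h b)\<close> with \<open>h b p\<close> the partial derivative of \<open>f\<close>;
  by the Leibniz rule \<open>v f\<close> is then \<open>(\<Sum>b. v (y b) \<cdot> h b p)\<close>. The coordinate functions \<open>y b\<close> are the same for all \<open>p\<close>
  near \<open>p0\<close>, which is what makes the dependence on \<open>p\<close> accessible.\<close>

lemma local_coordinates:
  assumes B: "tight_frame (B :: 'e set)"
  obtains U \<phi> W y where "(U, \<phi>) \<in> atlas G" "open W" "p0 \<in> W" "W \<subseteq> U" "\<And>b. b \<in> B \<Longrightarrow> y b \<in> C"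
    "\<And>p v f. p \<in> W \<Longrightarrow> v \<in> T p \<Longrightarrow> f \<in> C \<Longrightarrow>
       v f = (\<Sum>b\<in>B. v (y b) * dder (\<lambda>x. f (inv_into U \<phi> x)) (\<phi> p) b)"
proof -
  obtain U \<phi> where U: "(U, \<phi>) \<in> atlas G" "p0 \<in> U" by (rule chart_at)
  note ch = chart[OF U(1)]
  obtain \<rho> where \<rho>: "\<rho> > 0" "cball (\<phi> p0) \<rho> \<subseteq> \<phi> ` U"
    using chart_ball[OF U open_UNIV] by auto
  define y where "y b = chart_ext U \<phi> (\<phi> p0) \<rho> (\<lambda>x. x \<bullet> b)" for b
  have y: "y b \<in> C" for b
    unfolding y_def by (rule chart_ext_smooth[OF U(1) \<rho> smooth_on_linear[OF bounded_linear_inner_left]])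
  let ?S = "ball (\<phi> p0) (\<rho> / 2)"
  let ?W = "inv_into U \<phi> ` ?S"
  have SU: "?S \<subseteq> \<phi> ` U"
  proof -
    have "?S \<subseteq> cball (\<phi> p0) \<rho>" using \<rho>(1) by auto
    then show ?thesis using \<rho>(2) by blast
  qed
  have W: "open ?W" by (rule open_chart_preimage[OF U(1) open_ball SU])
  have WU: "?W \<subseteq> U" using SU ch(8) by blast
  have \<phi>W: "\<phi> q \<in> ?S" if "q \<in> ?W" for q using that SU ch(9) by force
  have p0: "p0 \<in> ?W" using \<rho>(1) ch(7)[OF U(2)] by (intro image_eqI[of _ _ "\<phi> p0"]) auto
  have yW: "y b q = \<phi> q \<bullet> b" if "q \<in> ?W" for b q
    unfolding y_def using chart_ext_near[OF U(1) \<rho>(1), of q "\<phi> p0"] \<phi>W[OF that] WU that by blast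
  have "v f = (\<Sum>b\<in>B. v (y b) * dder (\<lambda>x. f (inv_into U \<phi> x)) (\<phi> p) b)"
    if p: "p \<in> ?W" and v: "v \<in> T p" and f: "f \<in> C" for p v f
  proof -
    let ?f = "\<lambda>x. f (inv_into U \<phi> x)" and ?x = "\<phi> p"
    have pU: "p \<in> U" using p WU by blast
    obtain \<epsilon> where \<epsilon>: "\<epsilon> > 0" "cball ?x \<epsilon> \<subseteq> \<phi> ` (U \<inter> ?W)"
      using chart_ball[OF U(1) pU W p] by blast
    then have \<epsilon>U: "cball ?x \<epsilon> \<subseteq> \<phi> ` U" by blast
    have fs: "smooth_on (ball ?x \<epsilon>) ?f"
      using smooth_on_subset[OF smooth_fun_chart[OF f U(1)]] \<epsilon>U ball_subset_cball by blast
    define H where "H b = ray_moment 0 (\<lambda>z. dder ?f z b) ?x" for b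
    have H: "smooth_on (ball ?x \<epsilon>) (H b)" for b
      unfolding H_def by (rule smooth_on_ray_moment[OF B smooth_on_dder[OF open_ball fs]])
    define h where "h b = chart_ext U \<phi> ?x \<epsilon> (H b)" for b
    have h: "h b \<in> C" for b unfolding h_def by (rule chart_ext_smooth[OF U(1) \<epsilon>(1) \<epsilon>U H])
    have hp: "h b p = dder ?f ?x b" for b
      unfolding h_def using chart_ext_near[OF U(1) \<epsilon>(1) pU, of ?x] \<epsilon>(1) by (simp add: H_def ray_moment_at_center)
    let ?F = "\<lambda>q. f p + (\<Sum>b\<in>B. (y b q - y b p) * h b q)"
    have t: "(\<lambda>q. (y b q - y b p) * h b q) \<in> C" for b
      by (rule C_mult[OF C_diff[OF y C_const] h])
    have F: "(\<lambda>q. \<Sum>b\<in>B. (y b q - y b p) * h b q) \<in> C" by (rule C_sum[OF t])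
    let ?V = "inv_into U \<phi> ` ball ?x (\<epsilon> / 2)"
    have bs: "ball ?x (\<epsilon> / 2) \<subseteq> cball ?x \<epsilon>" using \<epsilon>(1) by auto
    have "f q = ?F q" if q: "q \<in> ?V" for q
    proof -
      have qq: "\<phi> q \<in> ball ?x (\<epsilon> / 2)" "q \<in> U" using q bs \<epsilon>U ch(8,9) by force+
      then have "\<phi> q \<in> \<phi> ` (U \<inter> ?W)" using bs \<epsilon>(2) by blast
      then have qW: "q \<in> ?W" using qq(2) ch(4) by (auto dest: inj_onD)
      have "\<phi> q \<in> ball ?x \<epsilon>" using qq(1) \<epsilon>(1) by (simp add: field_simps)
      then have "?f (\<phi> q) = ?f ?x + (\<Sum>b\<in>B. ((\<phi> q - ?x) \<bullet> b) * H b (\<phi> q))"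
        unfolding H_def by (rule hadamard[OF B fs])
      moreover have "h b q = H b (\<phi> q)" for b
        unfolding h_def using chart_ext_near[OF U(1) \<epsilon>(1) qq(2,1)] .
      ultimately show ?thesis
        using ch(7)[OF qq(2)] ch(7)[OF pU] by (simp add: yW[OF qW] yW[OF p] inner_diff_left)
    qed
    then have "v f = v ?F"
    proof (intro T_local[OF v f])
      show "?F \<in> C" by (rule C_add[OF C_const F])
      show "open ?V" by (rule open_chart_preimage[OF U(1) open_ball]) (use bs \<epsilon>U in blast)
      show "p \<in> ?V" using \<epsilon>(1) ch(7)[OF pU] by (intro image_eqI[of _ _ ?x]) auto
    qed
    also have "\<dots> = (\<Sum>b\<in>B. v (\<lambda>q. (y b q - y b p) * h b q))"
      using T_add[OF v C_const F] T_sum[OF v t] T_const[OF v] by simp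
    also have "\<dots> = (\<Sum>b\<in>B. v (y b) * dder ?f ?x b)"
    proof (rule sum.cong[OF refl])
      fix b
      have "(\<lambda>q. y b q - y b p) \<in> C" by (rule C_diff[OF y C_const])
      then have "v (\<lambda>q. (y b q - y b p) * h b q) = v (\<lambda>q. y b q - y b p) * h b p"
        using T_mult[OF v _ h] by simp
      then show "v (\<lambda>q. (y b q - y b p) * h b q) = v (y b) * dder ?f ?x b"
        using T_diff[OF v y C_const] T_const[OF v] hp by simp
    qed
    finally show ?thesis .
  qed
  then show thesis using that[OF U(1) W p0 WU, of y] y by blast
qed

text \<open>Smoothness on the product of the group with itself, in product charts.\<close>

definition smooth2 :: "('g \<Rightarrow> 'g \<Rightarrow> real) \<Rightarrow> bool" where
  "smooth2 F \<longleftrightarrow> (\<forall>U \<phi> V \<psi>. (U, \<phi>) \<in> atlas G \<longrightarrow> (V, \<psi>) \<in> atlas G \<longrightarrow>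
     smooth_on (\<phi> ` U \<times> \<psi> ` V) (\<lambda>z. F (inv_into U \<phi> (fst z)) (inv_into V \<psi> (snd z))))"

lemma smooth2_chart: "smooth2 F \<Longrightarrow> (U, \<phi>) \<in> atlas G \<Longrightarrow> (V, \<psi>) \<in> atlas G \<Longrightarrow>
    smooth_on (\<phi> ` U \<times> \<psi> ` V) (\<lambda>z. F (inv_into U \<phi> (fst z)) (inv_into V \<psi> (snd z)))"
  unfolding smooth2_def by blast

lemma smooth_on_prod_swap: "smooth_on S (\<lambda>z. (snd z, fst z))"
  by (intro smooth_on_Pair smooth_on_linear bounded_linear_fst bounded_linear_snd)

lemma smooth2_swap: "smooth2 F \<Longrightarrow> smooth2 (\<lambda>g h. F h g)"
  unfolding smooth2_def
proof (intro allI impI)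
  fix U \<phi> V \<psi>
  assume F: "\<forall>U \<phi> V \<psi>. (U, \<phi>) \<in> atlas G \<longrightarrow> (V, \<psi>) \<in> atlas G \<longrightarrow>
     smooth_on (\<phi> ` U \<times> \<psi> ` V) (\<lambda>z. F (inv_into U \<phi> (fst z)) (inv_into V \<psi> (snd z)))"
    and U: "(U, \<phi>) \<in> atlas G" "(V, \<psi>) \<in> atlas G"
  obtain B :: "'e set" where B: "tight_frame B" by (rule tight_frame_ex)
  from F U have "smooth_on (\<psi> ` V \<times> \<phi> ` U) (\<lambda>z. F (inv_into V \<psi> (fst z)) (inv_into U \<phi> (snd z)))"
    by blast
  from smooth_on_compose[OF tight_frame_prod[OF B B] smooth_on_prod_swap this, of "\<phi> ` U \<times> \<psi> ` V"]
  show "smooth_on (\<phi> ` U \<times> \<psi> ` V) (\<lambda>z. F (inv_into V \<psi> (snd z)) (inv_into U \<phi> (fst z)))"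
    by (simp add: image_subset_iff)
qed

lemma smooth2_slice: "smooth2 F \<Longrightarrow> F g \<in> C"
proof (rule smooth_funI)
  fix V \<psi> assume F: "smooth2 F" and V: "(V, \<psi>) \<in> atlas G"
  obtain B :: "'e set" where B: "tight_frame B" by (rule tight_frame_ex)
  obtain U \<phi> where U: "(U, \<phi>) \<in> atlas G" "g \<in> U" by (rule chart_at)
  have "smooth_on (\<psi> ` V) (\<lambda>x. (\<phi> g, x))" by (intro smooth_on_Pair smooth_on_const smooth_on_id)
  from smooth_on_compose[OF tight_frame_prod[OF B B] this smooth2_chart[OF F U(1) V]]
  show "smooth_on (\<psi> ` V) (\<lambda>x. F g (inv_into V \<psi> x))"
    using U chart(7)[OF U(1,2)] by (simp add: image_subset_iff)
qed

lemma dder_snd: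
  assumes "F differentiable (at (x, y))"
  shows "dder (\<lambda>y. F (x, y)) y b = dder F (x, y) (0, b)"
proof -
  have "((\<lambda>y. (x, y)) has_derivative (\<lambda>b. (0, b))) (at y)"
    by (auto intro!: derivative_eq_intros)
  then have "((\<lambda>y. F (x, y)) has_derivative (\<lambda>b. dder F (x, y) (0, b))) (at y)"
    using has_derivative_compose assms frechet_derivative_works by blast
  then show ?thesis using frechet_derivative_at by metis
qed

lemma dder_fst:
  assumes "F differentiable (at (x, y))"
  shows "dder (\<lambda>x. F (x, y)) x b = dder F (x, y) (b, 0)"
proof -
  have "((\<lambda>x. (x, y)) has_derivative (\<lambda>b. (b, 0))) (at x)"
    by (auto intro!: derivative_eq_intros)
  then have "((\<lambda>x. F (x, y)) has_derivative (\<lambda>b. dder F (x, y) (b, 0))) (at x)"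
    using has_derivative_compose assms frechet_derivative_works by blast
  then show ?thesis using frechet_derivative_at by metis
qed

end

section \<open>Functions of two group elements and invariant vector fields\<close>

context lie
begin

lemma smooth2_mult:
  assumes f: "f \<in> C"
  shows "smooth2 (\<lambda>g h. f (g \<bullet>\<bullet> h))"
  unfolding smooth2_def
proof (intro allI impI)
  fix U \<phi> V \<psi> assume U: "(U, \<phi>) \<in> atlas G" and V: "(V, \<psi>) \<in> atlas G"
  obtain B :: "'e set" where B: "tight_frame B" by (rule tight_frame_ex)
  let ?S = "\<phi> ` U \<times> \<psi> ` V"
  let ?m = "\<lambda>z. inv_into U \<phi> (fst z) \<bullet>\<bullet> inv_into V \<psi> (snd z)"
  have oS: "open ?S" using open_Times chart(2)[OF U] chart(2)[OF V] by blast
  have cm: "continuous_on ?S ?m"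
  proof -
    have "continuous_on UNIV (\<lambda>(p, q). p \<bullet>\<bullet> q)" using lie by (simp add: lie_group_def)
    moreover have "continuous_on ?S (\<lambda>z. (inv_into U \<phi> (fst z), inv_into V \<psi> (snd z)))"
      by (intro continuous_on_Pair continuous_on_compose2[OF chart(6)[OF U]]
          continuous_on_compose2[OF chart(6)[OF V]] continuous_on_fst continuous_on_snd continuous_on_id) auto
    ultimately show ?thesis using continuous_on_compose2[of UNIV "\<lambda>(p, q). p \<bullet>\<bullet> q" ?S] by fastforce
  qed
  show "smooth_on ?S (\<lambda>z. f (?m z))"
  proof (rule smooth_on_local[OF oS])
    fix z assume z: "z \<in> ?S"
    obtain W \<kappa> where W: "(W, \<kappa>) \<in> atlas G" "?m z \<in> W" by (rule chart_at)
    let ?T = "?S \<inter> ?m -` W"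
    have oT: "open ?T" by (rule continuous_open_preimage[OF cm oS chart(1)[OF W(1)]])
    have "smooth_on {(x, y). x \<in> \<phi> ` U \<and> y \<in> \<psi> ` V \<and> inv_into U \<phi> x \<bullet>\<bullet> inv_into V \<psi> y \<in> W}
          (\<lambda>(x, y). \<kappa> (inv_into U \<phi> x \<bullet>\<bullet> inv_into V \<psi> y))"
      using lie U V W(1) unfolding lie_group_def by fast
    moreover have "{(x, y). x \<in> \<phi> ` U \<and> y \<in> \<psi> ` V \<and> inv_into U \<phi> x \<bullet>\<bullet> inv_into V \<psi> y \<in> W} = ?T"
      by auto
    ultimately have "smooth_on ?T (\<lambda>z. \<kappa> (?m z))" by (simp add: case_prod_beta')
    then have "smooth_on ?T (\<lambda>z. f (inv_into W \<kappa> (\<kappa> (?m z))))"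
      by (rule smooth_on_compose[OF B _ smooth_fun_chart[OF f W(1)]]) auto
    then have "smooth_on ?T (\<lambda>z. f (?m z))"
      by (rule smooth_on_cong[OF oT, rotated]) (simp add: chart(7)[OF W(1)])
    then show "\<exists>T. open T \<and> z \<in> T \<and> smooth_on T (\<lambda>z. f (?m z))"
      using oT z W(2) by blast
  qed
qed

lemma smooth2_inverse:
  assumes F: "smooth2 F"
  shows "smooth2 (\<lambda>g h. F (iv g) h)"
  unfolding smooth2_def
proof (intro allI impI)
  fix U \<phi> V \<psi> assume U: "(U, \<phi>) \<in> atlas G" and V: "(V, \<psi>) \<in> atlas G"
  obtain B :: "'e set" where B: "tight_frame B" by (rule tight_frame_ex)
  let ?S = "\<phi> ` U \<times> \<psi> ` V"
  let ?m = "\<lambda>x. iv (inv_into U \<phi> x)"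
  have oS: "open ?S" using open_Times chart(2)[OF U] chart(2)[OF V] by blast
  have cm: "continuous_on (\<phi> ` U) ?m"
  proof -
    have "continuous_on UNIV iv" using lie by (simp add: lie_group_def)
    then show ?thesis using continuous_on_compose2[OF _ chart(6)[OF U]] by blast
  qed
  show "smooth_on ?S (\<lambda>z. F (iv (inv_into U \<phi> (fst z))) (inv_into V \<psi> (snd z)))"
  proof (rule smooth_on_local[OF oS])
    fix z assume z: "z \<in> ?S"
    obtain W \<kappa> where W: "(W, \<kappa>) \<in> atlas G" "?m (fst z) \<in> W" by (rule chart_at)
    let ?R = "\<phi> ` U \<inter> ?m -` W"
    let ?T = "?R \<times> \<psi> ` V"
    have oT: "open ?T"
      using open_Times continuous_open_preimage[OF cm chart(2)[OF U] chart(1)[OF W(1)]]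
        chart(2)[OF V] by blast
    have "smooth_on {x \<in> \<phi> ` U. iv (inv_into U \<phi> x) \<in> W} (\<lambda>x. \<kappa> (iv (inv_into U \<phi> x)))"
      using lie U W(1) unfolding lie_group_def by fast
    moreover have "{x \<in> \<phi> ` U. iv (inv_into U \<phi> x) \<in> W} = ?R" by auto
    ultimately have k: "smooth_on ?R (\<lambda>x. \<kappa> (?m x))" by simp
    have "smooth_on ?T (\<lambda>z. \<kappa> (?m (fst z)))"
    proof -
      have "smooth_on ?T (\<lambda>z. \<kappa> (?m (fst z)) \<bullet> b)" for b
        by (rule smooth_on_compose[OF B smooth_on_linear[OF bounded_linear_fst]
              smooth_on_linear_comp[OF bounded_linear_inner_left k]]) auto
      then have "smooth_on ?T (\<lambda>z. \<Sum>b\<in>B. (\<kappa> (?m (fst z)) \<bullet> b) *\<^sub>R b)"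
        by (intro smooth_on_sum smooth_on_linear_comp[OF bounded_linear_scaleR_left])
      then show ?thesis by (simp add: tight_frameD(2)[OF B])
    qed
    then have "smooth_on ?T (\<lambda>z. (\<kappa> (?m (fst z)), snd z))"
      by (rule smooth_on_Pair[OF _ smooth_on_linear[OF bounded_linear_snd]])
    from smooth_on_compose[OF tight_frame_prod[OF B B] this smooth2_chart[OF F W(1) V]]
    have "smooth_on ?T (\<lambda>z. F (inv_into W \<kappa> (\<kappa> (?m (fst z)))) (inv_into V \<psi> (snd z)))"
      by (auto simp: image_subset_iff)
    then have "smooth_on ?T (\<lambda>z. F (?m (fst z)) (inv_into V \<psi> (snd z)))"
      by (rule smooth_on_cong[OF oT, rotated]) (auto simp: chart(7)[OF W(1)])
    then show "\<exists>T. open T \<and> z \<in> T \<and> smooth_on T (\<lambda>z. F (?m (fst z)) (inv_into V \<psi> (snd z)))"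
      using oT z W(2) by (intro exI[of _ ?T]) auto
  qed
qed

text \<open>A tangent vector acting on one variable is a constant-coefficient combination of partial
  derivatives in a chart.\<close>

lemma smooth2_tangent_smooth:
  assumes F: "smooth2 F" and v: "v \<in> T q"
  shows "(\<lambda>g. v (F g)) \<in> C"
proof (rule smooth_funI)
  fix U \<phi> assume U: "(U, \<phi>) \<in> atlas G"
  obtain B :: "'e set" where B: "tight_frame B" by (rule tight_frame_ex)
  obtain V \<psi> W y where V: "(V, \<psi>) \<in> atlas G" "open W" "q \<in> W" "W \<subseteq> V"
    and rep: "\<And>p v f. p \<in> W \<Longrightarrow> v \<in> T p \<Longrightarrow> f \<in> C \<Longrightarrow>
       v f = (\<Sum>b\<in>B. v (y b) * dder (\<lambda>x. f (inv_into V \<psi> x)) (\<psi> p) b)"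
    by (rule local_coordinates[OF B, of q]) blast
  let ?S = "\<phi> ` U \<times> \<psi> ` V"
  have oS: "open ?S" using open_Times chart(2)[OF U] chart(2)[OF V(1)] by blast
  define FF where "FF = (\<lambda>z. F (inv_into U \<phi> (fst z)) (inv_into V \<psi> (snd z)))"
  have FF: "smooth_on ?S FF" using smooth2_chart[OF F U V(1)] unfolding FF_def .
  have vF: "v (F (inv_into U \<phi> x)) = (\<Sum>b\<in>B. v (y b) * dder FF (x, \<psi> q) (0, b))"
    if x: "x \<in> \<phi> ` U" for x
  proof -
    have "(x, \<psi> q) \<in> ?S" using x V(3,4) by blast
    then have "FF differentiable (at (x, \<psi> q))" using smooth_on_differentiable[OF FF] by blast
    from dder_snd[OF this] show ?thesis
      using rep[OF V(3) v smooth2_slice[OF F], of "inv_into U \<phi> x"] by (simp add: FF_def)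
  qed
  have "smooth_on (\<phi> ` U) (\<lambda>x. \<Sum>b\<in>B. v (y b) * dder FF (x, \<psi> q) (0, b))"
  proof (intro smooth_on_sum smooth_on_mult smooth_on_const)
    fix b
    have "smooth_on (\<phi> ` U) (\<lambda>x. (x, \<psi> q))"
      by (intro smooth_on_Pair smooth_on_id smooth_on_const)
    then show "smooth_on (\<phi> ` U) (\<lambda>x. dder FF (x, \<psi> q) (0, b))"
      by (rule smooth_on_compose[OF tight_frame_prod[OF B B] _ smooth_on_dder[OF oS FF]]) (use V(3,4) in auto)
  qed
  then show "smooth_on (\<phi> ` U) (\<lambda>x. v (F (inv_into U \<phi> x)))"
    by (rule smooth_on_cong[OF chart(2)[OF U], rotated]) (simp add: vF)
qed

text \<open>In local coordinates this is the symmetry of second partial derivatives on the product.\<close>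

lemma tangent_commute:
  assumes F: "smooth2 F" and v: "v \<in> T p" and w: "w \<in> T q"
  shows "v (\<lambda>x. w (F x)) = w (\<lambda>y. v (\<lambda>x. F x y))"
proof -
  obtain B :: "'e set" where B: "tight_frame B" by (rule tight_frame_ex)
  obtain U \<phi> W y where U: "(U, \<phi>) \<in> atlas G" "open W" "p \<in> W" "W \<subseteq> U"
    and repv: "\<And>p v f. p \<in> W \<Longrightarrow> v \<in> T p \<Longrightarrow> f \<in> C \<Longrightarrow>
       v f = (\<Sum>b\<in>B. v (y b) * dder (\<lambda>x. f (inv_into U \<phi> x)) (\<phi> p) b)"
    by (rule local_coordinates[OF B, of p]) blast
  obtain V \<psi> X z where V: "(V, \<psi>) \<in> atlas G" "open X" "q \<in> X" "X \<subseteq> V"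
    and repw: "\<And>p v f. p \<in> X \<Longrightarrow> v \<in> T p \<Longrightarrow> f \<in> C \<Longrightarrow>
       v f = (\<Sum>b\<in>B. v (z b) * dder (\<lambda>x. f (inv_into V \<psi> x)) (\<psi> p) b)"
    by (rule local_coordinates[OF B, of q]) blast
  let ?S = "\<phi> ` U \<times> \<psi> ` V"
  have oU: "open (\<phi> ` U)" "open (\<psi> ` V)" using chart(2) U(1) V(1) by blast+
  have oS: "open ?S" using open_Times oU by blast
  define FF where "FF = (\<lambda>z. F (inv_into U \<phi> (fst z)) (inv_into V \<psi> (snd z)))"
  have FF: "smooth_on ?S FF" using smooth2_chart[OF F U(1) V(1)] unfolding FF_def .
  have pq: "\<phi> p \<in> \<phi> ` U" "\<psi> q \<in> \<psi> ` V" using U V by blast+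
  then have pqS: "(\<phi> p, \<psi> q) \<in> ?S" by blast
  have dFF: "FF differentiable (at s)" if "s \<in> ?S" for s using smooth_on_differentiable[OF FF that] .
  have ddFF: "(\<lambda>s. dder FF s d) differentiable (at s)" if "s \<in> ?S" for s d
    using smooth_on_differentiable[OF smooth_on_dder[OF oS FF] that] .
  have wF: "w (F (inv_into U \<phi> x)) = (\<Sum>b\<in>B. w (z b) * dder FF (x, \<psi> q) (0, b))"
    if x: "x \<in> \<phi> ` U" for x
    using dder_snd[OF dFF, of x "\<psi> q"] x pq(2) repw[OF V(3) w smooth2_slice[OF F], of "inv_into U \<phi> x"]
    by (simp add: FF_def)
  have vF: "v (\<lambda>x. F x (inv_into V \<psi> y')) = (\<Sum>b\<in>B. v (y b) * dder FF (\<phi> p, y') (b, 0))"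
    if y': "y' \<in> \<psi> ` V" for y'
    using dder_fst[OF dFF, of "\<phi> p" y'] y' pq(1)
      repv[OF U(3) v smooth2_slice[OF smooth2_swap[OF F]], of "inv_into V \<psi> y'"]
    by (simp add: FF_def)
  have "dder (\<lambda>x. w (F (inv_into U \<phi> x))) (\<phi> p) c =
      (\<Sum>b\<in>B. w (z b) * dder (\<lambda>s. dder FF s (0, b)) (\<phi> p, \<psi> q) (c, 0))" for c
  proof -
    let ?D = "\<lambda>x. \<Sum>b\<in>B. w (z b) * dder FF (x, \<psi> q) (0, b)"
    have d1: "(\<lambda>x. dder FF (x, \<psi> q) (0, b)) differentiable (at (\<phi> p))" for b
    proof (rule smooth_on_differentiable[OF _ pq(1)])
      show "smooth_on (\<phi> ` U) (\<lambda>x. dder FF (x, \<psi> q) (0, b))"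
        by (rule smooth_on_compose[OF tight_frame_prod[OF B B] _ smooth_on_dder[OF oS FF]])
           (use pq(2) in \<open>auto intro!: smooth_on_Pair smooth_on_id smooth_on_const\<close>)
    qed
    have c1: "(\<lambda>x. w (z b)) differentiable (at (\<phi> p))" for b by simp
    have d2: "(\<lambda>x. w (z b) * dder FF (x, \<psi> q) (0, b)) differentiable (at (\<phi> p))" for b
      by (rule differentiable_mult[OF c1 d1])
    have "?D differentiable (at (\<phi> p))" by (intro differentiable_sum tight_frameD(1)[OF B] ballI d2)
    then have "dder (\<lambda>x. w (F (inv_into U \<phi> x))) (\<phi> p) = dder ?D (\<phi> p)"
      by (intro dder_cong_open[OF oU(1) pq(1)]) (simp_all add: wF)
    then have "dder (\<lambda>x. w (F (inv_into U \<phi> x))) (\<phi> p) c = dder ?D (\<phi> p) c" by simp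
    also have "\<dots> = (\<Sum>b\<in>B. w (z b) * dder (\<lambda>x. dder FF (x, \<psi> q) (0, b)) (\<phi> p) c)"
      unfolding dder_sum[OF d2] dder_mult[OF c1 d1] by simp
    also have "\<dots> = (\<Sum>b\<in>B. w (z b) * dder (\<lambda>s. dder FF s (0, b)) (\<phi> p, \<psi> q) (c, 0))"
      using dder_fst[OF ddFF[OF pqS]] by simp
    finally show ?thesis .
  qed
  then have L: "v (\<lambda>x. w (F x)) = (\<Sum>c\<in>B. \<Sum>b\<in>B. v (y c) * w (z b) * dder (\<lambda>s. dder FF s (0, b)) (\<phi> p, \<psi> q) (c, 0))"
    using repv[OF U(3) v smooth2_tangent_smooth[OF F w]] by (simp add: sum_distrib_left mult.assoc)
  have "dder (\<lambda>y'. v (\<lambda>x. F x (inv_into V \<psi> y'))) (\<psi> q) c =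
      (\<Sum>b\<in>B. v (y b) * dder (\<lambda>s. dder FF s (b, 0)) (\<phi> p, \<psi> q) (0, c))" for c
  proof -
    let ?D = "\<lambda>y'. \<Sum>b\<in>B. v (y b) * dder FF (\<phi> p, y') (b, 0)"
    have d1: "(\<lambda>y'. dder FF (\<phi> p, y') (b, 0)) differentiable (at (\<psi> q))" for b
    proof (rule smooth_on_differentiable[OF _ pq(2)])
      show "smooth_on (\<psi> ` V) (\<lambda>y'. dder FF (\<phi> p, y') (b, 0))"
        by (rule smooth_on_compose[OF tight_frame_prod[OF B B] _ smooth_on_dder[OF oS FF]])
           (use pq(1) in \<open>auto intro!: smooth_on_Pair smooth_on_id smooth_on_const\<close>)
    qed
    have c1: "(\<lambda>x. v (y b)) differentiable (at (\<psi> q))" for b by simp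
    have d2: "(\<lambda>y'. v (y b) * dder FF (\<phi> p, y') (b, 0)) differentiable (at (\<psi> q))" for b
      by (rule differentiable_mult[OF c1 d1])
    have "?D differentiable (at (\<psi> q))" by (intro differentiable_sum tight_frameD(1)[OF B] ballI d2)
    then have "dder (\<lambda>y'. v (\<lambda>x. F x (inv_into V \<psi> y'))) (\<psi> q) = dder ?D (\<psi> q)"
      by (intro dder_cong_open[OF oU(2) pq(2)]) (simp_all add: vF)
    then have "dder (\<lambda>y'. v (\<lambda>x. F x (inv_into V \<psi> y'))) (\<psi> q) c = dder ?D (\<psi> q) c" by simp
    also have "\<dots> = (\<Sum>b\<in>B. v (y b) * dder (\<lambda>y'. dder FF (\<phi> p, y') (b, 0)) (\<psi> q) c)"
      unfolding dder_sum[OF d2] dder_mult[OF c1 d1] by simp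
    also have "\<dots> = (\<Sum>b\<in>B. v (y b) * dder (\<lambda>s. dder FF s (b, 0)) (\<phi> p, \<psi> q) (0, c))"
      using dder_snd[OF ddFF[OF pqS]] by simp
    finally show ?thesis .
  qed
  then have "w (\<lambda>y. v (\<lambda>x. F x y)) = (\<Sum>c\<in>B. \<Sum>b\<in>B. w (z c) * v (y b) * dder (\<lambda>s. dder FF s (b, 0)) (\<phi> p, \<psi> q) (0, c))"
    using repw[OF V(3) w smooth2_tangent_smooth[OF smooth2_swap[OF F] v]]
    by (simp add: sum_distrib_left mult.assoc)
  also have "\<dots> = (\<Sum>c\<in>B. \<Sum>b\<in>B. v (y b) * w (z c) * dder (\<lambda>s. dder FF s (0, c)) (\<phi> p, \<psi> q) (b, 0))"
    using second_derivative_symmetric[OF tight_frame_prod[OF B B] oS pqS FF] by (simp add: mult_ac)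
  also have "\<dots> = v (\<lambda>x. w (F x))" unfolding L by (rule sum.swap)
  finally show ?thesis by simp
qed

text \<open>Applied to \<open>F p h = f (p\<inverse> h)\<close>, this says that the coefficients of a vector field in a left-invariant frame
  are smooth.\<close>

lemma vector_field_smooth2:
  assumes F: "smooth2 F" and X: "X \<in> vector_fields G"
  shows "(\<lambda>p. X p (F p)) \<in> C"
proof (rule smooth_fun_local)
  fix p0
  obtain B :: "'e set" where B: "tight_frame B" by (rule tight_frame_ex)
  obtain U \<phi> W y where U: "(U, \<phi>) \<in> atlas G" "open W" "p0 \<in> W" "W \<subseteq> U" and y: "\<And>b. b \<in> B \<Longrightarrow> y b \<in> C"
    and rep: "\<And>p v f. p \<in> W \<Longrightarrow> v \<in> T p \<Longrightarrow> f \<in> C \<Longrightarrow>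
       v f = (\<Sum>b\<in>B. v (y b) * dder (\<lambda>x. f (inv_into U \<phi> x)) (\<phi> p) b)"
    by (rule local_coordinates[OF B, of p0]) blast
  have XT: "X p \<in> T p" for p using X unfolding vector_fields_def by blast
  have XC: "(\<lambda>p. X p f) \<in> C" if "f \<in> C" for f using X that unfolding vector_fields_def by blast
  let ?S = "\<phi> ` U \<times> \<phi> ` U"
  have oS: "open ?S" using open_Times chart(2)[OF U(1)] by blast
  have oW: "open (\<phi> ` W)" by (rule open_chart_image[OF U(1,2,4)])
  define FF where "FF = (\<lambda>z. F (inv_into U \<phi> (fst z)) (inv_into U \<phi> (snd z)))"
  have FF: "smooth_on ?S FF" using smooth2_chart[OF F U(1) U(1)] unfolding FF_def .
  have eq: "X (inv_into U \<phi> x) (F (inv_into U \<phi> x)) =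
      (\<Sum>b\<in>B. X (inv_into U \<phi> x) (y b) * dder FF (x, x) (0, b))" if x: "x \<in> \<phi> ` W" for x
  proof -
    have xU: "x \<in> \<phi> ` U" "inv_into U \<phi> x \<in> W" using x U(4) chart(7)[OF U(1)] by auto
    have "FF differentiable (at (x, x))" using smooth_on_differentiable[OF FF] xU by blast
    from dder_snd[OF this] show ?thesis
      using rep[OF xU(2) XT smooth2_slice[OF F], of "inv_into U \<phi> x"] chart(9)[OF U(1) xU(1)]
      by (simp add: FF_def)
  qed
  have "smooth_on (\<phi> ` W) (\<lambda>x. \<Sum>b\<in>B. X (inv_into U \<phi> x) (y b) * dder FF (x, x) (0, b))"
  proof (intro smooth_on_sum smooth_on_mult)
    fix b assume b: "b \<in> B"
    show "smooth_on (\<phi> ` W) (\<lambda>x. X (inv_into U \<phi> x) (y b))"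
      using smooth_on_subset[OF smooth_fun_chart[OF XC[OF y[OF b]] U(1)]] U(4) by blast
    have "smooth_on (\<phi> ` W) (\<lambda>x. (x, x))"
      by (intro smooth_on_Pair smooth_on_id)
    then show "smooth_on (\<phi> ` W) (\<lambda>x. dder FF (x, x) (0, b))"
      by (rule smooth_on_compose[OF tight_frame_prod[OF B B] _ smooth_on_dder[OF oS FF]]) (use U(4) in auto)
  qed
  then have "smooth_on (\<phi> ` W) (\<lambda>x. X (inv_into U \<phi> x) (F (inv_into U \<phi> x)))"
    by (rule smooth_on_cong[OF oW, rotated]) (simp add: eq)
  then show "\<exists>U \<phi> W. (U, \<phi>) \<in> atlas G \<and> open W \<and> p0 \<in> W \<and> W \<subseteq> U \<and>
    smooth_on (\<phi> ` W) (\<lambda>x. X (inv_into U \<phi> x) (F (inv_into U \<phi> x)))"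
    using U by blast
qed

text \<open>The coordinate derivations at the unit span the Lie algebra, and the cut-off coordinates read off
  coefficients.\<close>

lemma lie_alg_frame:
  obtains I :: "'e set" and f :: "'e \<Rightarrow> 'g \<Rightarrow> real" and E where "finite I"
    "\<And>i. i \<in> I \<Longrightarrow> f i \<in> C" "\<And>i. i \<in> I \<Longrightarrow> E i \<in> lie_alg G"
    "\<And>v h. v \<in> lie_alg G \<Longrightarrow> v h = (\<Sum>i\<in>I. v (f i) * E i h)"
proof -
  obtain B :: "'e set" where B: "tight_frame B" by (rule tight_frame_ex)
  obtain U \<phi> W y where U: "(U, \<phi>) \<in> atlas G" "open W" "e1 \<in> W" "W \<subseteq> U" and y: "\<And>b. b \<in> B \<Longrightarrow> y b \<in> C"
    and rep: "\<And>p v f. p \<in> W \<Longrightarrow> v \<in> T p \<Longrightarrow> f \<in> C \<Longrightarrow>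
       v f = (\<Sum>b\<in>B. v (y b) * dder (\<lambda>x. f (inv_into U \<phi> x)) (\<phi> p) b)"
    by (rule local_coordinates[OF B, of e1]) blast
  define E where "E b f = (if f \<in> C then dder (\<lambda>x. f (inv_into U \<phi> x)) (\<phi> e1) b else 0)" for b f
  have e: "\<phi> e1 \<in> \<phi> ` U" "inv_into U \<phi> (\<phi> e1) = e1" using U chart(7)[OF U(1)] by blast+
  have d: "(\<lambda>x. f (inv_into U \<phi> x)) differentiable (at (\<phi> e1))" if "f \<in> C" for f
    using smooth_on_differentiable[OF smooth_fun_chart[OF that U(1)] e(1)] .
  have "E b \<in> lie_alg G" for b
  proof (rule T_I)
    fix f h and c :: real assume f: "f \<in> C" 
    show "E b (\<lambda>q. c * f q) = c * E b f"
      using f C_cmult[OF f, of c] dder_mult[OF _ d[OF f], of "\<lambda>x. c" b] by (simp add: E_def)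
    assume h: "h \<in> C"
    show "E b (\<lambda>q. f q + h q) = E b f + E b h"
      using f h C_add[OF f h] dder_add[OF d[OF f] d[OF h], of b] by (simp add: E_def)
    show "E b (\<lambda>q. f q * h q) = f e1 * E b h + E b f * h e1"
      using f h C_mult[OF f h] dder_mult[OF d[OF f] d[OF h], of b] e(2) by (simp add: E_def)
  qed (simp add: E_def)
  moreover have "v h = (\<Sum>b\<in>B. v (y b) * E b h)" if v: "v \<in> lie_alg G" for v h
    using rep[OF U(3) v, of h] T_outside[OF v, of h] by (cases "h \<in> C") (simp_all add: E_def)
  ultimately show thesis using that[of B y E] tight_frameD(1)[OF B] y by blast
qed

section \<open>Invariant vector fields and the adjoint action\<close>

abbreviation LA where "LA \<equiv> lie_alg G"

lemma C_left: "f \<in> C \<Longrightarrow> (\<lambda>h. f (g \<bullet>\<bullet> h)) \<in> C"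
  using smooth2_slice[OF smooth2_mult] by blast

lemma C_right: "f \<in> C \<Longrightarrow> (\<lambda>h. f (h \<bullet>\<bullet> g)) \<in> C"
  using smooth2_slice[OF smooth2_swap[OF smooth2_mult]] by blast

lemma C_left_iff: "(\<lambda>h. f (g \<bullet>\<bullet> h)) \<in> C \<longleftrightarrow> f \<in> C"
  using C_left[of "\<lambda>h. f (g \<bullet>\<bullet> h)" "iv g"] C_left[of f g] by auto

lemma C_right_iff: "(\<lambda>h. f (h \<bullet>\<bullet> g)) \<in> C \<longleftrightarrow> f \<in> C"
  using C_right[of "\<lambda>h. f (h \<bullet>\<bullet> g)" "iv g"] C_right[of f g] by auto

lemma ltrans_T:
  assumes v: "v \<in> T p"
  shows "ltrans G g v \<in> T (g \<bullet>\<bullet> p)"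
  unfolding ltrans_def
  by (rule T_I) (simp_all add: T_outside[OF v] C_left_iff T_add[OF v] T_cmult[OF v] T_mult[OF v])

lemma rtrans_T:
  assumes v: "v \<in> T p"
  shows "rtrans G g v \<in> T (p \<bullet>\<bullet> g)"
  unfolding rtrans_def
  by (rule T_I) (simp_all add: T_outside[OF v] C_right_iff T_add[OF v] T_cmult[OF v] T_mult[OF v])

lemma ltrans_ltrans [simp]: "ltrans G g (ltrans G h v) = ltrans G (g \<bullet>\<bullet> h) v"
  by (simp add: ltrans_def gr.assoc)

lemma rtrans_rtrans [simp]: "rtrans G g (rtrans G h v) = rtrans G (h \<bullet>\<bullet> g) v"
  by (simp add: rtrans_def gr.assoc)

lemma trans_one [simp]: "ltrans G e1 v = v" "rtrans G e1 v = v"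
  by (simp_all add: ltrans_def rtrans_def)

lemma ltrans_rtrans: "ltrans G g (rtrans G h v) = rtrans G h (ltrans G g v)"
  by (simp add: rtrans_def ltrans_def gr.assoc)

lemma ltrans_T_iff: "ltrans G g v \<in> T (g \<bullet>\<bullet> p) \<longleftrightarrow> v \<in> T p"
  using ltrans_T[of v p g] ltrans_T[of "ltrans G g v" "g \<bullet>\<bullet> p" "iv g"] by auto

lemma ltrans_LA: "v \<in> LA \<Longrightarrow> ltrans G g v \<in> T g"
  using ltrans_T[of v e1 g] by simp

lemma rtrans_LA: "v \<in> LA \<Longrightarrow> rtrans G g v \<in> T g"
  using rtrans_T[of v e1 g] by simp

lemma ltrans_inv_LA: "v \<in> T g \<Longrightarrow> ltrans G (iv g) v \<in> LA"
  using ltrans_T[of v g "iv g"] by simp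

lemma ltrans_inv_LA_iff: "ltrans G (iv g) v \<in> LA \<longleftrightarrow> v \<in> T g"
  using ltrans_T_iff[of "iv g" v g] by simp

lemma Ad_LA: "v \<in> LA \<Longrightarrow> Ad G g v \<in> LA"
  unfolding Ad_def using ltrans_T[OF rtrans_LA[of v "iv g"], of g] by simp

lemma Ad_Ad: "Ad G g (Ad G h v) = Ad G (g \<bullet>\<bullet> h) v"
  by (simp add: Ad_def ltrans_rtrans)

lemma Ad_one: "Ad G e1 v = v"
  by (simp add: Ad_def)

lemma Ad_LA_iff: "Ad G g v \<in> LA \<longleftrightarrow> v \<in> LA"
  using Ad_LA[of v g] Ad_LA[of "Ad G g v" "iv g"] by (auto simp: Ad_Ad Ad_one)

lemma T_zero: "(\<lambda>f. 0) \<in> T p"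
  by (rule T_I) auto
lemma T_plus: "u \<in> T p \<Longrightarrow> v \<in> T p \<Longrightarrow> (\<lambda>f. u f + v f) \<in> T p"
  by (rule T_I) (simp_all add: T_outside[of u p] T_outside[of v p] T_add[of u p] T_add[of v p] T_cmult[of u p] T_cmult[of v p] T_mult[of u p] T_mult[of v p] algebra_simps)
lemma T_scale: "u \<in> T p \<Longrightarrow> (\<lambda>f. c * u f) \<in> T p"
  by (rule T_I) (simp_all add: T_outside[of u p] T_add[of u p] T_cmult[of u p] T_mult[of u p] algebra_simps)
lemma T_uminus: "u \<in> T p \<Longrightarrow> (\<lambda>f. - u f) \<in> T p"
  using T_scale[of u p "-1"] by simp
lemma T_minus_mem: "u \<in> T p \<Longrightarrow> v \<in> T p \<Longrightarrow> (\<lambda>f. u f - v f) \<in> T p"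
  using T_plus[of u p "\<lambda>f. - v f"] T_uminus by simp
lemma T_combination: "(\<And>i. i \<in> I \<Longrightarrow> w i \<in> T p) \<Longrightarrow> (\<lambda>f. \<Sum>i\<in>I. c i * w i f) \<in> T p"
  by (induction I rule: infinite_finite_induct) (simp_all add: T_zero T_plus T_scale)

abbreviation lin where "lin p \<xi> \<equiv> linear_over sc (*) (T p) \<xi>"

lemma lin_add: "lin p \<xi> \<Longrightarrow> u \<in> T p \<Longrightarrow> v \<in> T p \<Longrightarrow> \<xi> (\<lambda>f. u f + v f) = \<xi> u + \<xi> v"
  unfolding linear_over_def plus_fun_def by blast
lemma lin_scale: "lin p \<xi> \<Longrightarrow> u \<in> T p \<Longrightarrow> \<xi> (\<lambda>f. c * u f) = c * \<xi> u"
  unfolding linear_over_def sc_def by blast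
lemma lin_zero: "lin p \<xi> \<Longrightarrow> \<xi> (\<lambda>f. 0) = 0"
  using lin_scale[OF _ T_zero, of p \<xi> 0] by simp
lemma lin_uminus: "lin p \<xi> \<Longrightarrow> u \<in> T p \<Longrightarrow> \<xi> (\<lambda>f. - u f) = - \<xi> u"
  using lin_scale[of p \<xi> u "-1"] by simp
lemma lin_diff: "lin p \<xi> \<Longrightarrow> u \<in> T p \<Longrightarrow> v \<in> T p \<Longrightarrow> \<xi> (\<lambda>f. u f - v f) = \<xi> u - \<xi> v"
  using lin_add[of p \<xi> u "\<lambda>f. - v f"] by (simp add: T_uminus lin_uminus)
lemma lin_sum:
  assumes "lin p \<xi>" "\<And>i. i \<in> I \<Longrightarrow> w i \<in> T p"
  shows "\<xi> (\<lambda>f. \<Sum>i\<in>I. c i * w i f) = (\<Sum>i\<in>I. c i * \<xi> (w i))"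
  using assms(2)
  by (induction I rule: infinite_finite_induct)
     (simp_all add: lin_zero[OF assms(1)] lin_add[OF assms(1)] lin_scale[OF assms(1)] T_combination T_scale)

lemma linI:
  assumes "\<And>u v. u \<in> T p \<Longrightarrow> v \<in> T p \<Longrightarrow> \<xi> (\<lambda>f. u f + v f) = \<xi> u + \<xi> v"
    "\<And>u c. u \<in> T p \<Longrightarrow> \<xi> (\<lambda>f. c * u f) = c * \<xi> u"
  shows "lin p \<xi>"
  using assms unfolding linear_over_def plus_fun_def sc_def by blast

lemma lin_eval: "lin p (\<lambda>u. u f)"
  by (rule linI) auto

lemma bilinI:
  "(\<And>w. w \<in> T p \<Longrightarrow> lin p (\<lambda>v. B v w)) \<Longrightarrow> (\<And>v. v \<in> T p \<Longrightarrow> lin p (B v)) \<Longrightarrow> bilin (T p) B"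
  unfolding bilinear_over_def by blast
lemma bilinD: "bilin (T p) B \<Longrightarrow> w \<in> T p \<Longrightarrow> lin p (\<lambda>v. B v w)" "bilin (T p) B \<Longrightarrow> v \<in> T p \<Longrightarrow> lin p (B v)"
  unfolding bilinear_over_def by blast+

lemma bilin_swap: "bilin (T p) B \<Longrightarrow> bilin (T p) (\<lambda>u v. B v u)"
  unfolding bilinear_over_def by blast

lemma lin_mult_const: "lin p \<xi> \<Longrightarrow> lin p (\<lambda>u. \<xi> u * c)" "lin p \<xi> \<Longrightarrow> lin p (\<lambda>u. c * \<xi> u)"
  by (rule linI; simp add: lin_add lin_scale algebra_simps)+

lemma bilin_prod: "lin p \<phi> \<Longrightarrow> lin p \<psi> \<Longrightarrow> bilin (T p) (\<lambda>u v. \<phi> u * \<psi> v)"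
  by (rule bilinI) (auto intro: lin_mult_const)

lemma lin_ltrans: "lin p (\<lambda>u. ltrans G g u f)" "lin p (\<lambda>u. rtrans G g u f)"
  by (rule linI; simp add: ltrans_def rtrans_def)+

lemma lin_comp_ltrans: "lin g \<xi> \<Longrightarrow> lin e1 (\<lambda>u. \<xi> (ltrans G g u))"
proof (rule linI)
  fix u v and c :: real assume x: "lin g \<xi>" and u: "u \<in> LA"
  show "\<xi> (ltrans G g (\<lambda>f. c * u f)) = c * \<xi> (ltrans G g u)"
    using lin_scale[OF x ltrans_LA[OF u], of c] by (simp add: ltrans_def)
  assume v: "v \<in> LA"
  show "\<xi> (ltrans G g (\<lambda>f. u f + v f)) = \<xi> (ltrans G g u) + \<xi> (ltrans G g v)"
    using lin_add[OF x ltrans_LA[OF u] ltrans_LA[OF v]] by (simp add: ltrans_def)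
qed

lemma lin_comp_rtrans: "lin g \<xi> \<Longrightarrow> lin e1 (\<lambda>u. \<xi> (rtrans G g u))"
proof (rule linI)
  fix u v and c :: real assume x: "lin g \<xi>" and u: "u \<in> LA"
  show "\<xi> (rtrans G g (\<lambda>f. c * u f)) = c * \<xi> (rtrans G g u)"
    using lin_scale[OF x rtrans_LA[OF u], of c] by (simp add: rtrans_def)
  assume v: "v \<in> LA"
  show "\<xi> (rtrans G g (\<lambda>f. u f + v f)) = \<xi> (rtrans G g u) + \<xi> (rtrans G g v)"
    using lin_add[OF x rtrans_LA[OF u] rtrans_LA[OF v]] by (simp add: rtrans_def)
qed

text \<open>Invariant vector fields act on functions as operators; all later computations are in terms of these.\<close>

definition L where "L v f = (\<lambda>g. ltrans G g v f)"
definition R where "R v f = (\<lambda>g. rtrans G g v f)"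

lemma ltrans_L: "ltrans G g v f = L v f g" and rtrans_R: "rtrans G g v f = R v f g"
  by (simp_all add: L_def R_def)

lemma L_app: "L v f g = v (\<lambda>h. f (g \<bullet>\<bullet> h))" and R_app: "R v f g = v (\<lambda>h. f (h \<bullet>\<bullet> g))"
  by (simp_all add: L_def R_def ltrans_def rtrans_def)

lemma L_smooth: "v \<in> LA \<Longrightarrow> f \<in> C \<Longrightarrow> L v f \<in> C"
  using smooth2_tangent_smooth[OF smooth2_mult, of f v e1] by (simp add: L_app[abs_def])

lemma R_smooth: "v \<in> LA \<Longrightarrow> f \<in> C \<Longrightarrow> R v f \<in> C"
  using smooth2_tangent_smooth[OF smooth2_swap[OF smooth2_mult], of f v e1] by (simp add: R_app[abs_def])

lemma LR_field: "v \<in> LA \<Longrightarrow> (\<lambda>g. ltrans G g v) \<in> vector_fields G" "v \<in> LA \<Longrightarrow> (\<lambda>g. rtrans G g v) \<in> vector_fields G"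
  unfolding vector_fields_def using L_smooth R_smooth ltrans_LA rtrans_LA by (auto simp: ltrans_L rtrans_R)

lemma L_one: "L v f e1 = v f" and R_one: "R v f e1 = v f"
  by (simp_all add: L_app R_app)

lemma L_mult: "v \<in> LA \<Longrightarrow> f \<in> C \<Longrightarrow> h \<in> C \<Longrightarrow> L v (\<lambda>q. f q * h q) g = f g * L v h g + L v f g * h g"
  unfolding L_def by (rule T_mult[OF ltrans_LA])
lemma R_mult: "v \<in> LA \<Longrightarrow> f \<in> C \<Longrightarrow> h \<in> C \<Longrightarrow> R v (\<lambda>q. f q * h q) g = f g * R v h g + R v f g * h g"
  unfolding R_def by (rule T_mult[OF rtrans_LA])
lemma L_sum: "v \<in> LA \<Longrightarrow> (\<And>i. i \<in> I \<Longrightarrow> f i \<in> C) \<Longrightarrow> L v (\<lambda>q. \<Sum>i\<in>I. f i q) g = (\<Sum>i\<in>I. L v (f i) g)"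
  unfolding L_def by (rule T_sum[OF ltrans_LA])
lemma R_sum: "v \<in> LA \<Longrightarrow> (\<And>i. i \<in> I \<Longrightarrow> f i \<in> C) \<Longrightarrow> R v (\<lambda>q. \<Sum>i\<in>I. f i q) g = (\<Sum>i\<in>I. R v (f i) g)"
  unfolding R_def by (rule T_sum[OF rtrans_LA])
lemma L_add: "v \<in> LA \<Longrightarrow> f \<in> C \<Longrightarrow> h \<in> C \<Longrightarrow> L v (\<lambda>q. f q + h q) g = L v f g + L v h g"
  unfolding L_def by (rule T_add[OF ltrans_LA])
lemma L_diff: "v \<in> LA \<Longrightarrow> f \<in> C \<Longrightarrow> h \<in> C \<Longrightarrow> L v (\<lambda>q. f q - h q) g = L v f g - L v h g"
  unfolding L_def by (rule T_diff[OF ltrans_LA])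
lemma L_cmult: "v \<in> LA \<Longrightarrow> f \<in> C \<Longrightarrow> L v (\<lambda>q. c * f q) g = c * L v f g"
  unfolding L_def by (rule T_cmult[OF ltrans_LA])
lemma R_cmult: "v \<in> LA \<Longrightarrow> f \<in> C \<Longrightarrow> R v (\<lambda>q. c * f q) g = c * R v f g"
  unfolding R_def by (rule T_cmult[OF rtrans_LA])

lemma Ad_app: "Ad G g v f = v (\<lambda>k. f (g \<bullet>\<bullet> (k \<bullet>\<bullet> iv g)))"
  by (simp add: Ad_def ltrans_def rtrans_def)

text \<open>After conjugating the right-invariant field into the form \<open>g \<cdot> w'\<close>, this is the
  interchange of derivatives in the two arguments of \<open>(h, k) \<mapsto> f (g k h)\<close>.\<close>

lemma L_R_commute:
  assumes v: "v \<in> LA" and w: "w \<in> LA" and f: "f \<in> C"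
  shows "L v (R w f) = R w (L v f)"
proof
  fix g
  let ?w = "Ad G (iv g) w" and ?f = "\<lambda>q. f (g \<bullet>\<bullet> q)"
  have w': "?w \<in> LA" using Ad_LA[OF w] .
  have "v (\<lambda>h. ?w (\<lambda>k. ?f (k \<bullet>\<bullet> h))) = ?w (\<lambda>k. v (\<lambda>h. ?f (k \<bullet>\<bullet> h)))"
    by (rule tangent_commute[OF smooth2_swap[OF smooth2_mult[OF C_left[OF f]]] v w'])
  then show "L v (R w f) g = R w (L v f) g"
    by (simp add: L_app R_app Ad_app gr.assoc)
qed

lemma lbr_app: "lbr G v w f = v (L w f) - w (L v f)"
  by (simp add: lbr_def L_def)

lemma L_lbr:
  "L (lbr G v w) f g = L v (L w f) g - L w (L v f) g"
  by (simp add: L_app[abs_def] lbr_app gr.assoc)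

text \<open>In the product rule for \<open>v \<circ> L w\<close> the mixed terms are symmetric in \<open>v\<close> and \<open>w\<close>, so that they cancel in the
  commutator.\<close>

lemma lbr_LA:
  assumes v: "v \<in> LA" and w: "w \<in> LA"
  shows "lbr G v w \<in> LA"
proof (rule T_I)
  fix f assume "f \<notin> C"
  then have "L w f = (\<lambda>g. 0)" "L v f = (\<lambda>g. 0)"
    unfolding L_def using T_outside[OF ltrans_LA[OF w]] T_outside[OF ltrans_LA[OF v]] by auto
  then show "lbr G v w f = 0" using T_const[OF v, of 0] T_const[OF w, of 0] by (simp add: lbr_app)
next
  fix f h and c :: real assume f: "f \<in> C"
  show "lbr G v w (\<lambda>q. c * f q) = c * lbr G v w f"
    by (simp add: lbr_app L_cmult[OF v f, abs_def] L_cmult[OF w f, abs_def] T_cmult[OF v] T_cmult[OF w]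
        L_smooth v w f algebra_simps)
  assume h: "h \<in> C"
  have LC: "L v f \<in> C" "L w f \<in> C" "L v h \<in> C" "L w h \<in> C" using L_smooth v w f h by auto
  have e: "L u (\<lambda>q. f q + h q) = (\<lambda>g. L u f g + L u h g)" if "u \<in> LA" for u
    using L_add[OF that f h] by blast
  show "lbr G v w (\<lambda>q. f q + h q) = lbr G v w f + lbr G v w h"
    unfolding lbr_app e[OF v] e[OF w] T_add[OF v LC(2,4)] T_add[OF w LC(1,3)] by simp
  have e: "L u (\<lambda>q. f q * h q) = (\<lambda>g. f g * L u h g + L u f g * h g)" if "u \<in> LA" for u
    using L_mult[OF that f h] by blast
  have vw: "u (\<lambda>g. f g * L x h g + L x f g * h g) =
      f e1 * u (L x h) + u f * L x h e1 + (L x f e1 * u h + u (L x f) * h e1)"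
    if "u \<in> LA" "x \<in> LA" for u x
    using that f h by (simp add: T_add[OF that(1)] T_mult[OF that(1)] L_smooth C_mult)
  show "lbr G v w (\<lambda>q. f q * h q) = f e1 * lbr G v w h + lbr G v w f * h e1"
    unfolding lbr_app e[OF v] e[OF w] vw[OF v w] vw[OF w v] L_one by (simp add: algebra_simps)
qed

lemma lbr_anti: "lbr G v w = (\<lambda>f. - lbr G w v f)"
  by (simp add: lbr_app fun_eq_iff)

lemma L_lin_v: "L (\<lambda>f. u f + v f) f = (\<lambda>g. L u f g + L v f g)" "L (\<lambda>f. c * u f) f = (\<lambda>g. c * L u f g)"
  by (simp_all add: L_app fun_eq_iff)

lemma lbr_add_left: "u \<in> LA \<Longrightarrow> v \<in> LA \<Longrightarrow> w \<in> LA \<Longrightarrow> lbr G (\<lambda>f. u f + v f) w = (\<lambda>f. lbr G u w f + lbr G v w f)"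
proof
  fix f assume a: "u \<in> LA" "v \<in> LA" "w \<in> LA"
  show "lbr G (\<lambda>f. u f + v f) w f = lbr G u w f + lbr G v w f"
  proof (cases "f \<in> C")
    case True
    then show ?thesis using a by (simp add: lbr_app L_lin_v T_add[OF a(3)] L_smooth)
  next
    case False
    then show ?thesis using a T_outside[OF lbr_LA] T_plus by simp
  qed
qed

lemma lbr_scale_left: "u \<in> LA \<Longrightarrow> w \<in> LA \<Longrightarrow> lbr G (\<lambda>f. c * u f) w = (\<lambda>f. c * lbr G u w f)"
proof
  fix f assume a: "u \<in> LA" "w \<in> LA"
  show "lbr G (\<lambda>f. c * u f) w f = c * lbr G u w f"
  proof (cases "f \<in> C")
    case True
    then show ?thesis using a by (simp add: lbr_app L_lin_v T_cmult[OF a(2)] L_smooth algebra_simps)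
  next
    case False
    then show ?thesis using a T_outside[OF lbr_LA] T_scale by simp
  qed
qed

lemma lin_lbr_left: "lin e1 \<xi> \<Longrightarrow> w \<in> LA \<Longrightarrow> lin e1 (\<lambda>u. \<xi> (lbr G u w))"
  by (rule linI) (simp_all add: lbr_add_left lbr_scale_left lin_add lin_scale lbr_LA)

lemma lin_lbr_right: "lin e1 \<xi> \<Longrightarrow> w \<in> LA \<Longrightarrow> lin e1 (\<lambda>u. \<xi> (lbr G w u))"
proof (rule linI)
  fix u v and c :: real assume x: "lin e1 \<xi>" and w: "w \<in> LA" and u: "u \<in> LA"
  have s: "\<xi> (lbr G w u) = - \<xi> (lbr G u w)" if "u \<in> LA" for u
    using lin_uminus[OF x lbr_LA[OF that w]] lbr_anti[of w u] by simp
  note l = lin_lbr_left[OF x w]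
  show "\<xi> (lbr G w (\<lambda>f. c * u f)) = c * \<xi> (lbr G w u)"
    using s[OF T_scale[OF u, of c]] s[OF u] lin_scale[OF l u, of c] by simp
  assume v: "v \<in> LA"
  show "\<xi> (lbr G w (\<lambda>f. u f + v f)) = \<xi> (lbr G w u) + \<xi> (lbr G w v)"
    using s[OF T_plus[OF u v]] s[OF u] s[OF v] lin_add[OF l u v] by simp
qed

lemma lin_lbr_anti: "lin e1 \<xi> \<Longrightarrow> u \<in> LA \<Longrightarrow> w \<in> LA \<Longrightarrow> \<xi> (lbr G w u) = - \<xi> (lbr G u w)"
  using lin_uminus[OF _ lbr_LA[of u w]] lbr_anti[of w u] by simp

lemma lbr_ext: "u \<in> LA \<Longrightarrow> v \<in> LA \<Longrightarrow> (\<And>f. f \<in> C \<Longrightarrow> u f = v f) \<Longrightarrow> u = v"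
  using T_outside by (metis ext)

text \<open>The Lie bracket is the commutator of the operators \<open>L v\<close> and \<open>L w\<close>, evaluated at the unit.\<close>

lemma lbr_jacobi:
  assumes a: "u \<in> LA" "v \<in> LA" "w \<in> LA" and x: "lin e1 \<xi>"
  shows "\<xi> (lbr G (lbr G u v) w) - \<xi> (lbr G (lbr G u w) v) = \<xi> (lbr G u (lbr G v w))"
proof -
  have "(\<lambda>f. lbr G (lbr G u v) w f - lbr G (lbr G u w) v f) = lbr G u (lbr G v w)"
  proof (rule lbr_ext)
    show "(\<lambda>f. lbr G (lbr G u v) w f - lbr G (lbr G u w) v f) \<in> LA" "lbr G u (lbr G v w) \<in> LA"
      using a by (auto intro!: T_minus_mem lbr_LA)
    fix f assume f: "f \<in> C"
    have Lx: "L (lbr G x y) f' e1 = L x (L y f') e1 - L y (L x f') e1" for x y f' by (rule L_lbr)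
    have Ld: "L z (L (lbr G x y) f) e1 = L z (L x (L y f)) e1 - L z (L y (L x f)) e1"
      if "x \<in> LA" "y \<in> LA" "z \<in> LA" for x y z
    proof -
      have "L (lbr G x y) f = (\<lambda>g. L x (L y f) g - L y (L x f) g)" using L_lbr by blast
      then show ?thesis using L_diff[OF that(3) L_smooth[OF that(1) L_smooth[OF that(2) f]]
        L_smooth[OF that(2) L_smooth[OF that(1) f]], of e1] by simp
    qed
    have "L (lbr G (lbr G u v) w) f e1 - L (lbr G (lbr G u w) v) f e1 = L (lbr G u (lbr G v w)) f e1"
      by (simp add: Lx Ld a)
    then show "lbr G (lbr G u v) w f - lbr G (lbr G u w) v f = lbr G u (lbr G v w) f"
      by (simp add: L_one)
  qed
  then show ?thesis using lin_diff[OF x, of "lbr G (lbr G u v) w" "lbr G (lbr G u w) v"] a by (simp add: lbr_LA)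
qed

text \<open>At the unit left- and right-invariant fields agree; since they commute, the order of two right
  translations is turned around when one of them is traded for a left translation. Other points are
  reduced to the unit by a right translation.\<close>

lemma R_lbr:
  assumes v: "v \<in> LA" and w: "w \<in> LA" and f: "f \<in> C"
  shows "R (lbr G v w) f g = R w (R v f) g - R v (R w f) g"
proof -
  let ?f = "\<lambda>q. f (q \<bullet>\<bullet> g)"
  have f1: "?f \<in> C" by (rule C_right[OF f])
  have sw: "u (R x ?f) = x (L u ?f)" if "u \<in> LA" "x \<in> LA" for u x
    using L_R_commute[OF that f1] L_one[of u "R x ?f"] R_one[of x "L u ?f"] by simp
  have "R x (R u f) g = x (R u ?f)" for x u
    by (simp add: R_app[abs_def] gr.assoc)
  then have "R w (R v f) g - R v (R w f) g = v (L w ?f) - w (L v ?f)"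
    using sw[OF v w] sw[OF w v] by simp
  then show ?thesis by (simp add: R_app lbr_app)
qed

lemma R_eq_L_Ad: "R w f g = L (Ad G (iv g) w) f g"
  by (simp add: R_app L_app Ad_app gr.assoc)

lemma Ad_smooth:
  assumes w: "w \<in> LA" and f: "f \<in> C"
  shows "(\<lambda>h. Ad G (iv h) w f) \<in> C"
  using vector_field_smooth2[OF smooth2_inverse[OF smooth2_mult[OF f]] LR_field(2)[OF w]]
  by (simp add: Ad_app rtrans_def)

lemma lie_alg_frame_lin:
  obtains I :: "'e set" and f :: "'e \<Rightarrow> 'g \<Rightarrow> real" and E where "finite I"
    "\<And>i. i \<in> I \<Longrightarrow> f i \<in> C" "\<And>i. i \<in> I \<Longrightarrow> E i \<in> LA"
    "\<And>v h. v \<in> LA \<Longrightarrow> v h = (\<Sum>i\<in>I. v (f i) * E i h)"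
    "\<And>v \<xi>. v \<in> LA \<Longrightarrow> lin e1 \<xi> \<Longrightarrow> \<xi> v = (\<Sum>i\<in>I. v (f i) * \<xi> (E i))"
proof -
  obtain I :: "'e set" and f :: "'e \<Rightarrow> 'g \<Rightarrow> real" and E where fr: "finite I"
    "\<And>i. i \<in> I \<Longrightarrow> f i \<in> C" "\<And>i. i \<in> I \<Longrightarrow> E i \<in> LA"
    "\<And>v h. v \<in> LA \<Longrightarrow> v h = (\<Sum>i\<in>I. v (f i) * E i h)" by (rule lie_alg_frame) blast
  have "\<xi> v = (\<Sum>i\<in>I. v (f i) * \<xi> (E i))" if v: "v \<in> LA" and x: "lin e1 \<xi>" for v \<xi>
  proof -
    have "v = (\<lambda>h. \<Sum>i\<in>I. v (f i) * E i h)" using fr(4)[OF v] by blast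
    then have "\<xi> v = \<xi> (\<lambda>h. \<Sum>i\<in>I. v (f i) * E i h)" by simp
    then show ?thesis using lin_sum[OF x fr(3)] by simp
  qed
  then show thesis using that fr by blast
qed

text \<open>The expansion \<open>R w = (\<Sum>i. c i \<cdot> L (E i))\<close> with \<open>c i h = Ad h\<inverse> w (f i)\<close> of right-invariant fields in
  a left-invariant frame, differentiated along \<open>L u\<close> (which commutes with \<open>R w\<close>) and along \<open>R u\<close>,
  yields the derivatives of the adjoint action.\<close>

lemma Ad_derivatives:
  assumes u: "u \<in> LA" and w: "w \<in> LA" and x: "lin e1 \<xi>"
  shows "(\<lambda>h. \<xi> (Ad G (iv h) w)) \<in> C"
    and "L u (\<lambda>h. \<xi> (Ad G (iv h) w)) g = - \<xi> (lbr G u (Ad G (iv g) w))"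
    and "R u (\<lambda>h. \<xi> (Ad G (iv h) w)) g = - \<xi> (Ad G (iv g) (lbr G u w))"
proof -
  obtain I :: "'e set" and f :: "'e \<Rightarrow> 'g \<Rightarrow> real" and E where fr: "finite I"
    "\<And>i. i \<in> I \<Longrightarrow> f i \<in> C" "\<And>i. i \<in> I \<Longrightarrow> E i \<in> LA"
    "\<And>v h. v \<in> LA \<Longrightarrow> v h = (\<Sum>i\<in>I. v (f i) * E i h)"
    "\<And>v \<xi>. v \<in> LA \<Longrightarrow> lin e1 \<xi> \<Longrightarrow> \<xi> v = (\<Sum>i\<in>I. v (f i) * \<xi> (E i))"
    by (rule lie_alg_frame_lin) blast
  define c where "c i h = Ad G (iv h) w (f i)" for i h
  have c: "c i \<in> C" if "i \<in> I" for i unfolding c_def using Ad_smooth[OF w fr(2)[OF that]] .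
  have xc: "\<xi> (Ad G (iv h) w) = (\<Sum>i\<in>I. c i h * \<xi> (E i))" for h
    unfolding c_def by (rule fr(5)[OF Ad_LA[OF w] x])
  have xc': "(\<lambda>h. \<xi> (Ad G (iv h) w)) = (\<lambda>h. \<Sum>i\<in>I. \<xi> (E i) * c i h)"
    using xc by (simp add: mult.commute fun_eq_iff)
  show "(\<lambda>h. \<xi> (Ad G (iv h) w)) \<in> C"
    unfolding xc' by (intro C_sum C_cmult c)
  have Lc: "L u (\<lambda>h. \<xi> (Ad G (iv h) w)) g = (\<Sum>i\<in>I. L u (c i) g * \<xi> (E i))"
  proof -
    have "L u (\<lambda>h. \<Sum>i\<in>I. \<xi> (E i) * c i h) g = (\<Sum>i\<in>I. L u (\<lambda>h. \<xi> (E i) * c i h) g)"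
      by (rule L_sum[OF u C_cmult[OF c]])
    then show ?thesis unfolding xc' using L_cmult[OF u c] by (simp add: mult.commute)
  qed
  have Rc: "R u (\<lambda>h. \<xi> (Ad G (iv h) w)) g = (\<Sum>i\<in>I. R u (c i) g * \<xi> (E i))"
  proof -
    have "R u (\<lambda>h. \<Sum>i\<in>I. \<xi> (E i) * c i h) g = (\<Sum>i\<in>I. R u (\<lambda>h. \<xi> (E i) * c i h) g)"
      by (rule R_sum[OF u C_cmult[OF c]])
    then show ?thesis unfolding xc' using R_cmult[OF u c] by (simp add: mult.commute)
  qed
  have Rw: "R w h = (\<lambda>q. \<Sum>i\<in>I. c i q * L (E i) h q)" for h
  proof
    fix q
    show "R w h q = (\<Sum>i\<in>I. c i q * L (E i) h q)"
      unfolding R_eq_L_Ad c_def using fr(5)[OF Ad_LA[OF w] lin_ltrans(1)] unfolding ltrans_L .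
  qed
  have t: "(\<lambda>q. c i q * L (E i) h q) \<in> C" if "i \<in> I" "h \<in> C" for i h
    using that c fr(3) L_smooth by blast
  have "(\<lambda>h. \<Sum>i\<in>I. L u (c i) g * E i h) = (\<lambda>h. - lbr G u (Ad G (iv g) w) h)"
  proof (rule lbr_ext)
    show "(\<lambda>h. \<Sum>i\<in>I. L u (c i) g * E i h) \<in> LA" by (rule T_combination[OF fr(3)])
    show "(\<lambda>h. - lbr G u (Ad G (iv g) w) h) \<in> LA" by (intro T_uminus lbr_LA u Ad_LA w)
    fix h assume h: "h \<in> C"
    define k where "k = (\<lambda>q. h (iv g \<bullet>\<bullet> q))"
    have k: "k \<in> C" unfolding k_def by (rule C_left[OF h])
    have Lk: "L v k g = v h" for v by (simp add: k_def L_app)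
    have "L u (R w k) g = (\<Sum>i\<in>I. L u (\<lambda>q. c i q * L (E i) k q) g)"
      unfolding Rw by (rule L_sum[OF u t[OF _ k]])
    also have "\<dots> = (\<Sum>i\<in>I. c i g * L u (L (E i) k) g + L u (c i) g * L (E i) k g)"
      by (rule sum.cong[OF refl], rule L_mult[OF u c L_smooth[OF fr(3) k]])
    finally have "L u (R w k) g =
        (\<Sum>i\<in>I. c i g * L u (L (E i) k) g + L u (c i) g * L (E i) k g)" .
    moreover have "R w (L u k) g = (\<Sum>i\<in>I. c i g * L (E i) (L u k) g)" unfolding Rw ..
    ultimately have "(\<Sum>i\<in>I. L u (c i) g * L (E i) k g) =
        - (\<Sum>i\<in>I. c i g * (L u (L (E i) k) g - L (E i) (L u k) g))"
      using L_R_commute[OF u w k] by (simp add: sum.distrib sum_subtractf right_diff_distrib)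
    also have "\<dots> = - (\<Sum>i\<in>I. c i g * L (lbr G u (E i)) k g)" by (simp add: L_lbr)
    also have "\<dots> = - L (lbr G u (Ad G (iv g) w)) k g"
      using fr(5)[OF Ad_LA[OF w, of "iv g"] lin_lbr_right[OF lin_ltrans(1)[of e1 g k] u]]
      by (simp add: c_def ltrans_L)
    finally show "(\<Sum>i\<in>I. L u (c i) g * E i h) = - lbr G u (Ad G (iv g) w) h"
      unfolding Lk .
  qed
  then have "\<xi> (\<lambda>h. \<Sum>i\<in>I. L u (c i) g * E i h) = \<xi> (\<lambda>h. - lbr G u (Ad G (iv g) w) h)" by simp
  then show "L u (\<lambda>h. \<xi> (Ad G (iv h) w)) g = - \<xi> (lbr G u (Ad G (iv g) w))"
    unfolding Lc using lin_sum[where I = I and w = E and c = "\<lambda>i. L u (c i) g", OF x fr(3)] lin_uminus[OF x lbr_LA[OF u Ad_LA[OF w]]] by simp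
  have "(\<lambda>h. \<Sum>i\<in>I. R u (c i) g * E i h) = (\<lambda>h. - Ad G (iv g) (lbr G u w) h)"
  proof (rule lbr_ext)
    show "(\<lambda>h. \<Sum>i\<in>I. R u (c i) g * E i h) \<in> LA" by (rule T_combination[OF fr(3)])
    show "(\<lambda>h. - Ad G (iv g) (lbr G u w) h) \<in> LA" by (intro T_uminus lbr_LA u Ad_LA w)
    fix h assume h: "h \<in> C"
    define k where "k = (\<lambda>q. h (iv g \<bullet>\<bullet> q))"
    have k: "k \<in> C" unfolding k_def by (rule C_left[OF h])
    have Lk: "L v k g = v h" for v by (simp add: k_def L_app)
    have "R u (R w k) g = (\<Sum>i\<in>I. R u (\<lambda>q. c i q * L (E i) k q) g)"
      unfolding Rw by (rule R_sum[OF u t[OF _ k]])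
    also have "\<dots> = (\<Sum>i\<in>I. c i g * R u (L (E i) k) g + R u (c i) g * L (E i) k g)"
      by (rule sum.cong[OF refl], rule R_mult[OF u c L_smooth[OF fr(3) k]])
    finally have "R u (R w k) g =
        (\<Sum>i\<in>I. c i g * R u (L (E i) k) g + R u (c i) g * L (E i) k g)" .
    moreover have "R w (R u k) g = (\<Sum>i\<in>I. c i g * L (E i) (R u k) g)" unfolding Rw ..
    moreover have "L (E i) (R u k) = R u (L (E i) k)" if "i \<in> I" for i
      using L_R_commute[OF fr(3)[OF that] u k] .
    ultimately have "(\<Sum>i\<in>I. R u (c i) g * L (E i) k g) = R u (R w k) g - R w (R u k) g"
      by (simp add: sum.distrib)
    also have "\<dots> = - R (lbr G u w) k g" using R_lbr[OF u w k] by simp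
    also have "\<dots> = - L (Ad G (iv g) (lbr G u w)) k g" by (simp add: R_eq_L_Ad)
    finally show "(\<Sum>i\<in>I. R u (c i) g * E i h) = - Ad G (iv g) (lbr G u w) h"
      unfolding Lk .
  qed
  then have "\<xi> (\<lambda>h. \<Sum>i\<in>I. R u (c i) g * E i h) = \<xi> (\<lambda>h. - Ad G (iv g) (lbr G u w) h)" by simp
  then show "R u (\<lambda>h. \<xi> (Ad G (iv h) w)) g = - \<xi> (Ad G (iv g) (lbr G u w))"
    unfolding Rc using lin_sum[where I = I and w = E and c = "\<lambda>i. R u (c i) g", OF x fr(3)] lin_uminus[OF x Ad_LA[OF lbr_LA[OF u w]]] by simp
qed

end

section \<open>The preconnection of a quasitriangular structure\<close>

lemma sum_form_app: "(\<Sum>i\<in>I. f i) g us = (\<Sum>i\<in>I. f i g us)" for f :: "'i \<Rightarrow> 'g form"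
  by (induction I rule: infinite_finite_induct) auto

lemma tensor_square_expansion:
  assumes "t \<in> tensor_square V" "0 \<in> V"
  obtains n and \<alpha> \<beta> :: "nat \<Rightarrow> 'g tvec" where "\<And>i. \<alpha> i \<in> V" "\<And>i. \<beta> i \<in> V"
    "\<And>B. bilin V B \<Longrightarrow> t B = (\<Sum>i<n. B (\<alpha> i) (\<beta> i))"
proof -
  obtain uvs where uvs: "set uvs \<subseteq> V \<times> V" "\<And>B. bilin V B \<Longrightarrow> t B = (\<Sum>(u, v)\<leftarrow>uvs. B u v)"
    using assms(1) unfolding tensor_square_def by blast
  define \<alpha> where "\<alpha> i = (if i < length uvs then fst (uvs ! i) else 0)" for i
  define \<beta> where "\<beta> i = (if i < length uvs then snd (uvs ! i) else 0)" for i
  have mem: "uvs ! i \<in> V \<times> V" if "i < length uvs" for i using uvs(1) nth_mem[OF that] by blast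
  have "\<alpha> i \<in> V" "\<beta> i \<in> V" for i
    using mem[of i] assms(2) by (auto simp: \<alpha>_def \<beta>_def mem_Times_iff)
  moreover have "t B = (\<Sum>i<length uvs. B (\<alpha> i) (\<beta> i))" if "bilin V B" for B
    using uvs(2)[OF that] by (simp add: sum_list_sum_nth atLeast0LessThan \<alpha>_def \<beta>_def case_prod_beta)
  ultimately show thesis using that by blast
qed

context lie
begin

lemma bilin_cong: "bilin (T p) B' \<Longrightarrow> (\<And>u v. u \<in> T p \<Longrightarrow> v \<in> T p \<Longrightarrow> B u v = B' u v) \<Longrightarrow> bilin (T p) B"
proof (rule bilinI)
  assume B': "bilin (T p) B'" and e: "\<And>u v. u \<in> T p \<Longrightarrow> v \<in> T p \<Longrightarrow> B u v = B' u v"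
  fix w assume w: "w \<in> T p"
  show "lin p (\<lambda>v. B v w)"
    by (rule linI) (simp_all add: e w T_plus T_scale lin_add[OF bilinD(1)[OF B' w]] lin_scale[OF bilinD(1)[OF B' w]])
  show "lin p (B w)"
    by (rule linI) (simp_all add: e w T_plus T_scale lin_add[OF bilinD(2)[OF B' w]] lin_scale[OF bilinD(2)[OF B' w]])
qed

lemma lin_add_fun: "lin p \<phi> \<Longrightarrow> lin p \<psi> \<Longrightarrow> lin p (\<lambda>u. \<phi> u + \<psi> u)"
  by (rule linI) (simp_all add: lin_add lin_scale algebra_simps)
lemma lin_zero_fun: "lin p (\<lambda>u. 0)"
  by (rule linI) simp_all
lemma lin_sum_fun: "(\<And>i. i \<in> I \<Longrightarrow> lin p (\<phi> i)) \<Longrightarrow> lin p (\<lambda>u. \<Sum>i\<in>I. \<phi> i u)"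
  by (induction I rule: infinite_finite_induct) (simp_all add: lin_add_fun lin_zero_fun)
lemma lin_cong: "lin p \<phi> \<Longrightarrow> (\<And>u. u \<in> T p \<Longrightarrow> \<psi> u = \<phi> u) \<Longrightarrow> lin p \<psi>"
  by (rule linI) (simp_all add: T_plus T_scale lin_add lin_scale)

lemma lin_LA_L: assumes "V \<in> T g" "x \<in> C" shows "lin e1 (\<lambda>u. V (L u x))" "lin e1 (\<lambda>u. V (R u x))"
proof -
  have R_lin: "R (\<lambda>f. u f + v f) f = (\<lambda>g. R u f g + R v f g)" "R (\<lambda>f. c * u f) f = (\<lambda>g. c * R u f g)" for u v c f
    by (simp_all add: R_app fun_eq_iff)
  show "lin e1 (\<lambda>u. V (L u x))" "lin e1 (\<lambda>u. V (R u x))"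
    using assms
    by (auto intro!: linI simp: L_lin_v R_lin T_add[OF assms(1)] T_cmult[OF assms(1)] L_smooth R_smooth)
qed

lemma lin_L: "lin e1 (\<lambda>u. L u x g)" "lin e1 (\<lambda>u. R u x g)"
  using lin_ltrans[of e1 g x] by (simp_all add: L_def R_def)

lemma Ad_lin: "lin e1 \<xi> \<Longrightarrow> lin e1 (\<lambda>u. \<xi> (Ad G g u))"
proof (rule linI)
  fix u v and c :: real assume x: "lin e1 \<xi>" and u: "u \<in> LA"
  show "\<xi> (Ad G g (\<lambda>f. c * u f)) = c * \<xi> (Ad G g u)"
    using lin_scale[OF x Ad_LA[OF u], of c g] by (simp add: Ad_app[abs_def])
  assume v: "v \<in> LA"
  show "\<xi> (Ad G g (\<lambda>f. u f + v f)) = \<xi> (Ad G g u) + \<xi> (Ad G g v)"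
    using lin_add[OF x Ad_LA[OF u] Ad_LA[OF v]] by (simp add: Ad_app[abs_def])
qed

lemma dual_iff: "\<phi> \<in> dual LA \<longleftrightarrow> lin e1 \<phi> \<and> (\<forall>u. u \<notin> LA \<longrightarrow> \<phi> u = 0)"
  by (simp add: dual_def)

lemma dual_funsD:
  assumes "s \<in> dual_funs G"
  shows "s g \<in> dual LA" "lin e1 (s g)" "u \<notin> LA \<Longrightarrow> s g u = 0" "(\<lambda>g. s g v) \<in> C"
proof -
  show d: "s g \<in> dual LA" for g using assms by (simp add: dual_funs_def)
  then show "lin e1 (s g)" "u \<notin> LA \<Longrightarrow> s g u = 0" by (auto simp: dual_iff)
  show "(\<lambda>g. s g v) \<in> C"
  proof (cases "v \<in> LA")
    case True then show ?thesis using assms by (simp add: dual_funs_def)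
  next
    case False then show ?thesis using d by (simp add: dual_iff)
  qed
qed

lemma dual_funsI:
  assumes "\<And>g. lin e1 (s g)" "\<And>g u. u \<notin> LA \<Longrightarrow> s g u = 0" "\<And>v. v \<in> LA \<Longrightarrow> (\<lambda>g. s g v) \<in> C"
  shows "s \<in> dual_funs G"
  using assms by (simp add: dual_funs_def dual_iff)

abbreviation Om where "Om k \<equiv> forms G k"

lemma formsD:
  assumes "\<xi> \<in> Om k"
  shows "\<not> (length us = k \<and> set us \<subseteq> T g) \<Longrightarrow> \<xi> g us = 0"
  using conjunct1[OF assms[unfolded forms_def mem_Collect_eq]] by simp

lemma forms_zero: "0 \<in> Om k"
  unfolding forms_def mem_Collect_eq zero_fun_apply by (simp add: lin_zero_fun)

lemma forms_plus: assumes "\<xi> \<in> Om k" "\<eta> \<in> Om k" shows "\<xi> + \<eta> \<in> Om k"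
  unfolding forms_def mem_Collect_eq plus_fun_apply
proof (intro conjI allI impI)
  note a = assms[unfolded forms_def mem_Collect_eq]
  fix p us
  show "\<xi> p us + \<eta> p us = 0" if "\<not> (length us = k \<and> set us \<subseteq> T p)"
    using formsD[OF assms(1) that] formsD[OF assms(2) that] by simp
  show "lin p (\<lambda>u. \<xi> p (us[i := u]) + \<eta> p (us[i := u]))"
    if "length us = k \<and> set us \<subseteq> T p \<and> i < k" for i
    using that conjunct1[OF conjunct2[OF a(1)]] conjunct1[OF conjunct2[OF a(2)]] by (simp add: lin_add_fun)
  show "\<xi> p us + \<eta> p us = 0" if "length us = k \<and> i < j \<and> j < k \<and> us ! i = us ! j" for i j
  proof -
    have "\<xi> p us = 0" by (rule conjunct1[OF conjunct2[OF conjunct2[OF a(1)]], rule_format, OF that])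
    moreover have "\<eta> p us = 0" by (rule conjunct1[OF conjunct2[OF conjunct2[OF a(2)]], rule_format, OF that])
    ultimately show ?thesis by simp
  qed
  fix Xs assume X: "length Xs = k \<and> set Xs \<subseteq> vector_fields G"
  show "(\<lambda>p. \<xi> p (map (\<lambda>X. X p) Xs) + \<eta> p (map (\<lambda>X. X p) Xs)) \<in> C"
    by (rule C_add; rule conjunct2[OF conjunct2[OF conjunct2[OF a(1)]], rule_format, OF X]
        conjunct2[OF conjunct2[OF conjunct2[OF a(2)]], rule_format, OF X])
qed

lemma forms_fsc: assumes "\<xi> \<in> Om k" shows "fsc c \<xi> \<in> Om k"
  unfolding forms_def mem_Collect_eq fsc_def
proof (intro conjI allI impI)
  note a = assms[unfolded forms_def mem_Collect_eq]
  fix p us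
  show "c * \<xi> p us = 0" if "\<not> (length us = k \<and> set us \<subseteq> T p)"
    using formsD[OF assms(1) that] by simp
  show "lin p (\<lambda>u. c * \<xi> p (us[i := u]))"
    if "length us = k \<and> set us \<subseteq> T p \<and> i < k" for i
    using that conjunct1[OF conjunct2[OF a]] by (simp add: lin_mult_const)
  show "c * \<xi> p us = 0" if "length us = k \<and> i < j \<and> j < k \<and> us ! i = us ! j" for i j
    using conjunct1[OF conjunct2[OF conjunct2[OF a]], rule_format, OF that] by simp
  fix Xs assume X: "length Xs = k \<and> set Xs \<subseteq> vector_fields G"
  show "(\<lambda>p. c * \<xi> p (map (\<lambda>X. X p) Xs)) \<in> C"
    by (rule C_cmult[OF conjunct2[OF conjunct2[OF conjunct2[OF a]], rule_format, OF X]])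
qed

lemma fsc_minus: "\<xi> - \<eta> = \<xi> + fsc (- 1) \<eta>" and fsc_uminus: "- \<xi> = fsc (- 1) \<xi>"
  and fsc_fsc: "fsc c (fsc d \<xi>) = fsc (c * d) \<xi>" and fsc_one: "fsc 1 \<xi> = \<xi>"
  and fsc_zero: "fsc c 0 = 0" "fsc 0 \<xi> = 0" and fsc_plus: "fsc c (\<xi> + \<eta>) = fsc c \<xi> + fsc c \<eta>"
  by (simp_all add: fsc_def fun_eq_iff algebra_simps)

lemma forms_minus: "\<xi> \<in> Om k \<Longrightarrow> \<eta> \<in> Om k \<Longrightarrow> \<xi> - \<eta> \<in> Om k"
  unfolding fsc_minus by (intro forms_plus forms_fsc)
lemma forms_uminus: "\<xi> \<in> Om k \<Longrightarrow> - \<xi> \<in> Om k"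
  unfolding fsc_uminus by (rule forms_fsc)
lemma forms_sum: "(\<And>i. i \<in> I \<Longrightarrow> f i \<in> Om k) \<Longrightarrow> (\<Sum>i\<in>I. f i) \<in> Om k"
  by (induction I rule: infinite_finite_induct) (auto simp: forms_zero forms_plus)

lemma form_eqI:
  assumes "\<xi> \<in> Om k" "\<eta> \<in> Om k"
    "\<And>p us. length us = k \<Longrightarrow> set us \<subseteq> T p \<Longrightarrow> \<xi> p us = \<eta> p us"
  shows "\<xi> = \<eta>"
proof (intro ext)
  fix p us show "\<xi> p us = \<eta> p us"
    using assms(3)[of us p] formsD[OF assms(1), of us p] formsD[OF assms(2), of us p] by force
qed

lemma forms1D:
  assumes "\<tau> \<in> forms G 1"
  shows "\<not> (length us = 1 \<and> set us \<subseteq> T p) \<Longrightarrow> \<tau> p us = 0"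
    "lin p (\<lambda>u. \<tau> p [u])"
    "X \<in> vector_fields G \<Longrightarrow> (\<lambda>p. \<tau> p [X p]) \<in> C"
proof -
  note c = assms[unfolded forms_def mem_Collect_eq]
  show "\<not> (length us = 1 \<and> set us \<subseteq> T p) \<Longrightarrow> \<tau> p us = 0"
    using conjunct1[OF c] by simp
  from conjunct1[OF conjunct2[OF c], rule_format, of "[\<lambda>f. 0]" p 0]
  show "lin p (\<lambda>u. \<tau> p [u])" by (simp add: T_zero)
  assume X: "X \<in> vector_fields G"
  from conjunct2[OF conjunct2[OF conjunct2[OF c]], rule_format, of "[X]"] X
  show "(\<lambda>p. \<tau> p [X p]) \<in> C" by simp
qed

lemma forms1I:
  assumes "\<And>p us. \<not> (length us = 1 \<and> set us \<subseteq> T p) \<Longrightarrow> \<tau> p us = 0"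
    "\<And>p. lin p (\<lambda>u. \<tau> p [u])"
    "\<And>X. X \<in> vector_fields G \<Longrightarrow> (\<lambda>p. \<tau> p [X p]) \<in> C"
  shows "\<tau> \<in> forms G 1"
  unfolding forms_def
proof (intro CollectI conjI allI impI)
  fix p us i assume "length us = 1 \<and> set us \<subseteq> T p \<and> i < (1::nat)"
  then obtain v where "us = [v]" "i = 0" by (auto simp: length_Suc_conv)
  then show "lin p (\<lambda>u. \<tau> p (us[i := u]))" using assms(2) by simp
next
  fix Xs assume "length Xs = 1 \<and> set Xs \<subseteq> vector_fields G"
  then obtain X where "Xs = [X]" "X \<in> vector_fields G" by (auto simp: length_Suc_conv)
  then show "(\<lambda>p. \<tau> p (map (\<lambda>X. X p) Xs)) \<in> C" using assms(3) by simp
qed (use assms(1) in auto)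

lemma tilde_dual_funs: "\<tau> \<in> forms G 1 \<Longrightarrow> tilde G \<tau> \<in> dual_funs G"
proof (rule dual_funsI)
  assume \<tau>: "\<tau> \<in> forms G 1"
  fix g
  show "lin e1 (tilde G \<tau> g)"
    by (rule lin_cong[OF lin_comp_ltrans[OF forms1D(2)[OF \<tau>]]]) (simp add: tilde_def)
  fix v assume v: "v \<in> LA"
  show "(\<lambda>g. tilde G \<tau> g v) \<in> C"
    using forms1D(3)[OF \<tau> LR_field(1)[OF v]] v by (simp add: tilde_def)
qed (simp add: tilde_def)

lemma dual_field_smooth:
  assumes s: "s \<in> dual_funs G" and X: "X \<in> vector_fields G"
  shows "(\<lambda>p. s p (ltrans G (iv p) (X p))) \<in> C"
proof -
  obtain I :: "'e set" and f :: "'e \<Rightarrow> 'g \<Rightarrow> real" and E where fr: "finite I"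
    "\<And>i. i \<in> I \<Longrightarrow> f i \<in> C" "\<And>i. i \<in> I \<Longrightarrow> E i \<in> LA"
    "\<And>v h. v \<in> LA \<Longrightarrow> v h = (\<Sum>i\<in>I. v (f i) * E i h)"
    "\<And>v \<xi>. v \<in> LA \<Longrightarrow> lin e1 \<xi> \<Longrightarrow> \<xi> v = (\<Sum>i\<in>I. v (f i) * \<xi> (E i))"
    by (rule lie_alg_frame_lin) blast
  have X': "ltrans G (iv p) (X p) \<in> LA" for p
    using X ltrans_inv_LA by (simp add: vector_fields_def)
  have c: "(\<lambda>p. ltrans G (iv p) (X p) (f i)) \<in> C" if "i \<in> I" for i
    using vector_field_smooth2[OF smooth2_inverse[OF smooth2_mult[OF fr(2)[OF that]]] X]
    by (simp add: ltrans_def)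
  have "(\<lambda>p. s p (ltrans G (iv p) (X p))) = (\<lambda>p. \<Sum>i\<in>I. ltrans G (iv p) (X p) (f i) * s p (E i))"
    using fr(5)[OF X' dual_funsD(2)[OF s]] by blast
  also have "\<dots> \<in> C" by (intro C_sum C_mult c dual_funsD(4)[OF s])
  finally show ?thesis .
qed

lemma untilde_forms: "s \<in> dual_funs G \<Longrightarrow> untilde G s \<in> forms G 1"
proof (rule forms1I)
  assume s: "s \<in> dual_funs G"
  fix p us assume "\<not> (length us = 1 \<and> set us \<subseteq> T p)"
  then consider "length us \<noteq> 1" | u where "us = [u]" "u \<notin> T p"
    by (cases us rule: remdups_adj.cases) auto
  then show "untilde G s p us = 0"
  proof cases
    case 2
    then have "ltrans G (iv p) u \<notin> LA" by (simp add: ltrans_inv_LA_iff)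
    then show ?thesis using 2 dual_funsD(3)[OF s] by (simp add: untilde_def)
  qed (simp add: untilde_def)
next
  assume s: "s \<in> dual_funs G"
  fix p
  show "lin p (\<lambda>u. untilde G s p [u])"
  proof (rule linI)
    fix u v and c :: real assume u: "u \<in> T p"
    show "untilde G s p [\<lambda>f. c * u f] = c * untilde G s p [u]"
      using lin_scale[OF dual_funsD(2)[OF s] ltrans_inv_LA[OF u]] by (simp add: untilde_def ltrans_def)
    assume v: "v \<in> T p"
    show "untilde G s p [\<lambda>f. u f + v f] = untilde G s p [u] + untilde G s p [v]"
      using lin_add[OF dual_funsD(2)[OF s] ltrans_inv_LA[OF u] ltrans_inv_LA[OF v]]
      by (simp add: untilde_def ltrans_def)
  qed
next
  assume s: "s \<in> dual_funs G"
  fix X assume "X \<in> vector_fields G"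
  then show "(\<lambda>p. untilde G s p [X p]) \<in> C"
    using dual_field_smooth[OF s] by (simp add: untilde_def)
qed

lemma tilde_untilde: "s \<in> dual_funs G \<Longrightarrow> tilde G (untilde G s) = s"
  by (auto simp: tilde_def untilde_def fun_eq_iff dual_funsD)

lemma df_eq:
  "df G a p us = (if length us = 1 \<and> set us \<subseteq> T p then hd us a else 0)"
proof (cases "set us \<subseteq> T p")
  case True
  show ?thesis
  proof (cases us rule: remdups_adj.cases)
    case (2 u)
    have u: "u \<in> T p" using True 2 by simp
    have "nths [u] (- {0}) = []" by (simp add: nths_def)
    then show ?thesis using True 2 by (simp add: ext_d_def fun_form_def)
  next
    case (3 u v vs)
    have n1: "nths us (- {i}) \<noteq> []" if "i < length us" for i
    proof -
      obtain j where j: "j < length us" "j \<noteq> i" using 3 that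
        by (cases i) (auto intro: that[of "Suc 0"] that[of 0])
      then have "us ! j \<in> set (nths us (- {i}))" unfolding set_nths by blast
      then show ?thesis by auto
    qed
    have "(us ! i) (\<lambda>q. fun_form a q (map (ltrans G (q \<bullet>\<bullet> iv p)) (nths us (- {i})))) = 0"
      if i: "i < length us" for i
    proof -
      have "us ! i \<in> T p" using True i nth_mem by blast
      then show ?thesis using n1[OF i] T_const[of "us ! i" p 0] by (simp add: fun_form_def)
    qed
    then show ?thesis using True 3 by (simp add: ext_d_def fun_form_def)
  qed (simp add: ext_d_def)
qed (simp add: ext_d_def)

lemma df_forms: assumes a: "a \<in> C" shows "df G a \<in> forms G 1"
proof (rule forms1I)
  fix p
  show "lin p (\<lambda>u. df G a p [u])" by (rule lin_cong[OF lin_eval[of p a]]) (simp add: df_eq)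
next
  fix X assume X: "X \<in> vector_fields G"
  then show "(\<lambda>p. df G a p [X p]) \<in> C" using a by (simp add: df_eq vector_fields_def)
qed (auto simp: df_eq)

lemma tilde_df: "v \<in> LA \<Longrightarrow> tilde G (df G a) g v = L v a g"
  by (simp add: tilde_def df_eq ltrans_LA ltrans_L)

end

text \<open>Fixed expansions of both parts of \<open>r\<close> turn contractions with these tensors into finite sums.\<close>

locale qt = lie G
  for G :: "('g::{t2_space,second_countable_topology}, 'e::real_inner) lie_group_data" +
  fixes \<omega> :: "'g \<Rightarrow> 'g tens2" and r :: "'g tens2"
    and n m :: nat and \<alpha> \<beta> p q :: "nat \<Rightarrow> 'g tvec"
  assumes plg: "poisson_lie_group G \<omega>" and qtr: "quasitriangular G \<omega> r"
    and \<alpha>: "\<And>i. \<alpha> i \<in> lie_alg G" and \<beta>: "\<And>i. \<beta> i \<in> lie_alg G"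
    and pL: "\<And>i. p i \<in> lie_alg G" and qL: "\<And>i. q i \<in> lie_alg G"
    and rm: "\<And>B. bilin (lie_alg G) B \<Longrightarrow> r_minus r B = (\<Sum>i<n. B (\<alpha> i) (\<beta> i))"
    and rp: "\<And>B. bilin (lie_alg G) B \<Longrightarrow> r_plus r B = (\<Sum>i<m. B (p i) (q i))"
begin

lemma rm_swap: "bilin LA B \<Longrightarrow> (\<Sum>i<n. B (\<beta> i) (\<alpha> i)) = - (\<Sum>i<n. B (\<alpha> i) (\<beta> i))"
  using rm[of B] rm[OF bilin_swap[of e1 B]] by (simp add: r_minus_def tflip_def)

text \<open>Only the antisymmetric part of \<open>r\<close> survives because \<open>\<omega> g\<close> is antisymmetric. In other words \<open>r\<^sub>+\<close> is invariant
  under the adjoint action of the whole group, which infinitesimal invariance alone gives on the identity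
  component only.\<close>

lemma omega_eq:
  assumes B: "bilin (T g) B"
  shows "\<omega> g B = (\<Sum>i<n. B (ltrans G g (\<alpha> i)) (ltrans G g (\<beta> i)) - B (rtrans G g (\<alpha> i)) (rtrans G g (\<beta> i)))"
proof -
  let ?Bl = "\<lambda>u v. B (ltrans G g u) (ltrans G g v)" and ?Br = "\<lambda>u v. B (rtrans G g u) (rtrans G g v)"
  have bl: "bilin LA ?Bl"
    by (rule bilinI) (auto intro: lin_comp_ltrans bilinD[OF B] ltrans_LA
        lin_comp_ltrans[OF bilinD(1)[OF B ltrans_LA]])
  have br: "bilin LA ?Br"
    by (rule bilinI) (auto intro: lin_comp_rtrans bilinD[OF B] rtrans_LA
        lin_comp_rtrans[OF bilinD(1)[OF B rtrans_LA]])
  have w: "\<omega> g B' = r (\<lambda>u v. B' (ltrans G g u) (ltrans G g v)) - r (\<lambda>u v. B' (rtrans G g u) (rtrans G g v))"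
    if "bilin (T g) B'" for B'
    using qtr that unfolding quasitriangular_def tens_eq_def by blast
  have "tflip (\<omega> g) B = - \<omega> g B"
    using plg B unfolding poisson_lie_group_def poisson_bivector_def tens_eq_def by simp
  then have "\<omega> g B = (\<omega> g B - \<omega> g (\<lambda>u v. B v u)) / 2" by (simp add: tflip_def)
  also have "\<dots> = r_minus r ?Bl - r_minus r ?Br"
    unfolding w[OF B] w[OF bilin_swap[OF B]] by (simp add: r_minus_def tflip_def field_simps)
  finally show ?thesis using rm[OF bl] rm[OF br] by (simp add: sum_subtractf)
qed

lemma pb_eq:
  "pb \<omega> x y g = (\<Sum>i<n. L (\<alpha> i) x g * L (\<beta> i) y g - R (\<alpha> i) x g * R (\<beta> i) y g)"
  unfolding pb_def L_def R_def by (rule omega_eq) (intro bilin_prod lin_eval)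

lemma pb_smooth: "x \<in> C \<Longrightarrow> y \<in> C \<Longrightarrow> pb \<omega> x y \<in> C"
  using plg unfolding poisson_lie_group_def poisson_bivector_def by blast

lemma pb_jacobi: "x \<in> C \<Longrightarrow> y \<in> C \<Longrightarrow> z \<in> C \<Longrightarrow>
    pb \<omega> x (pb \<omega> y z) g + pb \<omega> y (pb \<omega> z x) g + pb \<omega> z (pb \<omega> x y) g = 0"
proof -
  assume "x \<in> C" "y \<in> C" "z \<in> C"
  then have "pb \<omega> x (pb \<omega> y z) + pb \<omega> y (pb \<omega> z x) + pb \<omega> z (pb \<omega> x y) = 0"
    using plg unfolding poisson_lie_group_def poisson_bivector_def by blast
  then show ?thesis by (metis plus_fun_apply zero_fun_apply)
qed

lemma pb_anti: "pb \<omega> x y g = - pb \<omega> y x g"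
proof -
  have "(\<Sum>i<n. L (\<beta> i) x g * L (\<alpha> i) y g) = - (\<Sum>i<n. L (\<alpha> i) x g * L (\<beta> i) y g)"
    "(\<Sum>i<n. R (\<beta> i) x g * R (\<alpha> i) y g) = - (\<Sum>i<n. R (\<alpha> i) x g * R (\<beta> i) y g)"
    by (rule rm_swap[OF bilin_prod[OF lin_L(1) lin_L(1)]], rule rm_swap[OF bilin_prod[OF lin_L(2) lin_L(2)]])
  then show ?thesis by (simp add: pb_eq sum_subtractf mult.commute)
qed

lemma pb_tangent: obtains V where "V \<in> T g" "\<And>y. pb \<omega> x y g = V y"
proof
  let ?V = "\<lambda>f. (\<Sum>i<n. L (\<alpha> i) x g * ltrans G g (\<beta> i) f) + (\<Sum>i<n. (- R (\<alpha> i) x g) * rtrans G g (\<beta> i) f)"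
  show "?V \<in> T g" by (intro T_plus T_combination ltrans_LA rtrans_LA \<beta>)
  show "pb \<omega> x y g = ?V y" for y
    by (simp add: pb_eq ltrans_L rtrans_R sum_subtractf sum_negf)
qed

lemma pb_const: "pb \<omega> x (\<lambda>h. c) g = 0"
  by (rule pb_tangent[of g x]) (simp add: T_const)
lemma pb_add: "y \<in> C \<Longrightarrow> z \<in> C \<Longrightarrow> pb \<omega> x (\<lambda>h. y h + z h) g = pb \<omega> x y g + pb \<omega> x z g"
  by (rule pb_tangent[of g x]) (simp add: T_add)
lemma pb_cmult: "y \<in> C \<Longrightarrow> pb \<omega> x (\<lambda>h. c * y h) g = c * pb \<omega> x y g"
  by (rule pb_tangent[of g x]) (simp add: T_cmult)
lemma pb_mult: "y \<in> C \<Longrightarrow> z \<in> C \<Longrightarrow> pb \<omega> x (\<lambda>h. y h * z h) g = y g * pb \<omega> x z g + pb \<omega> x y g * z g"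
  by (rule pb_tangent[of g x]) (simp add: T_mult)
lemma pb_sum: "(\<And>i. i \<in> I \<Longrightarrow> y i \<in> C) \<Longrightarrow> pb \<omega> x (\<lambda>h. \<Sum>i\<in>I. y i h) g = (\<Sum>i\<in>I. pb \<omega> x (y i) g)"
  by (rule pb_tangent[of g x]) (simp add: T_sum)

text \<open>The preconnection in both pictures: on functions with values in the dual of the Lie algebra, and on
  1-forms.\<close>

definition Gam where
  "Gam a s = (\<lambda>g. pb_vec \<omega> a s g + (\<lambda>w. r_minus r (\<lambda>u v. ltrans G g u a * ad_star G v (s g) w)))"

definition gam :: "'g precon" where
  "gam a \<tau> = untilde G (Gam a (tilde G \<tau>))"

definition Xi :: "'g dual_op" where
  "Xi \<phi> \<psi> = (\<lambda>w. r_minus r (\<lambda>u v. \<phi> u * ad_star G v \<psi> w))"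

lemma lin_ad_star: "lin e1 \<psi> \<Longrightarrow> lin e1 (\<lambda>v. ad_star G v \<psi> w)"
  unfolding ad_star_def by (cases "w \<in> LA") (simp_all add: lin_lbr_right lin_zero_fun)

lemma Xi_eq:
  "lin e1 \<phi> \<Longrightarrow> lin e1 \<psi> \<Longrightarrow> Xi \<phi> \<psi> w = (\<Sum>i<n. \<phi> (\<alpha> i) * ad_star G (\<beta> i) \<psi> w)"
  unfolding Xi_def by (rule rm) (intro bilin_prod lin_ad_star)

lemma Gam_eq:
  assumes s: "s \<in> dual_funs G" and w: "w \<in> LA"
  shows "Gam a s g w = pb \<omega> a (\<lambda>h. s h w) g + (\<Sum>i<n. L (\<alpha> i) a g * s g (lbr G w (\<beta> i)))"
proof -
  have "bilin LA (\<lambda>u v. ltrans G g u a * ad_star G v (s g) w)"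
    by (intro bilin_prod lin_ltrans lin_ad_star dual_funsD[OF s])
  from rm[OF this] show ?thesis
    using w by (simp add: Gam_def pb_vec_def plus_fun_def ad_star_def ltrans_L)
qed

lemma Gam_outside:
  assumes s: "s \<in> dual_funs G" and w: "w \<notin> LA"
  shows "Gam a s g w = 0"
proof -
  have "bilin LA (\<lambda>u v. 0)" by (intro bilinI lin_zero_fun)
  then have "r_minus r (\<lambda>u v. 0) = 0" using rm by simp
  then show ?thesis
    using w by (simp add: Gam_def pb_vec_def plus_fun_def ad_star_def dual_funsD(3)[OF s w] pb_const)
qed

lemma Gam_dual_funs:
  assumes a: "a \<in> C" and s: "s \<in> dual_funs G"
  shows "Gam a s \<in> dual_funs G"
proof (rule dual_funsI)
  fix g
  have ps: "pb \<omega> a (\<lambda>h. s h (\<lambda>f. u f + v f)) g = pb \<omega> a (\<lambda>h. s h u) g + pb \<omega> a (\<lambda>h. s h v) g"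
    if "u \<in> LA" "v \<in> LA" for u v
    using pb_add[OF dual_funsD(4)[OF s] dual_funsD(4)[OF s]] lin_add[OF dual_funsD(2)[OF s] that] by simp
  have pc: "pb \<omega> a (\<lambda>h. s h (\<lambda>f. c * u f)) g = c * pb \<omega> a (\<lambda>h. s h u) g" if "u \<in> LA" for u c
    using pb_cmult[OF dual_funsD(4)[OF s]] lin_scale[OF dual_funsD(2)[OF s] that] by simp
  have "lin e1 (\<lambda>w. pb \<omega> a (\<lambda>h. s h w) g + (\<Sum>i<n. L (\<alpha> i) a g * s g (lbr G w (\<beta> i))))"
  proof (intro lin_add_fun lin_sum_fun lin_mult_const lin_lbr_left dual_funsD[OF s] \<beta>)
    show "lin e1 (\<lambda>w. pb \<omega> a (\<lambda>h. s h w) g)" by (rule linI) (simp_all add: ps pc)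
  qed
  then show "lin e1 (Gam a s g)" by (rule lin_cong) (simp add: Gam_eq s)
  fix v assume v: "v \<in> LA"
  have "(\<lambda>g. pb \<omega> a (\<lambda>h. s h v) g + (\<Sum>i<n. L (\<alpha> i) a g * s g (lbr G v (\<beta> i)))) \<in> C"
  proof (rule C_add)
    show "(\<lambda>g. pb \<omega> a (\<lambda>h. s h v) g) \<in> C" using pb_smooth[OF a dual_funsD(4)[OF s]] .
    show "(\<lambda>g. \<Sum>i<n. L (\<alpha> i) a g * s g (lbr G v (\<beta> i))) \<in> C"
      by (intro C_sum C_mult L_smooth \<alpha> a dual_funsD[OF s])
  qed
  then show "(\<lambda>g. Gam a s g v) \<in> C" by (simp add: Gam_eq s v)
qed (rule Gam_outside[OF s])

lemma gam_app:
  "gam a \<tau> g us = (if length us = 1 then Gam a (tilde G \<tau>) g (ltrans G (iv g) (hd us)) else 0)"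
  by (simp add: gam_def untilde_def)

lemma gam_forms: "a \<in> C \<Longrightarrow> \<tau> \<in> forms G 1 \<Longrightarrow> gam a \<tau> \<in> forms G 1"
  unfolding gam_def by (intro untilde_forms Gam_dual_funs tilde_dual_funs)

lemma tilde_gam: "a \<in> C \<Longrightarrow> \<tau> \<in> forms G 1 \<Longrightarrow> tilde G (gam a \<tau>) = Gam a (tilde G \<tau>)"
  unfolding gam_def by (intro tilde_untilde Gam_dual_funs tilde_dual_funs)

lemma tilde_con_gam: "a \<in> C \<Longrightarrow> s \<in> dual_funs G \<Longrightarrow> tilde_con G gam a s = Gam a s"
  unfolding tilde_con_def gam_def by (simp add: tilde_untilde Gam_dual_funs)

lemma Gam_add_left:
  assumes "x \<in> C" "y \<in> C" and s: "s \<in> dual_funs G"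
  shows "Gam (\<lambda>h. x h + y h) s g w = Gam x s g w + Gam y s g w"
proof (cases "w \<in> LA")
  case True
  have "pb \<omega> (\<lambda>h. x h + y h) z g = pb \<omega> x z g + pb \<omega> y z g" for z
    using pb_add[OF assms(1,2), of z g] by (simp add: pb_anti[of _ z])
  then show ?thesis using assms True \<alpha> by (simp add: Gam_eq L_add algebra_simps sum.distrib)
qed (simp add: Gam_outside s)

lemma Gam_cmult_left:
  assumes "x \<in> C" and s: "s \<in> dual_funs G"
  shows "Gam (\<lambda>h. c * x h) s g w = c * Gam x s g w"
proof (cases "w \<in> LA")
  case True
  have "pb \<omega> (\<lambda>h. c * x h) z g = c * pb \<omega> x z g" for z
    using pb_cmult[OF assms(1), of z c g] by (simp add: pb_anti[of _ z])
  then show ?thesis using assms True \<alpha> by (simp add: Gam_eq L_cmult algebra_simps sum_distrib_left)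
qed (simp add: Gam_outside s)

lemma Gam_mult_left:
  assumes "x \<in> C" "y \<in> C" and s: "s \<in> dual_funs G"
  shows "Gam (\<lambda>h. x h * y h) s g w = x g * Gam y s g w + y g * Gam x s g w"
proof (cases "w \<in> LA")
  case True
  have "pb \<omega> (\<lambda>h. x h * y h) z g = x g * pb \<omega> y z g + y g * pb \<omega> x z g" for z
    using pb_mult[OF assms(1,2), of z g] by (simp add: pb_anti[of _ z] algebra_simps)
  then show ?thesis using assms True \<alpha>
    by (simp add: Gam_eq L_mult algebra_simps sum.distrib sum_distrib_left)
qed (simp add: Gam_outside s)

lemma Gam_add_right:
  assumes s: "s \<in> dual_funs G" "t \<in> dual_funs G" "(\<lambda>g v. s g v + t g v) \<in> dual_funs G"
  shows "Gam x (\<lambda>g v. s g v + t g v) g w = Gam x s g w + Gam x t g w"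
  by (cases "w \<in> LA") (simp_all add: Gam_eq Gam_outside s pb_add dual_funsD(4) algebra_simps sum.distrib)

lemma Gam_cmult_right:
  assumes s: "s \<in> dual_funs G" "(\<lambda>g v. c * s g v) \<in> dual_funs G"
  shows "Gam x (\<lambda>g v. c * s g v) g w = c * Gam x s g w"
  by (cases "w \<in> LA") (simp_all add: Gam_eq Gam_outside s pb_cmult dual_funsD(4) algebra_simps sum_distrib_left)

lemma Gam_mult_right:
  assumes "y \<in> C" and s: "s \<in> dual_funs G" "(\<lambda>g v. y g * s g v) \<in> dual_funs G"
  shows "Gam x (\<lambda>g v. y g * s g v) g w = y g * Gam x s g w + pb \<omega> x y g * s g w"
  by (cases "w \<in> LA")
     (simp_all add: Gam_eq Gam_outside assms pb_mult dual_funsD(3,4) algebra_simps sum_distrib_left)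

lemma forms1_fmul: "y \<in> C \<Longrightarrow> \<tau> \<in> forms G 1 \<Longrightarrow> fmul y \<tau> \<in> forms G 1"
  by (rule forms1I) (simp_all add: fmul_def forms1D lin_mult_const C_mult)

lemma tilde_plus: "tilde G (\<tau> + \<sigma>) = (\<lambda>g v. tilde G \<tau> g v + tilde G \<sigma> g v)"
  and tilde_fsc: "tilde G (fsc c \<tau>) = (\<lambda>g v. c * tilde G \<tau> g v)"
  and tilde_fmul: "tilde G (fmul y \<tau>) = (\<lambda>g v. y g * tilde G \<tau> g v)"
  by (auto simp: tilde_def fsc_def fmul_def fun_eq_iff)

lemma untilde_tilde: assumes "\<tau> \<in> forms G 1" shows "untilde G (tilde G \<tau>) = \<tau>"
proof (intro ext)
  fix g us
  show "untilde G (tilde G \<tau>) g us = \<tau> g us"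
  proof (cases "length us = 1")
    case True
    then obtain u where "us = [u]" by (auto simp: length_Suc_conv)
    then show ?thesis using forms1D(1)[OF assms, of us g]
      by (simp add: untilde_def tilde_def ltrans_inv_LA_iff)
  qed (simp add: untilde_def forms1D(1)[OF assms])
qed

lemma preconnection_gam: "preconnection G \<omega> gam"
  unfolding preconnection_def
proof (intro conjI ballI)
  fix x \<tau> assume x: "x \<in> C" and \<tau>: "\<tau> \<in> forms G 1"
  show "gam x \<tau> \<in> forms G 1" by (rule gam_forms[OF x \<tau>])
  fix y assume y: "y \<in> C"
  note t = tilde_dual_funs[OF \<tau>]
  show "gam (x * y) \<tau> = fmul x (gam y \<tau>) + fmul y (gam x \<tau>)"
    by (intro ext) (simp add: gam_app fmul_def times_fun_def Gam_mult_left[OF x y t])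
  show "gam x (fmul y \<tau>) = fmul y (gam x \<tau>) + fmul (pb \<omega> x y) \<tau>"
  proof (intro ext)
    fix g us
    have "\<tau> g us = untilde G (tilde G \<tau>) g us" using untilde_tilde[OF \<tau>] by simp
    then show "gam x (fmul y \<tau>) g us = (fmul y (gam x \<tau>) + fmul (pb \<omega> x y) \<tau>) g us"
      using Gam_mult_right[OF y t] tilde_dual_funs[OF forms1_fmul[OF y \<tau>]]
      by (simp add: gam_app fmul_def[of _ "gam x \<tau>"] fmul_def[of "pb \<omega> x y"] tilde_fmul untilde_def)
  qed
next
  show "bilinear_over sc fsc fsc C (forms G 1) gam"
    unfolding bilinear_over_def linear_over_def
  proof (intro conjI ballI allI)
    fix \<tau> x y and c :: real assume \<tau>: "\<tau> \<in> forms G 1" and x: "x \<in> C"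
    note t = tilde_dual_funs[OF \<tau>]
    show "gam (sc c x) \<tau> = fsc c (gam x \<tau>)"
      by (intro ext) (simp add: gam_app fsc_def sc_def Gam_cmult_left[OF x t])
    assume y: "y \<in> C"
    show "gam (x + y) \<tau> = gam x \<tau> + gam y \<tau>"
      by (intro ext) (simp add: gam_app plus_fun_def Gam_add_left[OF x y t])
  next
    fix x \<tau> \<sigma> and c :: real assume x: "x \<in> C" and \<tau>: "\<tau> \<in> forms G 1"
    show "gam x (fsc c \<tau>) = fsc c (gam x \<tau>)"
      using Gam_cmult_right[OF tilde_dual_funs[OF \<tau>]] tilde_dual_funs[OF forms_fsc[OF \<tau>]]
      by (intro ext) (simp add: gam_app fsc_def[of _ "gam x \<tau>"] tilde_fsc)
    assume \<sigma>: "\<sigma> \<in> forms G 1"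
    show "gam x (\<tau> + \<sigma>) = gam x \<tau> + gam x \<sigma>"
      using Gam_add_right[OF tilde_dual_funs[OF \<tau>] tilde_dual_funs[OF \<sigma>]] tilde_dual_funs[OF forms_plus[OF \<tau> \<sigma>]]
      by (intro ext) (simp add: gam_app tilde_plus)
  qed
qed

text \<open>Left-invariant fields commute with the right-invariant half of the bivector, so they fail to be
  derivations of the Poisson bracket only by the commutators with the left-invariant half.\<close>

lemma L_pb:
  assumes x: "x \<in> C" and y: "y \<in> C" and w: "w \<in> LA"
  shows "L w (pb \<omega> x y) g =
      pb \<omega> x (L w y) g + (\<Sum>i<n. L (\<alpha> i) x g * L (lbr G w (\<beta> i)) y g)
    - (pb \<omega> y (L w x) g + (\<Sum>i<n. L (\<alpha> i) y g * L (lbr G w (\<beta> i)) x g))"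
proof -
  have Lx: "L (\<alpha> i) x \<in> C" "L (\<beta> i) x \<in> C" "R (\<alpha> i) x \<in> C" "R (\<beta> i) x \<in> C" for i
    using x \<alpha> \<beta> by (auto intro: L_smooth R_smooth)
  have Ly: "L (\<alpha> i) y \<in> C" "L (\<beta> i) y \<in> C" "R (\<alpha> i) y \<in> C" "R (\<beta> i) y \<in> C" for i
    using y \<alpha> \<beta> by (auto intro: L_smooth R_smooth)
  have "L w (pb \<omega> x y) g = L w (\<lambda>g. \<Sum>i<n. L (\<alpha> i) x g * L (\<beta> i) y g - R (\<alpha> i) x g * R (\<beta> i) y g) g"
    by (simp add: pb_eq[abs_def])
  also have "\<dots> = (\<Sum>i<n. L w (\<lambda>g. L (\<alpha> i) x g * L (\<beta> i) y g - R (\<alpha> i) x g * R (\<beta> i) y g) g)"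
    by (rule L_sum[OF w]) (intro C_diff C_mult Lx Ly)
  also have "\<dots> = (\<Sum>i<n. L (\<alpha> i) x g * L w (L (\<beta> i) y) g + L w (L (\<alpha> i) x) g * L (\<beta> i) y g
      - (R (\<alpha> i) x g * R (\<beta> i) (L w y) g + R (\<alpha> i) (L w x) g * R (\<beta> i) y g))"
  proof (rule sum.cong[OF refl])
    fix i
    show "L w (\<lambda>g. L (\<alpha> i) x g * L (\<beta> i) y g - R (\<alpha> i) x g * R (\<beta> i) y g) g =
      L (\<alpha> i) x g * L w (L (\<beta> i) y) g + L w (L (\<alpha> i) x) g * L (\<beta> i) y g
      - (R (\<alpha> i) x g * R (\<beta> i) (L w y) g + R (\<alpha> i) (L w x) g * R (\<beta> i) y g)"
      using L_diff[OF w C_mult[OF Lx(1) Ly(2)] C_mult[OF Lx(3) Ly(4)], of i i i i g]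
        L_mult[OF w Lx(1) Ly(2), of i i g] L_mult[OF w Lx(3) Ly(4), of i i g]
        L_R_commute[OF w \<alpha> x] L_R_commute[OF w \<beta> y] by simp
  qed
  finally have A: "L w (pb \<omega> x y) g = \<dots>" .
  have B1: "(\<Sum>i<n. L w (L (\<beta> i) x) g * L (\<alpha> i) y g) = - (\<Sum>i<n. L w (L (\<alpha> i) x) g * L (\<beta> i) y g)"
    using rm_swap[OF bilin_prod[OF lin_LA_L(1)[OF ltrans_LA[OF w] x] lin_L(1)]] by (simp add: ltrans_L)
  have B2: "(\<Sum>i<n. R (\<beta> i) (L w x) g * R (\<alpha> i) y g) = - (\<Sum>i<n. R (\<alpha> i) (L w x) g * R (\<beta> i) y g)"
    by (rule rm_swap[OF bilin_prod[OF lin_L(2) lin_L(2)]])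
  have "pb \<omega> x (L w y) g + (\<Sum>i<n. L (\<alpha> i) x g * L (lbr G w (\<beta> i)) y g)
      = (\<Sum>i<n. L (\<alpha> i) x g * L w (L (\<beta> i) y) g) - (\<Sum>i<n. R (\<alpha> i) x g * R (\<beta> i) (L w y) g)"
    by (simp add: pb_eq L_lbr algebra_simps sum.distrib sum_subtractf)
  moreover have "pb \<omega> y (L w x) g + (\<Sum>i<n. L (\<alpha> i) y g * L (lbr G w (\<beta> i)) x g)
      = - (\<Sum>i<n. L w (L (\<alpha> i) x) g * L (\<beta> i) y g) + (\<Sum>i<n. R (\<alpha> i) (L w x) g * R (\<beta> i) y g)"
    using B1 B2 by (simp add: pb_eq L_lbr algebra_simps sum.distrib sum_subtractf)
  ultimately show ?thesis unfolding A by (simp add: sum.distrib sum_subtractf)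
qed

lemma compatible_gam: "compatible G \<omega> gam"
  unfolding compatible_def
proof (intro ballI ext)
  fix x y g us assume x: "x \<in> C" and y: "y \<in> C"
  note t = tilde_dual_funs[OF df_forms]
  show "df G (pb \<omega> x y) g us = (gam x (df G y) - gam y (df G x)) g us"
  proof (cases "length us = 1")
    case True
    then obtain u where us: "us = [u]" by (auto simp: length_Suc_conv)
    let ?w = "ltrans G (iv g) u"
    show ?thesis
    proof (cases "u \<in> T g")
      case True
      then have w: "?w \<in> LA" by (rule ltrans_inv_LA)
      have "u (pb \<omega> x y) = L ?w (pb \<omega> x y) g" by (simp add: L_def)
      then show ?thesis using us True L_pb[OF x y w, of g] \<beta>
        by (simp add: df_eq gam_app Gam_eq[OF t[OF x] w] Gam_eq[OF t[OF y] w] tilde_df w lbr_LA)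
    next
      case False
      then have "?w \<notin> LA" by (simp add: ltrans_inv_LA_iff)
      then show ?thesis using us False by (simp add: df_eq gam_app Gam_outside t x y)
    qed
  next
    case False
    then show ?thesis by (simp add: df_eq gam_app)
  qed
qed

lemma dual_bilinear_Xi: "dual_bilinear G Xi"
proof -
  have o: "ad_star G v \<psi> w = 0" if "w \<notin> LA" for v \<psi> w using that by (simp add: ad_star_def)
  have mem: "Xi \<phi> \<psi> \<in> dual LA" if d: "\<phi> \<in> dual LA" "\<psi> \<in> dual LA" for \<phi> \<psi>
  proof -
    have l: "lin e1 \<phi>" "lin e1 \<psi>" using d by (auto simp: dual_iff)
    have "lin e1 (\<lambda>w. \<Sum>i<n. \<phi> (\<alpha> i) * \<psi> (lbr G w (\<beta> i)))"
      by (intro lin_sum_fun lin_mult_const lin_lbr_left l \<beta>)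
    then have "lin e1 (Xi \<phi> \<psi>)" by (rule lin_cong) (simp add: Xi_eq l ad_star_def)
    then show ?thesis using Xi_eq[OF l] o by (simp add: dual_iff)
  qed
  have d_plus: "\<phi> + \<psi> \<in> dual LA" if "\<phi> \<in> dual LA" "\<psi> \<in> dual LA" for \<phi> \<psi>
    using that by (simp add: dual_iff plus_fun_def lin_add_fun)
  have d_sc: "sc c \<phi> \<in> dual LA" if "\<phi> \<in> dual LA" for c \<phi>
    using that by (simp add: dual_iff sc_def lin_mult_const)
  have X: "Xi \<phi> \<psi> = (\<lambda>w. \<Sum>i<n. \<phi> (\<alpha> i) * ad_star G (\<beta> i) \<psi> w)" if "\<phi> \<in> dual LA" "\<psi> \<in> dual LA" for \<phi> \<psi>
    using that Xi_eq by (auto simp: dual_iff)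
  have ad: "ad_star G v (\<phi> + \<psi>) w = ad_star G v \<phi> w + ad_star G v \<psi> w"
    "ad_star G v (sc c \<phi>) w = c * ad_star G v \<phi> w" for v \<phi> \<psi> w c
    by (simp_all add: ad_star_def sc_def)
  have "Xi (\<phi> + \<phi>') \<psi> = Xi \<phi> \<psi> + Xi \<phi>' \<psi>" "Xi \<psi> (\<phi> + \<phi>') = Xi \<psi> \<phi> + Xi \<psi> \<phi>'"
    if "\<phi> \<in> dual LA" "\<phi>' \<in> dual LA" "\<psi> \<in> dual LA" for \<phi> \<phi>' \<psi>
    using that d_plus by (auto simp: X ad fun_eq_iff algebra_simps sum.distrib)
  moreover have "Xi (sc c \<phi>) \<psi> = sc c (Xi \<phi> \<psi>)" "Xi \<psi> (sc c \<phi>) = sc c (Xi \<psi> \<phi>)"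
    if "\<phi> \<in> dual LA" "\<psi> \<in> dual LA" for \<phi> \<psi> c
    using that by (simp_all add: X d_sc ad) (simp_all add: sc_def fun_eq_iff sum_distrib_left mult_ac)
  ultimately show ?thesis
    unfolding dual_bilinear_def bilinear_over_def linear_over_def using mem by blast
qed

lemma left_inv_gam: "left_inv_by G \<omega> gam Xi"
  unfolding left_inv_by_def
proof (intro conjI ballI allI dual_bilinear_Xi)
  fix a s g assume a: "a \<in> C" and s: "s \<in> dual_funs G"
  have l: "lin e1 (L_hat G a g)"
    by (rule lin_cong[OF lin_ltrans(1)[of e1 g a]]) (simp add: L_hat_def)
  show "tilde_con G gam a s g = pb_vec \<omega> a s g + Xi (L_hat G a g) (s g)"
  proof
    fix w
    have "bilin LA (\<lambda>u v. ltrans G g u a * ad_star G v (s g) w)"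
      by (intro bilin_prod lin_ltrans lin_ad_star dual_funsD[OF s])
    from rm[OF this] have "r_minus r (\<lambda>u v. ltrans G g u a * ad_star G v (s g) w) = Xi (L_hat G a g) (s g) w"
      unfolding Xi_eq[OF l dual_funsD(2)[OF s]] using \<alpha> by (simp add: L_hat_def)
    then show "tilde_con G gam a s g w = (pb_vec \<omega> a s g + Xi (L_hat G a g) (s g)) w"
      by (simp add: tilde_con_gam[OF a s] Gam_def)
  qed
qed

text \<open>Differentiating \<open>h \<mapsto> t h w = s h (Ad h\<inverse> w)\<close> produces the derivative of \<open>s\<close> and that of the adjoint action.
  Along the left half of \<open>\<omega>\<close> the latter is the correction term in \<open>Gam\<close>; along the right half it is
  minus the correction term for \<open>R_hat\<close> and \<open>t\<close>.\<close>

lemma right_inv_gam: "right_inv_by G \<omega> gam Xi"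
  unfolding right_inv_by_def Let_def
proof (intro conjI ballI allI dual_bilinear_Xi)
  fix a s g assume a: "a \<in> C" and s: "s \<in> dual_funs G"
  define t where "t = (\<lambda>h. Ad_star G h (s h))"
  have t: "t h w = s h (Ad G (iv h) w)" for h w by (simp add: t_def Ad_star_def)
  have tl: "lin e1 (t h)" for h
    using Ad_lin[OF dual_funsD(2)[OF s]] by (simp add: t[abs_def])
  have l: "lin e1 (R_hat G a g)"
    by (rule lin_cong[OF lin_ltrans(2)[of e1 g a]]) (simp add: R_hat_def)
  have "Ad_star G g (Gam a s g) w = pb \<omega> a (\<lambda>h. t h w) g + Xi (R_hat G a g) (t g) w" for w
  proof (cases "w \<in> LA")
    case False
    then have "Ad G h w \<notin> LA" for h by (simp add: Ad_LA_iff)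
    then show ?thesis using False
      by (simp add: Ad_star_def Gam_outside[OF s] t dual_funsD(3)[OF s] pb_const Xi_eq[OF l tl] ad_star_def)
  next
    case w: True
    let ?W = "Ad G (iv g) w"
    have W: "?W \<in> LA" by (rule Ad_LA[OF w])
    obtain I :: "'e set" and f :: "'e \<Rightarrow> 'g \<Rightarrow> real" and E where fr: "finite I"
      "\<And>i. i \<in> I \<Longrightarrow> f i \<in> C" "\<And>i. i \<in> I \<Longrightarrow> E i \<in> LA"
      "\<And>v h. v \<in> LA \<Longrightarrow> v h = (\<Sum>i\<in>I. v (f i) * E i h)"
      "\<And>v \<xi>. v \<in> LA \<Longrightarrow> lin e1 \<xi> \<Longrightarrow> \<xi> v = (\<Sum>i\<in>I. v (f i) * \<xi> (E i))"
      by (rule lie_alg_frame_lin) blast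
    define c where "c i h = Ad G (iv h) w (f i)" for i h
    have c: "c i \<in> C" if "i \<in> I" for i unfolding c_def using Ad_smooth[OF w fr(2)[OF that]] .
    have sE: "(\<lambda>h. s h (E i)) \<in> C" for i by (rule dual_funsD(4)[OF s])
    have e: "s h (Ad G (iv k) w) = (\<Sum>i\<in>I. c i k * s h (E i))" for h k
      unfolding c_def by (rule fr(5)[OF Ad_LA[OF w] dual_funsD(2)[OF s]])
    have product: "pb \<omega> a (\<lambda>h. t h w) g = pb \<omega> a (\<lambda>h. s h ?W) g + pb \<omega> a (\<lambda>h. s g (Ad G (iv h) w)) g"
    proof -
      have "pb \<omega> a (\<lambda>h. t h w) g = (\<Sum>i\<in>I. c i g * pb \<omega> a (\<lambda>h. s h (E i)) g + pb \<omega> a (c i) g * s g (E i))"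
        unfolding t e by (subst pb_sum) (auto intro!: C_mult c sE sum.cong simp: pb_mult c sE)
      moreover have "pb \<omega> a (\<lambda>h. s h ?W) g = (\<Sum>i\<in>I. c i g * pb \<omega> a (\<lambda>h. s h (E i)) g)"
        unfolding e by (subst pb_sum) (auto intro!: C_cmult sE simp: pb_cmult sE)
      moreover have "pb \<omega> a (\<lambda>h. s g (Ad G (iv h) w)) g = (\<Sum>i\<in>I. pb \<omega> a (c i) g * s g (E i))"
      proof -
        have "pb \<omega> a (\<lambda>h. \<Sum>i\<in>I. s g (E i) * c i h) g = (\<Sum>i\<in>I. s g (E i) * pb \<omega> a (c i) g)"
          by (subst pb_sum) (auto intro!: C_cmult c simp: pb_cmult c)
        then show ?thesis unfolding e by (simp add: mult.commute)
      qed
      ultimately show ?thesis by (simp add: sum.distrib)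
    qed
    have "pb \<omega> a (\<lambda>h. s g (Ad G (iv h) w)) g =
        (\<Sum>i<n. L (\<alpha> i) a g * - s g (lbr G (\<beta> i) ?W) - R (\<alpha> i) a g * - t g (lbr G (\<beta> i) w))"
      unfolding pb_eq using Ad_derivatives(2,3)[OF \<beta> w dual_funsD(2)[OF s]] by (simp add: t)
    also have "\<dots> = (\<Sum>i<n. L (\<alpha> i) a g * s g (lbr G ?W (\<beta> i))) - (\<Sum>i<n. R (\<alpha> i) a g * t g (lbr G w (\<beta> i)))"
      using lin_lbr_anti[OF dual_funsD(2)[OF s] \<beta> W] lin_lbr_anti[OF tl \<beta> w]
      by (simp add: sum_subtractf sum_negf)
    moreover have "Xi (R_hat G a g) (t g) w = (\<Sum>i<n. R (\<alpha> i) a g * t g (lbr G w (\<beta> i)))"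
      unfolding Xi_eq[OF l tl] using w \<alpha> by (simp add: ad_star_def R_hat_def rtrans_R)
    ultimately show ?thesis
      using product Gam_eq[OF s W, of a g] by (simp add: Ad_star_def)
  qed
  then show "Ad_star G g (tilde_con G gam a s g) =
      pb_vec \<omega> a (\<lambda>h. Ad_star G h (s h)) g + Xi (R_hat G a g) (Ad_star G g (s g))"
    by (simp add: tilde_con_gam[OF a s] pb_vec_def fun_eq_iff t_def)
qed

end

section \<open>Curvature and the classical Yang-Baxter equation\<close>

lemma sum_swap_neg:
  fixes F H :: "'a \<Rightarrow> 'b \<Rightarrow> real"
  assumes "\<And>l. l \<in> B \<Longrightarrow> (\<Sum>k\<in>A. F k l) = - (\<Sum>k\<in>A. H k l)"
  shows "(\<Sum>k\<in>A. \<Sum>l\<in>B. F k l) = - (\<Sum>k\<in>A. \<Sum>l\<in>B. H k l)"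
proof -
  have "(\<Sum>k\<in>A. \<Sum>l\<in>B. F k l) = (\<Sum>l\<in>B. \<Sum>k\<in>A. F k l)" by (rule sum.swap)
  also have "\<dots> = - (\<Sum>l\<in>B. \<Sum>k\<in>A. H k l)" by (simp add: assms sum_negf)
  also have "(\<Sum>l\<in>B. \<Sum>k\<in>A. H k l) = (\<Sum>k\<in>A. \<Sum>l\<in>B. H k l)" by (rule sum.swap)
  finally show ?thesis .
qed

context lie
begin

definition trilin where
  "trilin X \<longleftrightarrow> (\<forall>x\<in>LA. bilin LA (X x)) \<and> (\<forall>y\<in>LA. bilin LA (\<lambda>x z. X x y z))"

lemma trilinD:
  assumes "trilin X" "a \<in> LA" "b \<in> LA"
  shows "lin e1 (\<lambda>x. X x a b)" "lin e1 (\<lambda>x. X a x b)" "lin e1 (\<lambda>x. X a b x)"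
  using assms unfolding trilin_def by (auto dest: bilinD)

lemma trilinI:
  assumes "\<And>a b. a \<in> LA \<Longrightarrow> b \<in> LA \<Longrightarrow> lin e1 (\<lambda>x. X x a b)"
    "\<And>a b. a \<in> LA \<Longrightarrow> b \<in> LA \<Longrightarrow> lin e1 (\<lambda>x. X a x b)"
    "\<And>a b. a \<in> LA \<Longrightarrow> b \<in> LA \<Longrightarrow> lin e1 (\<lambda>x. X a b x)"
  shows "trilin X"
  unfolding trilin_def using assms by (auto intro!: bilinI)

lemma trilin_prod: "lin e1 \<phi> \<Longrightarrow> lin e1 \<psi> \<Longrightarrow> lin e1 \<xi> \<Longrightarrow> trilin (\<lambda>a b c. \<phi> a * \<psi> b * \<xi> c)"
  by (intro trilinI) (simp_all add: lin_mult_const)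

end

context qt
begin

text \<open>The Yang-Baxter expression of \<open>r\<^sub>-\<close>, paired with a trilinear form.\<close>

definition yb where
  "yb X = (\<Sum>i<n. \<Sum>j<n. X (lbr G (\<alpha> j) (\<alpha> i)) (\<beta> j) (\<beta> i) + X (\<alpha> j) (lbr G (\<beta> j) (\<alpha> i)) (\<beta> i)
     + X (\<alpha> j) (\<alpha> i) (lbr G (\<beta> j) (\<beta> i)))"

lemma r_eq: "bilin LA B \<Longrightarrow> r B = (\<Sum>k<m. B (p k) (q k)) + (\<Sum>i<n. B (\<alpha> i) (\<beta> i))"
  using rp[of B] rm[of B] by (simp add: r_plus_def r_minus_def field_simps)

lemma r_r_eq:
  assumes F: "\<And>a b. a \<in> LA \<Longrightarrow> b \<in> LA \<Longrightarrow> bilin LA (F a b)"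
    and F': "\<And>c d. c \<in> LA \<Longrightarrow> d \<in> LA \<Longrightarrow> bilin LA (\<lambda>a b. F a b c d)"
  shows "r (\<lambda>a b. r (\<lambda>c d. F a b c d)) =
      (\<Sum>k<m. (\<Sum>l<m. F (p k) (q k) (p l) (q l)) + (\<Sum>i<n. F (p k) (q k) (\<alpha> i) (\<beta> i)))
    + (\<Sum>j<n. (\<Sum>l<m. F (\<alpha> j) (\<beta> j) (p l) (q l)) + (\<Sum>i<n. F (\<alpha> j) (\<beta> j) (\<alpha> i) (\<beta> i)))"
proof -
  let ?B = "\<lambda>a b. (\<Sum>l<m. F a b (p l) (q l)) + (\<Sum>i<n. F a b (\<alpha> i) (\<beta> i))"
  have e: "r (F a b) = ?B a b" if "a \<in> LA" "b \<in> LA" for a b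
    by (rule r_eq[OF F[OF that]])
  have "bilin LA ?B"
    by (intro bilinI lin_add_fun lin_sum_fun) (auto dest: bilinD[OF F'[OF pL qL]] bilinD[OF F'[OF \<alpha> \<beta>]])
  then have "bilin LA (\<lambda>a b. r (F a b))" by (rule bilin_cong) (simp add: e)
  then show ?thesis by (simp add: r_eq e pL qL \<alpha> \<beta>)
qed

lemma rp_invariant:
  assumes v: "v \<in> LA" and B: "bilin LA B"
  shows "(\<Sum>k<m. B (lbr G v (p k)) (q k)) = - (\<Sum>k<m. B (p k) (lbr G v (q k)))"
proof -
  have b1: "bilin LA (\<lambda>x y. B (lbr G v x) y)"
    by (rule bilinI) (auto intro: lin_lbr_right bilinD[OF B] v bilinD(2)[OF B lbr_LA[OF v]] lin_lbr_right[OF bilinD(1)[OF B]])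
  have b2: "bilin LA (\<lambda>x y. B x (lbr G v y))"
    by (rule bilinI) (auto intro: lin_lbr_right bilinD[OF B] v bilinD(1)[OF B lbr_LA[OF v]] lin_lbr_right[OF bilinD(2)[OF B]])
  have "ad_tens G v (r_plus r) B = 0"
    using qtr v B unfolding quasitriangular_def tens_eq_def by simp
  then show ?thesis using rp[OF b1] rp[OF b2] by (simp add: ad_tens_def)
qed

text \<open>In the Yang-Baxter equation for \<open>r = r\<^sub>+ + r\<^sub>-\<close> invariance of \<open>r\<^sub>+\<close> cancels the mixed terms
  and two of the three terms that are quadratic in \<open>r\<^sub>+\<close>.\<close>

lemma yb_symmetric_part:
  assumes X: "trilin X"
  shows "yb X = - (\<Sum>k<m. \<Sum>l<m. X (p k) (p l) (lbr G (q k) (q l)))"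
proof -
  note [simp] = lbr_LA \<alpha> \<beta> pL qL
  note l1 = trilinD(1)[OF X] and l2 = trilinD(2)[OF X] and l3 = trilinD(3)[OF X]
  have cy: "r (\<lambda>a b. r (\<lambda>c d. X (lbr G a c) b d)) + r (\<lambda>a b. r (\<lambda>c d. X a (lbr G b c) d)) +
       r (\<lambda>a b. r (\<lambda>c d. X a c (lbr G b d))) = 0"
    using qtr X unfolding quasitriangular_def cybe_def trilin_def by blast
  have s1: "r (\<lambda>a b. r (\<lambda>c d. X (lbr G a c) b d)) =
      (\<Sum>k<m. (\<Sum>l<m. X (lbr G (p k) (p l)) (q k) (q l)) + (\<Sum>i<n. X (lbr G (p k) (\<alpha> i)) (q k) (\<beta> i)))
    + (\<Sum>j<n. (\<Sum>l<m. X (lbr G (\<alpha> j) (p l)) (\<beta> j) (q l)) + (\<Sum>i<n. X (lbr G (\<alpha> j) (\<alpha> i)) (\<beta> j) (\<beta> i)))"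
    by (rule r_r_eq; rule bilinI; simp add: l2 l3 lin_lbr_left[OF l1] lin_lbr_right[OF l1])
  have s2: "r (\<lambda>a b. r (\<lambda>c d. X a (lbr G b c) d)) =
      (\<Sum>k<m. (\<Sum>l<m. X (p k) (lbr G (q k) (p l)) (q l)) + (\<Sum>i<n. X (p k) (lbr G (q k) (\<alpha> i)) (\<beta> i)))
    + (\<Sum>j<n. (\<Sum>l<m. X (\<alpha> j) (lbr G (\<beta> j) (p l)) (q l)) + (\<Sum>i<n. X (\<alpha> j) (lbr G (\<beta> j) (\<alpha> i)) (\<beta> i)))"
    by (rule r_r_eq; rule bilinI; simp add: l1 l3 lin_lbr_left[OF l2] lin_lbr_right[OF l2])
  have s3: "r (\<lambda>a b. r (\<lambda>c d. X a c (lbr G b d))) =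
      (\<Sum>k<m. (\<Sum>l<m. X (p k) (p l) (lbr G (q k) (q l))) + (\<Sum>i<n. X (p k) (\<alpha> i) (lbr G (q k) (\<beta> i))))
    + (\<Sum>j<n. (\<Sum>l<m. X (\<alpha> j) (p l) (lbr G (\<beta> j) (q l))) + (\<Sum>i<n. X (\<alpha> j) (\<alpha> i) (lbr G (\<beta> j) (\<beta> i))))"
    by (rule r_r_eq; rule bilinI; simp add: l1 l2 lin_lbr_left[OF l3] lin_lbr_right[OF l3])
  \<comment> \<open>invariance of \<open>r\<^sub>+\<close> moves a bracket from one of its legs to the other; the indices name the
    slots of \<open>X\<close> that are occupied by these legs\<close>
  have inv12: "(\<Sum>k<m. X (lbr G (p k) c) (q k) d) = - (\<Sum>k<m. X (p k) (lbr G (q k) c) d)"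
    if cd: "c \<in> LA" "d \<in> LA" for c d
  proof -
    have "bilin LA (\<lambda>x y. X x y d)" by (rule bilinI) (simp_all add: l1 l2 cd)
    from rp_invariant[OF cd(1) this] show ?thesis
      using lin_lbr_anti[OF l1 _ cd(1)] lin_lbr_anti[OF l2 _ cd(1)] cd by (simp add: sum_negf)
  qed
  have inv23: "(\<Sum>l<m. X a (lbr G b (p l)) (q l)) = - (\<Sum>l<m. X a (p l) (lbr G b (q l)))"
    if ab: "a \<in> LA" "b \<in> LA" for a b
    by (rule rp_invariant[OF ab(2)], rule bilinI) (simp_all add: l2 l3 ab)
  have inv13: "(\<Sum>k<m. X (p k) a (lbr G (q k) b)) = - (\<Sum>k<m. X (lbr G (p k) b) a (q k))"
    if ab: "a \<in> LA" "b \<in> LA" for a b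
  proof -
    have "bilin LA (\<lambda>x y. X x a y)" by (rule bilinI) (simp_all add: l1 l3 ab)
    from rp_invariant[OF ab(2) this] show ?thesis
      using lin_lbr_anti[OF l1 _ ab(2)] lin_lbr_anti[OF l3 _ ab(2)] ab by (simp add: sum_negf)
  qed
  have pp: "(\<Sum>k<m. \<Sum>l<m. X (lbr G (p k) (p l)) (q k) (q l)) = - (\<Sum>k<m. \<Sum>l<m. X (p k) (lbr G (q k) (p l)) (q l))"
    by (rule sum_swap_neg, rule inv12) simp_all
  have pm: "(\<Sum>k<m. \<Sum>i<n. X (lbr G (p k) (\<alpha> i)) (q k) (\<beta> i)) = - (\<Sum>k<m. \<Sum>i<n. X (p k) (lbr G (q k) (\<alpha> i)) (\<beta> i))"
    by (rule sum_swap_neg, rule inv12) simp_all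
  have mp: "(\<Sum>j<n. \<Sum>l<m. X (\<alpha> j) (lbr G (\<beta> j) (p l)) (q l)) = - (\<Sum>j<n. \<Sum>l<m. X (\<alpha> j) (p l) (lbr G (\<beta> j) (q l)))"
    by (simp only: inv23[OF \<alpha> \<beta>] sum_negf)
  have mix: "(\<Sum>k<m. \<Sum>i<n. X (p k) (\<alpha> i) (lbr G (q k) (\<beta> i))) = - (\<Sum>j<n. \<Sum>l<m. X (lbr G (\<alpha> j) (p l)) (\<beta> j) (q l))"
  proof -
    have "(\<Sum>k<m. \<Sum>i<n. X (p k) (\<alpha> i) (lbr G (q k) (\<beta> i))) = - (\<Sum>k<m. \<Sum>i<n. X (lbr G (p k) (\<beta> i)) (\<alpha> i) (q k))"
      by (rule sum_swap_neg, rule inv13) simp_all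
    also have "\<dots> = (\<Sum>k<m. \<Sum>i<n. X (lbr G (\<beta> i) (p k)) (\<alpha> i) (q k))"
      by (simp only: lin_lbr_anti[OF l1[OF \<alpha> qL] pL \<beta>] sum_negf)
    also have "\<dots> = (\<Sum>k<m. - (\<Sum>i<n. X (lbr G (\<alpha> i) (p k)) (\<beta> i) (q k)))"
    proof (rule sum.cong[OF refl])
      fix k
      have "bilin LA (\<lambda>u v. X (lbr G u (p k)) v (q k))"
        by (rule bilinI) (simp_all add: lin_lbr_left[OF l1] l2)
      from rm_swap[OF this] show "(\<Sum>i<n. X (lbr G (\<beta> i) (p k)) (\<alpha> i) (q k)) = - (\<Sum>i<n. X (lbr G (\<alpha> i) (p k)) (\<beta> i) (q k))" .
    qed
    also have "\<dots> = - (\<Sum>j<n. \<Sum>l<m. X (lbr G (\<alpha> j) (p l)) (\<beta> j) (q l))"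
      by (subst sum.swap) (simp add: sum_negf)
    finally show ?thesis .
  qed
  have "yb X = (\<Sum>j<n. \<Sum>i<n. X (lbr G (\<alpha> j) (\<alpha> i)) (\<beta> j) (\<beta> i))
      + (\<Sum>j<n. \<Sum>i<n. X (\<alpha> j) (lbr G (\<beta> j) (\<alpha> i)) (\<beta> i)) + (\<Sum>j<n. \<Sum>i<n. X (\<alpha> j) (\<alpha> i) (lbr G (\<beta> j) (\<beta> i)))"
    unfolding yb_def by (subst sum.swap) (simp add: sum.distrib)
  then show ?thesis using cy pp pm mp mix unfolding s1 s2 s3 by (simp add: sum.distrib)
qed

text \<open>The derivative terms cancel by the Jacobi identity and compatibility; what remains is tensorial.\<close>

lemma curvature_Gam:
  assumes x: "x \<in> C" and y: "y \<in> C" and s: "s \<in> dual_funs G" and w: "w \<in> LA"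
  shows "Gam x (Gam y s) g w - Gam y (Gam x s) g w - Gam (pb \<omega> x y) s g w =
    yb (\<lambda>a b c. L a x g * L b y g * s g (lbr G w c))"
proof -
  note [simp] = lbr_LA \<alpha> \<beta> w
  note ls = dual_funsD(2)[OF s]
  have sC: "(\<lambda>h. s h v) \<in> C" for v by (rule dual_funsD(4)[OF s])
  have twice: "Gam x (Gam y s) g w = pb \<omega> x (pb \<omega> y (\<lambda>h. s h w)) g
      + (\<Sum>i<n. L (\<alpha> i) y g * pb \<omega> x (\<lambda>h. s h (lbr G w (\<beta> i))) g
            + pb \<omega> x (L (\<alpha> i) y) g * s g (lbr G w (\<beta> i)))
      + (\<Sum>i<n. L (\<alpha> i) x g * pb \<omega> y (\<lambda>h. s h (lbr G w (\<beta> i))) g)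
      + (\<Sum>j<n. \<Sum>i<n. L (\<alpha> j) x g * L (\<alpha> i) y g * s g (lbr G (lbr G w (\<beta> j)) (\<beta> i)))"
    if x: "x \<in> C" and y: "y \<in> C" for x y
  proof -
    have Ly: "L (\<alpha> i) y \<in> C" for i using L_smooth y \<alpha> by blast
    have t: "(\<lambda>h. L (\<alpha> i) y h * s h v) \<in> C" for i v by (rule C_mult[OF Ly sC])
    have "(\<lambda>h. Gam y s h w) = (\<lambda>h. pb \<omega> y (\<lambda>h. s h w) h + (\<Sum>i<n. L (\<alpha> i) y h * s h (lbr G w (\<beta> i))))"
      using Gam_eq[OF s w] by blast
    then have "pb \<omega> x (\<lambda>h. Gam y s h w) g =
        pb \<omega> x (\<lambda>h. pb \<omega> y (\<lambda>h. s h w) h + (\<Sum>i<n. L (\<alpha> i) y h * s h (lbr G w (\<beta> i)))) g"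
      by (rule arg_cong)
    also have "\<dots> = pb \<omega> x (pb \<omega> y (\<lambda>h. s h w)) g
        + pb \<omega> x (\<lambda>h. \<Sum>i<n. L (\<alpha> i) y h * s h (lbr G w (\<beta> i))) g"
      by (rule pb_add[OF pb_smooth[OF y sC] C_sum[OF t]])
    also have "pb \<omega> x (\<lambda>h. \<Sum>i<n. L (\<alpha> i) y h * s h (lbr G w (\<beta> i))) g
        = (\<Sum>i<n. pb \<omega> x (\<lambda>h. L (\<alpha> i) y h * s h (lbr G w (\<beta> i))) g)"
      by (rule pb_sum[OF t])
    finally have "pb \<omega> x (\<lambda>h. Gam y s h w) g = pb \<omega> x (pb \<omega> y (\<lambda>h. s h w)) g
        + (\<Sum>i<n. pb \<omega> x (\<lambda>h. L (\<alpha> i) y h * s h (lbr G w (\<beta> i))) g)" .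
    then show ?thesis
      unfolding Gam_eq[OF Gam_dual_funs[OF y s] w]
      by (simp add: Gam_eq[OF s] pb_mult[OF Ly sC] distrib_left sum.distrib sum_distrib_left mult.assoc)
  qed
  have br: "Gam (pb \<omega> x y) s g w = pb \<omega> (pb \<omega> x y) (\<lambda>h. s h w) g
      + (\<Sum>i<n. L (\<alpha> i) (pb \<omega> x y) g * s g (lbr G w (\<beta> i)))"
    by (rule Gam_eq[OF s w])
  have jac: "pb \<omega> x (pb \<omega> y (\<lambda>h. s h w)) g - pb \<omega> y (pb \<omega> x (\<lambda>h. s h w)) g - pb \<omega> (pb \<omega> x y) (\<lambda>h. s h w) g = 0"
  proof -
    have "(\<lambda>h. pb \<omega> (\<lambda>h. s h w) x h) = (\<lambda>h. (-1) * pb \<omega> x (\<lambda>h. s h w) h)" using pb_anti[of "\<lambda>h. s h w" x] by simp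
    then have "pb \<omega> y (pb \<omega> (\<lambda>h. s h w) x) g = - pb \<omega> y (pb \<omega> x (\<lambda>h. s h w)) g"
      using pb_cmult[OF pb_smooth[OF x sC], of y "-1"] by simp
    then show ?thesis using pb_jacobi[OF x y sC, of w g] pb_anti[of "\<lambda>h. s h w" "pb \<omega> x y" g] by simp
  qed
  let ?\<phi> = "\<lambda>a. L a x g" and ?\<psi> = "\<lambda>b. L b y g" and ?\<xi> = "\<lambda>c. s g (lbr G w c)"
  have l\<xi>: "lin e1 ?\<xi>" by (rule lin_lbr_right[OF ls w])
  have E0: "Gam x (Gam y s) g w - Gam y (Gam x s) g w - Gam (pb \<omega> x y) s g w =
      (\<Sum>i<n. (pb \<omega> x (L (\<alpha> i) y) g - pb \<omega> y (L (\<alpha> i) x) g - L (\<alpha> i) (pb \<omega> x y) g) * ?\<xi> (\<beta> i))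
    + (\<Sum>j<n. \<Sum>i<n. ?\<phi> (\<alpha> j) * ?\<psi> (\<alpha> i) * s g (lbr G (lbr G w (\<beta> j)) (\<beta> i)))
    - (\<Sum>j<n. \<Sum>i<n. ?\<psi> (\<alpha> j) * ?\<phi> (\<alpha> i) * s g (lbr G (lbr G w (\<beta> j)) (\<beta> i)))"
    using jac unfolding twice[OF x y] twice[OF y x] br
    by (simp add: sum.distrib sum_subtractf algebra_simps)
  have E1: "(\<Sum>i<n. (pb \<omega> x (L (\<alpha> i) y) g - pb \<omega> y (L (\<alpha> i) x) g - L (\<alpha> i) (pb \<omega> x y) g) * ?\<xi> (\<beta> i))
      = (\<Sum>i<n. \<Sum>j<n. ?\<phi> (\<alpha> j) * ?\<psi> (lbr G (\<beta> j) (\<alpha> i)) * ?\<xi> (\<beta> i))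
      + (\<Sum>i<n. \<Sum>j<n. ?\<phi> (lbr G (\<alpha> j) (\<alpha> i)) * ?\<psi> (\<beta> j) * ?\<xi> (\<beta> i))"
  proof -
    have "pb \<omega> x (L (\<alpha> i) y) g - pb \<omega> y (L (\<alpha> i) x) g - L (\<alpha> i) (pb \<omega> x y) g
      = (\<Sum>j<n. ?\<phi> (\<alpha> j) * ?\<psi> (lbr G (\<beta> j) (\<alpha> i))) + (\<Sum>j<n. ?\<phi> (lbr G (\<alpha> j) (\<alpha> i)) * ?\<psi> (\<beta> j))" for i
    proof -
      have "(\<Sum>j<n. ?\<phi> (lbr G (\<beta> j) (\<alpha> i)) * ?\<psi> (\<alpha> j)) = - (\<Sum>j<n. ?\<phi> (lbr G (\<alpha> j) (\<alpha> i)) * ?\<psi> (\<beta> j))"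
        by (rule rm_swap[OF bilin_prod[OF lin_lbr_left[OF lin_L(1) \<alpha>] lin_L(1)]])
      then show ?thesis
        using lin_lbr_anti[OF lin_L(1) \<beta> \<alpha>] unfolding L_pb[OF x y \<alpha>]
        by (simp add: sum_negf mult.commute)
    qed
    then show ?thesis by (simp add: sum_distrib_right distrib_right sum.distrib)
  qed
  have E2: "(\<Sum>j<n. \<Sum>i<n. ?\<phi> (\<alpha> j) * ?\<psi> (\<alpha> i) * s g (lbr G (lbr G w (\<beta> j)) (\<beta> i)))
    - (\<Sum>j<n. \<Sum>i<n. ?\<psi> (\<alpha> j) * ?\<phi> (\<alpha> i) * s g (lbr G (lbr G w (\<beta> j)) (\<beta> i)))
    = (\<Sum>i<n. \<Sum>j<n. ?\<phi> (\<alpha> j) * ?\<psi> (\<alpha> i) * ?\<xi> (lbr G (\<beta> j) (\<beta> i)))"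
  proof -
    have "(\<Sum>j<n. \<Sum>i<n. ?\<psi> (\<alpha> j) * ?\<phi> (\<alpha> i) * s g (lbr G (lbr G w (\<beta> j)) (\<beta> i)))
      = (\<Sum>j<n. \<Sum>i<n. ?\<phi> (\<alpha> j) * ?\<psi> (\<alpha> i) * s g (lbr G (lbr G w (\<beta> i)) (\<beta> j)))"
      by (subst sum.swap) (simp add: mult.commute)
    then have "(\<Sum>j<n. \<Sum>i<n. ?\<phi> (\<alpha> j) * ?\<psi> (\<alpha> i) * s g (lbr G (lbr G w (\<beta> j)) (\<beta> i)))
      - (\<Sum>j<n. \<Sum>i<n. ?\<psi> (\<alpha> j) * ?\<phi> (\<alpha> i) * s g (lbr G (lbr G w (\<beta> j)) (\<beta> i)))
      = (\<Sum>j<n. \<Sum>i<n. ?\<phi> (\<alpha> j) * ?\<psi> (\<alpha> i) *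
          (s g (lbr G (lbr G w (\<beta> j)) (\<beta> i)) - s g (lbr G (lbr G w (\<beta> i)) (\<beta> j))))"
      by (simp add: sum_subtractf right_diff_distrib)
    then show ?thesis using lbr_jacobi[OF w \<beta> \<beta> ls] by (subst sum.swap) simp
  qed
  show ?thesis unfolding E0 E1 yb_def using E2 by (simp add: sum.distrib)
qed

lemma curvature_gam:
  assumes x: "x \<in> C" and y: "y \<in> C" and \<tau>: "\<tau> \<in> forms G 1"
  shows "tilde G (curvature \<omega> gam x y \<tau>) g w =
    (if w \<in> LA then yb (\<lambda>a b c. L a x g * L b y g * tilde G \<tau> g (lbr G w c)) else 0)"
    and "curvature \<omega> gam x y \<tau> \<in> forms G 1"
proof -
  note f = gam_forms[OF x gam_forms[OF y \<tau>]] gam_forms[OF y gam_forms[OF x \<tau>]] gam_forms[OF pb_smooth[OF x y] \<tau>]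
  show "curvature \<omega> gam x y \<tau> \<in> forms G 1" unfolding curvature_def by (intro forms_minus f)
  show "tilde G (curvature \<omega> gam x y \<tau>) g w =
    (if w \<in> LA then yb (\<lambda>a b c. L a x g * L b y g * tilde G \<tau> g (lbr G w c)) else 0)"
  proof (cases "w \<in> LA")
    case True
    have "tilde G (curvature \<omega> gam x y \<tau>) g w =
        tilde G (gam x (gam y \<tau>)) g w - tilde G (gam y (gam x \<tau>)) g w - tilde G (gam (pb \<omega> x y) \<tau>) g w"
      using True by (simp add: curvature_def tilde_def)
    then show ?thesis
      using True curvature_Gam[OF x y tilde_dual_funs[OF \<tau>] True]
      by (simp only: tilde_gam[OF x gam_forms[OF y \<tau>]] tilde_gam[OF y gam_forms[OF x \<tau>]]
          tilde_gam[OF pb_smooth[OF x y] \<tau>] tilde_gam[OF x \<tau>] tilde_gam[OF y \<tau>] if_True)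
  qed (simp add: tilde_def)
qed

lemma trilin_curvature:
  "s \<in> dual_funs G \<Longrightarrow> w \<in> LA \<Longrightarrow> trilin (\<lambda>a b c. L a x g * L b y g * s g (lbr G w c))"
  by (intro trilin_prod lin_L lin_lbr_right dual_funsD)

lemma triangular_yb:
  assumes "triangular G r" and X: "trilin X"
  shows "yb X = 0"
proof -
  have "(\<Sum>k<m. X (p k) (p l) (lbr G (q k) (q l))) = 0" for l
  proof -
    have b: "bilin LA (\<lambda>u v. X u (p l) (lbr G v (q l)))"
      by (rule bilinI) (simp_all add: trilinD(1)[OF X pL] lbr_LA qL lin_lbr_left[OF trilinD(3)[OF X _ pL] qL])
    from rp[OF b] show ?thesis using assms(1) b unfolding triangular_def tens_eq_def by simp
  qed
  then show ?thesis unfolding yb_symmetric_part[OF X] by (subst sum.swap) simp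
qed

lemma triangular_flat:
  assumes "triangular G r" and x: "x \<in> C" and y: "y \<in> C" and \<tau>: "\<tau> \<in> forms G 1"
  shows "curvature \<omega> gam x y \<tau> = 0"
proof -
  have "tilde G (curvature \<omega> gam x y \<tau>) = (\<lambda>g w. 0)"
    using triangular_yb[OF assms(1) trilin_curvature[OF tilde_dual_funs[OF \<tau>]]]
    by (simp add: curvature_gam[OF x y \<tau>] fun_eq_iff)
  then have "untilde G (tilde G (curvature \<omega> gam x y \<tau>)) = untilde G (\<lambda>g w. 0)" by simp
  then show ?thesis
    unfolding untilde_tilde[OF curvature_gam(2)[OF x y \<tau>]] by (simp add: untilde_def fun_eq_iff)
qed

end

context lie
begin

text \<open>The derived series of an abelian ideal is zero after one step.\<close>

lemma abelian_ideal_zero: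
  assumes ss: "lie_semisimple G" and I: "lie_ideal G I" and ab: "\<And>v w. v \<in> I \<Longrightarrow> w \<in> I \<Longrightarrow> lbr G v w = 0"
  shows "I = {0}"
proof -
  have z: "0 \<in> I" using I unfolding lie_ideal_def fun_subspace_def by blast
  have "{lbr G v w | v w. v \<in> I \<and> w \<in> I} = {0}"
  proof (intro equalityI subsetI)
    fix x :: "'g tvec" assume "x \<in> {0}"
    then have "x = lbr G 0 0" using ab[OF z z] by simp
    then show "x \<in> {lbr G v w | v w. v \<in> I \<and> w \<in> I}" using z by blast
  qed (auto simp: ab)
  moreover have "fun_subspace hull {0 :: 'g tvec} = {0}"
    by (rule hull_unique) (auto simp: fun_subspace_def sc_def)
  ultimately have "derived_series G I (Suc 0) = {0}" by simp
  then show ?thesis using ss I unfolding lie_semisimple_def by blast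
qed

text \<open>The centre is an abelian ideal.\<close>

lemma semisimple_center:
  assumes ss: "lie_semisimple G" and z: "z \<in> LA" and c: "\<And>w. w \<in> LA \<Longrightarrow> lbr G w z = 0"
  shows "z = 0"
proof -
  define Z where "Z = {z \<in> LA. \<forall>w\<in>LA. lbr G w z = 0}"
  have lz: "lbr G w z f = 0" if "z \<in> Z" "w \<in> LA" for w z f using that by (simp add: Z_def)
  have Zf: "z \<in> Z" if "z \<in> LA" "\<And>w f. w \<in> LA \<Longrightarrow> lbr G w z f = 0" for z
    using that by (simp add: Z_def fun_eq_iff)
  have ZLA: "z \<in> LA" if "z \<in> Z" for z using that by (simp add: Z_def)
  have "fun_subspace Z"
    unfolding fun_subspace_def
  proof (intro conjI ballI allI)
    show "0 \<in> Z"
      by (rule Zf) (use T_zero[of e1] lin_zero[OF lin_lbr_right[OF lin_eval]] in \<open>auto simp: zero_fun_def\<close>)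
    fix u and c :: real assume u: "u \<in> Z"
    show "sc c u \<in> Z"
      by (rule Zf) (use T_scale[OF ZLA[OF u]] lin_scale[OF lin_lbr_right[OF lin_eval] ZLA[OF u]] lz[OF u] in \<open>auto simp: sc_def\<close>)
    fix v assume v: "v \<in> Z"
    show "u + v \<in> Z"
      by (rule Zf) (use T_plus[OF ZLA[OF u] ZLA[OF v]] lin_add[OF lin_lbr_right[OF lin_eval] ZLA[OF u] ZLA[OF v]]
          lz[OF u] lz[OF v] in \<open>auto simp: plus_fun_def\<close>)
  qed
  moreover have "lbr G v w \<in> Z" if "v \<in> LA" "w \<in> Z" for v w
    using that \<open>fun_subspace Z\<close> by (simp add: Z_def fun_subspace_def)
  ultimately have "lie_ideal G Z" unfolding lie_ideal_def using ZLA by blast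
  moreover have "lbr G v w = 0" if "v \<in> Z" "w \<in> Z" for v w using that by (simp add: Z_def)
  ultimately have "Z = {0}" by (rule abelian_ideal_zero[OF ss])
  then show ?thesis using z c by (auto simp: Z_def)
qed

end

context qt
begin

text \<open>\<open>rplus_map\<close> is \<open>r\<^sub>+\<close> regarded as a map from the dual of the Lie algebra. It is equivariant, so its
  image is an ideal; if the curvature vanishes, brackets of elements of the image are central, hence
  zero, so that the image is an abelian ideal.\<close>

definition rplus_map where "rplus_map \<phi> = (\<lambda>f. \<Sum>k<m. \<phi> (p k) * q k f)"

lemma rplus_map_LA: "rplus_map \<phi> \<in> LA"
  unfolding rplus_map_def by (rule T_combination[OF qL])

lemma flat_triangular:
  assumes ss: "lie_semisimple G"
    and flat: "\<forall>x\<in>C. \<forall>y\<in>C. \<forall>\<tau>\<in>forms G 1. curvature \<omega> gam x y \<tau> = 0"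
  shows "triangular G r"
proof -
  obtain I :: "'e set" and f :: "'e \<Rightarrow> 'g \<Rightarrow> real" and E where fr: "finite I"
    "\<And>i. i \<in> I \<Longrightarrow> f i \<in> C" "\<And>i. i \<in> I \<Longrightarrow> E i \<in> LA"
    "\<And>v h. v \<in> LA \<Longrightarrow> v h = (\<Sum>i\<in>I. v (f i) * E i h)"
    "\<And>v \<xi>. v \<in> LA \<Longrightarrow> lin e1 \<xi> \<Longrightarrow> \<xi> v = (\<Sum>i\<in>I. v (f i) * \<xi> (E i))"
    by (rule lie_alg_frame_lin) blast
  have yb0: "yb (\<lambda>a b c. \<phi> a * \<psi> b * lbr G w c h) = 0"
    if l: "lin e1 \<phi>" "lin e1 \<psi>" and w: "w \<in> LA" for \<phi> \<psi> w h
  proof -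
    have real: "\<exists>x\<in>C. \<forall>v\<in>LA. L v x e1 = \<phi> v" if l: "lin e1 \<phi>" for \<phi>
    proof -
      let ?x = "\<lambda>g. \<Sum>i\<in>I. \<phi> (E i) * f i g"
      have "L v ?x e1 = \<phi> v" if v: "v \<in> LA" for v
      proof -
        have "v ?x = (\<Sum>i\<in>I. v (\<lambda>g. \<phi> (E i) * f i g))" by (rule T_sum[OF v C_cmult[OF fr(2)]])
        then show ?thesis using T_cmult[OF v fr(2)] fr(5)[OF v l] by (simp add: L_one mult.commute)
      qed
      moreover have "?x \<in> C" by (intro C_sum C_cmult fr(2))
      ultimately show ?thesis by blast
    qed
    obtain x where x: "x \<in> C" "\<And>v. v \<in> LA \<Longrightarrow> L v x e1 = \<phi> v" using real[OF l(1)] by auto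
    obtain y where y: "y \<in> C" "\<And>v. v \<in> LA \<Longrightarrow> L v y e1 = \<psi> v" using real[OF l(2)] by auto
    define s where "s = (\<lambda>(g::'g) v. if v \<in> LA then v h else 0)"
    have s: "s \<in> dual_funs G"
      by (rule dual_funsI) (auto simp: s_def intro: lin_cong[OF lin_eval])
    have "tilde G (curvature \<omega> gam x y (untilde G s)) e1 w = 0"
      using flat x(1) y(1) untilde_forms[OF s] by (simp add: tilde_def)
    then show ?thesis
      unfolding curvature_gam(1)[OF x(1) y(1) untilde_forms[OF s]] tilde_untilde[OF s]
      using w by (simp add: yb_def x(2) y(2) s_def lbr_LA \<alpha> \<beta>)
  qed
  have central: "lbr G w (lbr G (rplus_map \<phi>) (rplus_map \<psi>)) h = 0"
    if l: "lin e1 \<phi>" "lin e1 \<psi>" and w: "w \<in> LA" for \<phi> \<psi> w h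
  proof -
    have l3: "lin e1 (\<lambda>c. lbr G w c h)" by (rule lin_lbr_right[OF lin_eval w])
    have "lbr G w (lbr G (rplus_map \<phi>) (rplus_map \<psi>)) h =
        (\<Sum>k<m. \<phi> (p k) * lbr G w (lbr G (q k) (rplus_map \<psi>)) h)"
      unfolding rplus_map_def[of \<phi>] by (rule lin_sum[OF lin_lbr_left[OF l3 rplus_map_LA] qL])
    also have "\<dots> = (\<Sum>k<m. \<phi> (p k) * (\<Sum>l<m. \<psi> (p l) * lbr G w (lbr G (q k) (q l)) h))"
      unfolding rplus_map_def[of \<psi>] by (subst lin_sum[OF lin_lbr_right[OF l3 qL] qL]) simp
    also have "\<dots> = - yb (\<lambda>a b c. \<phi> a * \<psi> b * lbr G w c h)"
      unfolding yb_symmetric_part[OF trilin_prod[OF l l3]] by (simp add: sum_distrib_left mult.assoc)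
    finally show ?thesis using yb0[OF l w] by simp
  qed
  define J where "J = rplus_map ` dual LA"
  have abel: "lbr G v w = 0" if vw: "v \<in> J" "w \<in> J" for v w
  proof -
    obtain \<phi> where \<phi>: "v = rplus_map \<phi>" "lin e1 \<phi>" using vw(1) by (auto simp: J_def dual_iff)
    obtain \<psi> where \<psi>: "w = rplus_map \<psi>" "lin e1 \<psi>" using vw(2) by (auto simp: J_def dual_iff)
    show ?thesis
      unfolding \<phi>(1) \<psi>(1)
    proof (rule semisimple_center[OF ss lbr_LA[OF rplus_map_LA rplus_map_LA]])
      fix z assume "z \<in> LA"
      then show "lbr G z (lbr G (rplus_map \<phi>) (rplus_map \<psi>)) = 0"
        using central[OF \<phi>(2) \<psi>(2)] by (simp add: fun_eq_iff)
    qed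
  qed
  have "lie_ideal G J"
    unfolding lie_ideal_def fun_subspace_def
  proof (intro conjI ballI allI)
    show "J \<subseteq> LA" using rplus_map_LA by (auto simp: J_def)
    have "(\<lambda>u. 0) \<in> dual LA" by (simp add: dual_iff lin_zero_fun)
    then show "0 \<in> J" unfolding J_def by (intro image_eqI[of _ _ "\<lambda>u. 0"]) (simp_all add: rplus_map_def fun_eq_iff)
    fix u assume "u \<in> J"
    then obtain \<phi> where \<phi>: "\<phi> \<in> dual LA" "u = rplus_map \<phi>" by (auto simp: J_def)
    have l: "lin e1 \<phi>" using \<phi> by (simp add: dual_iff)
    show "sc c u \<in> J" for c
      unfolding J_def using \<phi>
      by (intro image_eqI[of _ _ "\<lambda>u. c * \<phi> u"])
         (auto simp: rplus_map_def sc_def fun_eq_iff sum_distrib_left mult.assoc dual_iff lin_mult_const)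
    show "u + v \<in> J" if vJ: "v \<in> J" for v
    proof -
      obtain \<psi> where \<psi>: "\<psi> \<in> dual LA" "v = rplus_map \<psi>" using vJ by (auto simp: J_def)
      show ?thesis
        unfolding J_def using \<phi> \<psi>
        by (intro image_eqI[of _ _ "\<lambda>u. \<phi> u + \<psi> u"])
           (auto simp: rplus_map_def fun_eq_iff distrib_right sum.distrib dual_iff lin_add_fun)
    qed
    show "lbr G v u \<in> J" if v: "v \<in> LA" for v
    proof -
      define \<phi>' where "\<phi>' = (\<lambda>u. if u \<in> LA then - \<phi> (lbr G v u) else 0)"
      have "lin e1 (\<lambda>u. (-1) * \<phi> (lbr G v u))" by (intro lin_mult_const lin_lbr_right l v)
      then have "lin e1 \<phi>'" by (rule lin_cong) (simp add: \<phi>'_def)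
      then have d: "\<phi>' \<in> dual LA" by (simp add: dual_iff \<phi>'_def)
      have "lbr G v u = rplus_map \<phi>'"
      proof
        fix h
        have "lbr G v u h = (\<Sum>k<m. \<phi> (p k) * lbr G v (q k) h)"
          unfolding \<phi>(2) rplus_map_def by (rule lin_sum[OF lin_lbr_right[OF lin_eval v] qL])
        also have "\<dots> = - (\<Sum>k<m. \<phi> (lbr G v (p k)) * q k h)"
          using rp_invariant[OF v bilin_prod[OF l lin_eval[of e1 h]]] by simp
        also have "\<dots> = rplus_map \<phi>' h" by (simp add: rplus_map_def \<phi>'_def pL sum_negf)
        finally show "lbr G v u h = rplus_map \<phi>' h" .
      qed
      then show ?thesis using d by (simp add: J_def)
    qed
  qed
  then have J0: "J = {0}" using abelian_ideal_zero[OF ss] abel by blast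
  show ?thesis
    unfolding triangular_def tens_eq_def
  proof (intro allI impI)
    fix B assume B: "bilin LA B"
    have "r_plus r B = (\<Sum>k<m. \<Sum>i\<in>I. p k (f i) * B (E i) (q k))"
      using rp[OF B] fr(5)[OF pL bilinD(1)[OF B qL]] by simp
    also have "\<dots> = (\<Sum>i\<in>I. \<Sum>k<m. p k (f i) * B (E i) (q k))" by (rule sum.swap)
    also have "\<dots> = (\<Sum>i\<in>I. 0)"
    proof (rule sum.cong[OF refl])
      fix i assume i: "i \<in> I"
      define \<phi> where "\<phi> = (\<lambda>u. if u \<in> LA then u (f i) else 0)"
      have "\<phi> \<in> dual LA" by (auto simp: dual_iff \<phi>_def intro: lin_cong[OF lin_eval])
      then have "rplus_map \<phi> = (\<lambda>f. 0)" using J0 by (auto simp: J_def zero_fun_def)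
      then have "B (E i) (rplus_map \<phi>) = 0" using lin_zero[OF bilinD(2)[OF B fr(3)[OF i]]] by simp
      moreover have "B (E i) (rplus_map \<phi>) = (\<Sum>k<m. \<phi> (p k) * B (E i) (q k))"
        unfolding rplus_map_def by (rule lin_sum[OF bilinD(2)[OF B fr(3)[OF i]] qL])
      ultimately show "(\<Sum>k<m. p k (f i) * B (E i) (q k)) = 0" by (simp add: \<phi>_def pL)
    qed
    finally show "r_plus r B = 0 B" by simp
  qed
qed

end

section \<open>Forms of low degree\<close>

context lie
begin

lemma fun_form_Om: assumes "x \<in> C" shows "fun_form x \<in> Om 0"
  unfolding forms_def using assms by (auto simp: fun_form_def)

lemma df_Om: "x \<in> C \<Longrightarrow> df G x \<in> Om 1"
  by (rule df_forms)

lemma df_app: "u \<in> T p \<Longrightarrow> df G x p [u] = u x"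
  by (simp add: df_eq)

text \<open>Extending both tangent vectors to left-invariant fields, \<open>d(dx)\<close> is \<open>L a (L b x) - L b (L a x) - L [a, b] x\<close>.\<close>

lemma d_df:
  assumes x: "x \<in> C" and f: "ext_d G (df G x) \<in> Om 2"
  shows "ext_d G (df G x) = 0"
proof (rule form_eqI[OF f forms_zero])
  fix p us assume "length us = 2" and us: "set us \<subseteq> T p"
  then obtain u v where uv: "us = [u, v]" by (auto simp: numeral_2_eq_2 length_Suc_conv)
  have uT: "u \<in> T p" and vT: "v \<in> T p" using us uv by auto
  define a b where ab: "a = ltrans G (iv p) u" "b = ltrans G (iv p) v"
  have aL: "a \<in> LA" and bL: "b \<in> LA" using uT vT ltrans_inv_LA by (auto simp: ab)
  have u: "u f = L a f p" and v: "v f = L b f p" for f by (simp_all add: ab L_def)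
  have t: "ltrans G (q \<bullet>\<bullet> iv p) u = ltrans G q a" "ltrans G (q \<bullet>\<bullet> iv p) v = ltrans G q b" for q
    by (simp_all add: ab)
  have d: "df G x q [ltrans G q c] = L c x q" if "c \<in> LA" for c q
    using that by (simp add: df_app ltrans_LA ltrans_L)
  have nth: "nths [u, v] (- {0}) = [v]" "nths [u, v] (- {Suc 0}) = [u]" "nths [u, v] (- {0, Suc 0}) = []"
    by (simp_all add: nths_Cons)
  have "ext_d G (df G x) p [u, v] =
      u (\<lambda>q. df G x q [ltrans G (q \<bullet>\<bullet> iv p) v]) - v (\<lambda>q. df G x q [ltrans G (q \<bullet>\<bullet> iv p) u])
      - df G x p [ltrans G p (lbr G a b)]"
    using uT vT unfolding ext_d_def[of G "df G x"]
    by (simp add: nth lessThan_Suc numeral_2_eq_2 ab[symmetric] del: fun_form_def)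
  also have "\<dots> = L a (L b x) p - L b (L a x) p - L (lbr G a b) x p"
    unfolding t d[OF aL] d[OF bL] d[OF lbr_LA[OF aL bL]] u v ..
  also have "\<dots> = 0" by (simp add: L_lbr)
  finally show "ext_d G (df G x) p us = 0 p us" by (simp add: uv)
qed

lemma wedge_fun_left:
  assumes "\<xi> \<in> Om 0"
  shows "wedge \<xi> \<eta> g us = (\<Sum>\<pi> | \<pi> permutes {..<length us}.
      of_int (sign \<pi>) * \<xi> g [] * \<eta> g (map (\<lambda>i. us ! \<pi> i) [0..<length us])) / fact (length us)"
proof -
  let ?N = "length us"
  let ?f = "\<lambda>k. (\<Sum>\<pi> | \<pi> permutes {..<?N}. of_int (sign \<pi>) *
        \<xi> g (map (\<lambda>i. us ! \<pi> i) [0..<k]) * \<eta> g (map (\<lambda>i. us ! \<pi> i) [k..<?N])) / (fact k * fact (?N - k))"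
  have "?f k = 0" if "k \<in> {..?N} - {0}" for k
  proof -
    have "\<xi> g (map (\<lambda>i. us ! \<pi> i) [0..<k]) = 0" for \<pi> by (rule formsD[OF assms]) (use that in auto)
    then show ?thesis by simp
  qed
  then have "(\<Sum>k\<le>?N. ?f k) = (\<Sum>k\<in>{0}. ?f k)" by (intro sum.mono_neutral_right) auto
  then show ?thesis by (simp add: wedge_def)
qed

lemma wedge_fun_right:
  assumes "\<xi> \<in> Om 0"
  shows "wedge \<eta> \<xi> g us = (\<Sum>\<pi> | \<pi> permutes {..<length us}.
      of_int (sign \<pi>) * \<eta> g (map (\<lambda>i. us ! \<pi> i) [0..<length us]) * \<xi> g []) / fact (length us)"
proof -
  let ?N = "length us"
  let ?f = "\<lambda>k. (\<Sum>\<pi> | \<pi> permutes {..<?N}. of_int (sign \<pi>) *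
        \<eta> g (map (\<lambda>i. us ! \<pi> i) [0..<k]) * \<xi> g (map (\<lambda>i. us ! \<pi> i) [k..<?N])) / (fact k * fact (?N - k))"
  have "?f k = 0" if "k \<in> {..?N} - {?N}" for k
  proof -
    have "\<xi> g (map (\<lambda>i. us ! \<pi> i) [k..<?N]) = 0" for \<pi> by (rule formsD[OF assms]) (use that in auto)
    then show ?thesis by simp
  qed
  then have "(\<Sum>k\<le>?N. ?f k) = (\<Sum>k\<in>{?N}. ?f k)" by (intro sum.mono_neutral_right) auto
  then show ?thesis by (simp add: wedge_def)
qed

lemma wedge_fun_commute: "\<xi> \<in> Om 0 \<Longrightarrow> wedge \<xi> \<eta> = wedge \<eta> \<xi>"
  by (intro ext) (simp add: wedge_fun_left wedge_fun_right mult_ac)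

lemma wedge_fun_1form: "x \<in> C \<Longrightarrow> \<tau> \<in> Om 1 \<Longrightarrow> wedge (fun_form x) \<tau> g [u] = x g * \<tau> g [u]"
  by (subst wedge_fun_left[OF fun_form_Om]) (simp_all add: fun_form_def lessThan_Suc)

lemma permutes_2: "{\<pi>. \<pi> permutes {..<2::nat}} = {id, Transposition.transpose 0 1}"
proof -
  have e: "{..<2::nat} = {0, 1}" by auto
  show ?thesis unfolding e by (simp add: permutes_doubleton_iff set_eq_iff)
qed

lemma wedge_1form_1form:
  assumes a: "\<sigma> \<in> Om 1" and b: "\<tau> \<in> Om 1"
  shows "wedge \<sigma> \<tau> g [u, v] = \<sigma> g [u] * \<tau> g [v] - \<sigma> g [v] * \<tau> g [u]"
proof -
  let ?us = "[u, v]"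
  let ?f = "\<lambda>k. (\<Sum>\<pi> | \<pi> permutes {..<2::nat}. of_int (sign \<pi>) *
        \<sigma> g (map (\<lambda>i. ?us ! \<pi> i) [0..<k]) * \<tau> g (map (\<lambda>i. ?us ! \<pi> i) [k..<2])) / (fact k * fact (2 - k))"
  have "?f k = 0" if "k \<in> {..2} - {1}" for k
  proof -
    have "\<sigma> g (map (\<lambda>i. ?us ! \<pi> i) [0..<k]) = 0" for \<pi> by (rule formsD[OF a]) (use that in auto)
    then show ?thesis by simp
  qed
  then have "(\<Sum>k\<le>2. ?f k) = (\<Sum>k\<in>{1}. ?f k)" by (intro sum.mono_neutral_right) auto
  also have "\<dots> = (\<Sum>\<pi>\<in>{id, Transposition.transpose 0 (1::nat)}. of_int (sign \<pi>) *
        \<sigma> g (map (\<lambda>i. ?us ! \<pi> i) [0..<1]) * \<tau> g (map (\<lambda>i. ?us ! \<pi> i) [1..<2]))"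
    by (simp add: permutes_2)
  also have "\<dots> = \<sigma> g [u] * \<tau> g [v] - \<sigma> g [v] * \<tau> g [u]"
  proof -
    have "id \<noteq> Transposition.transpose 0 (1::nat)" by (metis id_apply transpose_apply_first zero_neq_one)
    then show ?thesis by (simp add: sign_swap_id numeral_2_eq_2)
  qed
  finally show ?thesis by (simp add: wedge_def numeral_2_eq_2)
qed

text \<open>The two products differ by a cyclic rotation of the three arguments.\<close>

lemma wedge_1form_2form:
  assumes a: "\<sigma> \<in> Om 1" and b: "\<tau> \<in> Om 2" and us: "length us = 3"
  shows "wedge \<sigma> \<tau> g us = wedge \<tau> \<sigma> g us"
proof -
  let ?S = "{\<pi>. \<pi> permutes {..<3::nat}}"
  let ?f = "\<lambda>k. (\<Sum>\<pi>\<in>?S. of_int (sign \<pi>) *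
        \<sigma> g (map (\<lambda>i. us ! \<pi> i) [0..<k]) * \<tau> g (map (\<lambda>i. us ! \<pi> i) [k..<3])) / (fact k * fact (3 - k))"
  let ?h = "\<lambda>k. (\<Sum>\<pi>\<in>?S. of_int (sign \<pi>) *
        \<tau> g (map (\<lambda>i. us ! \<pi> i) [0..<k]) * \<sigma> g (map (\<lambda>i. us ! \<pi> i) [k..<3])) / (fact k * fact (3 - k))"
  have "?f k = 0" if "k \<in> {..3} - {1}" for k
  proof -
    have "\<sigma> g (map (\<lambda>i. us ! \<pi> i) [0..<k]) = 0" for \<pi> by (rule formsD[OF a]) (use that in auto)
    then show ?thesis by simp
  qed
  then have f: "(\<Sum>k\<le>3. ?f k) = ?f 1" by (subst sum.mono_neutral_right[of "{..3}" "{1}"]) auto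
  have "?h k = 0" if "k \<in> {..3} - {2}" for k
  proof -
    have "\<tau> g (map (\<lambda>i. us ! \<pi> i) [0..<k]) = 0" for \<pi> by (rule formsD[OF b]) (use that in auto)
    then show ?thesis by simp
  qed
  then have h: "(\<Sum>k\<le>3. ?h k) = ?h 2" by (subst sum.mono_neutral_right[of "{..3}" "{2}"]) auto
  \<comment> \<open>cyclic rotation of three entries, an even permutation\<close>
  define \<rho> where "\<rho> = Transposition.transpose 0 (1::nat) \<circ> Transposition.transpose 1 2"
  have \<rho>: "\<rho> permutes {..<3}" unfolding \<rho>_def by (intro permutes_compose permutes_swap_id) auto
  have r: "\<rho> 0 = 1" "\<rho> 1 = 2" "\<rho> 2 = 0" by (simp_all add: \<rho>_def transpose_def)
  have s\<rho>: "sign \<rho> = 1" unfolding \<rho>_def by (simp add: sign_compose permutation_swap_id sign_swap_id)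
  have l: "[0..<2] = [0, 1::nat]" "[2..<3] = [2::nat]" "[0..<1] = [0::nat]" "[1..<3] = [1, 2::nat]"
    by (simp_all add: upt_rec numeral_2_eq_2 numeral_3_eq_3)
  have "(\<Sum>\<pi>\<in>?S. of_int (sign \<pi>) * \<tau> g (map (\<lambda>i. us ! \<pi> i) [0..<2]) * \<sigma> g (map (\<lambda>i. us ! \<pi> i) [2..<3]))
    = (\<Sum>\<pi>\<in>?S. of_int (sign (\<pi> \<circ> \<rho>)) * \<tau> g (map (\<lambda>i. us ! (\<pi> \<circ> \<rho>) i) [0..<2]) * \<sigma> g (map (\<lambda>i. us ! (\<pi> \<circ> \<rho>) i) [2..<3]))"
    by (rule sum_permutations_compose_right[OF \<rho>])
  also have "\<dots> = (\<Sum>\<pi>\<in>?S. of_int (sign \<pi>) * \<sigma> g (map (\<lambda>i. us ! \<pi> i) [0..<1]) * \<tau> g (map (\<lambda>i. us ! \<pi> i) [1..<3]))"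
  proof (rule sum.cong[OF refl])
    fix \<pi> assume "\<pi> \<in> ?S"
    then have "permutation \<pi>" using permutation_permutes by blast
    moreover have "permutation \<rho>" using \<rho> permutation_permutes by blast
    ultimately have "sign (\<pi> \<circ> \<rho>) = sign \<pi>" by (simp add: sign_compose s\<rho>)
    then show "of_int (sign (\<pi> \<circ> \<rho>)) * \<tau> g (map (\<lambda>i. us ! (\<pi> \<circ> \<rho>) i) [0..<2]) * \<sigma> g (map (\<lambda>i. us ! (\<pi> \<circ> \<rho>) i) [2..<3])
      = of_int (sign \<pi>) * \<sigma> g (map (\<lambda>i. us ! \<pi> i) [0..<1]) * \<tau> g (map (\<lambda>i. us ! \<pi> i) [1..<3])"
      unfolding l by (simp add: r r(2)[unfolded One_nat_def])
  qed
  finally have "?h 2 = ?f 1" by (simp add: fact_numeral)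
  then show ?thesis using f h us by (simp add: wedge_def)
qed

end

section \<open>The bracket of forms defined by a deformation\<close>

lemma ser_mul_low:
  "ser_mul P F H 0 = P 0 (F 0) (H 0)"
  "ser_mul P F H 1 = P 0 (F 0) (H 1) + P 0 (F 1) (H 0) + P 1 (F 0) (H 0)"
  "ser_mul P F H 2 = P 0 (F 0) (H 2) + P 0 (F 1) (H 1) + P 0 (F 2) (H 0)
     + P 1 (F 0) (H 1) + P 1 (F 1) (H 0) + P 2 (F 0) (H 0)"
  by (simp_all add: ser_mul_def numeral_2_eq_2 add.assoc)

lemma ser_d_low: "ser_d D F 0 = D 0 (F 0)" "ser_d D F 1 = D 0 (F 1) + D 1 (F 0)"
  by (simp_all add: ser_d_def)

lemma const_ser_low: "const_ser \<xi> 0 = \<xi>" "const_ser \<xi> 1 = 0" "const_ser \<xi> 2 = 0"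
  by (simp_all add: const_ser_def)

lemma fseries_app:
  fixes F H :: "'g fseries"
  shows "(F + H) i = F i + H i" "(F - H) i = F i - H i"
  by simp_all

locale deform = qt +
  fixes P :: "nat \<Rightarrow> 'a form \<Rightarrow> 'a form \<Rightarrow> 'a form" and D :: "nat \<Rightarrow> 'a form \<Rightarrow> 'a form"
  assumes defm: "deformation G \<omega> gam P D"
begin

lemma
  shows P_Om: "\<xi> \<in> Om k \<Longrightarrow> \<eta> \<in> Om l \<Longrightarrow> P i \<xi> \<eta> \<in> Om (k + l)"
    and P_add_left: "\<xi> \<in> Om k \<Longrightarrow> \<xi>' \<in> Om k \<Longrightarrow> \<eta> \<in> Om l \<Longrightarrow> P i (\<xi> + \<xi>') \<eta> = P i \<xi> \<eta> + P i \<xi>' \<eta>"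
    and P_fsc_left: "\<xi> \<in> Om k \<Longrightarrow> \<eta> \<in> Om l \<Longrightarrow> P i (fsc c \<xi>) \<eta> = fsc c (P i \<xi> \<eta>)"
    and P_add_right: "\<xi> \<in> Om k \<Longrightarrow> \<eta> \<in> Om l \<Longrightarrow> \<eta>' \<in> Om l \<Longrightarrow> P i \<xi> (\<eta> + \<eta>') = P i \<xi> \<eta> + P i \<xi> \<eta>'"
    and P_fsc_right: "\<xi> \<in> Om k \<Longrightarrow> \<eta> \<in> Om l \<Longrightarrow> P i \<xi> (fsc c \<eta>) = fsc c (P i \<xi> \<eta>)"
proof -
  have a: "(\<forall>\<xi>\<in>Om k. \<forall>\<eta>\<in>Om l. P i \<xi> \<eta> \<in> Om (k + l)) \<and> bilinear_over fsc fsc fsc (Om k) (Om l) (P i)"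
    using conjunct1[OF defm[unfolded deformation_def]] by simp
  show "\<xi> \<in> Om k \<Longrightarrow> \<eta> \<in> Om l \<Longrightarrow> P i \<xi> \<eta> \<in> Om (k + l)" using conjunct1[OF a] by simp
  note b = conjunct2[OF a, unfolded bilinear_over_def linear_over_def]
  show "\<xi> \<in> Om k \<Longrightarrow> \<xi>' \<in> Om k \<Longrightarrow> \<eta> \<in> Om l \<Longrightarrow> P i (\<xi> + \<xi>') \<eta> = P i \<xi> \<eta> + P i \<xi>' \<eta>"
    "\<xi> \<in> Om k \<Longrightarrow> \<eta> \<in> Om l \<Longrightarrow> P i (fsc c \<xi>) \<eta> = fsc c (P i \<xi> \<eta>)"
    using conjunct1[OF b] by simp_all
  show "\<xi> \<in> Om k \<Longrightarrow> \<eta> \<in> Om l \<Longrightarrow> \<eta>' \<in> Om l \<Longrightarrow> P i \<xi> (\<eta> + \<eta>') = P i \<xi> \<eta> + P i \<xi> \<eta>'"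
    "\<xi> \<in> Om k \<Longrightarrow> \<eta> \<in> Om l \<Longrightarrow> P i \<xi> (fsc c \<eta>) = fsc c (P i \<xi> \<eta>)"
    using conjunct2[OF b] by simp_all
qed

lemma
  shows D_Om: "\<xi> \<in> Om k \<Longrightarrow> D i \<xi> \<in> Om (k + 1)"
    and D_add: "\<xi> \<in> Om k \<Longrightarrow> \<xi>' \<in> Om k \<Longrightarrow> D i (\<xi> + \<xi>') = D i \<xi> + D i \<xi>'"
    and D_fsc: "\<xi> \<in> Om k \<Longrightarrow> D i (fsc c \<xi>) = fsc c (D i \<xi>)"
proof -
  have a: "(\<forall>\<xi>\<in>Om k. D i \<xi> \<in> Om (k + 1)) \<and> linear_over fsc fsc (Om k) (D i)"
    using conjunct1[OF conjunct2[OF defm[unfolded deformation_def]]] by simp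
  show "\<xi> \<in> Om k \<Longrightarrow> D i \<xi> \<in> Om (k + 1)" using conjunct1[OF a] by simp
  show "\<xi> \<in> Om k \<Longrightarrow> \<xi>' \<in> Om k \<Longrightarrow> D i (\<xi> + \<xi>') = D i \<xi> + D i \<xi>'"
    "\<xi> \<in> Om k \<Longrightarrow> D i (fsc c \<xi>) = fsc c (D i \<xi>)"
    using conjunct2[OF a, unfolded linear_over_def] by simp_all
qed

lemma P_zero: "\<eta> \<in> Om l \<Longrightarrow> P i 0 \<eta> = 0" "\<xi> \<in> Om k \<Longrightarrow> P i \<xi> 0 = 0"
  using P_fsc_left[OF forms_zero[of 0], of \<eta> l i 0] P_fsc_right[OF _ forms_zero[of 0], of \<xi> k i 0]
  by (simp_all add: fsc_zero)

lemma P0: "\<xi> \<in> Om k \<Longrightarrow> \<eta> \<in> Om l \<Longrightarrow> P 0 \<xi> \<eta> = wedge \<xi> \<eta>"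
  using conjunct1[OF conjunct2[OF conjunct2[OF defm[unfolded deformation_def]]]] by simp
lemma D0: "\<xi> \<in> Om k \<Longrightarrow> D 0 \<xi> = ext_d G \<xi>"
  using conjunct1[OF conjunct2[OF conjunct2[OF conjunct2[OF defm[unfolded deformation_def]]]]] by simp

lemma wedge_Om: "\<xi> \<in> Om k \<Longrightarrow> \<eta> \<in> Om l \<Longrightarrow> wedge \<xi> \<eta> \<in> Om (k + l)"
  using P_Om[of \<xi> k \<eta> l 0] by (simp add: P0)
lemma d_Om: "\<xi> \<in> Om k \<Longrightarrow> ext_d G \<xi> \<in> Om (k + 1)"
  using D_Om[of \<xi> k 0] by (simp add: D0)
lemma d_add: assumes x: "\<xi> \<in> Om k" and y: "\<xi>' \<in> Om k"
  shows "ext_d G (\<xi> + \<xi>') = ext_d G \<xi> + ext_d G \<xi>'"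
  using D_add[OF x y, of 0] unfolding D0[OF x] D0[OF y] D0[OF forms_plus[OF x y]] .
lemma d_fsc: assumes x: "\<xi> \<in> Om k" shows "ext_d G (fsc c \<xi>) = fsc c (ext_d G \<xi>)"
  using D_fsc[OF x, of 0 c] unfolding D0[OF x] D0[OF forms_fsc[OF x]] .
lemma d_zero: "ext_d G 0 = 0"
  using d_fsc[OF forms_zero[of 0], of 0] by (simp add: fsc_zero)
lemma d_minus: "\<xi> \<in> Om k \<Longrightarrow> \<xi>' \<in> Om k \<Longrightarrow> ext_d G (\<xi> - \<xi>') = ext_d G \<xi> - ext_d G \<xi>'"
  unfolding fsc_minus by (simp add: d_add[OF _ forms_fsc] d_fsc)

lemma const_mul:
  assumes x: "\<xi> \<in> Om k" and y: "\<eta> \<in> Om l"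
  shows "ser_mul P (const_ser \<xi>) (const_ser \<eta>) 0 = P 0 \<xi> \<eta>"
    "ser_mul P (const_ser \<xi>) (const_ser \<eta>) 1 = P 1 \<xi> \<eta>"
    "ser_mul P (const_ser \<xi>) (const_ser \<eta>) 2 = P 2 \<xi> \<eta>"
  unfolding ser_mul_low const_ser_low
  by (simp_all only: P_zero[OF x] P_zero[OF y] P_zero[OF forms_zero[of 0]] add_0_left add_0_right)

lemma wedge_assoc:
  assumes x: "\<xi> \<in> Om k" and y: "\<eta> \<in> Om l" and z: "\<zeta> \<in> Om m'"
  shows "wedge (wedge \<xi> \<eta>) \<zeta> = wedge \<xi> (wedge \<eta> \<zeta>)"
    and P1_assoc: "P 1 (wedge \<xi> \<eta>) \<zeta> + wedge (P 1 \<xi> \<eta>) \<zeta> = P 1 \<xi> (wedge \<eta> \<zeta>) + wedge \<xi> (P 1 \<eta> \<zeta>)"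
proof -
  let ?l = "ser_mul P (ser_mul P (const_ser \<xi>) (const_ser \<eta>)) (const_ser \<zeta>)"
  let ?r = "ser_mul P (const_ser \<xi>) (ser_mul P (const_ser \<eta>) (const_ser \<zeta>))"
  have "ser_eq_upto 2 ?l ?r"
    using conjunct1[OF conjunct2[OF conjunct2[OF conjunct2[OF conjunct2[OF conjunct2[OF defm[unfolded deformation_def]]]]]]]
      x y z by blast
  then have e: "?l 0 = ?r 0" "?l 1 = ?r 1" by (simp_all add: ser_eq_upto_def)
  note Pxy = P_Om[OF x y] and Pyz = P_Om[OF y z]
  from e(1) show "wedge (wedge \<xi> \<eta>) \<zeta> = wedge \<xi> (wedge \<eta> \<zeta>)"
    unfolding ser_mul_low(1) const_ser_low(1)
    by (simp only: P0[OF x y] P0[OF y z] P0[OF wedge_Om[OF x y] z] P0[OF x wedge_Om[OF y z]])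
  from e(2) show "P 1 (wedge \<xi> \<eta>) \<zeta> + wedge (P 1 \<xi> \<eta>) \<zeta> = P 1 \<xi> (wedge \<eta> \<zeta>) + wedge \<xi> (P 1 \<eta> \<zeta>)"
    unfolding ser_mul_low(2)[of P "ser_mul P (const_ser \<xi>) (const_ser \<eta>)" "const_ser \<zeta>"]
      ser_mul_low(2)[of P "const_ser \<xi>" "ser_mul P (const_ser \<eta>) (const_ser \<zeta>)"]
      const_ser_low const_mul[OF x y] const_mul[OF y z]
    by (simp only: P_zero[OF Pxy] P_zero[OF Pyz] P_zero[OF wedge_Om[OF x y]] P_zero[OF wedge_Om[OF y z]]
        P0[OF x y] P0[OF y z] P0[OF Pxy z] P0[OF x Pyz] add_0_left add_0_right add.commute)
qed

lemma d_wedge: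
  assumes x: "\<xi> \<in> Om k" and y: "\<eta> \<in> Om l"
  shows "ext_d G (wedge \<xi> \<eta>) = wedge (ext_d G \<xi>) \<eta> + fsc ((- 1) ^ k) (wedge \<xi> (ext_d G \<eta>))"
    and d_P1: "ext_d G (P 1 \<xi> \<eta>) + D 1 (wedge \<xi> \<eta>) = P 1 (ext_d G \<xi>) \<eta> + wedge (D 1 \<xi>) \<eta>
      + fsc ((- 1) ^ k) (P 1 \<xi> (ext_d G \<eta>) + wedge \<xi> (D 1 \<eta>))"
proof -
  let ?l = "ser_d D (ser_mul P (const_ser \<xi>) (const_ser \<eta>))"
  let ?r = "ser_mul P (ser_d D (const_ser \<xi>)) (const_ser \<eta>) +
         ser_sc ((- 1) ^ k) (ser_mul P (const_ser \<xi>) (ser_d D (const_ser \<eta>)))"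
  have "ser_eq_upto 2 ?l ?r"
    using conjunct1[OF conjunct2[OF conjunct2[OF conjunct2[OF conjunct2[OF conjunct2[OF conjunct2[OF
      defm[unfolded deformation_def]]]]]]]] x y by blast
  then have e: "?l 0 = ?r 0" "?l 1 = ?r 1" by (simp_all add: ser_eq_upto_def)
  have Dz: "D i 0 = 0" for i using D_fsc[OF forms_zero[of 0], of i 0] by (simp add: fsc_zero)
  note dx = d_Om[OF x] and dy = d_Om[OF y]
  from e(1) show "ext_d G (wedge \<xi> \<eta>) = wedge (ext_d G \<xi>) \<eta> + fsc ((- 1) ^ k) (wedge \<xi> (ext_d G \<eta>))"
    unfolding ser_d_low fseries_app ser_sc_def const_mul[OF x y] ser_mul_low const_ser_low
    by (simp only: P0[OF x y] D0[OF x] D0[OF y] D0[OF wedge_Om[OF x y]] P0[OF dx y] P0[OF x dy])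
  from e(2) show "ext_d G (P 1 \<xi> \<eta>) + D 1 (wedge \<xi> \<eta>) = P 1 (ext_d G \<xi>) \<eta> + wedge (D 1 \<xi>) \<eta>
      + fsc ((- 1) ^ k) (P 1 \<xi> (ext_d G \<eta>) + wedge \<xi> (D 1 \<eta>))"
    unfolding ser_d_low fseries_app ser_sc_def const_mul[OF x y] ser_mul_low const_ser_low
    by (simp only: P0[OF x y] D0[OF x] D0[OF y] D0[OF P_Om[OF x y]] P_zero[OF x] P_zero[OF y] P_zero[OF dx] P_zero[OF dy] Dz
        P0[OF D_Om[OF x] y] P0[OF x D_Om[OF y]] P_zero[OF D_Om[OF x]] P_zero[OF D_Om[OF y]]
        add_0_left add_0_right add.commute)
qed

text \<open>The leading coefficient of the supercommutator. Associativity and the Leibniz rule at this order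
  make it a graded biderivation compatible with the exterior derivative.\<close>

definition br where
  "br k l \<xi> \<eta> = P 1 \<xi> \<eta> - fsc ((- 1) ^ (k * l)) (P 1 \<eta> \<xi>)"

text \<open>Graded commutativity of the wedge product in degrees \<open>k\<close> and \<open>l\<close>.\<close>

definition gcomm :: "nat \<Rightarrow> nat \<Rightarrow> bool" where
  "gcomm k l \<longleftrightarrow> (\<forall>\<xi>\<in>Om k. \<forall>\<eta>\<in>Om l. wedge \<xi> \<eta> = fsc ((- 1) ^ (k * l)) (wedge \<eta> \<xi>))"

lemma gcomm_0: "gcomm 0 l" "gcomm k 0"
  unfolding gcomm_def using wedge_fun_commute by (auto simp: fsc_one)

lemma gcomm_11: "gcomm 1 1"
  unfolding gcomm_def
proof (intro ballI)
  fix \<xi> \<eta> assume x: "\<xi> \<in> Om 1" and y: "\<eta> \<in> Om 1"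
  show "wedge \<xi> \<eta> = fsc ((- 1) ^ (1 * 1)) (wedge \<eta> \<xi>)"
  proof (rule form_eqI[OF wedge_Om[OF x y] forms_fsc[OF wedge_Om[OF y x]]])
    fix p :: 'a and us :: "'a tvec list" assume "length us = 1 + 1"
    then obtain u v where "us = [u, v]" by (auto simp: length_Suc_conv)
    then show "wedge \<xi> \<eta> p us = fsc ((- 1) ^ (1 * 1)) (wedge \<eta> \<xi>) p us"
      by (simp add: wedge_1form_1form[OF x y] wedge_1form_1form[OF y x] fsc_def)
  qed
qed

lemma gcomm_12: "gcomm 1 2" "gcomm 2 1"
proof -
  have e: "wedge \<xi> \<eta> = wedge \<eta> \<xi>" if x: "\<xi> \<in> Om 1" and y: "\<eta> \<in> Om 2" for \<xi> \<eta>
  proof (rule form_eqI[OF wedge_Om[OF x y]])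
    show "wedge \<eta> \<xi> \<in> Om (1 + 2)" using wedge_Om[OF y x] by (simp add: add.commute)
  qed (use wedge_1form_2form[OF x y] in simp)
  show "gcomm 1 2" "gcomm 2 1" unfolding gcomm_def using e by (auto simp: fsc_one)
qed

lemma gcommD: "gcomm k l \<Longrightarrow> \<xi> \<in> Om k \<Longrightarrow> \<eta> \<in> Om l \<Longrightarrow> wedge \<xi> \<eta> = fsc ((- 1) ^ (k * l)) (wedge \<eta> \<xi>)"
  unfolding gcomm_def by blast

lemma br_Om: "\<xi> \<in> Om k \<Longrightarrow> \<eta> \<in> Om l \<Longrightarrow> br k l \<xi> \<eta> \<in> Om (k + l)"
  unfolding br_def using P_Om[of \<xi> k \<eta> l 1] P_Om[of \<eta> l \<xi> k 1]
  by (intro forms_minus forms_fsc) (simp_all add: add.commute)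

lemma br_add_right: "\<xi> \<in> Om k \<Longrightarrow> \<eta> \<in> Om l \<Longrightarrow> \<eta>' \<in> Om l \<Longrightarrow> br k l \<xi> (\<eta> + \<eta>') = br k l \<xi> \<eta> + br k l \<xi> \<eta>'"
  unfolding br_def by (simp add: P_add_left[of \<eta> l] P_add_right[of \<xi> k \<eta> l] fsc_plus)
lemma br_fsc_right: "\<xi> \<in> Om k \<Longrightarrow> \<eta> \<in> Om l \<Longrightarrow> br k l \<xi> (fsc c \<eta>) = fsc c (br k l \<xi> \<eta>)"
  unfolding br_def by (simp add: P_fsc_left[of \<eta> l] P_fsc_right[of \<xi> k \<eta> l])
     (simp add: fsc_def fun_eq_iff algebra_simps)
lemma br_zero: "\<xi> \<in> Om k \<Longrightarrow> br k l \<xi> 0 = 0" "\<eta> \<in> Om l \<Longrightarrow> br k l 0 \<eta> = 0"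
  unfolding br_def by (simp_all add: P_zero fsc_zero)

lemma br_sum_right:
  assumes x: "\<xi> \<in> Om k" and "\<And>i. i \<in> I \<Longrightarrow> \<eta> i \<in> Om l"
  shows "br k l \<xi> (\<Sum>i\<in>I. fsc (c i) (\<eta> i)) = (\<Sum>i\<in>I. fsc (c i) (br k l \<xi> (\<eta> i)))"
  using assms(2)
proof (induction I rule: infinite_finite_induct)
  case (insert i I)
  have "fsc (c i) (\<eta> i) \<in> Om l" "(\<Sum>i\<in>I. fsc (c i) (\<eta> i)) \<in> Om l"
    using insert.prems by (auto intro!: forms_fsc forms_sum)
  note add = br_add_right[OF x this]
  have "\<eta> i \<in> Om l" using insert.prems by simp
  note scale = br_fsc_right[OF x this]
  have "br k l \<xi> (\<Sum>i\<in>I. fsc (c i) (\<eta> i)) = (\<Sum>i\<in>I. fsc (c i) (br k l \<xi> (\<eta> i)))"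
    using insert by blast
  then show ?case unfolding sum.insert[OF insert.hyps] add scale by (rule arg_cong)
qed (simp_all add: br_zero[OF x])

lemma d_sum:
  assumes "\<And>i. i \<in> I \<Longrightarrow> \<eta> i \<in> Om l"
  shows "ext_d G (\<Sum>i\<in>I. fsc (c i) (\<eta> i)) = (\<Sum>i\<in>I. fsc (c i) (ext_d G (\<eta> i)))"
  using assms
proof (induction I rule: infinite_finite_induct)
  case (insert i I)
  have "fsc (c i) (\<eta> i) \<in> Om l" "(\<Sum>i\<in>I. fsc (c i) (\<eta> i)) \<in> Om l"
    using insert.prems by (auto intro!: forms_fsc forms_sum)
  note add = d_add[OF this]
  have "\<eta> i \<in> Om l" using insert.prems by simp
  note scale = d_fsc[OF this]
  have "ext_d G (\<Sum>i\<in>I. fsc (c i) (\<eta> i)) = (\<Sum>i\<in>I. fsc (c i) (ext_d G (\<eta> i)))"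
    using insert by blast
  then show ?case unfolding sum.insert[OF insert.hyps] add scale by (rule arg_cong)
qed (simp_all add: d_zero)

lemma sign_sq: "((- 1) ^ i :: real) * (- 1) ^ i = 1"
  by (simp add: power_mult_distrib[symmetric])

text \<open>To first order, associativity says that \<open>P 1\<close> is a Hochschild cocycle for the wedge product, and the
  antisymmetrisation of a cocycle of a commutative algebra is a biderivation: combine the cocycle
  identities for \<open>(\<xi>, \<eta>, \<zeta>)\<close>, \<open>(\<eta>, \<zeta>, \<xi>)\<close> and \<open>(\<eta>, \<xi>, \<zeta>)\<close>.\<close>

lemma br_wedge:
  assumes x: "\<xi> \<in> Om k" and y: "\<eta> \<in> Om l" and z: "\<zeta> \<in> Om m'"
    and gc: "gcomm k l" "gcomm k m'" "gcomm k (l + m')"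
  shows "br k (l + m') \<xi> (wedge \<eta> \<zeta>) =
    wedge (br k l \<xi> \<eta>) \<zeta> + fsc ((- 1) ^ (k * l)) (wedge \<eta> (br k m' \<xi> \<zeta>))"
proof -
  let ?a = "(- 1) ^ (k * l) :: real" and ?b = "(- 1) ^ (k * m') :: real"
  have ab: "(- 1) ^ (k * (l + m')) = ?a * ?b" by (simp add: distrib_left power_add)
  have aa: "?a * ?a = 1" "?b * ?b = 1" by (rule sign_sq)+
  have c1: "wedge \<xi> \<eta> = fsc ?a (wedge \<eta> \<xi>)" by (rule gcommD[OF gc(1) x y])
  have c2: "wedge \<xi> \<zeta> = fsc ?b (wedge \<zeta> \<xi>)" by (rule gcommD[OF gc(2) x z])
  have c3: "wedge \<xi> (P 1 \<eta> \<zeta>) = fsc (?a * ?b) (wedge (P 1 \<eta> \<zeta>) \<xi>)"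
    using gcommD[OF gc(3) x P_Om[OF y z]] unfolding ab .
  have A1: "P 1 \<xi> (wedge \<eta> \<zeta>) = fsc ?a (P 1 (wedge \<eta> \<xi>) \<zeta>) + wedge (P 1 \<xi> \<eta>) \<zeta> - wedge \<xi> (P 1 \<eta> \<zeta>)"
    using P1_assoc[OF x y z] unfolding c1 P_fsc_left[OF wedge_Om[OF y x] z]
    by (simp add: algebra_simps)
  have A2: "P 1 (wedge \<eta> \<zeta>) \<xi> = P 1 \<eta> (wedge \<zeta> \<xi>) + wedge \<eta> (P 1 \<zeta> \<xi>) - wedge (P 1 \<eta> \<zeta>) \<xi>"
    using P1_assoc[OF y z x] by (simp add: algebra_simps)
  have A3: "P 1 (wedge \<eta> \<xi>) \<zeta> = fsc ?b (P 1 \<eta> (wedge \<zeta> \<xi>)) + wedge \<eta> (P 1 \<xi> \<zeta>) - wedge (P 1 \<eta> \<xi>) \<zeta>"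
    using P1_assoc[OF y x z] unfolding c2 P_fsc_right[OF y wedge_Om[OF z x]]
    by (simp add: algebra_simps)
  have wl: "wedge (P 1 \<xi> \<eta> - fsc ?a (P 1 \<eta> \<xi>)) \<zeta> = wedge (P 1 \<xi> \<eta>) \<zeta> - fsc ?a (wedge (P 1 \<eta> \<xi>) \<zeta>)"
  proof -
    have o: "P 1 \<xi> \<eta> \<in> Om (k + l)" "P 1 \<eta> \<xi> \<in> Om (k + l)"
      using P_Om[OF x y] P_Om[OF y x] by (simp_all add: add.commute)
    have "P 0 (P 1 \<xi> \<eta> + fsc (- ?a) (P 1 \<eta> \<xi>)) \<zeta> = P 0 (P 1 \<xi> \<eta>) \<zeta> + fsc (- ?a) (P 0 (P 1 \<eta> \<xi>) \<zeta>)"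
      by (simp only: P_add_left[OF o(1) forms_fsc[OF o(2)] z] P_fsc_left[OF o(2) z])
    then have "wedge (P 1 \<xi> \<eta> + fsc (- ?a) (P 1 \<eta> \<xi>)) \<zeta> = wedge (P 1 \<xi> \<eta>) \<zeta> + fsc (- ?a) (wedge (P 1 \<eta> \<xi>) \<zeta>)"
      by (simp only: P0[OF forms_plus[OF o(1) forms_fsc[OF o(2)]] z] P0[OF o(1) z] P0[OF o(2) z])
    then show ?thesis by (simp add: fsc_minus fsc_fsc)
  qed
  have wr: "wedge \<eta> (P 1 \<xi> \<zeta> - fsc ?b (P 1 \<zeta> \<xi>)) = wedge \<eta> (P 1 \<xi> \<zeta>) - fsc ?b (wedge \<eta> (P 1 \<zeta> \<xi>))"
  proof -
    have o: "P 1 \<xi> \<zeta> \<in> Om (k + m')" "P 1 \<zeta> \<xi> \<in> Om (k + m')"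
      using P_Om[OF x z] P_Om[OF z x] by (simp_all add: add.commute)
    have "P 0 \<eta> (P 1 \<xi> \<zeta> + fsc (- ?b) (P 1 \<zeta> \<xi>)) = P 0 \<eta> (P 1 \<xi> \<zeta>) + fsc (- ?b) (P 0 \<eta> (P 1 \<zeta> \<xi>))"
      by (simp only: P_add_right[OF y o(1) forms_fsc[OF o(2)]] P_fsc_right[OF y o(2)])
    then have "wedge \<eta> (P 1 \<xi> \<zeta> + fsc (- ?b) (P 1 \<zeta> \<xi>)) = wedge \<eta> (P 1 \<xi> \<zeta>) + fsc (- ?b) (wedge \<eta> (P 1 \<zeta> \<xi>))"
      by (simp only: P0[OF y forms_plus[OF o(1) forms_fsc[OF o(2)]]] P0[OF y o(1)] P0[OF y o(2)])
    then show ?thesis by (simp add: fsc_minus fsc_fsc)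
  qed
  have pure: "(a * X + Y - a * b * Z) - a * b * (W + V - Z) = Y - a * U + a * (T' - b * V)"
    if "X = b * W + T' - U" "a * a = 1" "b * b = 1" for a b X Y Z W V U T' :: real
    using that by algebra
  show ?thesis
  proof (intro ext)
    fix g us
    have X: "P 1 (wedge \<eta> \<xi>) \<zeta> g us = ?b * P 1 \<eta> (wedge \<zeta> \<xi>) g us + wedge \<eta> (P 1 \<xi> \<zeta>) g us - wedge (P 1 \<eta> \<xi>) \<zeta> g us"
      unfolding A3 by (simp add: fsc_def)
    show "br k (l + m') \<xi> (wedge \<eta> \<zeta>) g us =
      (wedge (br k l \<xi> \<eta>) \<zeta> + fsc ?a (wedge \<eta> (br k m' \<xi> \<zeta>))) g us"
      unfolding br_def ab wl wr A1 A2 c3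
      using pure[OF X aa, of "wedge (P 1 \<xi> \<eta>) \<zeta> g us" "wedge (P 1 \<eta> \<zeta>) \<xi> g us" "wedge \<eta> (P 1 \<zeta> \<xi>) g us"]
      by (simp add: fsc_def)
  qed
qed

text \<open>The correction \<open>D 1\<close> of the differential enters only through graded commutators of the wedge product,
  which vanish.\<close>

lemma d_br:
  assumes x: "\<xi> \<in> Om k" and y: "\<eta> \<in> Om l"
    and gc: "gcomm k l" "gcomm (k + 1) l" "gcomm k (l + 1)"
  shows "ext_d G (br k l \<xi> \<eta>) =
    br (k + 1) l (ext_d G \<xi>) \<eta> + fsc ((- 1) ^ k) (br k (l + 1) \<xi> (ext_d G \<eta>))"
proof -
  let ?a = "(- 1) ^ (k * l) :: real" and ?k = "(- 1) ^ k :: real" and ?l = "(- 1) ^ l :: real"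
  have s: "(- 1) ^ ((k + 1) * l) = ?a * ?l" "(- 1) ^ (k * (l + 1)) = ?a * ?k"
    by (simp_all add: distrib_left distrib_right power_add mult.commute)
  have sq: "?k * ?k = 1" "?l * ?l = 1" "?a * ?a = 1" by (rule sign_sq)+
  note o = P_Om[OF x y, of 1] P_Om[OF y x, of 1, unfolded add.commute[of l k]]
  have dbr: "ext_d G (br k l \<xi> \<eta>) = ext_d G (P 1 \<xi> \<eta>) - fsc ?a (ext_d G (P 1 \<eta> \<xi>))"
    unfolding br_def by (simp only: d_minus[OF o(1) forms_fsc[OF o(2)]] d_fsc[OF o(2)])
  have c1: "wedge \<xi> \<eta> = fsc ?a (wedge \<eta> \<xi>)" by (rule gcommD[OF gc(1) x y])
  have c2: "wedge (D 1 \<xi>) \<eta> = fsc (?a * ?l) (wedge \<eta> (D 1 \<xi>))"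
    using gcommD[OF gc(2) D_Om[OF x] y] unfolding s .
  have c3: "wedge \<xi> (D 1 \<eta>) = fsc (?a * ?k) (wedge (D 1 \<eta>) \<xi>)"
    using gcommD[OF gc(3) x D_Om[OF y]] unfolding s .
  note E1 = d_P1[OF x y, unfolded c1 c2 c3 D_fsc[OF wedge_Om[OF y x]]] and E2 = d_P1[OF y x]
  have pure: "X - a * Y = A - a * l * B + k * (A' - a * k * B')"
    if "X + a * Z = A + a * l * W + k * (A' + a * k * V)" "Y + Z = B' + V + l * (B + W)"
      "k * k = 1" "l * l = 1" "a * a = 1" for X Y Z A B A' B' W V a l k :: real
    using that by algebra
  show ?thesis
  proof (intro ext)
    fix g us
    have e1: "ext_d G (P 1 \<xi> \<eta>) g us + ?a * D 1 (wedge \<eta> \<xi>) g us =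
      P 1 (ext_d G \<xi>) \<eta> g us + ?a * ?l * wedge \<eta> (D 1 \<xi>) g us
      + ?k * (P 1 \<xi> (ext_d G \<eta>) g us + ?a * ?k * wedge (D 1 \<eta>) \<xi> g us)"
      using fun_cong[OF fun_cong[OF E1, of g], of us] by (simp add: fsc_def)
    have e2: "ext_d G (P 1 \<eta> \<xi>) g us + D 1 (wedge \<eta> \<xi>) g us =
      P 1 (ext_d G \<eta>) \<xi> g us + wedge (D 1 \<eta>) \<xi> g us
      + ?l * (P 1 \<eta> (ext_d G \<xi>) g us + wedge \<eta> (D 1 \<xi>) g us)"
      using fun_cong[OF fun_cong[OF E2, of g], of us] by (simp add: fsc_def)
    show "ext_d G (br k l \<xi> \<eta>) g us =
      (br (k + 1) l (ext_d G \<xi>) \<eta> + fsc ?k (br k (l + 1) \<xi> (ext_d G \<eta>))) g us"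
      unfolding dbr unfolding br_def s using pure[OF e1 e2 sq] by (simp add: fsc_def)
  qed
qed

lemma br_fun_fun: "x \<in> C \<Longrightarrow> y \<in> C \<Longrightarrow> br 0 0 (fun_form x) (fun_form y) = fun_form (pb \<omega> x y)"
  using conjunct1[OF conjunct2[OF conjunct2[OF conjunct2[OF conjunct2[OF conjunct2[OF conjunct2[OF conjunct2[OF
      defm[unfolded deformation_def]]]]]]]]] unfolding br_def by (simp add: fsc_one)

lemma br_fun_1form: "x \<in> C \<Longrightarrow> \<tau> \<in> Om 1 \<Longrightarrow> br 0 1 (fun_form x) \<tau> = gam x \<tau>"
  and br_1form_fun: "x \<in> C \<Longrightarrow> \<tau> \<in> Om 1 \<Longrightarrow> br 1 0 \<tau> (fun_form x) = - gam x \<tau>"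
proof -
  assume a: "x \<in> C" "\<tau> \<in> Om 1"
  have "P 1 (fun_form x) \<tau> - P 1 \<tau> (fun_form x) = gam x \<tau>"
    using conjunct2[OF conjunct2[OF conjunct2[OF conjunct2[OF conjunct2[OF conjunct2[OF conjunct2[OF conjunct2[OF
      defm[unfolded deformation_def]]]]]]]]] a by blast
  moreover from this have "P 1 \<tau> (fun_form x) - P 1 (fun_form x) \<tau> = - gam x \<tau>"
    by (metis minus_diff_eq)
  ultimately show "br 0 1 (fun_form x) \<tau> = gam x \<tau>" "br 1 0 \<tau> (fun_form x) = - gam x \<tau>"
    unfolding br_def mult_0 mult_0_right power_0 fsc_one .
qed

lemma ddf: "x \<in> C \<Longrightarrow> ext_d G (df G x) = 0"
proof -
  assume x: "x \<in> C"
  have "ext_d G (df G x) \<in> Om 2" using d_Om[OF df_Om[OF x]] by (simp add: numeral_2_eq_2)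
  then show ?thesis by (rule d_df[OF x])
qed

lemma scomm_const:
  assumes x: "\<xi> \<in> Om k" and y: "\<eta> \<in> Om l" and gc: "gcomm k l"
  shows "scomm P k l (const_ser \<xi>) (const_ser \<eta>) 0 = 0"
    "scomm P k l (const_ser \<xi>) (const_ser \<eta>) 1 = br k l \<xi> \<eta>"
    "scomm P k l (const_ser \<xi>) (const_ser \<eta>) 2 \<in> Om (k + l)"
proof -
  show "scomm P k l (const_ser \<xi>) (const_ser \<eta>) 0 = 0"
    unfolding scomm_def fseries_app ser_sc_def const_mul[OF x y] const_mul[OF y x] P0[OF x y] P0[OF y x]
    using gcommD[OF gc x y] by simp
  show "scomm P k l (const_ser \<xi>) (const_ser \<eta>) 1 = br k l \<xi> \<eta>"
    unfolding scomm_def fseries_app ser_sc_def const_mul[OF x y] const_mul[OF y x] br_def ..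
  show "scomm P k l (const_ser \<xi>) (const_ser \<eta>) 2 \<in> Om (k + l)"
    unfolding scomm_def fseries_app ser_sc_def const_mul[OF x y] const_mul[OF y x]
    using P_Om[OF x y, of 2] P_Om[OF y x, of 2] by (intro forms_minus forms_fsc) (simp_all add: add.commute)
qed

text \<open>Since the wedge product is graded commutative, every supercommutator raises the order by one, so only
  leading coefficients contribute to second order.\<close>

lemma scomm_nested:
  assumes x: "\<xi> \<in> Om k" and H: "H 0 = 0" "H 1 \<in> Om l" "H 2 \<in> Om l" and gc: "gcomm k l"
  shows "scomm P k l (const_ser \<xi>) H 0 = 0" "scomm P k l (const_ser \<xi>) H 1 = 0"
    "scomm P k l (const_ser \<xi>) H 2 = br k l \<xi> (H 1)"
proof -
  note z = P_zero[OF forms_zero[of 0]] P_zero[OF x] P_zero[OF H(2)] P_zero[OF H(3)]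
  have "wedge \<xi> (H 1) - fsc ((- 1) ^ (k * l)) (wedge (H 1) \<xi>) = 0"
    "wedge \<xi> (H 2) - fsc ((- 1) ^ (k * l)) (wedge (H 2) \<xi>) = 0"
    using gcommD[OF gc x H(2)] gcommD[OF gc x H(3)] by simp_all
  then show "scomm P k l (const_ser \<xi>) H 0 = 0" "scomm P k l (const_ser \<xi>) H 1 = 0"
    "scomm P k l (const_ser \<xi>) H 2 = br k l \<xi> (H 1)"
    unfolding scomm_def fseries_app ser_sc_def ser_mul_low const_ser_low H(1) br_def
      P0[OF x H(2)] P0[OF H(2) x] P0[OF x H(3)] P0[OF H(3) x] z
    by (simp_all add: fsc_zero fsc_plus)
qed

lemma scomm_scomm:
  assumes "\<xi> \<in> Om k" "\<eta> \<in> Om l" "\<zeta> \<in> Om m'" "gcomm l m'" "gcomm k (l + m')" "i < 3"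
  shows "scomm P k (l + m') (const_ser \<xi>) (scomm P l m' (const_ser \<eta>) (const_ser \<zeta>)) i =
    (if i = 2 then br k (l + m') \<xi> (br l m' \<eta> \<zeta>) else 0)"
proof -
  note s = scomm_const[OF assms(2,3,4)]
  have o: "br l m' \<eta> \<zeta> \<in> Om (l + m')" by (rule br_Om[OF assms(2,3)])
  note n = scomm_nested[where H = "scomm P l m' (const_ser \<eta>) (const_ser \<zeta>)", unfolded s(1,2),
      OF assms(1) refl o s(3) assms(5)]
  from assms(6) have "i = 0 \<or> i = 1 \<or> i = 2" by auto
  then show ?thesis using n by auto
qed

lemma super_J1_iff:
  assumes x: "x \<in> C" and y: "y \<in> C" and z: "z \<in> C"
  shows "super_J1 G P x y z \<theta> \<longleftrightarrow> \<theta> = curvature \<omega> gam x y (df G z)"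
proof -
  note f = fun_form_Om[OF x] fun_form_Om[OF y] df_Om[OF z]
  have g1: "gcomm 0 (0 + 1)" "gcomm 0 1" "gcomm 0 (1 + 0)" "gcomm 1 0" "gcomm 1 (0 + 0)" "gcomm 0 0" by (simp_all add: gcomm_0)
  have "br 0 1 (fun_form x) (br 0 1 (fun_form y) (df G z)) + br 1 0 (df G z) (br 0 0 (fun_form x) (fun_form y))
      + br 0 1 (fun_form y) (br 1 0 (df G z) (fun_form x)) = curvature \<omega> gam x y (df G z)"
  proof -
    note gx = gam_forms[OF x f(3)] and gy = gam_forms[OF y f(3)]
    have "br 0 1 (fun_form y) (- gam x (df G z)) = - gam y (gam x (df G z))"
      unfolding fsc_uminus br_fsc_right[OF f(2) gx] br_fun_1form[OF y gx] ..
    then show ?thesis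
      unfolding br_fun_1form[OF y f(3)] br_fun_1form[OF x gy] br_fun_fun[OF x y] br_1form_fun[OF pb_smooth[OF x y] f(3)]
        br_1form_fun[OF x f(3)] curvature_def by simp
  qed
  moreover have "super_J1 G P x y z \<theta> \<longleftrightarrow> (\<forall>i<(3::nat). (if i = 2 then
      br 0 1 (fun_form x) (br 0 1 (fun_form y) (df G z)) + br 1 0 (df G z) (br 0 0 (fun_form x) (fun_form y))
      + br 0 1 (fun_form y) (br 1 0 (df G z) (fun_form x)) else 0) = (if i = 2 then \<theta> else 0))"
    unfolding super_J1_def Let_def ser_eq_upto_def second_order_def fseries_app
    using scomm_scomm[OF f(1,2,3) g1(2,1)] scomm_scomm[OF f(3,1,2) g1(6,5)] scomm_scomm[OF f(2,3,1) g1(4,3)]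
    by simp
  ultimately show ?thesis by auto
qed

definition jac2 where
  "jac2 x y z = br 0 2 (fun_form x) (br 1 1 (df G y) (df G z)) - br 1 1 (df G z) (br 0 1 (fun_form x) (df G y))
     + br 1 1 (df G y) (br 1 0 (df G z) (fun_form x))"

definition jac3 where
  "jac3 x y z = br 1 2 (df G x) (br 1 1 (df G y) (df G z)) + br 1 2 (df G z) (br 1 1 (df G x) (df G y))
     + br 1 2 (df G y) (br 1 1 (df G z) (df G x))"

lemma super_J2_iff:
  assumes x: "x \<in> C" and y: "y \<in> C" and z: "z \<in> C"
  shows "super_J2 G P x y z \<theta> \<longleftrightarrow> \<theta> = jac2 x y z"
proof -
  note f = fun_form_Om[OF x] df_Om[OF y] df_Om[OF z]
  have g1: "gcomm 0 (1 + 1)" "gcomm 0 1" "gcomm 1 (0 + 1)" "gcomm 1 0" "gcomm 1 (1 + 0)" "gcomm 1 1"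
    using gcomm_11 by (simp_all add: gcomm_0)
  have "super_J2 G P x y z \<theta> \<longleftrightarrow> (\<forall>i<(3::nat). (if i = 2 then jac2 x y z else 0) = (if i = 2 then \<theta> else 0))"
    unfolding super_J2_def Let_def ser_eq_upto_def second_order_def fseries_app jac2_def
    using scomm_scomm[OF f(1,2,3) g1(6,1)] scomm_scomm[OF f(3,1,2) g1(2,3)] scomm_scomm[OF f(2,3,1) g1(4,5)]
    by (simp add: numeral_2_eq_2)
  then show ?thesis by auto
qed

lemma super_J3_iff:
  assumes x: "x \<in> C" and y: "y \<in> C" and z: "z \<in> C"
  shows "super_J3 G P x y z \<theta> \<longleftrightarrow> \<theta> = jac3 x y z"
proof -
  note f = df_Om[OF x] df_Om[OF y] df_Om[OF z]
  have g1: "gcomm 1 (1 + 1)" "gcomm 1 1"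
    using gcomm_11 gcomm_12 by (simp_all add: numeral_2_eq_2)
  have "super_J3 G P x y z \<theta> \<longleftrightarrow> (\<forall>i<(3::nat). (if i = 2 then jac3 x y z else 0) = (if i = 2 then \<theta> else 0))"
    unfolding super_J3_def Let_def ser_eq_upto_def second_order_def fseries_app jac3_def
    using scomm_scomm[OF f(1,2,3) g1(2,1)] scomm_scomm[OF f(3,1,2) g1(2,1)] scomm_scomm[OF f(2,3,1) g1(2,1)]
    by (simp add: numeral_2_eq_2)
  then show ?thesis by auto
qed

text \<open>The exterior derivative is a graded derivation of the bracket and kills exact forms; on the second
  Jacobi expression it therefore acts by replacing \<open>x\<close> with \<open>dx\<close>.\<close>

lemma jac3_d_jac2:
  assumes x: "x \<in> C" and y: "y \<in> C" and z: "z \<in> C"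
  shows "jac3 x y z = ext_d G (jac2 x y z)"
proof -
  note X = fun_form_Om[OF x] and dx = df_Om[OF x] and dy = df_Om[OF y] and dz = df_Om[OF z]
  note gc = gcomm_0 gcomm_11 gcomm_12
  have n: "(1::nat) + 1 = 2" "(0::nat) + 1 = 1" "(2::nat) + 1 = 3" "(0::nat) + 2 = 2" by simp_all
  have Oyz: "br 1 1 (df G y) (df G z) \<in> Om 2" using br_Om[OF dy dz] by (simp only: n)
  have Oxy: "br 0 1 (fun_form x) (df G y) \<in> Om 1" using br_Om[OF X dy] by simp
  have Ozx: "br 1 0 (df G z) (fun_form x) \<in> Om 1" using br_Om[OF dz X] by simp
  have d11: "ext_d G (br 1 1 (df G y) (df G z)) = 0"
    using d_br[OF dy dz, unfolded n] gc by (simp only: ddf[OF y] ddf[OF z] br_zero[OF dy] br_zero[OF dz] fsc_zero add_0_left)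
  have d01: "ext_d G (br 0 1 (fun_form x) (df G y)) = br 1 1 (df G x) (df G y)"
    using d_br[OF X dy, unfolded n] gc by (simp only: ddf[OF y] br_zero[OF X] fsc_zero add_0_right)
  have d10: "ext_d G (br 1 0 (df G z) (fun_form x)) = - br 1 1 (df G z) (df G x)"
    using d_br[OF dz X, unfolded n] gc by (simp only: ddf[OF z] br_zero[OF X] fsc_uminus add_0_left power_one_right)
  have t1: "ext_d G (br 0 2 (fun_form x) (br 1 1 (df G y) (df G z))) = br 1 2 (df G x) (br 1 1 (df G y) (df G z))"
    using d_br[OF X Oyz, unfolded n] gc by (simp only: d11 br_zero[OF X] fsc_zero add_0_right)
  have t2: "ext_d G (br 1 1 (df G z) (br 0 1 (fun_form x) (df G y))) = - br 1 2 (df G z) (br 1 1 (df G x) (df G y))"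
    using d_br[OF dz Oxy, unfolded n] gc by (simp only: ddf[OF z] d01 br_zero[OF Oxy] fsc_uminus add_0_left power_one_right)
  have Ozx': "br 1 1 (df G z) (df G x) \<in> Om 2" using br_Om[OF dz dx] by (simp only: n)
  have t3: "ext_d G (br 1 1 (df G y) (br 1 0 (df G z) (fun_form x))) = br 1 2 (df G y) (br 1 1 (df G z) (df G x))"
    using d_br[OF dy Ozx, unfolded n] gc
    by (simp only: ddf[OF y] d10 br_zero[OF Ozx] fsc_uminus add_0_left power_one_right br_fsc_right[OF dy Ozx'] fsc_fsc)
       (simp add: fsc_one)
  have o: "br 0 2 (fun_form x) (br 1 1 (df G y) (df G z)) \<in> Om 2" "br 1 1 (df G z) (br 0 1 (fun_form x) (df G y)) \<in> Om 2"
    "br 1 1 (df G y) (br 1 0 (df G z) (fun_form x)) \<in> Om 2"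
    using br_Om[OF X Oyz] br_Om[OF dz Oxy] br_Om[OF dy Ozx] by (simp_all only: n)
  show ?thesis
    unfolding jac3_def jac2_def d_add[OF forms_minus[OF o(1,2)] o(3)] d_minus[OF o(1,2)] t1 t2 t3 by simp
qed

end

section \<open>Vanishing of the obstructions\<close>

context lie
begin

lemma lin_diff_fun: "lin p \<phi> \<Longrightarrow> lin p \<psi> \<Longrightarrow> lin p (\<lambda>u. \<phi> u - \<psi> u)"
  by (rule linI) (simp_all add: lin_add lin_scale algebra_simps)

lemma tensor_square_parts:
  assumes "r \<in> tensor_square LA"
  shows "r_plus r \<in> tensor_square LA" "r_minus r \<in> tensor_square LA"
proof -
  obtain uvs where uvs: "set uvs \<subseteq> LA \<times> LA" "\<And>B. bilin LA B \<Longrightarrow> r B = (\<Sum>(u, v)\<leftarrow>uvs. B u v)"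
    using assms unfolding tensor_square_def by blast
  have scaled: "(\<Sum>(u, v)\<leftarrow>map (\<lambda>(u, v). (\<lambda>f. c * u f, v)) ws. B u v) = c * (\<Sum>(u, v)\<leftarrow>ws. B u v)"
    "(\<Sum>(u, v)\<leftarrow>map (\<lambda>(u, v). (\<lambda>f. c * v f, u)) ws. B u v) = c * (\<Sum>(u, v)\<leftarrow>ws. B v u)"
    if "set ws \<subseteq> LA \<times> LA" "bilin LA B" for ws B c
    using that(1) by (induction ws) (auto simp: lin_scale[OF bilinD(1)[OF that(2)]] algebra_simps)
  have part: "(\<lambda>B. (r B + s * tflip r B) / 2) \<in> tensor_square LA" for s
  proof -
    let ?ws = "map (\<lambda>(u, v). (\<lambda>f. 1 / 2 * u f, v)) uvs @ map (\<lambda>(u, v). (\<lambda>f. s / 2 * v f, u)) uvs"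
    have "set ?ws \<subseteq> LA \<times> LA" using uvs(1) T_scale[of _ e1 "1 / 2"] T_scale[of _ e1 "s / 2"] by auto
    moreover have "(r B + s * tflip r B) / 2 = (\<Sum>(u, v)\<leftarrow>?ws. B u v)" if B: "bilin LA B" for B
      unfolding map_append sum_list_append scaled[OF uvs(1) B] tflip_def uvs(2)[OF B] uvs(2)[OF bilin_swap[OF B]]
      by (simp add: field_simps)
    ultimately show ?thesis unfolding tensor_square_def by blast
  qed
  from part[of 1] part[of "-1"] show "r_plus r \<in> tensor_square LA" "r_minus r \<in> tensor_square LA"
    by (simp_all add: r_plus_def r_minus_def)
qed

lemma bilin_wedge:
  "lin p \<phi> \<Longrightarrow> lin p \<phi>' \<Longrightarrow> lin p \<psi> \<Longrightarrow> lin p \<psi>' \<Longrightarrow> bilin (T p) (\<lambda>a b. \<phi> a * \<psi> b - \<phi>' a * \<psi>' b)"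
  by (intro bilinI lin_diff_fun lin_mult_const)

lemma trilin_wedge:
  "lin e1 \<xi> \<Longrightarrow> lin e1 \<phi> \<Longrightarrow> lin e1 \<phi>' \<Longrightarrow> lin e1 \<psi> \<Longrightarrow> lin e1 \<psi>' \<Longrightarrow>
    trilin (\<lambda>a b c. \<xi> a * (\<phi> b * \<psi> c - \<phi>' b * \<psi>' c))"
  by (intro trilinI lin_mult_const lin_diff_fun)

end

context qt
begin

text \<open>The Poisson bracket as one sum \<open>{x, y} = (\<Sum>k\<in>K. eps k \<cdot> opA k x \<cdot> opB k y)\<close> over pairs of
  left-invariant fields, with sign 1, and of right-invariant fields, with sign -1.\<close>

definition K where "K = {..<n} \<times> (UNIV :: bool set)"
definition eps :: "nat \<times> bool \<Rightarrow> real" where "eps k = (if snd k then 1 else - 1)"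
definition opA where "opA k = (if snd k then L (\<alpha> (fst k)) else R (\<alpha> (fst k)))"
definition opB where "opB k = (if snd k then L (\<beta> (fst k)) else R (\<beta> (fst k)))"

lemma op_smooth: "f \<in> C \<Longrightarrow> opA k f \<in> C" "f \<in> C \<Longrightarrow> opB k f \<in> C"
  by (simp_all add: opA_def opB_def L_smooth R_smooth \<alpha> \<beta>)

lemma sum_K:
  fixes F :: "nat \<times> bool \<Rightarrow> real"
  shows "(\<Sum>k\<in>K. F k) = (\<Sum>i<n. F (i, True)) + (\<Sum>i<n. F (i, False))"
proof -
  have "(\<Sum>k\<in>K. F k) = (\<Sum>i<n. \<Sum>b\<in>UNIV. F (i, b))"
    unfolding K_def by (simp add: sum.cartesian_product case_prod_unfold)
  then show ?thesis by (simp add: UNIV_bool sum.distrib)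
qed

lemma sum_K_K:
  assumes "\<And>i j. F (j, True) (i, False) = 0" "\<And>i j. F (j, False) (i, True) = 0"
  shows "(\<Sum>l\<in>K. \<Sum>k\<in>K. eps l * (eps k * F l k)) =
    (\<Sum>j<n. \<Sum>i<n. F (j, True) (i, True)) + (\<Sum>j<n. \<Sum>i<n. F (j, False) (i, False))"
  unfolding sum_K by (simp add: assms eps_def)

lemma K_antisym:
  assumes "bilin LA (\<lambda>a b. Q (L a) (L b))" "bilin LA (\<lambda>a b. Q (R a) (R b))"
  shows "(\<Sum>k\<in>K. eps k * Q (opB k) (opA k)) = - (\<Sum>k\<in>K. eps k * Q (opA k) (opB k))"
  using rm_swap[OF assms(1)] rm_swap[OF assms(2)]
  by (simp add: sum_K eps_def opA_def opB_def sum_negf)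

lemma gam_df:
  assumes x: "x \<in> C" and y: "y \<in> C" and u: "u \<in> T g"
  shows "gam x (df G y) g [u] = (\<Sum>k\<in>K. eps k * (opA k x g * u (opB k y)))"
proof -
  let ?w = "ltrans G (iv g) u"
  have w: "?w \<in> LA" by (rule ltrans_inv_LA[OF u])
  have uw: "u f = L ?w f g" for f by (simp add: L_def)
  have "gam x (df G y) g [u] = pb \<omega> x (L ?w y) g + (\<Sum>i<n. L (\<alpha> i) x g * L (lbr G ?w (\<beta> i)) y g)"
    by (simp add: gam_app Gam_eq[OF tilde_dual_funs[OF df_forms[OF y]] w] tilde_df w lbr_LA \<beta>)
  also have "\<dots> = (\<Sum>i<n. L (\<alpha> i) x g * L ?w (L (\<beta> i) y) g) - (\<Sum>i<n. R (\<alpha> i) x g * L ?w (R (\<beta> i) y) g)"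
    by (simp add: pb_eq L_lbr L_R_commute[OF w \<beta> y] algebra_simps sum.distrib sum_subtractf)
  finally show ?thesis
    by (simp add: uw sum_K eps_def opA_def opB_def sum_negf)
qed

lemma lbr_fun:
  "L (lbr G a b) f = (\<lambda>g. L a (L b f) g - L b (L a f) g)"
  "a \<in> LA \<Longrightarrow> b \<in> LA \<Longrightarrow> f \<in> C \<Longrightarrow> R (lbr G a b) f = (\<lambda>g. R b (R a f) g - R a (R b f) g)"
  using L_lbr R_lbr by blast+

text \<open>The Yang-Baxter equation in operator form. The commutator of a left- and a right-invariant field
  vanishes, so only the purely left and the purely right part contribute.\<close>

lemma yang_baxter_operators:
  assumes tri: "triangular G r" and x: "x \<in> C" and y: "y \<in> C" and z: "z \<in> C"
    and u: "u \<in> T g" and v: "v \<in> T g"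
    and pr_def: "pr = (\<lambda>f h. u f * v h - v f * u h)"
  shows "(\<Sum>l\<in>K. \<Sum>k\<in>K. eps l * (eps k * (
      (opA l (opA k x) g - opA k (opA l x) g) * pr (opB l y) (opB k z)
    + opA l x g * (pr (opB l (opA k y)) (opB k z) - pr (opA k (opB l y)) (opB k z))
    + opA l x g * (pr (opA k y) (opB l (opB k z)) - pr (opA k y) (opB k (opB l z)))))) = 0"
    (is "(\<Sum>l\<in>K. \<Sum>k\<in>K. eps l * (eps k * ?N l k)) = 0")
proof -
  note [simp] = \<alpha> \<beta> lbr_LA
  let ?X = "\<lambda>a b c. L a x g * pr (L b y) (L c z)"
  let ?Y = "\<lambda>a b c. R a x g * pr (R b y) (R c z)"
  have X: "trilin ?X" and Y: "trilin ?Y"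
    unfolding pr_def by (intro trilin_wedge lin_L lin_LA_L[OF u] lin_LA_L[OF v] y z)+
  have tu: "w (\<lambda>g. f g - h g) = w f - w h" if "w = u \<or> w = v" "f \<in> C" "h \<in> C" for w f h
    using that T_diff[OF u that(2,3)] T_diff[OF v that(2,3)] by auto
  have LL: "(\<Sum>j<n. \<Sum>i<n. ?N (j, True) (i, True)) = yb ?X"
    unfolding yb_def
    by (subst sum.swap, intro sum.cong refl)
       (simp add: opA_def opB_def lbr_fun(1) pr_def tu L_smooth y z algebra_simps)
  have RR: "(\<Sum>j<n. \<Sum>i<n. ?N (j, False) (i, False)) = - yb ?Y"
    unfolding yb_def sum_negf[symmetric]
    by (subst sum.swap, intro sum.cong refl)
       (simp add: opA_def opB_def lbr_fun(2) x y z pr_def tu R_smooth algebra_simps)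
  have LR: "?N (j, True) (i, False) = 0" "?N (j, False) (i, True) = 0" for i j
    using L_R_commute[OF \<alpha> \<alpha> x] L_R_commute[OF \<beta> \<alpha> y] L_R_commute[OF \<alpha> \<beta> y] L_R_commute[OF \<beta> \<beta> z]
    by (simp_all add: opA_def opB_def)
  have "(\<Sum>l\<in>K. \<Sum>k\<in>K. eps l * (eps k * ?N l k)) =
    (\<Sum>j<n. \<Sum>i<n. ?N (j, True) (i, True)) + (\<Sum>j<n. \<Sum>i<n. ?N (j, False) (i, False))"
    by (rule sum_K_K[where F = ?N, OF LR])
  then show ?thesis unfolding LL RR by (simp add: triangular_yb[OF tri X] triangular_yb[OF tri Y])
qed

end

context deform
begin

lemma wedge_sum_right:
  assumes x: "\<xi> \<in> Om k" and y: "\<And>i. i \<in> I \<Longrightarrow> \<eta> i \<in> Om l"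
  shows "wedge \<xi> (\<Sum>i\<in>I. fsc (c i) (\<eta> i)) = (\<Sum>i\<in>I. fsc (c i) (wedge \<xi> (\<eta> i)))"
  using y
proof (induction I rule: infinite_finite_induct)
  case (insert i I)
  have o: "fsc (c i) (\<eta> i) \<in> Om l" "(\<Sum>i\<in>I. fsc (c i) (\<eta> i)) \<in> Om l" "\<eta> i \<in> Om l"
    using insert.prems by (auto intro!: forms_fsc forms_sum)
  have add: "wedge \<xi> (fsc (c i) (\<eta> i) + (\<Sum>i\<in>I. fsc (c i) (\<eta> i))) =
      fsc (c i) (wedge \<xi> (\<eta> i)) + wedge \<xi> (\<Sum>i\<in>I. fsc (c i) (\<eta> i))"
    using P_add_right[OF x o(1,2), of 0] P_fsc_right[OF x o(3), of 0 "c i"]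
    by (simp only: P0[OF x o(1)] P0[OF x o(2)] P0[OF x o(3)] P0[OF x forms_plus[OF o(1,2)]])
  have "wedge \<xi> (\<Sum>i\<in>I. fsc (c i) (\<eta> i)) = (\<Sum>i\<in>I. fsc (c i) (wedge \<xi> (\<eta> i)))"
    using insert by blast
  then show ?case unfolding sum.insert[OF insert.hyps] add by (rule arg_cong)
qed (use P0[OF x forms_zero[of 0]] P_zero(2)[OF x] in simp_all)

lemma fun_df_Om: "a \<in> C \<Longrightarrow> b \<in> C \<Longrightarrow> wedge (fun_form a) (df G b) \<in> Om 1"
  using wedge_Om[OF fun_form_Om df_Om] by simp

lemma gam_df_sum:
  assumes x: "x \<in> C" and z: "z \<in> C"
  shows "gam x (df G z) = (\<Sum>k\<in>K. fsc (eps k) (wedge (fun_form (opA k x)) (df G (opB k z))))"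
proof (rule form_eqI[OF gam_forms[OF x df_Om[OF z]]
      forms_sum[OF forms_fsc[OF fun_df_Om[OF op_smooth(1)[OF x] op_smooth(2)[OF z]]]]])
  fix p :: 'a and us :: "'a tvec list" assume us: "length us = 1" "set us \<subseteq> T p"
  then obtain u where u: "us = [u]" "u \<in> T p" by (auto simp: length_Suc_conv)
  show "gam x (df G z) p us = (\<Sum>k\<in>K. fsc (eps k) (wedge (fun_form (opA k x)) (df G (opB k z)))) p us"
    unfolding u(1) gam_df[OF x z u(2)] sum_form_app fsc_def
      wedge_fun_1form[OF op_smooth(1)[OF x] df_Om[OF op_smooth(2)[OF z]]] df_app[OF u(2)] ..
qed

lemma br_df_df:
  assumes y: "y \<in> C" and z: "z \<in> C"
  shows "br 1 1 (df G y) (df G z) = (\<Sum>k\<in>K. fsc (eps k) (wedge (df G (opA k y)) (df G (opB k z))))"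
proof -
  have n: "(1::nat) + 1 = 2" "(0::nat) + 1 = 1" by simp_all
  note X = fun_form_Om[OF y] and dy = df_Om[OF y] and dz = df_Om[OF z]
  have d: "ext_d G (wedge (fun_form a) (df G b)) = wedge (df G a) (df G b)" if a: "a \<in> C" and b: "b \<in> C" for a b
  proof -
    have "wedge (fun_form a) 0 = 0"
      using P0[OF fun_form_Om[OF a] forms_zero[of 0]] P_zero(2)[OF fun_form_Om[OF a]] by simp
    then show ?thesis
      using d_wedge[OF fun_form_Om[OF a] df_Om[OF b]] by (simp only: ddf[OF b] fsc_zero add_0_right)
  qed
  have "br 1 1 (df G y) (df G z) = ext_d G (br 0 1 (fun_form y) (df G z))"
    using d_br[OF X dz, unfolded n] gcomm_0 gcomm_11 by (simp only: ddf[OF z] br_zero[OF X] fsc_zero add_0_right)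
  also have "\<dots> = (\<Sum>k\<in>K. fsc (eps k) (ext_d G (wedge (fun_form (opA k y)) (df G (opB k z)))))"
    unfolding br_fun_1form[OF y dz] gam_df_sum[OF y z] by (rule d_sum[OF fun_df_Om[OF op_smooth(1)[OF y] op_smooth(2)[OF z]]])
  finally show ?thesis by (simp only: d[OF op_smooth(1)[OF y] op_smooth(2)[OF z]])
qed

text \<open>Written out in the operators \<open>opA\<close>, \<open>opB\<close>, the second obstruction becomes, after exchanging
  summation indices and using antisymmetry once, the left-hand side of the Yang-Baxter equation.\<close>

lemma triangular_jac2:
  assumes tri: "triangular G r" and x: "x \<in> C" and y: "y \<in> C" and z: "z \<in> C"
  shows "jac2 x y z = 0"
proof -
  note X = fun_form_Om[OF x] and dx = df_Om[OF x] and dy = df_Om[OF y] and dz = df_Om[OF z]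
  have n: "(1::nat) + 1 = 2" "(0::nat) + 1 = 1" "(0::nat) + 2 = 2" "(1::nat) + 0 = 1" by simp_all
  note A = op_smooth(1) and B = op_smooth(2)
  have w11: "wedge (df G a) (df G b) \<in> Om 2" if "a \<in> C" "b \<in> C" for a b
    using wedge_Om[OF df_Om[OF that(1)] df_Om[OF that(2)]] by (simp only: n)
  show ?thesis
  proof (rule form_eqI[OF _ forms_zero])
    have o: "br 0 2 (fun_form x) (br 1 1 (df G y) (df G z)) \<in> Om 2"
      using br_Om[OF X, of "br 1 1 (df G y) (df G z)" 2] br_Om[OF dy dz] by (simp only: n)
    have o2: "br 1 1 (df G z) (br 0 1 (fun_form x) (df G y)) \<in> Om 2"
      unfolding br_fun_1form[OF x dy] using br_Om[OF dz gam_forms[OF x dy]] by (simp only: n)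
    have o3: "br 1 1 (df G y) (br 1 0 (df G z) (fun_form x)) \<in> Om 2"
      unfolding br_1form_fun[OF x dz] using br_Om[OF dy forms_uminus[OF gam_forms[OF x dz]]] by (simp only: n)
    show "jac2 x y z \<in> Om 2" unfolding jac2_def by (intro forms_plus forms_minus o o2 o3)
    fix p :: 'a and us :: "'a tvec list" assume us: "length us = 2" "set us \<subseteq> T p"
    then obtain u v where uv: "us = [u, v]" by (auto simp: numeral_2_eq_2 length_Suc_conv)
    have u: "u \<in> T p" and v: "v \<in> T p" using us uv by auto
    define pr where "pr = (\<lambda>f h. u f * v h - v f * u h)"
    have pr_swap: "pr f h = - pr h f" for f h by (simp add: pr_def)
    have wv: "wedge (df G a) (df G b) p [u, v] = pr a b" if "a \<in> C" "b \<in> C" for a b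
      using that by (simp add: wedge_1form_1form[OF df_Om df_Om] df_app u v pr_def)
    have gv: "gam x' (df G a) p [w] = (\<Sum>l\<in>K. eps l * (opA l x' p * w (opB l a)))"
      if "x' \<in> C" "a \<in> C" "w \<in> T p" for x' a w using gam_df[OF that] .
    have br02: "br 0 2 (fun_form x) (wedge (df G a) (df G b)) p [u, v] =
        (\<Sum>l\<in>K. eps l * (opA l x p * (pr (opB l a) b + pr a (opB l b))))" if a: "a \<in> C" and b: "b \<in> C" for a b
    proof -
      have "br 0 2 (fun_form x) (wedge (df G a) (df G b)) =
          wedge (gam x (df G a)) (df G b) + wedge (df G a) (gam x (df G b))"
        using br_wedge[OF X df_Om[OF a] df_Om[OF b] gcomm_0(1) gcomm_0(1) gcomm_0(1)]
        by (simp only: n br_fun_1form[OF x df_Om[OF a]] br_fun_1form[OF x df_Om[OF b]] mult_0 power_0 fsc_one)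
      then show ?thesis
        unfolding plus_fun_apply
        by (simp add: wedge_1form_1form[OF gam_forms[OF x df_Om[OF a]] df_Om[OF b]]
            wedge_1form_1form[OF df_Om[OF a] gam_forms[OF x df_Om[OF b]]] gv[OF x a u] gv[OF x a v] gv[OF x b u]
            gv[OF x b v] df_app u v pr_def sum_distrib_left sum_distrib_right sum_subtractf[symmetric] sum.distrib[symmetric]
            algebra_simps)
    qed
    have br11: "br 1 1 (df G c) (wedge (fun_form a) (df G b)) p [u, v] =
        (\<Sum>l\<in>K. eps l * (a p * pr (opA l c) (opB l b) - opA l a p * pr (opB l c) b))"
      if c: "c \<in> C" and a: "a \<in> C" and b: "b \<in> C" for a b c
    proof -
      note X' = fun_form_Om[OF a] and dc = df_Om[OF c] and db = df_Om[OF b]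
      have "br 1 1 (df G c) (wedge (fun_form a) (df G b)) =
          wedge (- gam a (df G c)) (df G b) + wedge (fun_form a) (br 1 1 (df G c) (df G b))"
        using br_wedge[OF dc X' db gcomm_0(2) gcomm_11] gcomm_11
        by (simp only: n br_1form_fun[OF a dc] mult_0_right power_0 fsc_one)
      moreover have "wedge (- gam a (df G c)) (df G b) p [u, v] =
          (\<Sum>l\<in>K. - (eps l * (opA l a p * pr (opB l c) b)))"
        by (simp add: wedge_1form_1form[OF forms_uminus[OF gam_forms[OF a dc]] db] gv[OF a c u] gv[OF a c v]
            df_app u v pr_def sum_distrib_left sum_distrib_right sum_subtractf[symmetric] sum_negf[symmetric] algebra_simps)
      moreover have "wedge (fun_form a) (br 1 1 (df G c) (df G b)) p [u, v] =
          (\<Sum>l\<in>K. eps l * (a p * pr (opA l c) (opB l b)))"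
      proof -
        have "wedge (fun_form a) (wedge (df G f) (df G h)) p [u, v] = a p * pr f h"
          if f: "f \<in> C" and h: "h \<in> C" for f h
        proof -
          have "wedge (fun_form a) (wedge (df G f) (df G h)) = wedge (wedge (fun_form a) (df G f)) (df G h)"
            by (rule wedge_assoc[OF X' df_Om[OF f] df_Om[OF h], symmetric])
          then show ?thesis
            by (simp add: wedge_1form_1form[OF fun_df_Om[OF a f] df_Om[OF h]] wedge_fun_1form[OF a df_Om[OF f]] df_app u v
                pr_def algebra_simps)
        qed
        note one = this
        have "wedge (fun_form a) (\<Sum>k\<in>K. fsc (eps k) (wedge (df G (opA k c)) (df G (opB k b)))) =
           (\<Sum>k\<in>K. fsc (eps k) (wedge (fun_form a) (wedge (df G (opA k c)) (df G (opB k b)))))"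
          by (rule wedge_sum_right[OF X' w11[OF A[OF c] B[OF b]]])
        then show ?thesis unfolding br_df_df[OF c b]
          by (simp add: sum_form_app fsc_def one[OF A[OF c] B[OF b]])
      qed
      ultimately show ?thesis by (simp add: sum.distrib[symmetric] algebra_simps)
    qed
    have J1: "br 0 2 (fun_form x) (br 1 1 (df G y) (df G z)) p [u, v] =
        (\<Sum>k\<in>K. eps k * (\<Sum>l\<in>K. eps l * (opA l x p * (pr (opB l (opA k y)) (opB k z) + pr (opA k y) (opB l (opB k z))))))"
      unfolding br_df_df[OF y z] unfolding br_sum_right[OF X w11[OF A[OF y] B[OF z]]] unfolding sum_form_app fsc_def
        br02[OF A[OF y] B[OF z]] ..
    have J2: "br 1 1 (df G c) (gam x (df G b)) p [u, v] =
        (\<Sum>k\<in>K. eps k * (\<Sum>l\<in>K. eps l * (opA k x p * pr (opA l c) (opB l (opB k b)) - opA l (opA k x) p * pr (opB l c) (opB k b))))"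
      if c: "c \<in> C" and b: "b \<in> C" for b c
      unfolding gam_df_sum[OF x b] unfolding br_sum_right[OF df_Om[OF c] fun_df_Om[OF A[OF x] B[OF b]]] unfolding sum_form_app fsc_def
        br11[OF c A[OF x] B[OF b]] ..
    have J3: "br 1 1 (df G y) (br 1 0 (df G z) (fun_form x)) = - br 1 1 (df G y) (gam x (df G z))"
      unfolding br_1form_fun[OF x dz] fsc_uminus br_fsc_right[OF dy gam_forms[OF x dz]] ..
    let ?S = "\<lambda>F. \<Sum>l\<in>K. \<Sum>k\<in>K. eps l * (eps k * F l k) :: real"
    have S_swap: "(\<Sum>k\<in>K. eps k * (\<Sum>l\<in>K. eps l * F l k)) = ?S F" for F
      by (subst sum.swap) (simp add: sum_distrib_left mult.left_commute)
    have S_swap': "?S F = ?S (\<lambda>l k. F k l)" for F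
      by (subst sum.swap) (simp add: mult.left_commute)
    \<comment> \<open>the only place where antisymmetry of the bivector enters\<close>
    have anti: "?S (\<lambda>l k. opA l x p * pr (opB k (opB l y)) (opA k z)) = - ?S (\<lambda>l k. opA l x p * pr (opA k (opB l y)) (opB k z))"
    proof -
      have "(\<Sum>k\<in>K. eps k * pr (opB k f) (opA k z)) = - (\<Sum>k\<in>K. eps k * pr (opA k f) (opB k z))" if f: "f \<in> C" for f
      proof (rule K_antisym[where Q = "\<lambda>X Y. pr (X f) (Y z)"])
        show "bilin LA (\<lambda>a b. pr (L a f) (L b z))" "bilin LA (\<lambda>a b. pr (R a f) (R b z))"
          unfolding pr_def by (intro bilin_wedge lin_LA_L[OF u] lin_LA_L[OF v] f z)+
      qed
      note one = this[OF B[OF y]]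
      have "?S (\<lambda>l k. opA l x p * F l k) = (\<Sum>l\<in>K. eps l * opA l x p * (\<Sum>k\<in>K. eps k * F l k))" for F
        by (simp add: sum_distrib_left mult_ac)
      then show ?thesis by (simp only: one mult_minus_right sum_negf)
    qed
    have "jac2 x y z p [u, v] =
        ?S (\<lambda>l k. opA l x p * pr (opB l (opA k y)) (opB k z)) + ?S (\<lambda>l k. opA l x p * pr (opA k y) (opB l (opB k z)))
      - (?S (\<lambda>l k. opA k x p * pr (opA l z) (opB l (opB k y))) - ?S (\<lambda>l k. opA l (opA k x) p * pr (opB l z) (opB k y)))
      - (?S (\<lambda>l k. opA k x p * pr (opA l y) (opB l (opB k z))) - ?S (\<lambda>l k. opA l (opA k x) p * pr (opB l y) (opB k z)))"
    proof -
      have j1: "br 0 2 (fun_form x) (br 1 1 (df G y) (df G z)) p [u, v] =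
          ?S (\<lambda>l k. opA l x p * pr (opB l (opA k y)) (opB k z)) + ?S (\<lambda>l k. opA l x p * pr (opA k y) (opB l (opB k z)))"
        unfolding J1 S_swap by (simp add: distrib_left sum.distrib)
      have j2: "br 1 1 (df G c) (gam x (df G b)) p [u, v] =
          ?S (\<lambda>l k. opA k x p * pr (opA l c) (opB l (opB k b))) - ?S (\<lambda>l k. opA l (opA k x) p * pr (opB l c) (opB k b))"
        if "c \<in> C" "b \<in> C" for b c
        unfolding J2[OF that] S_swap by (simp add: right_diff_distrib sum_subtractf)
      have "jac2 x y z p [u, v] = br 0 2 (fun_form x) (br 1 1 (df G y) (df G z)) p [u, v]
          - br 1 1 (df G z) (gam x (df G y)) p [u, v] - br 1 1 (df G y) (gam x (df G z)) p [u, v]"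
        unfolding jac2_def br_fun_1form[OF x dy] J3 by simp
      then show ?thesis unfolding j1 j2[OF z y] j2[OF y z] .
    qed
    also have "\<dots> = 0"
    proof -
      have t3: "?S (\<lambda>l k. opA l (opA k x) p * pr (opB l z) (opB k y)) = - ?S (\<lambda>l k. opA k (opA l x) p * pr (opB l y) (opB k z))"
        by (subst S_swap') (simp add: pr_swap[of "opB _ z"] sum_negf)
      have t4: "?S (\<lambda>l k. opA k x p * pr (opA l z) (opB l (opB k y))) = ?S (\<lambda>l k. opA l x p * pr (opA k (opB l y)) (opB k z))"
        using anti by (subst S_swap') (simp add: pr_swap[of "opA _ z"] sum_negf)
      have t6: "?S (\<lambda>l k. opA k x p * pr (opA l y) (opB l (opB k z))) = ?S (\<lambda>l k. opA l x p * pr (opA k y) (opB k (opB l z)))"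
        by (rule S_swap')
      show ?thesis
        unfolding t3 t4 t6 using yang_baxter_operators[OF tri x y z u v pr_def]
        by (simp add: distrib_left right_diff_distrib left_diff_distrib sum.distrib sum_subtractf)
    qed
    finally show "jac2 x y z p us = 0 p us" by (simp add: uv)
  qed
qed

end


theorem theorem4p18:
  fixes G :: "('g::{t2_space,second_countable_topology}, 'e::real_inner) lie_group_data"
    and \<omega> :: "'g \<Rightarrow> 'g tens2"
    and r :: "'g tens2"
  assumes "poisson_lie_group G \<omega>"
    and "quasitriangular G \<omega> r"
  shows "\<exists>\<gamma> \<Xi>. preconnection G \<omega> \<gamma> \<and> compatible G \<omega> \<gamma> \<and> bicovariant G \<omega> \<gamma> \<and>
      left_inv_by G \<omega> \<gamma> \<Xi> \<and>
      (\<forall>\<phi>\<in>dual (lie_alg G). \<forall>\<psi>\<in>dual (lie_alg G). Xi_hat G r \<Xi> \<phi> \<psi> = 0) \<and>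
      (\<forall>a\<in>smooth_funs G. \<forall>s\<in>dual_funs G. \<forall>g.
         tilde_con G \<gamma> a s g =
           pb_vec \<omega> a s g + (\<lambda>w. r_minus r (\<lambda>u v. ltrans G g u a * ad_star G v (s g) w))) \<and>
      (lie_semisimple G \<longrightarrow>
         ((\<forall>x\<in>smooth_funs G. \<forall>y\<in>smooth_funs G. \<forall>\<tau>\<in>forms G 1. curvature \<omega> \<gamma> x y \<tau> = 0)
            \<longleftrightarrow> triangular G r) \<and>
         (triangular G r \<longrightarrow>
            (\<forall>P D. deformation G \<omega> \<gamma> P D \<longrightarrow>
               (\<forall>x\<in>smooth_funs G. \<forall>y\<in>smooth_funs G. \<forall>z\<in>smooth_funs G.
                  super_J1 G P x y z 0 \<and> super_J2 G P x y z 0 \<and> super_J3 G P x y z 0))))"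
proof -
  interpret lie G by unfold_locales (use assms(1) in \<open>simp add: poisson_lie_group_def\<close>)
  have zero: "0 \<in> LA" using T_zero[of e1] by (simp add: zero_fun_def)
  have rt: "r \<in> tensor_square LA" using assms(2) by (simp add: quasitriangular_def)
  \<comment> \<open>both parts of \<open>r\<close> are tensors again, that is, finite sums of decomposable ones\<close>
  obtain n and \<alpha> \<beta> :: "nat \<Rightarrow> 'g tvec" where m: "\<And>i. \<alpha> i \<in> LA" "\<And>i. \<beta> i \<in> LA"
    "\<And>B. bilin LA B \<Longrightarrow> r_minus r B = (\<Sum>i<n. B (\<alpha> i) (\<beta> i))"
    by (rule tensor_square_expansion[OF tensor_square_parts(2)[OF rt] zero]) (rule that)
  obtain m and p q :: "nat \<Rightarrow> 'g tvec" where p: "\<And>i. p i \<in> LA" "\<And>i. q i \<in> LA"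
    "\<And>B. bilin LA B \<Longrightarrow> r_plus r B = (\<Sum>i<m. B (p i) (q i))"
    by (rule tensor_square_expansion[OF tensor_square_parts(1)[OF rt] zero]) (rule that)
  interpret qt G \<omega> r n m \<alpha> \<beta> p q
    by unfold_locales (fact assms m p)+
  have hat: "Xi_hat G r Xi \<phi> \<psi> = 0" for \<phi> \<psi>
    by (simp add: Xi_hat_def Xi_def fun_eq_iff)
  have formula: "tilde_con G gam a s g =
      pb_vec \<omega> a s g + (\<lambda>w. r_minus r (\<lambda>u v. ltrans G g u a * ad_star G v (s g) w))"
    if "a \<in> C" "s \<in> dual_funs G" for a s g
    using tilde_con_gam[OF that] by (simp add: Gam_def)
  have obstructions: "super_J1 G P x y z 0 \<and> super_J2 G P x y z 0 \<and> super_J3 G P x y z 0"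
    if tri: "triangular G r" and d: "deformation G \<omega> gam P D" and x: "x \<in> C" and y: "y \<in> C" and z: "z \<in> C"
    for P D x y z
  proof -
    interpret deform G \<omega> r n m \<alpha> \<beta> p q P D by unfold_locales (fact d)
    have "jac2 x y z = 0" by (rule triangular_jac2[OF tri x y z])
    moreover from this have "jac3 x y z = 0" by (simp add: jac3_d_jac2[OF x y z] d_zero)
    ultimately show ?thesis
      using super_J1_iff[OF x y z] super_J2_iff[OF x y z] super_J3_iff[OF x y z]
        triangular_flat[OF tri x y df_Om[OF z]] by simp
  qed
  have flat: "(\<forall>x\<in>C. \<forall>y\<in>C. \<forall>\<tau>\<in>forms G 1. curvature \<omega> gam x y \<tau> = 0) \<longleftrightarrow> triangular G r"
    if "lie_semisimple G"
    using flat_triangular[OF that] triangular_flat by blast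
  have "bicovariant G \<omega> gam"
    unfolding bicovariant_def using left_inv_gam right_inv_gam by blast
  then show ?thesis
    by (intro exI[of _ gam] exI[of _ Xi] conjI impI allI ballI preconnection_gam compatible_gam left_inv_gam hat formula flat
        obstructions[THEN conjunct1] obstructions[THEN conjunct2, THEN conjunct1] obstructions[THEN conjunct2, THEN conjunct2])
qed

end
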